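(* Let $b\ge2$ and $l\ge0$ be integers, $\varkappa>0$, $Q(t)=e^{-2\varkappa t}$, and let $q\ge0$ be a bounded measurable function on $\mathbb R_+$ such that, with some constants $c,C>0$ and $R_0\ge0$, $$cQ(t)\le q(t)\le CQ(t),\qquad\forall t\ge R_0 .$$ Let $I$ be a compact interval with $I\subset\overline{\mathfrak l_0}$ (if $l=0$) or $I\subset\overline{\mathfrak l_l}\setminus\{(\pi l)^2\}$ (if $l\ge1$), let $\lambda,\lambda_1,\lambda_2\in I$ with $\lambda_1<\lambda_2$, and let $g_0>e$ be a constant. Then $$\widetilde M(\lambda;\mathbf A_{gq})=\frac1{8\varkappa^2}\,\rho(\lambda)(\ln g)^2+O(\ln g),\qquad g\ge g_0,$$ and there is a constant $C'$ such that $$\widetilde N(\lambda_1,\lambda_2;\mathbf A_{gq})\le C'\ln g,\qquad g\ge g_0 .$$ The constant $C'$ and the constant in $O(\ln g)$ are independent of $g$ and uniform in $\lambda,\lambda_1,\lambda_2\in I$.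
   Context: Half-line operators: for a bounded real measurable $V$ on $\mathbb R_+$, $A_V$ is the self-adjoint operator in $L^2(\mathbb R_+)$ acting as $-y''+Vy$ on each interval $(n-1,n)$, $n\in\mathbb N$, on functions with $y\in\mathsf H^2(n-1,n)$ for all $n$, $\sum_n\int_{n-1}^n(|y''|^2+|y|^2)dt<\infty$, $y(0)=0$, and $y(n+)=b^{1/2}y(n-)$, $y'(n+)=b^{-1/2}y'(n-)$ for all $n\in\mathbb N$. Counting functions: $M(\lambda;A_V)=\sum_{0<\alpha<1}\dim\ker(A_0+\alpha V-\lambda)$ for $\lambda$ in a gap of the spectrum of $A_0$; at an end of $\mathfrak l_l$ it is defined as the one-sided limit from inside $\mathfrak l_l$. $N(\lambda_1,\lambda_2;A_V)$ is the total multiplicity of the eigenvalues of $A_V$ in $(\lambda_1,\lambda_2)$. $\mathbf A_V$ denotes the Schrödinger operator $-\boldsymbol\Delta+V(|x|)$ on the homogeneous rooted metric tree with branching number $b$; it enters the claim only through the notation $\widetilde M(\lambda;\mathbf A_V):=\sum_{k\ge0}M(\lambda;A_{V_k})$ and $\widetilde N(\lambda_1,\lambda_2;\mathbf A_V):=\sum_{k\ge0}N(\lambda_1,\lambda_2;A_{V_k})$, where $V_k(t)=V(t+k)$. Gaps and bands: $R=\frac{b^{1/2}+b^{-1/2}}2$, $\theta=\arccos(1/R)$, $\mathfrak l_0=(-\infty,\theta^2)$, $\mathfrak l_l=((\pi l-\theta)^2,(\pi l+\theta)^2)$ for $l\ge1$; $\mathfrak b_l=[(\pi(l-1)+\theta)^2,(\pi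 l-\theta)^2]$, $l\in\mathbb N$. The points of $\mathfrak l_l$ other than $(\pi l)^2$ (all points of $\mathfrak l_0$) lie outside the spectrum of $A_0$. Density of states of $A_0$: $\rho:\mathbb R\to[0,\infty)$ is given by $\rho(\lambda)=l$ for $\lambda\in\mathfrak l_l$ ($l\ge0$), and for $\lambda\in\mathfrak b_l$ by $\rho(\lambda)=l-1+\frac1\pi\arccos\bigl(R\cos(\sqrt\lambda-\pi(l-1))\bigr)$. *)

theory Defs
  imports "HOL-Analysis.Analysis"
begin

text \<open>
  Elements of $L^2$ are represented by functions, equality being equality almost everywhere; the
  half-line is \<open>{0..}\<close> with Lebesgue measure.
\<close>

definition L2 :: "real set \<Rightarrow> (real \<Rightarrow> complex) set" where
  "L2 J = {f. f \<in> borel_measurable (lebesgue_on J) \<and>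
              integrable (lebesgue_on J) (\<lambda>t. (cmod (f t))\<^sup>2)}"

text \<open>
  \<open>H2_derivs r s y y1 y2\<close>: on the bounded interval \<open>(r, s)\<close> the function \<open>y\<close> belongs to the Sobolev
  space $H^2$, with first derivative \<open>y1\<close> and second derivative \<open>y2\<close>. As usual in one dimension,
  this means that \<open>y\<close> is (represented by) a $C^1$ function whose derivative is absolutely
  continuous, namely an indefinite Lebesgue integral of the square-integrable function \<open>y2\<close>.
\<close>

definition H2_derivs ::
    "real \<Rightarrow> real \<Rightarrow> (real \<Rightarrow> complex) \<Rightarrow> (real \<Rightarrow> complex) \<Rightarrow> (real \<Rightarrow> complex) \<Rightarrow> bool" where
  "H2_derivs r s y y1 y2 \<longleftrightarrow>
     y \<in> L2 {r<..<s} \<and> y1 \<in> L2 {r<..<s} \<and> y2 \<in> L2 {r<..<s} \<and>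
     (\<forall>t\<in>{r<..<s}. (y has_vector_derivative y1 t) (at t)) \<and>
     (\<forall>u v. r < u \<and> u \<le> v \<and> v < s \<longrightarrow> y1 v - y1 u = (LINT t|lebesgue_on {u..v}. y2 t))"

definition cell :: "nat \<Rightarrow> real set" where
  "cell n = {real n - 1<..<real n}"

text \<open>
  The domain of the half-line operators, with the first and second derivatives on the cells as
  further arguments. It does not depend on the bounded potential. The values of \<open>y\<close> at the integers
  play no role: $y(0)$ and $y(n\pm)$ are one-sided limits.
\<close>

definition in_domain ::
    "nat \<Rightarrow> (real \<Rightarrow> complex) \<Rightarrow> (real \<Rightarrow> complex) \<Rightarrow> (real \<Rightarrow> complex) \<Rightarrow> bool" where
  "in_domain b y y1 y2 \<longleftrightarrow>
     (\<forall>n\<ge>1. H2_derivs (real n - 1) (real n) y y1 y2) \<and>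
     summable (\<lambda>n. LINT t|lebesgue_on (cell (Suc n)). (cmod (y2 t))\<^sup>2 + (cmod (y t))\<^sup>2) \<and>
     (y \<longlongrightarrow> 0) (at_right 0) \<and>
     (\<forall>n::nat. n \<ge> 1 \<longrightarrow>
        (\<exists>u. (y \<longlongrightarrow> u) (at_left (real n)) \<and>
             (y \<longlongrightarrow> of_real (sqrt (real b)) * u) (at_right (real n))) \<and>
        (\<exists>w. (y1 \<longlongrightarrow> w) (at_left (real n)) \<and>
             (y1 \<longlongrightarrow> of_real (1 / sqrt (real b)) * w) (at_right (real n))))"

text \<open>The graph of the operator $A_V$, as a relation between representatives.\<close>

definition operator_A :: "nat \<Rightarrow> (real \<Rightarrow> real) \<Rightarrow> ((real \<Rightarrow> complex) \<times> (real \<Rightarrow> complex)) set" where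
  "operator_A b V = {(y, f). \<exists>y1 y2. in_domain b y y1 y2 \<and>
     (AE t in lebesgue_on {0..}. f t = - y2 t + of_real (V t) * y t)}"

definition kernel_minus ::
    "((real \<Rightarrow> complex) \<times> (real \<Rightarrow> complex)) set \<Rightarrow> real \<Rightarrow> (real \<Rightarrow> complex) set" where
  "kernel_minus T \<mu> = {y. \<exists>f. (y, f) \<in> T \<and> (AE t in lebesgue_on {0..}. f t = of_real \<mu> * y t)}"

text \<open>Linear independence in $L^2$, hence modulo functions vanishing almost everywhere.\<close>

definition L2_independent :: "(real \<Rightarrow> complex) set \<Rightarrow> bool" where
  "L2_independent F \<longleftrightarrow> finite F \<and>
     (\<forall>c :: (real \<Rightarrow> complex) \<Rightarrow> complex.
        (AE t in lebesgue_on {0..}. (\<Sum>f\<in>F. c f * f t) = 0) \<longrightarrow> (\<forall>f\<in>F. c f = 0))"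

definition L2_dim :: "(real \<Rightarrow> complex) set \<Rightarrow> ennreal" where
  "L2_dim S = (SUP F\<in>{F. F \<subseteq> S \<and> L2_independent F}. of_nat (card F))"

definition tree_R :: "nat \<Rightarrow> real" where
  "tree_R b = (sqrt (real b) + 1 / sqrt (real b)) / 2"

definition tree_theta :: "nat \<Rightarrow> real" where
  "tree_theta b = arccos (1 / tree_R b)"

definition gap :: "nat \<Rightarrow> nat \<Rightarrow> real set" where
  "gap b l = (if l = 0 then {..<(tree_theta b)\<^sup>2}
              else {(pi * real l - tree_theta b)\<^sup>2<..<(pi * real l + tree_theta b)\<^sup>2})"

definition band :: "nat \<Rightarrow> nat \<Rightarrow> real set" where
  "band b l = {(pi * (real l - 1) + tree_theta b)\<^sup>2..(pi * real l - tree_theta b)\<^sup>2}"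

text \<open>For \<open>b \<ge> 2\<close> the gaps with \<open>l \<ge> 0\<close> and the bands with \<open>l \<ge> 1\<close> partition the real line.\<close>

definition density_of_states :: "nat \<Rightarrow> real \<Rightarrow> real" where
  "density_of_states b \<mu> =
     (if \<exists>l. \<mu> \<in> gap b l then real (THE l. \<mu> \<in> gap b l)
      else let l = (THE l. l \<ge> 1 \<and> \<mu> \<in> band b l)
           in real l - 1 + arccos (tree_R b * cos (sqrt \<mu> - pi * (real l - 1))) / pi)"

text \<open>
  The operator $A_0 + \alpha V$ is $A_{\alpha V}$. The sums over uncountable index sets are
  unconditional sums in \<open>[0, \<infinity>]\<close>.
\<close>

definition counting_M_inner :: "nat \<Rightarrow> real \<Rightarrow> (real \<Rightarrow> real) \<Rightarrow> ennreal" where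
  "counting_M_inner b \<mu> V =
     (\<Sum>\<^sub>\<infinity>\<alpha>\<in>{0<..<1}. L2_dim (kernel_minus (operator_A b (\<lambda>t. \<alpha> * V t)) \<mu>))"

text \<open>
  \<open>counting_M b l \<mu> V\<close> is meant for \<open>\<mu>\<close> in the closure of \<open>gap b l\<close>; at an end of the gap it is the
  limit from inside. The closures of different gaps are disjoint, so \<open>\<mu>\<close> determines \<open>l\<close>.
\<close>

definition counting_M :: "nat \<Rightarrow> nat \<Rightarrow> real \<Rightarrow> (real \<Rightarrow> real) \<Rightarrow> ennreal" where
  "counting_M b l \<mu> V =
     (if \<mu> \<in> gap b l then counting_M_inner b \<mu> V
      else Lim (at \<mu> within gap b l) (\<lambda>\<nu>. counting_M_inner b \<nu> V))"

definition counting_N :: "nat \<Rightarrow> real \<Rightarrow> real \<Rightarrow> (real \<Rightarrow> real) \<Rightarrow> ennreal" where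
  "counting_N b \<mu>1 \<mu>2 V = (\<Sum>\<^sub>\<infinity>\<mu>\<in>{\<mu>1<..<\<mu>2}. L2_dim (kernel_minus (operator_A b V) \<mu>))"

definition tree_M :: "nat \<Rightarrow> nat \<Rightarrow> real \<Rightarrow> (real \<Rightarrow> real) \<Rightarrow> ennreal" where
  "tree_M b l \<mu> V = (\<Sum>k. counting_M b l \<mu> (\<lambda>t. V (t + real k)))"

definition tree_N :: "nat \<Rightarrow> real \<Rightarrow> real \<Rightarrow> (real \<Rightarrow> real) \<Rightarrow> ennreal" where
  "tree_N b \<mu>1 \<mu>2 V = (\<Sum>k. counting_N b \<mu>1 \<mu>2 (\<lambda>t. V (t + real k)))"

end

theory Submission
  imports Defs
begin

text \<open>
  For $\<lambda>=\<mu>^2$ in the \<open>l\<close>-th gap the angle of the solution of $-y''+Vy=\<lambda>y$ that decays at infinity,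
  followed back to $0$ with its rotation number, is a function $S(V,\<mu>)$: the Weyl angle. The number
  $\<lambda>$ is an eigenvalue iff $S\<in>\<pi>\<int>$. As $\<alpha>$ grows, $S(\<alpha> V,\<mu>)$ increases continuously from its
  unperturbed value in $(-\<pi>,\<pi>)$, and $S(V,\<mu>)$ decreases in $\<mu>$; so both counting functions count
  multiples of $\<pi>$ in an interval. For $V=gq(\<cdot>+k)$ the potential is a barrier on which the angle does
  not rotate up to $t+k\<approx>T$ with $T=ln g/(2\<kappa>)$, and it is negligible beyond. Without potential the
  decaying solution rotates by $\<pi> l$ per cell, so $S=\<pi> l(T-k)+O(1)$ for $k\<le>T$, while for larger \<open>k\<close> there is
  no eigenvalue at all. Summing over \<open>k\<close> gives $lT^2/2+O(T)$.
\<close>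

subsection \<open>Functions with bounded weak derivative\<close>

text \<open>The main obstacle is uniformity up to the ends of a gap: there the fixed angle of the
  vertex jump is neutral, the unperturbed solution no longer decays, and the counts are limits from
  inside. The Weyl angle is therefore introduced as a threshold, the least starting angle whose
  orbit never falls below the unperturbed fixed angle. This makes sense at the ends as well, and
  explicit subsolutions bound it with constants that do not see the distance to the ends. Decay of
  solutions enters inside the open gap, where it identifies the eigenvalues. The excluded point
  (\<pi> l)^2 is the one where the fixed angle is a multiple of \<pi>. A fixed distance
  \<open>d\<close> from it makes the counts vanish exactly for large k; counts that are merely
  bounded could not be summed over k. Angles are scaled by \<mu> = sqrt \<lambda>, which requires
  \<mu> > 0, so l = 0 is a separate case in which nothing is counted. As the potential is only
  measurable, all equations are integral equations, and every comparison of angles is derived from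
  one integrating factor.\<close>

definition bdd_meas :: "real \<Rightarrow> real \<Rightarrow> (real \<Rightarrow> 'a::euclidean_space) \<Rightarrow> bool" where
  "bdd_meas a b f \<longleftrightarrow> f \<in> borel_measurable (lebesgue_on {a..b}) \<and> (\<exists>B. \<forall>t\<in>{a..b}. norm (f t) \<le> B)"

lemma bdd_measI:
  assumes "f \<in> borel_measurable (lebesgue_on {a..b})" "\<And>t. t \<in> {a..b} \<Longrightarrow> norm (f t) \<le> B"
  shows "bdd_meas a b f"
  using assms unfolding bdd_meas_def by blast

lemma bdd_meas_measurable: "bdd_meas a b f \<Longrightarrow> f \<in> borel_measurable (lebesgue_on {a..b})"
  by (simp add: bdd_meas_def)

lemma bdd_meas_bound:
  assumes "bdd_meas a b f"
  obtains B where "B \<ge> 0" "\<And>t. t \<in> {a..b} \<Longrightarrow> norm (f t) \<le> B"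
proof -
  obtain B where B: "\<forall>t\<in>{a..b}. norm (f t) \<le> B" using assms by (auto simp: bdd_meas_def)
  show ?thesis by (rule that[of "max B 0"]) (use B in force)+
qed

lemma bdd_meas_subset:
  assumes "bdd_meas a b f" "a \<le> u" "v \<le> b"
  shows "bdd_meas u v f"
proof -
  have sub: "{u..v} \<subseteq> {a..b}" using assms by auto
  obtain B where "\<And>t. t \<in> {a..b} \<Longrightarrow> norm (f t) \<le> B" using bdd_meas_bound[OF assms(1)] by blast
  moreover have "f \<in> borel_measurable (lebesgue_on {u..v})"
    using bdd_meas_measurable[OF assms(1)] sub by (rule measurable_restrict_mono)
  ultimately show ?thesis using sub by (intro bdd_measI[where B=B]) auto
qed

lemma bdd_meas_continuous: "continuous_on {a..b} f \<Longrightarrow> bdd_meas a b f"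
proof -
  assume c: "continuous_on {a..b} f"
  then have "bounded (f ` {a..b})" by (intro compact_imp_bounded compact_continuous_image) auto
  then show ?thesis using continuous_imp_measurable_on_sets_lebesgue[OF c]
    unfolding bdd_meas_def bounded_iff by auto
qed

lemma bdd_meas_const: "bdd_meas a b (\<lambda>_. c)"
  by (intro bdd_meas_continuous continuous_intros)

lemma bdd_meas_add:
  assumes "bdd_meas a b f" "bdd_meas a b g" shows "bdd_meas a b (\<lambda>t. f t + g t)"
proof -
  obtain A B where "\<And>t. t \<in> {a..b} \<Longrightarrow> norm (f t) \<le> A" "\<And>t. t \<in> {a..b} \<Longrightarrow> norm (g t) \<le> B"
    by (metis assms bdd_meas_bound)
  then show ?thesis using bdd_meas_measurable[OF assms(1)] bdd_meas_measurable[OF assms(2)]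
    by (intro bdd_measI[where B="A+B"] borel_measurable_add) (auto intro: norm_triangle_mono)
qed

lemma bdd_meas_mult:
  fixes f g :: "real \<Rightarrow> 'a::{euclidean_space, real_normed_algebra}"
  assumes "bdd_meas a b f" "bdd_meas a b g" shows "bdd_meas a b (\<lambda>t. f t * g t)"
proof -
  obtain A B where A: "A \<ge> 0" "\<And>t. t \<in> {a..b} \<Longrightarrow> norm (f t) \<le> A" and
    "\<And>t. t \<in> {a..b} \<Longrightarrow> norm (g t) \<le> B"
    by (metis assms bdd_meas_bound)
  then have "norm (f t * g t) \<le> A * B" if "t \<in> {a..b}" for t
    using that by (intro order_trans[OF norm_mult_ineq] mult_mono) auto
  then show ?thesis using bdd_meas_measurable[OF assms(1)] bdd_meas_measurable[OF assms(2)]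
    by (intro bdd_measI borel_measurable_times) auto
qed

lemma bdd_meas_minus: "bdd_meas a b f \<Longrightarrow> bdd_meas a b (\<lambda>t. - f t)"
  unfolding bdd_meas_def by auto

lemma bdd_meas_diff:
  assumes "bdd_meas a b f" "bdd_meas a b g" shows "bdd_meas a b (\<lambda>t. f t - g t)"
  using bdd_meas_add[OF assms(1) bdd_meas_minus[OF assms(2)]] by simp

lemma bdd_meas_of_real:
  assumes "bdd_meas a b f"
  shows "bdd_meas a b (\<lambda>t. of_real (f t) :: 'a::{euclidean_space, real_normed_algebra_1})"
proof -
  obtain A where "\<And>t. t \<in> {a..b} \<Longrightarrow> norm (f t) \<le> A" by (metis assms bdd_meas_bound)
  then show ?thesis using bdd_meas_measurable[OF assms] by (intro bdd_measI[where B=A]) auto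
qed

lemma bdd_meas_cong:
  assumes "bdd_meas a b f" "\<And>t. t \<in> {a..b} \<Longrightarrow> f t = g t" shows "bdd_meas a b g"
proof -
  obtain A where "\<And>t. t \<in> {a..b} \<Longrightarrow> norm (f t) \<le> A" by (metis assms(1) bdd_meas_bound)
  moreover have "g \<in> borel_measurable (lebesgue_on {a..b})"
    using bdd_meas_measurable[OF assms(1)] assms(2) by (subst measurable_cong[of _ _ f]) auto
  ultimately show ?thesis using assms(2) by (intro bdd_measI[where B=A]) auto
qed

lemma bdd_meas_absolutely_integrable:
  assumes "bdd_meas a b f" "a \<le> u" "v \<le> b" shows "f absolutely_integrable_on {u..v}"
proof -
  obtain B where "\<And>t. t \<in> {u..v} \<Longrightarrow> norm (f t) \<le> B" using bdd_meas_bound[OF bdd_meas_subset[OF assms]] by blast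
  then show ?thesis using bdd_meas_measurable[OF bdd_meas_subset[OF assms]]
    by (intro measurable_bounded_by_integrable_imp_absolutely_integrable[where g="\<lambda>_. B"]) auto
qed

lemma bdd_meas_integrable:
  assumes "bdd_meas a b f" "a \<le> u" "v \<le> b" shows "f integrable_on {u..v}"
  using bdd_meas_absolutely_integrable[OF assms] set_lebesgue_integral_eq_integral(1) by blast

lemma bdd_meas_integral_norm:
  assumes "bdd_meas a b f" "a \<le> u" "u \<le> v" "v \<le> b" "\<And>t. t \<in> {u..v} \<Longrightarrow> norm (f t) \<le> B"
  shows "norm (integral {u..v} f) \<le> B * (v - u)"
proof -
  have "norm (integral {u..v} f) \<le> integral {u..v} (\<lambda>_. B)"
    using assms by (intro integral_norm_bound_integral bdd_meas_integrable[OF assms(1)]) auto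
  then show ?thesis using assms(3) by (simp add: mult.commute)
qed

text \<open>With \<open>V\<close> merely measurable, derivatives exist only almost everywhere;
  \<open>f\<close> is the derivative of \<open>F\<close> in this integrated sense. Boundedness of
  \<open>f\<close> makes \<open>F\<close> Lipschitz, and the second order error estimates below rest
  on that.\<close>

definition ac_on :: "real \<Rightarrow> real \<Rightarrow> (real \<Rightarrow> 'a::euclidean_space) \<Rightarrow> (real \<Rightarrow> 'a) \<Rightarrow> bool" where
  "ac_on a b F f \<longleftrightarrow> bdd_meas a b f \<and> (\<forall>t\<in>{a..b}. F t - F a = integral {a..t} f)"

lemma ac_on_bdd_meas: "ac_on a b F f \<Longrightarrow> bdd_meas a b f"
  by (simp add: ac_on_def)

lemma ac_on_increment:
  assumes "ac_on a b F f" "a \<le> u" "u \<le> v" "v \<le> b"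
  shows "F v - F u = integral {u..v} f"
proof -
  have I: "integral {a..v} f = integral {a..u} f + integral {u..v} f"
    by (rule Henstock_Kurzweil_Integration.integral_combine[symmetric])
      (use assms in \<open>auto intro: bdd_meas_integrable[OF ac_on_bdd_meas]\<close>)
  have "F v - F u = (F v - F a) - (F u - F a)" by simp
  also have "\<dots> = integral {a..v} f - integral {a..u} f" using assms by (simp add: ac_on_def)
  finally have "F v - F u = integral {a..v} f - integral {a..u} f" .
  then show ?thesis unfolding I by simp
qed

lemma ac_onD: "ac_on a b F f \<Longrightarrow> t \<in> {a..b} \<Longrightarrow> F t = F a + integral {a..t} f"
  unfolding ac_on_def by (metis add.commute diff_add_cancel)

lemma ac_onI:
  assumes "bdd_meas a b f" "\<And>t. t \<in> {a..b} \<Longrightarrow> F t = F a + integral {a..t} f" shows "ac_on a b F f"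
  unfolding ac_on_def
proof (intro conjI ballI assms(1))
  fix t assume "t \<in> {a..b}"
  from assms(2)[OF this] show "F t - F a = integral {a..t} f" by (metis add_diff_cancel_left')
qed

lemma ac_on_Lipschitz:
  assumes "ac_on a b F f" "\<And>t. t \<in> {a..b} \<Longrightarrow> norm (f t) \<le> B" "u \<in> {a..b}" "v \<in> {a..b}"
  shows "norm (F v - F u) \<le> B * \<bar>v - u\<bar>"
proof -
  have *: "norm (F y - F x) \<le> B * \<bar>y - x\<bar>" if xy: "a \<le> x" "x \<le> y" "y \<le> b" for x y
  proof -
    have "norm (integral {x..y} f) \<le> B * (y - x)"
      using xy by (intro bdd_meas_integral_norm[OF ac_on_bdd_meas[OF assms(1)]] assms(2)) auto
    then show ?thesis unfolding ac_on_increment[OF assms(1) xy] using xy by simp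
  qed
  show ?thesis
  proof (cases "u \<le> v")
    case True
    then show ?thesis using *[of u v] assms(3,4) by simp
  next
    case False
    then have "norm (F u - F v) \<le> B * \<bar>u - v\<bar>" using *[of v u] assms(3,4) by simp
    then show ?thesis by (simp only: norm_minus_commute abs_minus_commute)
  qed
qed

lemma ac_on_continuous: "ac_on a b F f \<Longrightarrow> continuous_on {a..b} F"
proof -
  assume ac: "ac_on a b F f"
  have "continuous_on {a..b} (\<lambda>t. F a + integral {a..t} f)"
    by (intro continuous_intros indefinite_integral_continuous_1 bdd_meas_integrable[OF ac_on_bdd_meas[OF ac]]) auto
  then show ?thesis by (rule continuous_on_eq) (simp add: ac_onD[OF ac, symmetric])
qed

lemma ac_on_const: "ac_on a b (\<lambda>_. c) (\<lambda>_. 0)"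
  unfolding ac_on_def using bdd_meas_const[of a b 0] by simp

text \<open>
  Product and chain rule for functions with bounded weak derivative need no almost everywhere
  differentiation: the error of the candidate antiderivative is of second order in the step, so it
  is differentiable everywhere with derivative zero.
\<close>

lemma quadratic_increment_const:
  fixes h :: "real \<Rightarrow> 'a::real_normed_vector"
  assumes "\<And>u v. a \<le> u \<Longrightarrow> u \<le> v \<Longrightarrow> v \<le> b \<Longrightarrow> norm (h v - h u) \<le> K * (v - u)\<^sup>2"
    and "t \<in> {a..b}"
  shows "h t = h a"
proof -
  have K: "norm (h v - h u) \<le> \<bar>K\<bar> * (v - u)\<^sup>2" if "u \<in> {a..b}" "v \<in> {a..b}" for u v
  proof -
    have "norm (h v - h u) \<le> K * (v - u)\<^sup>2" 
      using that assms(1)[of u v] assms(1)[of v u]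
      by (cases "u \<le> v") (auto simp: norm_minus_commute power2_commute)
    also have "\<dots> \<le> \<bar>K\<bar> * (v - u)\<^sup>2" by (intro mult_right_mono) auto
    finally show ?thesis .
  qed
  have "(h has_derivative (\<lambda>_. 0)) (at x within {a..b})" if x: "x \<in> {a..b}" for x
    unfolding has_derivative_within_alt
  proof (intro conjI allI impI)
    fix e :: real assume "e > 0"
    show "\<exists>d>0. \<forall>y\<in>{a..b}. norm (y - x) < d \<longrightarrow> norm (h y - h x - 0) \<le> e * norm (y - x)"
    proof (intro exI conjI ballI impI)
      show "e / (\<bar>K\<bar> + 1) > 0" using \<open>e > 0\<close> by auto
      fix y assume y: "y \<in> {a..b}" "norm (y - x) < e / (\<bar>K\<bar> + 1)"
      have "norm (h y - h x) \<le> \<bar>K\<bar> * norm (y - x) * norm (y - x)"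
        using K[OF x y(1)] by (simp add: power2_eq_square)
      also have "\<dots> \<le> e * norm (y - x)"
      proof (intro mult_right_mono)
        have "\<bar>K\<bar> * norm (y - x) \<le> (\<bar>K\<bar> + 1) * norm (y - x)" by (intro mult_right_mono) auto
        also have "\<dots> \<le> e" using y(2) by (simp add: field_simps)
        finally show "\<bar>K\<bar> * norm (y - x) \<le> e" .
      qed auto
      finally show "norm (h y - h x - 0) \<le> e * norm (y - x)" by simp
    qed
  qed simp
  then obtain c where "\<forall>x\<in>{a..b}. h x = c"
    using has_derivative_zero_constant[of "{a..b}" h] by auto
  then show ?thesis using assms(2) by auto
qed

lemma ac_on_quadratic:
  assumes "bdd_meas a b f"
    and "\<And>u v. a \<le> u \<Longrightarrow> u \<le> v \<Longrightarrow> v \<le> b \<Longrightarrow> norm (F v - F u - integral {u..v} f) \<le> K * (v - u)\<^sup>2"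
  shows "ac_on a b F f"
proof (rule ac_onI)
  show "bdd_meas a b f" by fact
  fix t assume t: "t \<in> {a..b}"
  have "F t - integral {a..t} f = F a - integral {a..a} f"
  proof (rule quadratic_increment_const[where K=K and b=b])
    fix u v assume uv: "a \<le> u" "u \<le> v" "v \<le> b"
    have *: "integral {a..v} f = integral {a..u} f + integral {u..v} f"
      by (rule Henstock_Kurzweil_Integration.integral_combine[symmetric]) (use uv in \<open>auto intro: bdd_meas_integrable[OF assms(1)]\<close>)
    have "F v - integral {a..v} f - (F u - integral {a..u} f) = F v - F u - integral {u..v} f" by (simp add: *)
    then show "norm (F v - integral {a..v} f - (F u - integral {a..u} f)) \<le> K * (v - u)\<^sup>2"
      using assms(2)[OF uv] by (simp only:)
  qed (use t in auto)
  then show "F t = F a + integral {a..t} f" by (simp add: algebra_simps)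
qed

lemma ac_on_add:
  assumes "ac_on a b F f" "ac_on a b G g" shows "ac_on a b (\<lambda>t. F t + G t) (\<lambda>t. f t + g t)"
proof (rule ac_on_quadratic[where K=0])
  show "bdd_meas a b (\<lambda>t. f t + g t)" using assms by (intro bdd_meas_add ac_on_bdd_meas)
  fix u v assume uv: "a \<le> u" "u \<le> v" "v \<le> b"
  have "integral {u..v} (\<lambda>t. f t + g t) = integral {u..v} f + integral {u..v} g"
    using uv assms by (intro integral_add bdd_meas_integrable[OF ac_on_bdd_meas]) auto
  then have "F v + G v - (F u + G u) - integral {u..v} (\<lambda>t. f t + g t) = 0"
    unfolding ac_on_increment[OF assms(1) uv, symmetric] ac_on_increment[OF assms(2) uv, symmetric] by simp
  then show "norm (F v + G v - (F u + G u) - integral {u..v} (\<lambda>t. f t + g t)) \<le> 0 * (v-u)\<^sup>2"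
    by simp
qed

lemma ac_on_cong:
  assumes "ac_on a b F f" "\<And>t. t \<in> {a..b} \<Longrightarrow> F t = G t" "\<And>t. t \<in> {a..b} \<Longrightarrow> f t = g t"
  shows "ac_on a b G g"
  unfolding ac_on_def
proof (intro conjI ballI)
  show "bdd_meas a b g" using assms(1,3) by (auto intro: bdd_meas_cong ac_on_bdd_meas)
  fix t assume t: "t \<in> {a..b}"
  have "integral {a..t} f = integral {a..t} g"
    using t assms(3) by (intro Henstock_Kurzweil_Integration.integral_cong) auto
  moreover have "F t - F a = integral {a..t} f" using assms(1) t by (simp add: ac_on_def)
  moreover have "a \<in> {a..b}" using t by simp
  ultimately show "G t - G a = integral {a..t} g" using assms(2) t by metis
qed

lemma ac_on_mult:
  fixes F G :: "real \<Rightarrow> 'a::{euclidean_space, real_normed_algebra}"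
  assumes F: "ac_on a b F f" and G: "ac_on a b G g"
  shows "ac_on a b (\<lambda>t. F t * G t) (\<lambda>t. f t * G t + F t * g t)"
proof -
  obtain A where A: "A \<ge> 0" "\<And>t. t \<in> {a..b} \<Longrightarrow> norm (f t) \<le> A" by (metis F ac_on_bdd_meas bdd_meas_bound)
  obtain B where B: "B \<ge> 0" "\<And>t. t \<in> {a..b} \<Longrightarrow> norm (g t) \<le> B" by (metis G ac_on_bdd_meas bdd_meas_bound)
  note LF = ac_on_Lipschitz[OF F A(2)] and LG = ac_on_Lipschitz[OF G B(2)]
  have bF: "bdd_meas a b F" and bG: "bdd_meas a b G" using ac_on_continuous bdd_meas_continuous F G by blast+
  have bf: "bdd_meas a b f" and bg: "bdd_meas a b g" using F G ac_on_bdd_meas by auto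
  show ?thesis
  proof (rule ac_on_quadratic[where K="3*A*B"])
    show "bdd_meas a b (\<lambda>t. f t * G t + F t * g t)"
      by (intro bdd_meas_add bdd_meas_mult bF bG bf bg)
    fix u v assume uv: "a \<le> u" "u \<le> v" "v \<le> b"
    \<comment> \<open>Freezing \<open>G\<close> and \<open>F\<close> at \<open>u\<close> leaves two
      remainders of size O(v - u) in the integrand; their integrals are of second order.\<close>
    let ?r1 = "\<lambda>t. f t * (G t - G u)" and ?r2 = "\<lambda>t. (F t - F u) * g t"
    have b1: "bdd_meas a b ?r1" and b2: "bdd_meas a b ?r2"
      by (intro bdd_meas_mult bdd_meas_diff bdd_meas_const bF bG bf bg)+
    have if1: "f integrable_on {u..v}" "g integrable_on {u..v}"
       "?r1 integrable_on {u..v}" "?r2 integrable_on {u..v}"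
      using bdd_meas_integrable[of a b] bf bg b1 b2 uv by auto
    have if2: "(\<lambda>t. f t * G u) integrable_on {u..v}" "(\<lambda>t. F u * g t) integrable_on {u..v}"
      using integrable_on_mult_left[OF if1(1)] integrable_on_mult_right[OF if1(2)] by auto
    have if3: "integral {u..v} (\<lambda>t. f t * G u) = integral {u..v} f * G u"
      "integral {u..v} (\<lambda>t. F u * g t) = F u * integral {u..v} g"
      using if1(1,2) by (blast intro: integral_unique has_integral_mult_left has_integral_mult_right integrable_integral)+
    have "integral {u..v} (\<lambda>t. f t * G t + F t * g t) =
       integral {u..v} (\<lambda>t. (?r1 t + ?r2 t) + (f t * G u + F u * g t))"
      by (intro Henstock_Kurzweil_Integration.integral_cong) (simp add: algebra_simps)
    also have "\<dots> = (integral {u..v} ?r1 + integral {u..v} ?r2) + (integral {u..v} f * G u + F u * integral {u..v} g)"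
      using if1 if2 if3 by (simp add: integral_add integrable_add)
    finally have I: "integral {u..v} (\<lambda>t. f t * G t + F t * g t) =
      (integral {u..v} ?r1 + integral {u..v} ?r2) + ((F v - F u) * G u + F u * (G v - G u))"
      by (simp add: ac_on_increment[OF F uv] ac_on_increment[OF G uv])
    have n1: "norm (integral {u..v} ?r1) \<le> (A * (B * (v-u))) * (v - u)"
    proof (rule bdd_meas_integral_norm[OF b1 uv])
      fix t assume t: "t \<in> {u..v}"
      have "norm (G t - G u) \<le> B * (v - u)"
        using LG[of u t] t uv B mult_left_mono[of "t-u" "v-u" B] by auto
      then show "norm (f t * (G t - G u)) \<le> A * (B * (v-u))"
        using A t uv by (intro order_trans[OF norm_mult_ineq] mult_mono) auto
    qed
    have n2: "norm (integral {u..v} ?r2) \<le> ((A * (v-u)) * B) * (v - u)"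
    proof (rule bdd_meas_integral_norm[OF b2 uv])
      fix t assume t: "t \<in> {u..v}"
      have "norm (F t - F u) \<le> A * (v - u)"
        using LF[of u t] t uv A mult_left_mono[of "t-u" "v-u" A] by auto
      then show "norm ((F t - F u) * g t) \<le> (A * (v-u)) * B"
        using A B t uv by (intro order_trans[OF norm_mult_ineq] mult_mono) auto
    qed
    have n3: "norm ((F v - F u) * (G v - G u)) \<le> (A * (v-u)) * (B * (v-u))"
      using LF[of u v] LG[of u v] uv A B by (intro order_trans[OF norm_mult_ineq] mult_mono) auto
    have "F v * G v - F u * G u - integral {u..v} (\<lambda>t. f t * G t + F t * g t) =
       (F v - F u) * (G v - G u) - (integral {u..v} ?r1 + integral {u..v} ?r2)"
      unfolding I by (simp add: algebra_simps)
    also have "norm \<dots> \<le> (A * (v-u)) * (B * (v-u)) + ((A * (B * (v-u))) * (v - u) + ((A * (v-u)) * B) * (v - u))"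
      by (intro order_trans[OF norm_triangle_ineq4] add_mono order_trans[OF norm_triangle_ineq] n1 n2 n3)
    also have "\<dots> = 3*A*B * (v-u)\<^sup>2" by algebra
    finally show "norm (F v * G v - F u * G u - integral {u..v} (\<lambda>t. f t * G t + F t * g t)) \<le> 3*A*B * (v-u)\<^sup>2" .
  qed
qed

text \<open>The Lipschitz bound on \<open>G'\<close> is asked on a convex set around the range of
  \<open>F\<close> because the exponential has no global one; convexity keeps the mean value points
  inside.\<close>

lemma ac_on_chain:
  fixes F f G G' :: "real \<Rightarrow> real"
  assumes F: "ac_on a b F f" and S: "convex S" "F ` {a..b} \<subseteq> S"
    and G: "\<And>x. (G has_real_derivative G' x) (at x)"
    and L: "\<And>x y. x \<in> S \<Longrightarrow> y \<in> S \<Longrightarrow> \<bar>G' x - G' y\<bar> \<le> L * \<bar>x - y\<bar>"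
  shows "ac_on a b (\<lambda>t. G (F t)) (\<lambda>t. G' (F t) * f t)"
proof -
  obtain A where A: "A \<ge> 0" "\<And>t. t \<in> {a..b} \<Longrightarrow> norm (f t) \<le> A" by (metis F ac_on_bdd_meas bdd_meas_bound)
  note LF = ac_on_Lipschitz[OF F A(2)]
  have bf: "bdd_meas a b f" using F ac_on_bdd_meas by auto
  have cF: "continuous_on {a..b} F" using F by (rule ac_on_continuous)
  define M where "M = \<bar>L\<bar>"
  have M: "M \<ge> 0" by (simp add: M_def)
  have LM: "\<bar>G' x - G' y\<bar> \<le> M * \<bar>x - y\<bar>" if "x \<in> S" "y \<in> S" for x y
    using L[OF that] mult_right_mono[of L "\<bar>L\<bar>" "\<bar>x-y\<bar>"] unfolding M_def by linarith
  have "M-lipschitz_on S G'" by (rule lipschitz_onI) (use LM M in \<open>simp_all add: dist_real_def\<close>)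
  then have "continuous_on S G'" by (rule lipschitz_on_continuous_on)
  then have "continuous_on {a..b} (\<lambda>t. G' (F t))"
    using cF S(2) by (rule continuous_on_compose2)
  then have bG': "bdd_meas a b (\<lambda>t. G' (F t))" by (rule bdd_meas_continuous)
  show ?thesis
  proof (rule ac_on_quadratic[where K="2*M*A*A"])
    show "bdd_meas a b (\<lambda>t. G' (F t) * f t)" by (intro bdd_meas_mult bG' bf)
    fix u v assume uv: "a \<le> u" "u \<le> v" "v \<le> b"
    have FS: "F t \<in> S" if "t \<in> {u..v}" for t using S that uv by auto
    let ?r = "\<lambda>t. (G' (F t) - G' (F u)) * f t"
    have br: "bdd_meas a b ?r" by (intro bdd_meas_mult bdd_meas_diff bdd_meas_const bG' bf)
    have "integral {u..v} (\<lambda>t. G' (F t) * f t) = integral {u..v} (\<lambda>t. ?r t + G' (F u) * f t)"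
      by (intro Henstock_Kurzweil_Integration.integral_cong) (simp add: algebra_simps)
    also have "\<dots> = integral {u..v} ?r + G' (F u) * integral {u..v} f"
      using uv bdd_meas_integrable[OF br uv(1,3)] bdd_meas_integrable[OF bf uv(1,3)]
      by (simp add: integral_add integrable_on_mult_right)
    finally have I: "integral {u..v} (\<lambda>t. G' (F t) * f t) = integral {u..v} ?r + G' (F u) * (F v - F u)"
      by (simp add: ac_on_increment[OF F uv])
    have n1: "norm (integral {u..v} ?r) \<le> ((M * (A * (v-u))) * A) * (v - u)"
    proof (rule bdd_meas_integral_norm[OF br uv])
      fix t assume t: "t \<in> {u..v}"
      have "\<bar>F t - F u\<bar> \<le> A * (v - u)"
        using LF[of u t] t uv A mult_left_mono[of "t-u" "v-u" A] by auto
      then have "\<bar>G' (F t) - G' (F u)\<bar> \<le> M * (A * (v-u))"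
        using LM[of "F t" "F u"] FS t uv M mult_left_mono[of "\<bar>F t - F u\<bar>" "A*(v-u)" M] by force
      then show "norm ((G' (F t) - G' (F u)) * f t) \<le> (M * (A * (v-u))) * A"
        using A t uv M by (intro order_trans[OF norm_mult_ineq] mult_mono) auto
    qed
    have n2: "\<bar>G (F v) - G (F u) - G' (F u) * (F v - F u)\<bar> \<le> M * (A * (v-u)) * (A * (v-u))"
    proof -
      have "\<exists>\<xi>\<in>closed_segment (F u) (F v). G (F v) - G (F u) = G' \<xi> * (F v - F u)"
      proof (cases "F u = F v")
        case True then show ?thesis by auto
      next
        case False
        then consider "F u < F v" | "F v < F u" by linarith
        then show ?thesis
        proof cases
          case 1
          then obtain \<xi> where "F u < \<xi>" "\<xi> < F v" "G (F v) - G (F u) = (F v - F u) * G' \<xi>"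
            using MVT2[of "F u" "F v" G G'] G by auto
          then show ?thesis by (intro bexI[of _ \<xi>]) (auto simp: closed_segment_eq_real_ivl)
        next
          case 2
          then obtain \<xi> where "F v < \<xi>" "\<xi> < F u" "G (F u) - G (F v) = (F u - F v) * G' \<xi>"
            using MVT2[of "F v" "F u" G G'] G by auto
          then show ?thesis by (intro bexI[of _ \<xi>]) (auto simp: closed_segment_eq_real_ivl algebra_simps)
        qed
      qed
      then obtain \<xi> where \<xi>: "\<xi> \<in> closed_segment (F u) (F v)" "G (F v) - G (F u) = G' \<xi> * (F v - F u)" by auto
      have "\<xi> \<in> S" using \<xi>(1) closed_segment_subset[OF _ _ S(1), of "F u" "F v"] FS uv by auto
      have d: "\<bar>F v - F u\<bar> \<le> A * (v-u)" using LF[of u v] uv by auto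
      have "\<bar>\<xi> - F u\<bar> \<le> \<bar>F v - F u\<bar>" using \<xi>(1) by (auto simp: closed_segment_eq_real_ivl split: if_splits)
      then have "\<bar>G' \<xi> - G' (F u)\<bar> \<le> M * (A * (v-u))"
        using LM[OF \<open>\<xi> \<in> S\<close>, of "F u"] FS[of u] uv d M mult_left_mono[of "\<bar>\<xi> - F u\<bar>" "A*(v-u)" M] by force
      moreover have "G (F v) - G (F u) - G' (F u) * (F v - F u) = (G' \<xi> - G' (F u)) * (F v - F u)"
        using \<xi>(2) by (simp add: algebra_simps)
      ultimately show ?thesis using d A M uv by (auto simp: abs_mult intro!: mult_mono)
    qed
    have "norm (G (F v) - G (F u) - integral {u..v} (\<lambda>t. G' (F t) * f t)) \<le>
      \<bar>G (F v) - G (F u) - G' (F u) * (F v - F u)\<bar> + norm (integral {u..v} ?r)"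
      unfolding I by simp
    also have "\<dots> \<le> M * (A * (v-u)) * (A * (v-u)) + ((M * (A * (v-u))) * A) * (v - u)"
      by (intro add_mono n1 n2)
    also have "\<dots> = 2*M*A*A * (v-u)\<^sup>2" by algebra
    finally show "norm (G (F v) - G (F u) - integral {u..v} (\<lambda>t. G' (F t) * f t)) \<le> 2*M*A*A * (v-u)\<^sup>2" .
  qed
qed

lemma abs_sin_diff_le: "\<bar>sin x - sin y\<bar> \<le> \<bar>x - y\<bar>" for x y :: real
proof -
  have "\<bar>sin x - sin y\<bar> = 2 * \<bar>sin ((x-y)/2)\<bar> * \<bar>cos ((x+y)/2)\<bar>"
    by (simp add: sin_diff_sin abs_mult)
  also have "\<dots> \<le> 2 * \<bar>(x-y)/2\<bar> * 1"
    by (intro mult_mono abs_sin_x_le_abs_x) auto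
  finally show ?thesis by simp
qed

lemma abs_cos_diff_le: "\<bar>cos x - cos y\<bar> \<le> \<bar>x - y\<bar>" for x y :: real
  using abs_sin_diff_le[of "pi/2 - x" "pi/2 - y"] by (simp add: sin_diff algebra_simps abs_minus_commute)

lemma ac_on_sin:
  fixes F f :: "real \<Rightarrow> real"
  assumes "ac_on a b F f" shows "ac_on a b (\<lambda>t. sin (F t)) (\<lambda>t. cos (F t) * f t)"
  by (rule ac_on_chain[OF assms, where S=UNIV and L=1]) (auto simp: abs_cos_diff_le)

lemma ac_on_cos:
  fixes F f :: "real \<Rightarrow> real"
  assumes "ac_on a b F f" shows "ac_on a b (\<lambda>t. cos (F t)) (\<lambda>t. - sin (F t) * f t)"
proof (rule ac_on_chain[OF assms, where S=UNIV and L=1])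
  show "\<bar>- sin x - - sin y\<bar> \<le> 1 * \<bar>x - y\<bar>" for x y :: real
    using abs_sin_diff_le[of y x] by (simp add: abs_minus_commute)
qed auto

lemma ac_on_exp:
  fixes F f :: "real \<Rightarrow> real"
  assumes "ac_on a b F f" shows "ac_on a b (\<lambda>t. exp (F t)) (\<lambda>t. exp (F t) * f t)"
proof -
  obtain M where M: "\<And>t. t \<in> {a..b} \<Longrightarrow> norm (F t) \<le> M"
    using bdd_meas_bound[OF bdd_meas_continuous[OF ac_on_continuous[OF assms]]] by blast
  have *: "\<bar>exp x - exp y\<bar> \<le> exp M * \<bar>x - y\<bar>" if "y \<le> x" "x \<le> M" for x y :: real
  proof -
    have "exp y \<ge> exp x * (1 + (y - x))"
      using exp_ge_add_one_self[of "y - x"] by (simp add: exp_diff field_simps)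
    then have "exp x - exp y \<le> exp x * (x - y)" by (simp add: algebra_simps)
    also have "\<dots> \<le> exp M * (x - y)" using that by (intro mult_right_mono) auto
    finally show ?thesis using that by simp
  qed
  show ?thesis
  proof (rule ac_on_chain[OF assms, where S="{-M..M}" and L="exp M"])
    show "\<bar>exp x - exp y\<bar> \<le> exp M * \<bar>x - y\<bar>" if "x \<in> {-M..M}" "y \<in> {-M..M}" for x y :: real
      using *[of x y] *[of y x] that by (cases "y \<le> x") (auto simp: abs_minus_commute)
  qed (use M in \<open>auto simp: abs_le_iff minus_le_iff\<close>)
qed

lemma ac_on_of_real:
  assumes "ac_on a b F f"
  shows "ac_on a b (\<lambda>t. of_real (F t) :: complex) (\<lambda>t. of_real (f t))"
proof -
  have "integral {a..t} (\<lambda>t. of_real (f t) :: complex) = of_real (integral {a..t} f)" if "t \<in> {a..b}" for t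
  proof -
    have "(f has_integral (integral {a..t} f)) {a..t}"
      using bdd_meas_integrable[OF ac_on_bdd_meas[OF assms], of a t] that by (auto intro: integrable_integral)
    from has_integral_linear[OF this bounded_linear_of_real]
    show ?thesis by (auto simp: o_def intro: integral_unique)
  qed
  moreover have "F t - F a = integral {a..t} f" if "t \<in> {a..b}" for t
    using assms that by (simp add: ac_on_def)
  ultimately show ?thesis using assms bdd_meas_of_real[of a b f]
    by (simp add: ac_on_def flip: of_real_diff)
qed

lemma ac_on_cmult:
  fixes c :: "'a::{euclidean_space, real_normed_algebra}"
  assumes "ac_on a b F f" shows "ac_on a b (\<lambda>t. c * F t) (\<lambda>t. c * f t)"
  using ac_on_mult[OF ac_on_const assms] by simp

lemma ac_on_diff:
  assumes "ac_on a b F f" "ac_on a b G g" shows "ac_on a b (\<lambda>t. F t - G t) (\<lambda>t. f t - g t)"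
proof -
  have "ac_on a b (\<lambda>t. - G t) (\<lambda>t. - g t)"
    unfolding ac_on_def
  proof (intro conjI ballI)
    show "bdd_meas a b (\<lambda>t. - g t)" using assms(2) by (intro bdd_meas_minus ac_on_bdd_meas)
    fix t assume "t \<in> {a..b}"
    then have "G t - G a = integral {a..t} g" using assms(2) by (simp add: ac_on_def)
    then have "- (G t - G a) = integral {a..t} (\<lambda>t. - g t)" by simp
    then show "- G t - - G a = integral {a..t} (\<lambda>t. - g t)" by simp
  qed
  from ac_on_add[OF assms(1) this] show ?thesis by simp
qed

lemma ac_on_integral:
  assumes "bdd_meas a b f" shows "ac_on a b (\<lambda>t. integral {a..t} f) f"
  using assms by (auto simp: ac_on_def)

lemma ac_on_mono:
  fixes F f :: "real \<Rightarrow> real"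
  assumes "ac_on a b F f" "\<And>t. t \<in> {u..v} \<Longrightarrow> f t \<ge> 0" "a \<le> u" "u \<le> v" "v \<le> b"
  shows "F u \<le> F v"
proof -
  have "integral {u..v} f \<ge> 0" using assms by (intro integral_nonneg bdd_meas_integrable[OF ac_on_bdd_meas]) auto
  then show ?thesis using ac_on_increment[OF assms(1,3,4,5)] by simp
qed

lemma ac_on_zero_const:
  assumes "ac_on a b F f" "\<And>t. t \<in> {a..b} \<Longrightarrow> f t = 0" "t \<in> {a..b}"
  shows "F t = F a"
proof -
  have "integral {a..t} f = integral {a..t} (\<lambda>_. 0)"
    using assms by (intro Henstock_Kurzweil_Integration.integral_cong) auto
  then show ?thesis using ac_onD[OF assms(1,3)] by simp
qed

lemma ac_on_vector_derivative:
  assumes "ac_on a b F f" "continuous_on {a..b} f" "t \<in> {a<..<b}"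
  shows "(F has_vector_derivative f t) (at t)"
proof -
  have t: "t \<in> {a..b}" using assms(3) by auto
  have "((\<lambda>u. F a + integral {a..u} f) has_vector_derivative (0 + f t)) (at t within {a..b})"
    by (intro has_vector_derivative_add has_vector_derivative_const integral_has_vector_derivative assms t)
  then have "(F has_vector_derivative f t) (at t within {a..b})"
    by (intro has_vector_derivative_transform[OF t, of F "\<lambda>u. F a + integral {a..u} f"] ac_onD[OF assms(1)])
      simp_all
  then show ?thesis using assms(3) by (metis at_within_Icc_at greaterThanLessThan_iff)
qed

subsection \<open>Pruefer angles on an interval\<close>

text \<open>The right-hand side is only measurable in \<open>t\<close>, so the solution is one of
  the integral equation. The Picard iterates converge uniformly, and the Lipschitz bound carries the
  limit through the integral.\<close>

lemma picard_existence:
  fixes f :: "real \<Rightarrow> real \<Rightarrow> real"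
  assumes ab: "a \<le> b" and L: "L > 0"
    and meas: "\<And>\<phi>. continuous_on {a..b} \<phi> \<Longrightarrow> (\<lambda>t. f t (\<phi> t)) \<in> borel_measurable (lebesgue_on {a..b})"
    and bound: "\<And>t x. t \<in> {a..b} \<Longrightarrow> \<bar>f t x\<bar> \<le> B"
    and lip: "\<And>t x y. t \<in> {a..b} \<Longrightarrow> \<bar>f t x - f t y\<bar> \<le> L * \<bar>x - y\<bar>"
  shows "\<exists>\<phi>. \<phi> a = x0 \<and> ac_on a b \<phi> (\<lambda>t. f t (\<phi> t))"
proof -
  define p where "p = rec_nat (\<lambda>_. x0) (\<lambda>_ \<phi> t. x0 + integral {a..t} (\<lambda>s. f s (\<phi> s)))"
  have p0: "p 0 = (\<lambda>_. x0)" and pS: "p (Suc n) = (\<lambda>t. x0 + integral {a..t} (\<lambda>s. f s (p n s)))" for n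
    by (simp_all add: p_def)
  have bd: "bdd_meas a b (\<lambda>t. f t (\<phi> t))" if "continuous_on {a..b} \<phi>" for \<phi>
    using meas[OF that] bound by (intro bdd_measI[where B=B]) auto
  have acI: "ac_on a b (\<lambda>t. x0 + integral {a..t} (\<lambda>s. f s (\<phi> s))) (\<lambda>t. f t (\<phi> t))"
    if "continuous_on {a..b} \<phi>" for \<phi>
    using ac_on_add[OF ac_on_const[of a b x0] ac_on_integral[OF bd[OF that]]] by simp
  have cp: "continuous_on {a..b} (p n)" for n
  proof (induction n)
    case 0 show ?case unfolding p0 by simp
  next
    case (Suc n) then show ?case unfolding pS using ac_on_continuous[OF acI] by blast
  qed
  define M where "M = \<bar>B\<bar> * (b - a)"
  have M: "M \<ge> 0" using ab by (simp add: M_def)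
  \<comment> \<open>The weight exp(2L(t - a)) avoids subdividing the interval: the integral of L
    times the weight is at most half the weight, so each iteration gains a factor 1/2.\<close>
  have step: "\<bar>p (Suc n) t - p n t\<bar> \<le> M * (1/2)^n * exp (2 * L * (t - a))" if "t \<in> {a..b}" for n t
    using that
  proof (induction n arbitrary: t)
    case 0
    have "norm (integral {a..t} (\<lambda>s. f s x0)) \<le> B * (t - a)"
      using 0 bound by (intro bdd_meas_integral_norm[OF bd]) auto
    also have "\<dots> \<le> \<bar>B\<bar> * (b - a)" using 0 by (intro mult_mono) auto
    finally have "\<bar>p (Suc 0) t - p 0 t\<bar> \<le> M" by (simp add: p0 pS M_def)
    moreover have "M * 1 \<le> M * exp (2 * L * (t - a))" using M L 0 by (intro mult_left_mono) auto
    ultimately show ?case by simp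
  next
    case (Suc n)
    let ?e = "\<lambda>s. L * (M * (1/2)^n * exp (2 * L * (s - a)))"
    have int: "(\<lambda>s. f s (p k s)) integrable_on {a..t}" for k
      using bdd_meas_integrable[OF bd[OF cp], of a t] Suc.prems by auto
    have eint: "(?e has_integral (M * (1/2)^n / 2 * exp (2 * L * (t - a)) - M * (1/2)^n / 2 * exp (2 * L * (a - a)))) {a..t}"
      by (rule fundamental_theorem_of_calculus)
        (use Suc.prems L in \<open>auto intro!: derivative_eq_intros simp: has_real_derivative_iff_has_vector_derivative[symmetric]\<close>)
    have "p (Suc (Suc n)) t - p (Suc n) t = integral {a..t} (\<lambda>s. f s (p (Suc n) s) - f s (p n s))"
      using integral_diff[OF int[of "Suc n"] int[of n]] unfolding pS[of "Suc n"] pS[of n] by simp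
    also have "norm \<dots> \<le> integral {a..t} ?e"
    proof (rule integral_norm_bound_integral)
      show "(\<lambda>s. f s (p (Suc n) s) - f s (p n s)) integrable_on {a..t}" by (intro integrable_diff int)
      show "?e integrable_on {a..t}" using eint by blast
      fix s assume "s \<in> {a..t}"
      then have s: "s \<in> {a..b}" using Suc.prems by auto
      have "norm (f s (p (Suc n) s) - f s (p n s)) \<le> L * \<bar>p (Suc n) s - p n s\<bar>" using lip[OF s] by simp
      also have "\<dots> \<le> ?e s" using Suc.IH[OF s] L by (intro mult_left_mono) auto
      finally show "norm (f s (p (Suc n) s) - f s (p n s)) \<le> ?e s" .
    qed
    also have "integral {a..t} ?e \<le> M * (1/2)^Suc n * exp (2 * L * (t - a))"
      using integral_unique[OF eint] M by (simp add: field_simps)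
    finally show ?case by simp
  qed
  define K where "K = M * exp (2 * L * (b - a))"
  have step': "\<bar>p (Suc n) t - p n t\<bar> \<le> K * (1/2)^n" if t: "t \<in> {a..b}" for n t
  proof -
    have "M * (1/2)^n * exp (2 * L * (t - a)) \<le> M * (1/2)^n * exp (2 * L * (b - a))"
      using t M L by (intro mult_left_mono) auto
    then show ?thesis using step[OF t, of n] by (simp add: K_def algebra_simps)
  qed
  have "uniform_limit {a..b} (\<lambda>n t. \<Sum>i<n. p (Suc i) t - p i t) (\<lambda>t. \<Sum>i. p (Suc i) t - p i t) sequentially"
    by (rule Weierstrass_m_test[where M="\<lambda>n. K * (1/2)^n"]) (use step' in \<open>auto intro: summable_mult\<close>)
  moreover have "(\<Sum>i<n. p (Suc i) t - p i t) = p n t - p 0 t" for n t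
    using sum_lessThan_telescope[of "\<lambda>i. p i t" n] .
  ultimately have "uniform_limit {a..b} (\<lambda>n t. p n t - p 0 t) (\<lambda>t. \<Sum>i. p (Suc i) t - p i t) sequentially"
    by (simp only:)
  then have "uniform_limit {a..b} (\<lambda>n t. x0 + (p n t - x0)) (\<lambda>t. x0 + (\<Sum>i. p (Suc i) t - p i t)) sequentially"
    unfolding p0 by (intro uniform_limit_add uniform_limit_const)
  then have "uniform_limit {a..b} p (\<lambda>t. x0 + (\<Sum>i. p (Suc i) t - p i t)) sequentially" by simp
  then obtain \<phi> where \<phi>: "uniform_limit {a..b} p \<phi> sequentially" by blast
  have c\<phi>: "continuous_on {a..b} \<phi>"
    by (rule uniform_limit_theorem[OF _ \<phi>]) (use cp in auto)
  have eq: "\<phi> t = x0 + integral {a..t} (\<lambda>s. f s (\<phi> s))" if t: "t \<in> {a..b}" for t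
  proof -
    have "(\<lambda>n. p (Suc n) t) \<longlonglongrightarrow> \<phi> t"
      using tendsto_uniform_limitI[OF \<phi> t] by (rule LIMSEQ_Suc)
    moreover have "(\<lambda>n. integral {a..t} (\<lambda>s. f s (p n s))) \<longlonglongrightarrow> integral {a..t} (\<lambda>s. f s (\<phi> s))"
    proof (rule LIMSEQ_I)
      fix e :: real assume e: "e > 0"
      define e' where "e' = e / (L * (b - a) + 1)"
      have pos: "L * (b - a) + 1 > 0" using L ab by (meson add_nonneg_pos diff_ge_0_iff_ge less_imp_le mult_nonneg_nonneg zero_less_one)
      have "e' > 0" using e pos by (simp add: e'_def)
      then obtain N where N: "\<And>n s. n \<ge> N \<Longrightarrow> s \<in> {a..b} \<Longrightarrow> \<bar>p n s - \<phi> s\<bar> < e'"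
        using uniform_limitD[OF \<phi>, of e'] unfolding eventually_sequentially dist_real_def by blast
      have "norm (integral {a..t} (\<lambda>s. f s (p n s)) - integral {a..t} (\<lambda>s. f s (\<phi> s))) < e" if "n \<ge> N" for n
      proof -
        have "integral {a..t} (\<lambda>s. f s (p n s)) - integral {a..t} (\<lambda>s. f s (\<phi> s)) =
           integral {a..t} (\<lambda>s. f s (p n s) - f s (\<phi> s))"
          using bdd_meas_integrable[OF bd[OF cp], of a t] bdd_meas_integrable[OF bd[OF c\<phi>], of a t] t
          by (simp add: integral_diff)
        also have "norm \<dots> \<le> (L * e') * (t - a)"
        proof (rule bdd_meas_integral_norm[where a=a and b=b])
          show "bdd_meas a b (\<lambda>s. f s (p n s) - f s (\<phi> s))" by (intro bdd_meas_diff bd cp c\<phi>)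
          fix s assume "s \<in> {a..t}"
          then have s: "s \<in> {a..b}" using t by auto
          have "norm (f s (p n s) - f s (\<phi> s)) \<le> L * \<bar>p n s - \<phi> s\<bar>" using lip[OF s] by simp
          also have "\<dots> \<le> L * e'" using N[OF that s] L by (intro mult_left_mono) auto
          finally show "norm (f s (p n s) - f s (\<phi> s)) \<le> L * e'" .
        qed (use t in auto)
        also have "\<dots> \<le> (L * e') * (b - a)" using t L \<open>e' > 0\<close> by (intro mult_left_mono) auto
        also have "\<dots> < (L * (b - a) + 1) * e'" using \<open>e' > 0\<close> by (simp add: algebra_simps)
        also have "\<dots> = e" using pos by (simp add: e'_def)
        finally show ?thesis .
      qed
      then show "\<exists>N. \<forall>n\<ge>N. norm (integral {a..t} (\<lambda>s. f s (p n s)) - integral {a..t} (\<lambda>s. f s (\<phi> s))) < e" by blast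
    qed
    then have "(\<lambda>n. p (Suc n) t) \<longlonglongrightarrow> x0 + integral {a..t} (\<lambda>s. f s (\<phi> s))"
      unfolding pS by (intro tendsto_add tendsto_const)
    ultimately show ?thesis by (rule LIMSEQ_unique)
  qed
  have "\<phi> a = x0" using eq[of a] ab by simp
  moreover have "ac_on a b \<phi> (\<lambda>t. f t (\<phi> t))"
    by (rule ac_on_cong[OF acI[OF c\<phi>]]) (use eq in auto)
  ultimately show ?thesis by blast
qed

text \<open>The difference of two angles solves D' = mD + g with a bounded measurable
  \<open>m\<close> (\<open>prufer_sol_diff\<close>). The integrating factor removes the term mD;
  comparison, strictness and Lipschitz dependence of angles all come from here.\<close>

lemma linear_ode_factor:
  fixes D m g :: "real \<Rightarrow> real"
  assumes D: "ac_on a b D (\<lambda>t. m t * D t + g t)" and m: "bdd_meas a b m"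
  shows "ac_on a b (\<lambda>t. exp (- integral {a..t} m) * D t) (\<lambda>t. exp (- integral {a..t} m) * g t)"
proof -
  have "ac_on a b (\<lambda>t. - 1 * integral {a..t} m) (\<lambda>t. - 1 * m t)"
    by (intro ac_on_cmult ac_on_integral m)
  from ac_on_mult[OF ac_on_exp[OF this] D]
  show ?thesis by (rule ac_on_cong) (auto simp: algebra_simps)
qed

lemma linear_ode_lower:
  fixes D m g :: "real \<Rightarrow> real"
  assumes D: "ac_on a b D (\<lambda>t. m t * D t + g t)" and m: "bdd_meas a b m"
    and g: "\<And>t. t \<in> {a..b} \<Longrightarrow> g t \<ge> 0" and Da: "D a \<ge> 0" and ab: "a \<le> u" "u \<le> v" "v \<le> b"
  shows "D v \<ge> exp (integral {u..v} m) * D u" "D u \<ge> 0"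
proof -
  let ?E = "\<lambda>t. exp (- integral {a..t} m) * D t"
  note F = linear_ode_factor[OF D m]
  have "?E u \<le> ?E v" by (rule ac_on_mono[OF F]) (use g ab in auto)
  moreover have "integral {a..v} m = integral {a..u} m + integral {u..v} m"
    by (rule Henstock_Kurzweil_Integration.integral_combine[symmetric])
      (use ab in \<open>auto intro: bdd_meas_integrable[OF m]\<close>)
  ultimately have "exp (- integral {a..u} m) * D u \<le> exp (- integral {a..u} m) * (exp (- integral {u..v} m) * D v)"
    by (simp add: exp_add[symmetric] mult.assoc[symmetric])
  then have "D u \<le> exp (- integral {u..v} m) * D v" by simp
  then have "exp (integral {u..v} m) * D u \<le> exp (integral {u..v} m) * (exp (- integral {u..v} m) * D v)" by simp
  then show "D v \<ge> exp (integral {u..v} m) * D u"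
    by (simp add: mult.assoc[symmetric] exp_add[symmetric])
  have "?E a \<le> ?E u" by (rule ac_on_mono[OF F]) (use g ab in auto)
  then have "0 \<le> ?E u" using Da by simp
  then show "D u \<ge> 0" by (simp add: zero_le_mult_iff)
qed

text \<open>A Gronwall bound: exp(L(b - a)) bounds both the integrating factor and its inverse,
  hence the 2 in the exponent of the source term.\<close>

lemma linear_ode_upper:
  fixes D m g :: "real \<Rightarrow> real"
  assumes D: "ac_on a b D (\<lambda>t. m t * D t + g t)" and m: "bdd_meas a b m"
    and mL: "\<And>t. t \<in> {a..b} \<Longrightarrow> \<bar>m t\<bar> \<le> L" and gG: "\<And>t. t \<in> {a..b} \<Longrightarrow> \<bar>g t\<bar> \<le> G" 
    and ab: "a \<le> b"
  shows "\<bar>D b\<bar> \<le> exp (L * (b - a)) * \<bar>D a\<bar> + exp (2 * L * (b - a)) * G * (b - a)"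
proof -
  let ?E = "\<lambda>t. exp (- integral {a..t} m)"
  note F = linear_ode_factor[OF D m]
  have L0: "L \<ge> 0" using mL[of a] ab by force
  have G0: "G \<ge> 0" using gG[of a] ab by force
  have I: "\<bar>integral {a..t} m\<bar> \<le> L * (b - a)" if "t \<in> {a..b}" for t
  proof -
    have "norm (integral {a..t} m) \<le> L * (t - a)" using that mL by (intro bdd_meas_integral_norm[OF m]) auto
    also have "\<dots> \<le> L * (b - a)" using that L0 by (intro mult_left_mono) auto
    finally show ?thesis by simp
  qed
  have "norm (integral {a..b} (\<lambda>t. ?E t * g t)) \<le> exp (L * (b - a)) * G * (b - a)"
  proof (rule bdd_meas_integral_norm[OF ac_on_bdd_meas[OF F]])
    fix t assume t: "t \<in> {a..b}"
    have "?E t \<le> exp (L * (b - a))" using I[OF t] by simp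
    then show "norm (?E t * g t) \<le> exp (L * (b - a)) * G"
      using gG[OF t] by (simp add: abs_mult mult_mono)
  qed (use ab in auto)
  moreover have "?E b * D b = D a + integral {a..b} (\<lambda>t. ?E t * g t)"
    using ac_onD[OF F, of b] ab by simp
  ultimately have "\<bar>?E b * D b\<bar> \<le> \<bar>D a\<bar> + exp (L * (b - a)) * G * (b - a)" by (simp only: real_norm_def)
  then have "exp (integral {a..b} m) * \<bar>?E b * D b\<bar> \<le> exp (L * (b - a)) * (\<bar>D a\<bar> + exp (L * (b - a)) * G * (b - a))"
    using I[of b] ab by (intro mult_mono) auto
  moreover have "exp (integral {a..b} m) * \<bar>?E b * D b\<bar> = \<bar>D b\<bar>" by (simp add: abs_mult exp_minus field_simps)
  moreover have "exp (2 * L * (b - a)) = exp (L * (b - a)) * exp (L * (b - a))" by (simp add: exp_add[symmetric])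
  ultimately show ?thesis by (simp add: algebra_simps)
qed

text \<open>
  Angles are scaled: a solution of $-y''+Vy=\<mu>^2y$ is written as $\<mu> y=\<rho> sin \<phi>$,
  $y'=\<rho> cos \<phi>$. The equation for $\<phi>$ is then monotone in $\<mu>$ and, for $V\<ge>0$, in $V$.
\<close>

definition prufer_sol :: "(real \<Rightarrow> real) \<Rightarrow> real \<Rightarrow> real \<Rightarrow> real \<Rightarrow> real \<Rightarrow> (real \<Rightarrow> real) \<Rightarrow> bool" where
  "prufer_sol V \<mu> a b x \<phi> \<longleftrightarrow> \<phi> a = x \<and> ac_on a b \<phi> (\<lambda>t. \<mu> - V t / \<mu> * (sin (\<phi> t))\<^sup>2)"

lemma sin_sq_diff: "(sin x)\<^sup>2 - (sin y)\<^sup>2 = sin (x - y) * sin (x + y)" for x y :: real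
proof -
  have "sin (x - y) * sin (x + y) = (sin x)\<^sup>2 * (cos y)\<^sup>2 - (cos x)\<^sup>2 * (sin y)\<^sup>2"
    by (simp add: sin_add sin_diff power2_eq_square algebra_simps)
  also have "\<dots> = (sin x)\<^sup>2 - (sin y)\<^sup>2" by (simp add: cos_squared_eq algebra_simps)
  finally show ?thesis by simp
qed

lemma sin_sq_Lipschitz: "\<bar>(sin x)\<^sup>2 - (sin y)\<^sup>2\<bar> \<le> \<bar>x - y\<bar>" for x y :: real
proof -
  have "\<bar>sin (x - y)\<bar> * \<bar>sin (x + y)\<bar> \<le> \<bar>x - y\<bar> * 1"
    by (intro mult_mono abs_sin_x_le_abs_x) auto
  then show ?thesis by (simp add: sin_sq_diff abs_mult)
qed

lemma prufer_sol_exists: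
  assumes V: "bdd_meas a b V" and ab: "a \<le> b" and \<mu>: "\<mu> > 0"
  shows "\<exists>\<phi>. prufer_sol V \<mu> a b x \<phi>"
proof -
  obtain B where B: "B \<ge> 0" "\<And>t. t \<in> {a..b} \<Longrightarrow> norm (V t) \<le> B" using bdd_meas_bound[OF V] by blast
  have le: "\<bar>V t / \<mu> * c\<bar> \<le> (B / \<mu> + 1) * d" if "t \<in> {a..b}" "\<bar>c\<bar> \<le> d" for t c d
  proof -
    have "\<bar>V t / \<mu>\<bar> \<le> B / \<mu>" using B(2)[OF that(1)] \<mu> by (simp add: divide_right_mono)
    then have "\<bar>V t / \<mu>\<bar> \<le> B / \<mu> + 1" by simp
    then show ?thesis unfolding abs_mult using that(2) B \<mu> by (intro mult_mono) auto
  qed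
  show ?thesis unfolding prufer_sol_def
  proof (rule picard_existence[where L="B/\<mu> + 1" and B="\<mu> + (B/\<mu> + 1)"])
    show "a \<le> b" by fact
    show "B / \<mu> + 1 > 0" using B \<mu> by (simp add: add_nonneg_pos)
    show "(\<lambda>t. \<mu> - V t / \<mu> * (sin (\<phi> t))\<^sup>2) \<in> borel_measurable (lebesgue_on {a..b})"
      if "continuous_on {a..b} \<phi>" for \<phi>
      using bdd_meas_measurable[OF V] continuous_imp_measurable_on_sets_lebesgue[OF that] by measurable auto
    fix t x y assume t: "t \<in> {a..b}"
    have "\<bar>V t / \<mu> * (sin x)\<^sup>2\<bar> \<le> (B / \<mu> + 1) * 1" by (rule le[OF t]) (simp add: abs_square_le_1)
    then show "\<bar>\<mu> - V t / \<mu> * (sin x)\<^sup>2\<bar> \<le> \<mu> + (B/\<mu> + 1)"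
      using \<mu> by (intro order_trans[OF abs_triangle_ineq4] add_mono) auto
    have "\<bar>V t / \<mu> * ((sin y)\<^sup>2 - (sin x)\<^sup>2)\<bar> \<le> (B / \<mu> + 1) * \<bar>x - y\<bar>"
      using sin_sq_Lipschitz[of y x] by (intro le[OF t]) (simp add: abs_minus_commute)
    then show "\<bar>\<mu> - V t / \<mu> * (sin x)\<^sup>2 - (\<mu> - V t / \<mu> * (sin y)\<^sup>2)\<bar> \<le> (B / \<mu> + 1) * \<bar>x - y\<bar>"
      by (simp add: algebra_simps)
  qed
qed

text \<open>The angle equation is nonlinear, but a difference satisfies a linear equation whose
  coefficient contains the difference quotient of the squared sine, bounded by 1. The second
  function is arbitrary, so that it can serve as a sub- or supersolution.\<close>

lemma prufer_sol_diff:
  assumes \<phi>: "prufer_sol V \<mu> a b x \<phi>" and \<psi>: "ac_on a b \<psi> p" and V: "bdd_meas a b V" and \<mu>: "\<mu> > 0"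
  obtains m where "bdd_meas a b m" "\<And>t. t \<in> {a..b} \<Longrightarrow> \<bar>m t\<bar> \<le> \<bar>V t\<bar> / \<mu>"
    "ac_on a b (\<lambda>t. \<phi> t - \<psi> t) (\<lambda>t. m t * (\<phi> t - \<psi> t) + (\<mu> - V t / \<mu> * (sin (\<psi> t))\<^sup>2 - p t))"
proof -
  \<comment> \<open>Where the two angles agree the quotient is 0 by the convention on division,
    consistently with the vanishing numerator.\<close>
  define m where "m t = - (V t / \<mu>) * (((sin (\<phi> t))\<^sup>2 - (sin (\<psi> t))\<^sup>2) / (\<phi> t - \<psi> t))" for t
  have ac: "ac_on a b \<phi> (\<lambda>t. \<mu> - V t / \<mu> * (sin (\<phi> t))\<^sup>2)" using \<phi> by (simp add: prufer_sol_def)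
  obtain B where B: "B \<ge> 0" "\<And>t. t \<in> {a..b} \<Longrightarrow> norm (V t) \<le> B" using bdd_meas_bound[OF V] by blast
  have m1: "\<bar>m t\<bar> \<le> \<bar>V t\<bar> / \<mu>" for t
  proof -
    have "\<bar>((sin (\<phi> t))\<^sup>2 - (sin (\<psi> t))\<^sup>2) / (\<phi> t - \<psi> t)\<bar> \<le> 1"
      using sin_sq_Lipschitz[of "\<phi> t" "\<psi> t"] by (cases "\<phi> t = \<psi> t") (simp_all add: abs_divide)
    then have "\<bar>V t / \<mu>\<bar> * \<bar>((sin (\<phi> t))\<^sup>2 - (sin (\<psi> t))\<^sup>2) / (\<phi> t - \<psi> t)\<bar> \<le> \<bar>V t / \<mu>\<bar> * 1"
      by (intro mult_left_mono) auto
    then show ?thesis using \<mu> by (simp add: m_def abs_mult abs_divide)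
  qed
  have m2: "bdd_meas a b m"
  proof (rule bdd_measI[where B="B/\<mu>"])
    have "\<phi> \<in> borel_measurable (lebesgue_on {a..b})" "\<psi> \<in> borel_measurable (lebesgue_on {a..b})"
      using ac_on_continuous[OF ac] ac_on_continuous[OF \<psi>] by (auto intro: continuous_imp_measurable_on_sets_lebesgue)
    then show "m \<in> borel_measurable (lebesgue_on {a..b})"
      unfolding m_def using bdd_meas_measurable[OF V] by measurable
    fix t assume "t \<in> {a..b}"
    then have "\<bar>V t\<bar> / \<mu> \<le> B / \<mu>" using B(2)[of t] \<mu> by (simp add: divide_right_mono)
    then show "norm (m t) \<le> B / \<mu>" using m1[of t] by simp
  qed
  have "ac_on a b (\<lambda>t. \<phi> t - \<psi> t) (\<lambda>t. m t * (\<phi> t - \<psi> t) + (\<mu> - V t / \<mu> * (sin (\<psi> t))\<^sup>2 - p t))"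
  proof (rule ac_on_cong[OF ac_on_diff[OF ac \<psi>]])
    fix t assume "t \<in> {a..b}"
    have "m t * (\<phi> t - \<psi> t) = - (V t / \<mu>) * ((sin (\<phi> t))\<^sup>2 - (sin (\<psi> t))\<^sup>2)"
      by (simp add: m_def)
    then show "\<mu> - V t / \<mu> * (sin (\<phi> t))\<^sup>2 - p t = m t * (\<phi> t - \<psi> t) + (\<mu> - V t / \<mu> * (sin (\<psi> t))\<^sup>2 - p t)"
      by (simp add: algebra_simps)
  qed simp
  then show thesis using that m1 m2 by blast
qed

lemma prufer_sol_ge:
  assumes \<phi>: "prufer_sol V \<mu> a b x \<phi>" and \<psi>: "ac_on a b \<psi> p" and V: "bdd_meas a b V" and \<mu>: "\<mu> > 0"
    and "\<psi> a \<le> x" and "\<And>t. t \<in> {a..b} \<Longrightarrow> p t \<le> \<mu> - V t / \<mu> * (sin (\<psi> t))\<^sup>2" and t: "t \<in> {a..b}"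
  shows "\<psi> t \<le> \<phi> t"
proof -
  obtain m where m: "bdd_meas a b m" and
    D: "ac_on a b (\<lambda>t. \<phi> t - \<psi> t) (\<lambda>t. m t * (\<phi> t - \<psi> t) + (\<mu> - V t / \<mu> * (sin (\<psi> t))\<^sup>2 - p t))"
    by (rule prufer_sol_diff[OF \<phi> \<psi> V \<mu>])
  have "\<phi> a = x" using \<phi> by (simp add: prufer_sol_def)
  then show ?thesis using linear_ode_lower(2)[OF D m, of t t] assms(5,6) t by simp
qed

lemma prufer_sol_le:
  assumes \<phi>: "prufer_sol V \<mu> a b x \<phi>" and \<psi>: "ac_on a b \<psi> p" and V: "bdd_meas a b V" and \<mu>: "\<mu> > 0"
    and "x \<le> \<psi> a" and "\<And>t. t \<in> {a..b} \<Longrightarrow> \<mu> - V t / \<mu> * (sin (\<psi> t))\<^sup>2 \<le> p t" and t: "t \<in> {a..b}"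
  shows "\<phi> t \<le> \<psi> t"
proof -
  obtain m where m: "bdd_meas a b m" and
    D: "ac_on a b (\<lambda>t. \<phi> t - \<psi> t) (\<lambda>t. m t * (\<phi> t - \<psi> t) + (\<mu> - V t / \<mu> * (sin (\<psi> t))\<^sup>2 - p t))"
    by (rule prufer_sol_diff[OF \<phi> \<psi> V \<mu>])
  have D': "ac_on a b (\<lambda>t. \<psi> t - \<phi> t) (\<lambda>t. m t * (\<psi> t - \<phi> t) + (p t - (\<mu> - V t / \<mu> * (sin (\<psi> t))\<^sup>2)))"
    by (rule ac_on_cong[OF ac_on_cmult[OF D, of "-1"]]) (simp_all add: algebra_simps)
  have "\<phi> a = x" using \<phi> by (simp add: prufer_sol_def)
  then show ?thesis using linear_ode_lower(2)[OF D' m, of t t] assms(5,6) t by simp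
qed

subsection \<open>The jump at a vertex\<close>

text \<open>
  \<open>jump b\<close> is the continuous lift to angles of the linear map $(y,y')\<mapsto>(b^{1/2}y,b^{-1/2}y')$ fixing
  the multiples of $\<pi>/2$, and \<open>gain b\<close> is the square of the factor by which the radius changes.
\<close>

definition gain :: "real \<Rightarrow> real \<Rightarrow> real" where
  "gain b x = b * (sin x)\<^sup>2 + (cos x)\<^sup>2 / b"

definition jump :: "real \<Rightarrow> real \<Rightarrow> real" where
  "jump b x = x + arctan ((b - 1) * sin x * cos x / ((cos x)\<^sup>2 + b * (sin x)\<^sup>2))"

lemma jump_den_pos: "b > 0 \<Longrightarrow> (cos x)\<^sup>2 + b * (sin x)\<^sup>2 > 0" for b x :: real
proof -
  assume b: "b > 0"
  show ?thesis
  proof (cases "sin x = 0")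
    case True then have "(cos x)\<^sup>2 = 1" using sin_cos_squared_add[of x] by simp
    then show ?thesis using True by simp
  next
    case False then have "b * (sin x)\<^sup>2 > 0" using b by simp
    then show ?thesis by (simp add: add_nonneg_pos)
  qed
qed

lemma gain_pos: assumes "b > 0" shows "gain b x > 0"
proof -
  have "gain b x = ((cos x)\<^sup>2 + (b * b) * (sin x)\<^sup>2) / b" using assms by (simp add: gain_def field_simps)
  then show ?thesis using jump_den_pos[of "b*b" x] assms by simp
qed

lemma jump_polar:
  assumes b: "b > 0"
  shows "sin (jump b x) * sqrt (gain b x) = sqrt b * sin x"
    and "cos (jump b x) * sqrt (gain b x) = cos x / sqrt b"
proof -
  define s c where "s = sin x" and "c = cos x"
  have sc: "c\<^sup>2 + s\<^sup>2 = 1" by (simp add: s_def c_def)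
  \<comment> \<open>In complex terms M + iN = (c - is)(c + ibs). Adding its argument to
    \<open>x\<close> turns c + is into the direction of c + ibs, and its squared modulus factors as
    (c^2 + s^2)(c^2 + b^2 s^2).\<close>
  define N M where "N = (b - 1) * s * c" and "M = c\<^sup>2 + b * s\<^sup>2"
  have M: "M > 0" using jump_den_pos[OF b, of x] by (simp add: M_def s_def c_def)
  define R where "R = sqrt (c\<^sup>2 + b\<^sup>2 * s\<^sup>2)"
  have pos: "c\<^sup>2 + b\<^sup>2 * s\<^sup>2 > 0" using jump_den_pos[of "b\<^sup>2" x] b by (simp add: s_def c_def)
  then have R: "R > 0" by (simp add: R_def)
  have MN: "M\<^sup>2 + N\<^sup>2 = c\<^sup>2 + b\<^sup>2 * s\<^sup>2"
  proof -
    have "M\<^sup>2 + N\<^sup>2 = (c\<^sup>2 + b\<^sup>2 * s\<^sup>2) * (c\<^sup>2 + s\<^sup>2)"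
      unfolding M_def N_def by (simp add: power2_eq_square algebra_simps)
    then show ?thesis by (simp add: sc)
  qed
  have sq: "sqrt (1 + (N/M)\<^sup>2) = R / M"
  proof -
    have "1 + (N/M)\<^sup>2 = (M\<^sup>2 + N\<^sup>2) / M\<^sup>2" using M by (simp add: power_divide field_simps)
    then show ?thesis using M by (simp add: MN R_def real_sqrt_divide)
  qed
  have ca: "cos (arctan (N/M)) = M / R" and sa: "sin (arctan (N/M)) = N / R"
    unfolding cos_arctan sin_arctan sq using M by simp_all
  have j: "jump b x = x + arctan (N/M)" by (simp add: jump_def N_def M_def s_def c_def)
  have "gain b x = (c\<^sup>2 + b\<^sup>2 * s\<^sup>2) / b" using b by (simp add: gain_def s_def c_def power2_eq_square field_simps)
  then have g: "sqrt (gain b x) = R / sqrt b" by (simp add: R_def real_sqrt_divide)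
  have "sin (jump b x) = (s * M + c * N) / R"
    unfolding j sin_add ca sa by (simp add: s_def c_def add_divide_distrib)
  also have "s * M + c * N = b * s * (c\<^sup>2 + s\<^sup>2)" unfolding M_def N_def by (simp add: power2_eq_square algebra_simps)
  finally have "sin (jump b x) = b * s / R" by (simp add: sc)
  then show "sin (jump b x) * sqrt (gain b x) = sqrt b * sin x"
    using R b real_div_sqrt[of b] unfolding g s_def by (simp add: field_simps)
  have "cos (jump b x) = (c * M - s * N) / R"
    unfolding j cos_add ca sa by (simp add: s_def c_def diff_divide_distrib)
  also have "c * M - s * N = c * (c\<^sup>2 + s\<^sup>2)" unfolding M_def N_def by (simp add: power2_eq_square algebra_simps)
  finally have "cos (jump b x) = c / R" by (simp add: sc)
  then show "cos (jump b x) * sqrt (gain b x) = cos x / sqrt b"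
    using R b unfolding g by (simp add: c_def)
qed

text \<open>The vertex map has determinant 1 and preserves area, so the derivative of its action on
  angles is the inverse square of the factor by which it stretches the radius.\<close>

lemma DERIV_jump:
  assumes b: "b > 0" shows "(jump b has_real_derivative 1 / gain b x) (at x)"
proof -
  define s c where "s = sin x" and "c = cos x"
  have sc: "c\<^sup>2 = 1 - s\<^sup>2" by (simp add: s_def c_def cos_squared_eq)
  define N M where "N = (b - 1) * s * c" and "M = c\<^sup>2 + b * s\<^sup>2"
  have M: "M > 0" using jump_den_pos[OF b, of x] by (simp add: M_def s_def c_def)
  have pos: "c\<^sup>2 + b\<^sup>2 * s\<^sup>2 > 0" using jump_den_pos[of "b\<^sup>2" x] b by (simp add: s_def c_def)
  have MN: "M\<^sup>2 + N\<^sup>2 = c\<^sup>2 + b\<^sup>2 * s\<^sup>2"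
  proof -
    have "M\<^sup>2 + N\<^sup>2 = (c\<^sup>2 + b\<^sup>2 * s\<^sup>2) * (c\<^sup>2 + s\<^sup>2)"
      unfolding M_def N_def by (simp add: power2_eq_square algebra_simps)
    then show ?thesis by (simp add: sc)
  qed
  define N' M' where "N' = (b - 1) * (c\<^sup>2 - s\<^sup>2)" and "M' = 2 * (b - 1) * s * c"
  have "((\<lambda>x. (b - 1) * sin x * cos x / ((cos x)\<^sup>2 + b * (sin x)\<^sup>2)) has_real_derivative (N' * M - N * M') / (M * M)) (at x)"
    using M unfolding M_def N_def N'_def M'_def s_def c_def
    by (auto intro!: derivative_eq_intros simp: power2_eq_square algebra_simps)
  from DERIV_arctan[THEN DERIV_chain2, OF this]
  have "((\<lambda>x. arctan ((b - 1) * sin x * cos x / ((cos x)\<^sup>2 + b * (sin x)\<^sup>2))) has_real_derivative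
     inverse (1 + (N / M)\<^sup>2) * ((N' * M - N * M') / (M * M))) (at x)"
    by (simp add: N_def M_def s_def c_def)
  moreover have "inverse (1 + (N / M)\<^sup>2) * ((N' * M - N * M') / (M * M)) = (N' * M - N * M') / (M\<^sup>2 + N\<^sup>2)"
  proof -
    have "1 + (N / M)\<^sup>2 = (M\<^sup>2 + N\<^sup>2) / (M * M)" using M by (simp add: power2_eq_square field_simps)
    then show ?thesis using M by simp
  qed
  ultimately have "((\<lambda>x. arctan ((b - 1) * sin x * cos x / ((cos x)\<^sup>2 + b * (sin x)\<^sup>2))) has_real_derivative
     (N' * M - N * M') / (c\<^sup>2 + b\<^sup>2 * s\<^sup>2)) (at x)" by (simp only: MN)
  from DERIV_add[OF DERIV_ident this]
  have "(jump b has_real_derivative 1 + (N' * M - N * M') / (c\<^sup>2 + b\<^sup>2 * s\<^sup>2)) (at x)"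
    by (simp only: jump_def[abs_def])
  moreover have "1 + (N' * M - N * M') / (c\<^sup>2 + b\<^sup>2 * s\<^sup>2) = b / (c\<^sup>2 + b\<^sup>2 * s\<^sup>2)"
  proof -
    have "c\<^sup>2 + b\<^sup>2 * s\<^sup>2 + (N' * M - N * M') = c\<^sup>2 + b\<^sup>2 * s\<^sup>2 + (b - 1) * ((c\<^sup>2 - s\<^sup>2) * (c\<^sup>2 + b * s\<^sup>2) - 2 * (b - 1) * s\<^sup>2 * c\<^sup>2)"
      unfolding N_def M_def N'_def M'_def by (simp add: power2_eq_square algebra_simps)
    also have "\<dots> = b" unfolding sc by (simp add: power2_eq_square algebra_simps)
    finally show ?thesis using pos by (simp add: field_simps)
  qed
  moreover have "1 / gain b x = b / (c\<^sup>2 + b\<^sup>2 * s\<^sup>2)"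
    using b by (simp add: gain_def s_def c_def power2_eq_square field_simps)
  ultimately show ?thesis by simp
qed

lemma jump_strict_mono:
  assumes "b > 0" "x < y" shows "jump b x < jump b y"
proof (rule DERIV_pos_imp_increasing[OF assms(2)])
  show "\<exists>d. (jump b has_real_derivative d) (at z) \<and> 0 < d" for z
    using DERIV_jump[OF assms(1), of z] gain_pos[OF assms(1), of z] by force
qed

lemma jump_mono: "b > 0 \<Longrightarrow> x \<le> y \<Longrightarrow> jump b x \<le> jump b y"
  using jump_strict_mono[of b x y] by (cases "x = y") auto

lemma continuous_jump: "b > 0 \<Longrightarrow> continuous_on S (jump b)"
  by (meson DERIV_jump DERIV_isCont continuous_at_imp_continuous_on)

lemma jump_add_pi: "jump b (x + pi) = jump b x + pi"
  by (simp add: jump_def)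

lemma jump_add_int_pi: "jump b (x + of_int m * pi) = jump b x + of_int m * pi"
proof (induction m rule: int_induct[where k=0])
  case base show ?case by simp
next
  case (step1 i)
  have "jump b (x + of_int (i + 1) * pi) = jump b ((x + of_int i * pi) + pi)" by (simp add: algebra_simps)
  also have "\<dots> = jump b x + of_int (i + 1) * pi" unfolding jump_add_pi step1 by (simp add: algebra_simps)
  finally show ?case .
next
  case (step2 i)
  have "jump b (x + of_int (i - 1) * pi) + pi = jump b ((x + of_int (i - 1) * pi) + pi)" by (simp add: jump_add_pi)
  also have "(x + of_int (i - 1) * pi) + pi = x + of_int i * pi" by (simp add: algebra_simps)
  finally show ?case unfolding step2 by (simp add: algebra_simps)
qed

lemma jump_0: "jump b 0 = 0" by (simp add: jump_def)

lemma jump_half_pi: "jump b (pi/2 + of_int m * pi) = pi/2 + of_int m * pi"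
  unfolding jump_add_int_pi by (simp add: jump_def)

lemma jump_minus: "jump b (- x) = - jump b x"
  by (simp add: jump_def flip: arctan_minus)

lemma jump_bounds: "jump b x < x + pi/2" "jump b x > x - pi/2"
  using arctan_ubound[of "(b - 1) * sin x * cos x / ((cos x)\<^sup>2 + b * (sin x)\<^sup>2)"]
    arctan_lbound[of "(b - 1) * sin x * cos x / ((cos x)\<^sup>2 + b * (sin x)\<^sup>2)"]
  by (simp_all add: jump_def)

lemma gain_le: "b \<ge> 1 \<Longrightarrow> 1 / gain b x \<le> b"
proof -
  assume b: "b \<ge> 1"
  have "gain b x = 1 / b + (b - 1/b) * (sin x)\<^sup>2" unfolding gain_def cos_squared_eq using b by (simp add: field_simps)
  moreover have "(b - 1/b) * (sin x)\<^sup>2 \<ge> 0" using b by (intro mult_nonneg_nonneg) (auto simp: field_simps power2_eq_square[symmetric] one_le_power)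
  ultimately have "gain b x \<ge> 1 / b" by linarith
  then show ?thesis using b gain_pos[of b x] by (simp add: field_simps)
qed

lemma gain_eq: "b > 0 \<Longrightarrow> gain b x = 1 / b + (b - 1/b) * (sin x)\<^sup>2"
  unfolding gain_def cos_squared_eq by (simp add: field_simps)

lemma jump_Lipschitz:
  assumes "b \<ge> 1" shows "\<bar>jump b x - jump b y\<bar> \<le> b * \<bar>x - y\<bar>"
proof -
  have *: "\<bar>jump b x - jump b y\<bar> \<le> b * \<bar>x - y\<bar>" if yx: "y < x" for x y
  proof -
    obtain \<xi> where "jump b x - jump b y = (x - y) * (1 / gain b \<xi>)"
      using MVT2[OF yx, of "jump b" "\<lambda>x. 1 / gain b x"] DERIV_jump assms by auto
    then show ?thesis using gain_le[OF assms, of \<xi>] gain_pos[of b \<xi>] assms yx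
      mult_left_mono[OF gain_le[OF assms, of \<xi>], of "x - y"] by (simp add: abs_mult algebra_simps)
  qed
  show ?thesis using *[of x y] *[of y x] by (cases x y rule: linorder_cases) (auto simp: abs_minus_commute)
qed

text \<open>
  Between \<open>- zstar b\<close> and \<open>zstar b\<close> the jump is expanding on angles and shrinks the radius, and
  \<open>jump b z - z\<close> increases from minus to plus \<open>tree_theta\<close>. Hence \<open>zfix b \<delta>\<close> is, modulo $\<pi>$, the
  angle at the right end of a cell of the decaying unperturbed solution with $\<mu>=\<pi> l+\<delta>$.
\<close>

definition zstar :: "real \<Rightarrow> real" where "zstar b = arctan (1 / sqrt b)"

lemma zstar: assumes "b > 0" shows "0 < zstar b" "zstar b < pi/2" "(sin (zstar b))\<^sup>2 = 1 / (b + 1)"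
proof -
  show "0 < zstar b" "zstar b < pi/2" using assms arctan_ubound[of "1 / sqrt b"] by (auto simp: zstar_def)
  have "1 + 1/b = (b+1)/b" using assms by (simp add: field_simps)
  moreover have "b + b * b > 0" using assms by (simp add: add_pos_pos)
  ultimately show "(sin (zstar b))\<^sup>2 = 1 / (b + 1)"
    unfolding zstar_def sin_arctan using assms by (simp add: power_divide field_simps)
qed

lemma sin_sq_less_zstar:
  assumes "b > 0" "\<bar>z\<bar> < zstar b" shows "(sin z)\<^sup>2 < 1 / (b + 1)"
proof -
  have "sin \<bar>z\<bar> \<ge> 0" using assms zstar[OF assms(1)] by (intro sin_ge_zero) auto
  then have "\<bar>sin z\<bar> = sin \<bar>z\<bar>" by (cases "z \<ge> 0") (auto simp: abs_if)
  also have "\<dots> < sin (zstar b)"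
    using assms zstar[OF assms(1)] by (intro sin_monotone_2pi) auto
  finally have "\<bar>sin z\<bar>\<^sup>2 < (sin (zstar b))\<^sup>2" by (intro power_strict_mono) auto
  then show ?thesis using zstar(3)[OF assms(1)] by simp
qed

lemma gain_less_1:
  assumes "b > 1" "\<bar>z\<bar> < zstar b" shows "gain b z < 1"
proof -
  have "b - 1/b = (b - 1) * (b + 1) / b" using assms by (simp add: field_simps)
  then have pos: "b - 1/b > 0" using assms by simp
  have "gain b z < 1 / b + (b - 1/b) * (1 / (b + 1))"
    unfolding gain_eq[OF less_trans[OF zero_less_one assms(1)]]
    using sin_sq_less_zstar[of b z] assms pos by (intro add_strict_left_mono mult_strict_left_mono) auto
  also have "(b - 1/b) * (1 / (b + 1)) = (b - 1) / b"
    unfolding \<open>b - 1/b = (b - 1) * (b + 1) / b\<close> using assms by simp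
  also have "1 / b + (b - 1) / b = 1" using assms by (simp add: field_simps)
  finally show ?thesis .
qed

lemma gain_zstar: assumes "b > 1" shows "gain b (zstar b) = 1" "gain b (- zstar b) = 1"
proof -
  have "b - 1/b = (b - 1) * (b + 1) / b" using assms by (simp add: field_simps)
  then have "(b - 1/b) * (1 / (b + 1)) = (b - 1) / b" using assms by simp
  moreover have "1 / b + (b - 1) / b = 1" using assms by (simp add: field_simps)
  ultimately show "gain b (zstar b) = 1" "gain b (- zstar b) = 1"
    using assms by (simp_all add: gain_eq zstar(3))
qed

lemma gain_le_1:
  assumes "b > 1" "\<bar>z\<bar> \<le> zstar b" shows "gain b z \<le> 1"
proof (cases "\<bar>z\<bar> < zstar b")
  case True then show ?thesis using gain_less_1[OF assms(1)] by (simp add: less_imp_le)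
next
  case False then have "z = zstar b \<or> z = - zstar b" using assms(2) by auto
  then show ?thesis using gain_zstar[OF assms(1)] by auto
qed

text \<open>At \<open>z\<close> the slope of the jump is at least 1. The gain grows with slope at
  most \<open>b\<close>, and 1/x lies above its tangent 2 - x at 1, so up to \<open>z + d\<close>
  the slope stays above 1 - b d. This form survives at the ends of a gap, where the slope is exactly
  1.\<close>

lemma jump_quadratic:
  assumes b: "b > 1" and z: "\<bar>z\<bar> \<le> zstar b" and d: "d \<ge> 0"
  shows "jump b (z + d) \<ge> jump b z + d - b * d\<^sup>2"
proof (cases "d = 0")
  case False
  then obtain \<xi> where \<xi>: "z < \<xi>" "\<xi> < z + d" "jump b (z + d) - jump b z = d * (1 / gain b \<xi>)"
    using MVT2[of z "z + d" "jump b" "\<lambda>x. 1 / gain b x"] DERIV_jump b d by auto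
  have "1 / b \<le> 1" using b by simp
  then have "1 / b \<le> b" using b by linarith
  then have bb: "0 \<le> b - 1/b" "b - 1/b \<le> b" using b by auto
  have "gain b \<xi> - gain b z = (b - 1/b) * ((sin \<xi>)\<^sup>2 - (sin z)\<^sup>2)"
    using b by (simp add: gain_eq algebra_simps)
  also have "\<dots> \<le> b * \<bar>\<xi> - z\<bar>"
  proof -
    have "\<bar>(sin \<xi>)\<^sup>2 - (sin z)\<^sup>2\<bar> \<le> \<bar>\<xi> - z\<bar>" by (rule sin_sq_Lipschitz)
    then have "(sin \<xi>)\<^sup>2 - (sin z)\<^sup>2 \<le> \<bar>\<xi> - z\<bar>" by linarith
    then have "(b - 1/b) * ((sin \<xi>)\<^sup>2 - (sin z)\<^sup>2) \<le> (b - 1/b) * \<bar>\<xi> - z\<bar>" using bb by (intro mult_left_mono) auto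
    also have "\<dots> \<le> b * \<bar>\<xi> - z\<bar>" using bb by (intro mult_right_mono) auto
    finally show ?thesis .
  qed
  also have "\<dots> \<le> b * d" using \<xi> b by (intro mult_left_mono) auto
  finally have "gain b \<xi> \<le> 1 + b * d" using gain_le_1[OF b z] by linarith
  moreover have "1 / gain b \<xi> \<ge> 2 - gain b \<xi>"
  proof -
    have "(gain b \<xi> - 1)\<^sup>2 \<ge> 0" by simp
    then have "gain b \<xi> * (2 - gain b \<xi>) \<le> 1" by (simp add: power2_eq_square algebra_simps)
    then show ?thesis using gain_pos[of b \<xi>] b by (simp add: field_simps)
  qed
  ultimately have "1 / gain b \<xi> \<ge> 1 - b * d" by linarith
  then have "d * (1 / gain b \<xi>) \<ge> d * (1 - b * d)" using d by (intro mult_left_mono) auto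
  then show ?thesis using \<xi>(3) by (simp add: power2_eq_square algebra_simps)
qed simp

section \<open>The angle theta as the largest rotation at a vertex\<close>

lemma tree_R_eq: "b \<ge> 1 \<Longrightarrow> tree_R b = (real b + 1) / (2 * sqrt (real b))"
  by (simp add: tree_R_def field_simps)

text \<open>The square of \<open>tree_R b\<close> exceeds 1 by ((b - 1)/(2 sqrt b))^2, which turns
  the arccosine into an arctangent, the form in which \<open>jump\<close> produces it.\<close>

lemma tree_theta_eq: assumes "b \<ge> 1" shows "tree_theta b = arctan ((real b - 1) / (2 * sqrt (real b)))"
proof -
  let ?w = "(real b - 1) / (2 * sqrt (real b))"
  have "1 + ?w\<^sup>2 = ((real b + 1) / (2 * sqrt (real b)))\<^sup>2"
    using assms by (simp add: power_divide power_mult_distrib field_simps power2_eq_square)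
  then have "sqrt (1 + ?w\<^sup>2) = tree_R b" using assms by (simp add: tree_R_eq)
  then have "1 / tree_R b = cos (arctan ?w)" by (simp add: cos_arctan)
  moreover have "0 \<le> arctan ?w" "arctan ?w \<le> pi" using assms arctan_ubound[of ?w] pi_gt_zero by (simp, linarith)
  ultimately show ?thesis by (simp add: tree_theta_def arccos_cos)
qed

lemma tree_theta_bounds: assumes "b \<ge> 2" shows "0 < tree_theta b" "tree_theta b < pi/2"
  using assms arctan_ubound by (auto simp: tree_theta_eq)

text \<open>The slope of the jump equals 1 at \<open>zstar\<close>, so theta is the largest angle by
  which a vertex can turn a solution. A cell turns it by \<mu> = \<pi> l + \<delta>, and a vertex
  can compensate \<delta> exactly when its modulus is at most theta; hence the half-width of the
  gaps in sqrt \<lambda>.\<close>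

lemma jump_zstar: assumes "b \<ge> 2" shows "jump (real b) (zstar b) = zstar b + tree_theta b"
proof -
  let ?z = "zstar (real b)" and ?B = "real b"
  have s: "sin ?z = 1 / sqrt (?B + 1)" "cos ?z = sqrt ?B / sqrt (?B + 1)"
  proof -
    have "1 + 1 / ?B = (?B + 1) / ?B" using assms by (simp add: field_simps)
    then have "sqrt (1 + (1 / sqrt ?B)\<^sup>2) = sqrt (?B + 1) / sqrt ?B" using assms by (simp add: power_divide real_sqrt_divide)
    then show "sin ?z = 1 / sqrt (?B + 1)" "cos ?z = sqrt ?B / sqrt (?B + 1)"
      unfolding zstar_def sin_arctan cos_arctan using assms by simp_all
  qed
  have "(?B - 1) * sin ?z * cos ?z / ((cos ?z)\<^sup>2 + ?B * (sin ?z)\<^sup>2) = (?B - 1) / (2 * sqrt ?B)"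
  proof -
    have "(?B - 1) * sin ?z * cos ?z = (?B - 1) * sqrt ?B / (?B + 1)" unfolding s by simp
    moreover have "(cos ?z)\<^sup>2 + ?B * (sin ?z)\<^sup>2 = 2 * ?B / (?B + 1)" unfolding s by (simp add: power_divide)
    moreover have "(?B - 1) * sqrt ?B / (?B + 1) / (2 * ?B / (?B + 1)) = (?B - 1) * (sqrt ?B / ?B) / 2" using assms by simp
    moreover have "sqrt ?B / ?B = 1 / sqrt ?B" using real_div_sqrt[of ?B] assms by (simp add: field_simps)
    ultimately show ?thesis by simp
  qed
  then show ?thesis using assms by (simp add: jump_def tree_theta_eq)
qed

lemma jump_minus_id_strict:
  assumes b: "b > 1" and "- zstar b \<le> x" "x < y" "y \<le> zstar b"
  shows "jump b x - x < jump b y - y"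
proof (rule DERIV_pos_imp_increasing_open[OF assms(3)])
  fix z assume z: "x < z" "z < y"
  have "((\<lambda>x. jump b x - x) has_real_derivative (1 / gain b z - 1)) (at z)"
    using b by (intro derivative_intros DERIV_jump) auto
  moreover have "1 / gain b z - 1 > 0" using gain_less_1[OF b, of z] gain_pos[of b z] z assms by (simp add: field_simps)
  ultimately show "\<exists>y. ((\<lambda>x. jump b x - x) has_real_derivative y) (at z) \<and> 0 < y" by blast
next
  show "continuous_on {x..y} (\<lambda>x. jump b x - x)" using b by (intro continuous_intros continuous_jump) auto
qed

definition zfix :: "nat \<Rightarrow> real \<Rightarrow> real" where
  "zfix b \<delta> = (SOME z. \<bar>z\<bar> \<le> zstar b \<and> jump b z - z = - \<delta>)"

lemma zfix:
  assumes b: "b \<ge> 2" and \<delta>: "\<bar>\<delta>\<bar> \<le> tree_theta b"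
  shows "\<bar>zfix b \<delta>\<bar> \<le> zstar b" "jump b (zfix b \<delta>) = zfix b \<delta> - \<delta>"
proof -
  have z0: "zstar (real b) > 0" using b by (intro zstar) auto
  have "\<exists>z\<ge>- zstar b. z \<le> zstar b \<and> jump b z - z = - \<delta>"
    by (rule IVT') (use z0 b \<delta> in \<open>auto simp: jump_minus jump_zstar intro!: continuous_intros continuous_jump\<close>)
  then have "\<exists>z. \<bar>z\<bar> \<le> zstar b \<and> jump b z - z = - \<delta>" by (auto simp: abs_le_iff)
  then have "\<bar>zfix b \<delta>\<bar> \<le> zstar b \<and> jump b (zfix b \<delta>) - zfix b \<delta> = - \<delta>"
    unfolding zfix_def by (rule someI_ex)
  then show "\<bar>zfix b \<delta>\<bar> \<le> zstar b" "jump b (zfix b \<delta>) = zfix b \<delta> - \<delta>" by auto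
qed

lemma zfix_antimono:
  assumes b: "b \<ge> 2" and "- tree_theta b \<le> \<delta>" "\<delta> < \<delta>'" "\<delta>' \<le> tree_theta b"
  shows "zfix b \<delta>' < zfix b \<delta>"
proof (rule ccontr)
  assume "\<not> ?thesis"
  then have le: "zfix b \<delta> \<le> zfix b \<delta>'" by simp
  note Z = zfix[OF b, of \<delta>] zfix[OF b, of \<delta>']
  have "jump b (zfix b \<delta>) - zfix b \<delta> \<le> jump b (zfix b \<delta>') - zfix b \<delta>'"
    using jump_minus_id_strict[of b "zfix b \<delta>" "zfix b \<delta>'"] Z(1,3) b assms le
    by (cases "zfix b \<delta> = zfix b \<delta>'") (auto simp: abs_le_iff)
  moreover have "jump b (zfix b \<delta>) - zfix b \<delta> = - \<delta>" "jump b (zfix b \<delta>') - zfix b \<delta>' = - \<delta>'"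
    using Z(2,4) assms by (auto simp: abs_le_iff)
  ultimately show False using assms(3) by simp
qed

lemma zfix_0: assumes "b \<ge> 2" shows "zfix b 0 = 0"
proof -
  note Z = zfix[OF assms, of 0]
  have t: "0 \<le> tree_theta b" using tree_theta_bounds[OF assms] by simp
  show ?thesis
    using jump_minus_id_strict[of b "zfix b 0" 0] jump_minus_id_strict[of b 0 "zfix b 0"] Z t assms zstar(1)[of b]
    by (cases "zfix b 0" "0::real" rule: linorder_cases) (auto simp: jump_0)
qed

lemma zfix_theta:
  assumes "b \<ge> 2" "\<bar>\<delta>\<bar> < tree_theta b" shows "\<bar>zfix b \<delta>\<bar> < zstar b"
proof -
  note Z = zfix[OF assms(1), of \<delta>]
  have "zfix b \<delta> \<noteq> zstar b" "zfix b \<delta> \<noteq> - zstar b"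
    using Z assms jump_zstar[OF assms(1)] by (auto simp: jump_minus)
  then show ?thesis using Z assms by auto
qed

text \<open>Rigidity in the comparison: after leaving 0 upwards the difference can never return.
  Used by contradiction, it is the source of strict monotonicity of the flow in \<mu> and in
  \<open>V\<close>.\<close>

lemma linear_ode_zero:
  fixes D m g :: "real \<Rightarrow> real"
  assumes D: "ac_on a b D (\<lambda>t. m t * D t + g t)" and m: "bdd_meas a b m"
    and g: "\<And>t. t \<in> {a..b} \<Longrightarrow> g t \<ge> 0" and Da: "D a \<ge> 0" and Db: "D b \<le> 0" and ab: "a \<le> b"
  shows "\<And>t. t \<in> {a..b} \<Longrightarrow> D t = 0" "integral {a..b} g = 0"
proof -
  show z: "D t = 0" if t: "t \<in> {a..b}" for t
  proof -
    have "exp (integral {t..b} m) * D t \<le> 0" "D t \<ge> 0"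
      using linear_ode_lower[OF D m g Da, of t b] t Db by auto
    then show ?thesis by (simp add: mult_le_0_iff)
  qed
  have "integral {a..b} g = integral {a..b} (\<lambda>t. m t * D t + g t)"
    by (intro Henstock_Kurzweil_Integration.integral_cong) (simp add: z)
  also have "\<dots> = D b - D a" using ac_on_increment[OF D, of a b] ab by simp
  finally show "integral {a..b} g = 0" using z[of a] z[of b] ab by simp
qed

lemma ac_on_linear: "ac_on a b (\<lambda>t. x + c * (t - a)) (\<lambda>_. c :: real)"
  by (rule ac_onI) (auto intro: bdd_meas_const)

lemma sin_sq_add_int_pi: "(sin (x + of_int m * pi))\<^sup>2 = (sin x)\<^sup>2" for x :: real
proof -
  have "sin (of_int m * pi :: real) = 0" using sin_npi_int[of m] by (simp add: mult.commute)
  moreover have "(cos (of_int m * pi :: real))\<^sup>2 = 1" using cos_npi_int[of m] by (simp add: mult.commute)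
  ultimately show ?thesis by (simp add: sin_add power_mult_distrib)
qed

subsection \<open>The angle flow on the cells\<close>

definition potential :: "(real \<Rightarrow> real) \<Rightarrow> bool" where
  "potential V \<longleftrightarrow> V \<in> borel_measurable (lebesgue_on {0..}) \<and> (\<forall>t\<ge>0. 0 \<le> V t) \<and> (\<exists>B. \<forall>t\<ge>0. V t \<le> B)"

lemma potential_nonneg: "potential V \<Longrightarrow> t \<ge> 0 \<Longrightarrow> V t \<ge> 0"
  by (simp add: potential_def)

lemma potential_bound:
  assumes "potential V" obtains B where "B \<ge> 0" "\<And>t. t \<ge> 0 \<Longrightarrow> V t \<le> B"
proof -
  obtain B where "\<forall>t\<ge>0. V t \<le> B" using assms by (auto simp: potential_def)
  moreover then have "B \<ge> 0" using potential_nonneg[OF assms, of 0] by force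
  ultimately show ?thesis using that by blast
qed

lemma potential_bdd_meas: 
  assumes "potential V" "a \<ge> 0" shows "bdd_meas a b V"
proof -
  obtain B where B: "\<And>t. t \<ge> 0 \<Longrightarrow> V t \<le> B" using potential_bound[OF assms(1)] by blast
  have "V \<in> borel_measurable (lebesgue_on {a..b})"
    by (rule measurable_restrict_mono[of _ _ "{0..}"]) (use assms in \<open>auto simp: potential_def\<close>)
  then show ?thesis using B potential_nonneg[OF assms(1)] assms(2) by (intro bdd_measI[where B=B]) auto
qed

lemma potential_scale:
  assumes "potential V" "c \<ge> 0" shows "potential (\<lambda>t. c * V t)"
proof -
  obtain B where "\<And>t. t \<ge> 0 \<Longrightarrow> V t \<le> B" using potential_bound[OF assms(1)] by blast
  then have "\<forall>t\<ge>0. c * V t \<le> c * B" using assms by (auto intro: mult_left_mono)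
  then show ?thesis using assms unfolding potential_def by auto
qed

lemma potential_zero: "potential (\<lambda>_. 0)" unfolding potential_def by auto

text \<open>On the cell the choice is determined by uniqueness (\<open>prufer_eqI\<close>); outside
  the cell the chosen function is arbitrary.\<close>

definition prufer :: "(real \<Rightarrow> real) \<Rightarrow> real \<Rightarrow> nat \<Rightarrow> real \<Rightarrow> real \<Rightarrow> real" where
  "prufer V \<mu> n x = (SOME \<phi>. prufer_sol V \<mu> (real n) (real n + 1) x \<phi>)"

definition flow :: "(real \<Rightarrow> real) \<Rightarrow> real \<Rightarrow> nat \<Rightarrow> real \<Rightarrow> real" where
  "flow V \<mu> n x = prufer V \<mu> n x (real n + 1)"

lemma prufer:
  assumes "potential V" "\<mu> > 0" shows "prufer_sol V \<mu> (real n) (real n + 1) x (prufer V \<mu> n x)"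
  unfolding prufer_def using someI_ex[OF prufer_sol_exists[OF potential_bdd_meas[OF assms(1)] _ assms(2), of "real n" "real n + 1" x]]
  by simp

lemma prufer_start: "potential V \<Longrightarrow> \<mu> > 0 \<Longrightarrow> prufer V \<mu> n x (real n) = x"
  using prufer[of V \<mu> n x] by (simp add: prufer_sol_def)

lemma prufer_ac: "potential V \<Longrightarrow> \<mu> > 0 \<Longrightarrow>
   ac_on (real n) (real n + 1) (prufer V \<mu> n x) (\<lambda>t. \<mu> - V t / \<mu> * (sin (prufer V \<mu> n x t))\<^sup>2)"
  using prufer[of V \<mu> n x] by (simp add: prufer_sol_def)

lemma prufer_mono:
  assumes V: "potential V1" "potential V2" and \<mu>: "0 < \<mu>1" "\<mu>1 \<le> \<mu>2" and "x \<le> y"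
    and le: "\<And>t. t \<in> {real n..real n + 1} \<Longrightarrow> V2 t \<le> V1 t" and t: "t \<in> {real n..real n + 1}"
  shows "prufer V1 \<mu>1 n x t \<le> prufer V2 \<mu>2 n y t"
proof (rule prufer_sol_ge[OF prufer prufer_ac potential_bdd_meas])
  fix t assume t: "t \<in> {real n..real n + 1}"
  have "V2 t / \<mu>2 \<le> V1 t / \<mu>1" using le[OF t] \<mu> potential_nonneg[OF V(2), of t] t by (intro frac_le) auto
  then have "V2 t / \<mu>2 * (sin (prufer V1 \<mu>1 n x t))\<^sup>2 \<le> V1 t / \<mu>1 * (sin (prufer V1 \<mu>1 n x t))\<^sup>2"
    by (intro mult_right_mono) auto
  then show "\<mu>1 - V1 t / \<mu>1 * (sin (prufer V1 \<mu>1 n x t))\<^sup>2 \<le> \<mu>2 - V2 t / \<mu>2 * (sin (prufer V1 \<mu>1 n x t))\<^sup>2"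
    using \<mu> by linarith
qed (use assms prufer_start in auto)

lemma prufer_eqI:
  assumes V: "potential V" "\<mu> > 0" and \<phi>: "prufer_sol V \<mu> (real n) (real n + 1) x \<phi>" and t: "t \<in> {real n..real n + 1}"
  shows "prufer V \<mu> n x t = \<phi> t"
proof (rule antisym)
  have ac: "ac_on (real n) (real n + 1) \<phi> (\<lambda>t. \<mu> - V t / \<mu> * (sin (\<phi> t))\<^sup>2)" and s: "\<phi> (real n) = x"
    using \<phi> by (auto simp: prufer_sol_def)
  show "prufer V \<mu> n x t \<le> \<phi> t" by (rule prufer_sol_le[OF prufer ac potential_bdd_meas]) (use V t s in auto)
  show "prufer V \<mu> n x t \<ge> \<phi> t" by (rule prufer_sol_ge[OF prufer ac potential_bdd_meas]) (use V t s in auto)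
qed

lemma prufer_add_int_pi:
  assumes V: "potential V" "\<mu> > 0" and t: "t \<in> {real n..real n + 1}"
  shows "prufer V \<mu> n (x + of_int m * pi) t = prufer V \<mu> n x t + of_int m * pi"
proof (rule prufer_eqI[OF V _ t])
  show "prufer_sol V \<mu> (real n) (real n + 1) (x + of_int m * pi) (\<lambda>t. prufer V \<mu> n x t + of_int m * pi)"
    unfolding prufer_sol_def sin_sq_add_int_pi
    using ac_on_add[OF prufer_ac[OF V, of n x] ac_on_const[of _ _ "of_int m * pi"]] V
    by (simp add: prufer_start)
qed

lemma flow_mono:
  assumes "potential V1" "potential V2" "0 < \<mu>1" "\<mu>1 \<le> \<mu>2" "x \<le> y"
    and "\<And>t. t \<in> {real n..real n + 1} \<Longrightarrow> V2 t \<le> V1 t"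
  shows "flow V1 \<mu>1 n x \<le> flow V2 \<mu>2 n y"
  unfolding flow_def by (rule prufer_mono) (use assms in auto)

lemma flow_strict_mono:
  assumes V: "potential V" and \<mu>: "0 < \<mu>" and "x < y"
  shows "flow V \<mu> n x < flow V \<mu> n y"
proof -
  let ?\<phi> = "prufer V \<mu> n y" and ?\<psi> = "prufer V \<mu> n x"
  obtain m where m: "bdd_meas (real n) (real n + 1) m" and
    D: "ac_on (real n) (real n + 1) (\<lambda>t. ?\<phi> t - ?\<psi> t) (\<lambda>t. m t * (?\<phi> t - ?\<psi> t) + (\<mu> - V t / \<mu> * (sin (?\<psi> t))\<^sup>2 - (\<mu> - V t / \<mu> * (sin (?\<psi> t))\<^sup>2)))"
    by (rule prufer_sol_diff[OF prufer[OF V \<mu>] prufer_ac[OF V \<mu>] potential_bdd_meas[OF V] \<mu>]) auto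
  have "exp (integral {real n..real n + 1} m) * (y - x) \<le> flow V \<mu> n y - flow V \<mu> n x"
    using linear_ode_lower(1)[OF D m, of "real n" "real n + 1"] assms
    by (simp add: flow_def prufer_start[OF V \<mu>])
  moreover have "exp (integral {real n..real n + 1} m) * (y - x) > 0" using assms by simp
  ultimately show ?thesis by linarith
qed

lemma flow_strict_param:
  assumes V: "potential V1" "potential V2" and \<mu>: "0 < \<mu>1" "\<mu>1 \<le> \<mu>2"
    and le: "\<And>t. t \<in> {real n..real n + 1} \<Longrightarrow> V2 t \<le> V1 t" 
    and ge: "flow V2 \<mu>2 n x \<le> flow V1 \<mu>1 n x"
  shows "\<And>t. t \<in> {real n..real n + 1} \<Longrightarrow> prufer V2 \<mu>2 n x t = prufer V1 \<mu>1 n x t"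
    "integral {real n..real n + 1} (\<lambda>t. (\<mu>2 - \<mu>1) + (V1 t / \<mu>1 - V2 t / \<mu>2) * (sin (prufer V1 \<mu>1 n x t))\<^sup>2) = 0"
proof -
  have \<mu>2: "\<mu>2 > 0" using \<mu> by simp
  let ?\<phi> = "prufer V2 \<mu>2 n x" and ?\<psi> = "prufer V1 \<mu>1 n x"
  obtain m where m: "bdd_meas (real n) (real n + 1) m" and
    D: "ac_on (real n) (real n + 1) (\<lambda>t. ?\<phi> t - ?\<psi> t) (\<lambda>t. m t * (?\<phi> t - ?\<psi> t) + (\<mu>2 - V2 t / \<mu>2 * (sin (?\<psi> t))\<^sup>2 - (\<mu>1 - V1 t / \<mu>1 * (sin (?\<psi> t))\<^sup>2)))"
    by (rule prufer_sol_diff[OF prufer[OF V(2) \<mu>2] prufer_ac[OF V(1) \<mu>(1)] potential_bdd_meas[OF V(2)] \<mu>2]) auto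
  have g: "0 \<le> \<mu>2 - V2 t / \<mu>2 * (sin (?\<psi> t))\<^sup>2 - (\<mu>1 - V1 t / \<mu>1 * (sin (?\<psi> t))\<^sup>2)"
    if t: "t \<in> {real n..real n + 1}" for t
  proof -
    have "V2 t / \<mu>2 \<le> V1 t / \<mu>1" using le[OF t] \<mu> potential_nonneg[OF V(2), of t] t by (intro frac_le) auto
    then have "V2 t / \<mu>2 * (sin (?\<psi> t))\<^sup>2 \<le> V1 t / \<mu>1 * (sin (?\<psi> t))\<^sup>2"
      by (intro mult_right_mono) auto
    then show ?thesis using \<mu> by linarith
  qed
  have d: "?\<phi> (real n) - ?\<psi> (real n) \<ge> 0" "?\<phi> (real n + 1) - ?\<psi> (real n + 1) \<le> 0"
    using ge V \<mu> \<mu>2 by (auto simp: flow_def prufer_start)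
  note Z = linear_ode_zero[OF D m g d]
  show "prufer V2 \<mu>2 n x t = prufer V1 \<mu>1 n x t" if "t \<in> {real n..real n + 1}" for t
    using Z(1)[of t] that by simp
  show "integral {real n..real n + 1} (\<lambda>t. (\<mu>2 - \<mu>1) + (V1 t / \<mu>1 - V2 t / \<mu>2) * (sin (?\<psi> t))\<^sup>2) = 0"
    using Z(2) by (simp add: algebra_simps)
qed

lemma flow_strict_mu:
  assumes V: "potential V" and \<mu>: "0 < \<mu>1" "\<mu>1 < \<mu>2"
  shows "flow V \<mu>1 n x < flow V \<mu>2 n x"
proof (rule ccontr)
  assume "\<not> ?thesis"
  then have ge: "flow V \<mu>2 n x \<le> flow V \<mu>1 n x" by simp
  let ?\<psi> = "prufer V \<mu>1 n x"
  let ?g = "\<lambda>t. (\<mu>2 - \<mu>1) + (V t / \<mu>1 - V t / \<mu>2) * (sin (?\<psi> t))\<^sup>2"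
  have I: "integral {real n..real n + 1} ?g = 0"
    by (rule flow_strict_param(2)[OF V V _ _ _ ge]) (use \<mu> in auto)
  have bV: "bdd_meas (real n) (real n + 1) V" using V by (rule potential_bdd_meas) simp
  have "continuous_on {real n..real n + 1} (\<lambda>t. (sin (?\<psi> t))\<^sup>2)"
    using ac_on_continuous[OF prufer_ac[OF V \<mu>(1), of n x]] by (intro continuous_intros)
  then have "bdd_meas (real n) (real n + 1) (\<lambda>t. (\<mu>2 - \<mu>1) + ((1 / \<mu>1 - 1 / \<mu>2) * V t) * (sin (?\<psi> t))\<^sup>2)"
    by (intro bdd_meas_add bdd_meas_mult bdd_meas_const bV bdd_meas_continuous)
  then have "?g integrable_on {real n..real n + 1}"
    using bdd_meas_integrable[of "real n" "real n + 1" ?g "real n" "real n + 1"] by (simp add: algebra_simps)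
  moreover have "integral {real n..real n + 1} (\<lambda>_. \<mu>2 - \<mu>1) \<le> integral {real n..real n + 1} ?g"
  proof (rule integral_le)
    show "?g integrable_on {real n..real n + 1}" by fact
    fix t assume "t \<in> {real n..real n + 1}"
    then have "V t / \<mu>2 \<le> V t / \<mu>1" using potential_nonneg[OF V, of t] \<mu> by (intro divide_left_mono) auto
    then have "(V t / \<mu>1 - V t / \<mu>2) * (sin (?\<psi> t))\<^sup>2 \<ge> 0" by (intro mult_nonneg_nonneg) auto
    then show "\<mu>2 - \<mu>1 \<le> ?g t" by simp
  qed (rule integrable_const_ivl)
  ultimately show False using I \<mu> by simp
qed

text \<open>If the flow did not strictly gain, the positive difference of the potentials would force
  the sine of the angle to vanish on the whole cell. But then the angle moves with speed \<mu>, a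
  contradiction.\<close>

lemma flow_strict_V:
  assumes V: "potential V1" "potential V2" and \<mu>: "0 < \<mu>" and \<eta>: "\<eta> > 0"
    and le: "\<And>t. t \<in> {real n..real n + 1} \<Longrightarrow> V2 t + \<eta> \<le> V1 t" 
  shows "flow V1 \<mu> n x < flow V2 \<mu> n x"
proof (rule ccontr)
  assume "\<not> ?thesis"
  then have ge: "flow V2 \<mu> n x \<le> flow V1 \<mu> n x" by simp
  let ?\<psi> = "prufer V1 \<mu> n x" and ?I = "{real n..real n + 1}"
  let ?g = "\<lambda>t. (\<mu> - \<mu>) + (V1 t / \<mu> - V2 t / \<mu>) * (sin (?\<psi> t))\<^sup>2"
  have I: "integral ?I ?g = 0"
    by (rule flow_strict_param(2)[OF V _ _ _ ge]) (use \<mu> le \<eta> in \<open>force+\<close>)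
  have bV: "bdd_meas (real n) (real n + 1) V1" "bdd_meas (real n) (real n + 1) V2" using V by (auto intro: potential_bdd_meas)
  have c: "continuous_on ?I (\<lambda>t. (sin (?\<psi> t))\<^sup>2)"
    using ac_on_continuous[OF prufer_ac[OF V(1) \<mu>, of n x]] by (intro continuous_intros)
  then have "bdd_meas (real n) (real n + 1) (\<lambda>t. (1 / \<mu>) * (V1 t - V2 t) * (sin (?\<psi> t))\<^sup>2)"
    by (intro bdd_meas_diff bdd_meas_mult bdd_meas_const bV bdd_meas_continuous)
  then have ig: "?g integrable_on ?I"
    using bdd_meas_integrable[of "real n" "real n + 1" ?g "real n" "real n + 1"] by (simp add: diff_divide_distrib)
  have sint: "(\<lambda>t. (sin (?\<psi> t))\<^sup>2) integrable_on ?I" using c by (rule integrable_continuous_real)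
  have "integral ?I (\<lambda>t. \<eta> / \<mu> * (sin (?\<psi> t))\<^sup>2) \<le> integral ?I ?g"
  proof (rule integral_le[OF _ ig])
    show "(\<lambda>t. \<eta> / \<mu> * (sin (?\<psi> t))\<^sup>2) integrable_on ?I" using sint by (rule integrable_on_mult_right)
    fix t assume "t \<in> ?I"
    then have "\<eta> / \<mu> \<le> V1 t / \<mu> - V2 t / \<mu>" using le[of t] \<mu> by (simp add: diff_divide_distrib[symmetric] divide_right_mono)
    then show "\<eta> / \<mu> * (sin (?\<psi> t))\<^sup>2 \<le> ?g t" using mult_right_mono[of "\<eta>/\<mu>" "V1 t / \<mu> - V2 t / \<mu>" "(sin (?\<psi> t))\<^sup>2"] by simp
  qed
  then have "\<eta> / \<mu> * integral ?I (\<lambda>t. (sin (?\<psi> t))\<^sup>2) \<le> 0" using I by simp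
  then have "integral ?I (\<lambda>t. (sin (?\<psi> t))\<^sup>2) \<le> 0" using \<eta> \<mu> by (simp add: divide_le_0_iff mult_le_0_iff)
  moreover have "integral ?I (\<lambda>t. (sin (?\<psi> t))\<^sup>2) \<ge> 0" using sint by (intro integral_nonneg) auto
  ultimately have "integral ?I (\<lambda>t. (sin (?\<psi> t))\<^sup>2) = 0" by linarith
  then have z: "\<forall>t\<in>?I. (sin (?\<psi> t))\<^sup>2 = 0"
    using integral_eq_0_iff[of "real n" "real n + 1" "\<lambda>t. (sin (?\<psi> t))\<^sup>2"] c by simp
  have lin: "?\<psi> t = x + \<mu> * (t - real n)" if t: "t \<in> ?I" for t
  proof -
    have "integral {real n..t} (\<lambda>t. \<mu> - V1 t / \<mu> * (sin (?\<psi> t))\<^sup>2) = integral {real n..t} (\<lambda>_. \<mu>)"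
      using t z by (intro Henstock_Kurzweil_Integration.integral_cong) auto
    then show ?thesis using ac_onD[OF prufer_ac[OF V(1) \<mu>, of n x] t] t prufer_start[OF V(1) \<mu>, of n x] by simp
  qed
  \<comment> \<open>A time within the cell during which the angle advances by less than \<pi>, so
    that the sine cannot vanish again.\<close>
  define h where "h = min 1 (pi / (2 * \<mu>))"
  have h: "h > 0" "h \<le> 1" "\<mu> * h < pi"
  proof -
    show "h > 0" "h \<le> 1" using \<mu> by (auto simp: h_def)
    have "\<mu> * h \<le> \<mu> * (pi / (2 * \<mu>))" using \<mu> by (intro mult_left_mono) (auto simp: h_def)
    also have "\<dots> < pi" using \<mu> by simp
    finally show "\<mu> * h < pi" .
  qed
  have s0: "sin x = 0" using z[rule_format, of "real n"] lin[of "real n"] by simp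
  have "sin (x + \<mu> * h) = 0" using z[rule_format, of "real n + h"] lin[of "real n + h"] h by simp
  then have "cos x * sin (\<mu> * h) = 0" using s0 by (simp add: sin_add)
  moreover have "sin (\<mu> * h) > 0" using h \<mu> by (intro sin_gt_zero) auto
  moreover have "cos x \<noteq> 0" using s0 sin_zero_abs_cos_one by force
  ultimately show False by simp
qed

lemma prufer_bounds:
  assumes V: "potential V" and \<mu>: "0 < \<mu>" and t: "t \<in> {real n..real n + 1}"
  shows "prufer V \<mu> n x t \<le> x + \<mu> * (t - real n)"
    "(\<And>t. t \<in> {real n..real n + 1} \<Longrightarrow> V t \<le> v) \<Longrightarrow> prufer V \<mu> n x t \<ge> x + (\<mu> - v / \<mu>) * (t - real n)"
proof -
  show "prufer V \<mu> n x t \<le> x + \<mu> * (t - real n)"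
    by (rule prufer_sol_le[OF prufer[OF V \<mu>] ac_on_linear potential_bdd_meas[OF V] \<mu> _ _ t])
       (use V \<mu> potential_nonneg[OF V] in auto)
  assume v: "\<And>t. t \<in> {real n..real n + 1} \<Longrightarrow> V t \<le> v"
  show "prufer V \<mu> n x t \<ge> x + (\<mu> - v / \<mu>) * (t - real n)"
  proof (rule prufer_sol_ge[OF prufer[OF V \<mu>] ac_on_linear potential_bdd_meas[OF V] \<mu> _ _ t])
    fix t assume t: "t \<in> {real n..real n + 1}"
    have "V t / \<mu> * (sin (x + (\<mu> - v / \<mu>) * (t - real n)))\<^sup>2 \<le> v / \<mu> * 1"
      using v[OF t] potential_nonneg[OF V, of t] t \<mu> by (intro mult_mono divide_right_mono) (auto simp: abs_square_le_1)
    then show "\<mu> - v / \<mu> \<le> \<mu> - V t / \<mu> * (sin (x + (\<mu> - v / \<mu>) * (t - real n)))\<^sup>2" by simp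
  qed simp_all
qed

lemma flow_bounds:
  assumes V: "potential V" and \<mu>: "0 < \<mu>"
  shows "flow V \<mu> n x \<le> x + \<mu>"
    "(\<And>t. t \<in> {real n..real n + 1} \<Longrightarrow> V t \<le> v) \<Longrightarrow> flow V \<mu> n x \<ge> x + \<mu> - v / \<mu>"
  using prufer_bounds(1)[OF V \<mu>, of "real n + 1" n x] prufer_bounds(2)[OF V \<mu>, of "real n + 1" n v x]
  by (simp_all add: flow_def add_diff_eq)

text \<open>At an odd multiple of \<pi>/2 the squared sine is 1 and the angular speed is \<mu> -
  V/\<mu>, which is not positive here; so the constant is a supersolution.\<close>

lemma flow_barrier:
  assumes V: "potential V" and \<mu>: "0 < \<mu>" and ge: "\<And>t. t \<in> {real n..real n + 1} \<Longrightarrow> V t \<ge> \<mu>\<^sup>2"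
    and x: "x \<le> pi/2 + of_int m * pi"
  shows "flow V \<mu> n x \<le> pi/2 + of_int m * pi"
  unfolding flow_def
proof (rule prufer_sol_le[OF prufer[OF V \<mu>] ac_on_const potential_bdd_meas[OF V] \<mu>])
  fix t assume "t \<in> {real n..real n + 1}"
  then have "\<mu> \<le> V t / \<mu>" using ge[of t] \<mu> by (simp add: field_simps power2_eq_square)
  then show "\<mu> - V t / \<mu> * (sin (pi/2 + of_int m * pi))\<^sup>2 \<le> 0" by (simp add: sin_sq_add_int_pi)
qed (use x in auto)

lemma prufer_nonneg:
  assumes V: "potential V" and \<mu>: "0 < \<mu>" and x: "x \<ge> 0" and t: "t \<in> {real n..real n + 1}"
  shows "prufer V \<mu> n x t \<ge> 0"
  by (rule prufer_sol_ge[OF prufer[OF V \<mu>] ac_on_const potential_bdd_meas[OF V] \<mu> _ _ t]) (use x \<mu> in auto)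

lemma flow_diff:
  assumes V: "potential V1" "potential V2" and \<mu>: "0 < \<mu>" 
    and B: "\<And>t. t \<in> {real n..real n + 1} \<Longrightarrow> V1 t \<le> B"
    and e: "\<And>t. t \<in> {real n..real n + 1} \<Longrightarrow> \<bar>V1 t - V2 t\<bar> \<le> e"
  shows "\<bar>flow V1 \<mu> n x - flow V2 \<mu> n y\<bar> \<le> exp (B / \<mu>) * \<bar>x - y\<bar> + exp (2 * (B / \<mu>)) * (e / \<mu>)"
proof -
  let ?\<phi> = "prufer V1 \<mu> n x" and ?\<psi> = "prufer V2 \<mu> n y"
  obtain m where m: "bdd_meas (real n) (real n + 1) m" and mb: "\<And>t. t \<in> {real n..real n + 1} \<Longrightarrow> \<bar>m t\<bar> \<le> \<bar>V1 t\<bar> / \<mu>" and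
    D: "ac_on (real n) (real n + 1) (\<lambda>t. ?\<phi> t - ?\<psi> t) (\<lambda>t. m t * (?\<phi> t - ?\<psi> t) + (\<mu> - V1 t / \<mu> * (sin (?\<psi> t))\<^sup>2 - (\<mu> - V2 t / \<mu> * (sin (?\<psi> t))\<^sup>2)))"
    by (rule prufer_sol_diff[OF prufer[OF V(1) \<mu>] prufer_ac[OF V(2) \<mu>] potential_bdd_meas[OF V(1)] \<mu>]) auto
  have "\<bar>?\<phi> (real n + 1) - ?\<psi> (real n + 1)\<bar> \<le> exp (B / \<mu> * (real n + 1 - real n)) * \<bar>?\<phi> (real n) - ?\<psi> (real n)\<bar>
     + exp (2 * (B / \<mu>) * (real n + 1 - real n)) * (e / \<mu>) * (real n + 1 - real n)"
  proof (rule linear_ode_upper[OF D m])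
    fix t assume t: "t \<in> {real n..real n + 1}"
    have "\<bar>V1 t\<bar> / \<mu> \<le> B / \<mu>" using B[OF t] potential_nonneg[OF V(1), of t] t \<mu> by (simp add: divide_right_mono)
    then show "\<bar>m t\<bar> \<le> B / \<mu>" using mb[OF t] by linarith
    have "\<mu> - V1 t / \<mu> * (sin (?\<psi> t))\<^sup>2 - (\<mu> - V2 t / \<mu> * (sin (?\<psi> t))\<^sup>2) = - ((V1 t - V2 t) / \<mu> * (sin (?\<psi> t))\<^sup>2)"
      by (simp add: algebra_simps diff_divide_distrib)
    also have "\<bar>\<dots>\<bar> = \<bar>V1 t - V2 t\<bar> / \<mu> * (sin (?\<psi> t))\<^sup>2" using \<mu> by (simp add: abs_mult abs_divide)
    also have "\<dots> \<le> e / \<mu> * 1" using e[OF t] \<mu> by (intro mult_mono divide_right_mono) (auto simp: abs_square_le_1 intro: order_trans)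
    finally show "\<bar>\<mu> - V1 t / \<mu> * (sin (?\<psi> t))\<^sup>2 - (\<mu> - V2 t / \<mu> * (sin (?\<psi> t))\<^sup>2)\<bar> \<le> e / \<mu>" by simp
  qed simp
  then show ?thesis using V \<mu> by (simp add: flow_def prufer_start)
qed

subsection \<open>Orbits of angles and the Weyl angle\<close>

text \<open>
  \<open>orbit b l V \<mu> a n\<close> is the angle at \<open>n\<close> of the solution starting with angle \<open>a\<close>, minus $\<pi> l n$;
  so the decaying unperturbed solution has the constant orbit \<open>wfix b l \<mu>\<close>.
\<close>

primrec orbit :: "nat \<Rightarrow> nat \<Rightarrow> (real \<Rightarrow> real) \<Rightarrow> real \<Rightarrow> real \<Rightarrow> nat \<Rightarrow> real" where
  "orbit b l V \<mu> a 0 = a"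
| "orbit b l V \<mu> a (Suc n) = jump b (flow V \<mu> n (orbit b l V \<mu> a n)) - pi * real l"

lemma orbit_mono:
  assumes "b \<ge> 1" "potential V1" "potential V2" "0 < \<mu>1" "\<mu>1 \<le> \<mu>2" "\<And>t. t \<ge> 0 \<Longrightarrow> V2 t \<le> V1 t"
    and "orbit b l V1 \<mu>1 a n \<le> orbit b l V2 \<mu>2 a' n" and "n \<le> m"
  shows "orbit b l V1 \<mu>1 a m \<le> orbit b l V2 \<mu>2 a' m"
  using assms(8)
proof (induction m rule: dec_induct)
  case base show ?case by fact
next
  case (step m)
  have "flow V1 \<mu>1 m (orbit b l V1 \<mu>1 a m) \<le> flow V2 \<mu>2 m (orbit b l V2 \<mu>2 a' m)"
    by (rule flow_mono) (use assms step in auto)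
  then show ?case using assms(1) by (simp add: jump_mono)
qed

lemma orbit_strict_mono:
  assumes "b \<ge> 1" "potential V" "0 < \<mu>" "a < a'"
  shows "orbit b l V \<mu> a n < orbit b l V \<mu> a' n"
proof (induction n)
  case (Suc n)
  then show ?case using assms by (simp add: jump_strict_mono flow_strict_mono)
qed (use assms in simp)

lemma orbit_add_int_pi:
  assumes "potential V" "0 < \<mu>"
  shows "orbit b l V \<mu> (a + of_int m * pi) n = orbit b l V \<mu> a n + of_int m * pi"
proof (induction n)
  case (Suc n)
  then show ?case using assms by (simp add: flow_def prufer_add_int_pi jump_add_int_pi)
qed simp

text \<open>One constant for the start and the coupling together. It may grow with \<open>n\<close>,
  because continuity in \<alpha> is used for one \<open>n\<close> at a time.\<close>

lemma orbit_Lipschitz: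
  assumes b: "b \<ge> 1" and V: "potential V" and \<mu>: "0 < \<mu>"
  shows "\<exists>K\<ge>0. \<forall>\<alpha>\<in>{0..1}. \<forall>\<beta>\<in>{0..1}. \<forall>x y.
     \<bar>orbit b l (\<lambda>t. \<alpha> * V t) \<mu> x n - orbit b l (\<lambda>t. \<beta> * V t) \<mu> y n\<bar> \<le> K * (\<bar>x - y\<bar> + \<bar>\<alpha> - \<beta>\<bar>)"
proof (induction n)
  case 0
  show ?case by (rule exI[of _ 1]) auto
next
  case (Suc n)
  then obtain K where K: "K \<ge> 0" "\<And>\<alpha> \<beta> x y. \<alpha> \<in> {0..1} \<Longrightarrow> \<beta> \<in> {0..1} \<Longrightarrow>
     \<bar>orbit b l (\<lambda>t. \<alpha> * V t) \<mu> x n - orbit b l (\<lambda>t. \<beta> * V t) \<mu> y n\<bar> \<le> K * (\<bar>x - y\<bar> + \<bar>\<alpha> - \<beta>\<bar>)" by blast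
  obtain B where B: "B \<ge> 0" "\<And>t. t \<ge> 0 \<Longrightarrow> V t \<le> B" using potential_bound[OF V] by blast
  define M where "M = b * (exp (B / \<mu>) * K + exp (2 * (B / \<mu>)) * (B / \<mu>))"
  show ?case
  proof (intro exI[of _ M] conjI ballI allI)
    show "M \<ge> 0" using K B \<mu> by (simp add: M_def)
    fix \<alpha> \<beta> :: real and x y assume ab: "\<alpha> \<in> {0..1}" "\<beta> \<in> {0..1}"
    let ?u = "orbit b l (\<lambda>t. \<alpha> * V t) \<mu> x n" and ?v = "orbit b l (\<lambda>t. \<beta> * V t) \<mu> y n"
    have "\<bar>flow (\<lambda>t. \<alpha> * V t) \<mu> n ?u - flow (\<lambda>t. \<beta> * V t) \<mu> n ?v\<bar>
       \<le> exp (B / \<mu>) * \<bar>?u - ?v\<bar> + exp (2 * (B / \<mu>)) * (B * \<bar>\<alpha> - \<beta>\<bar> / \<mu>)"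
    proof (rule flow_diff)
      show "potential (\<lambda>t. \<alpha> * V t)" "potential (\<lambda>t. \<beta> * V t)" using potential_scale[OF V] ab by auto
      fix t assume "t \<in> {real n..real n + 1}"
      then have t: "t \<ge> 0" by simp
      have "\<alpha> * V t \<le> 1 * V t" using ab potential_nonneg[OF V t] by (intro mult_right_mono) auto
      then show "\<alpha> * V t \<le> B" using B(2)[OF t] by simp
      have "\<bar>\<alpha> * V t - \<beta> * V t\<bar> = V t * \<bar>\<alpha> - \<beta>\<bar>" using potential_nonneg[OF V t] by (simp add: abs_mult left_diff_distrib[symmetric])
      also have "\<dots> \<le> B * \<bar>\<alpha> - \<beta>\<bar>" using B(2)[OF t] by (intro mult_right_mono) auto
      finally show "\<bar>\<alpha> * V t - \<beta> * V t\<bar> \<le> B * \<bar>\<alpha> - \<beta>\<bar>" .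
    qed fact
    also have "exp (B / \<mu>) * \<bar>?u - ?v\<bar> \<le> exp (B / \<mu>) * (K * (\<bar>x - y\<bar> + \<bar>\<alpha> - \<beta>\<bar>))" using K(2)[OF ab] by simp
    also have "exp (2 * (B / \<mu>)) * (B * \<bar>\<alpha> - \<beta>\<bar> / \<mu>) \<le> exp (2 * (B / \<mu>)) * (B / \<mu> * (\<bar>x - y\<bar> + \<bar>\<alpha> - \<beta>\<bar>))"
      using B \<mu> by (simp add: field_simps)
    finally have "\<bar>flow (\<lambda>t. \<alpha> * V t) \<mu> n ?u - flow (\<lambda>t. \<beta> * V t) \<mu> n ?v\<bar>
       \<le> (exp (B / \<mu>) * K + exp (2 * (B / \<mu>)) * (B / \<mu>)) * (\<bar>x - y\<bar> + \<bar>\<alpha> - \<beta>\<bar>)" by (simp add: algebra_simps add_divide_distrib)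
    then have "real b * \<bar>flow (\<lambda>t. \<alpha> * V t) \<mu> n ?u - flow (\<lambda>t. \<beta> * V t) \<mu> n ?v\<bar> \<le> M * (\<bar>x - y\<bar> + \<bar>\<alpha> - \<beta>\<bar>)"
      unfolding M_def mult.assoc by (intro mult_left_mono) auto
    then show "\<bar>orbit b l (\<lambda>t. \<alpha> * V t) \<mu> x (Suc n) - orbit b l (\<lambda>t. \<beta> * V t) \<mu> y (Suc n)\<bar> \<le> M * (\<bar>x - y\<bar> + \<bar>\<alpha> - \<beta>\<bar>)"
      using jump_Lipschitz[of b "flow (\<lambda>t. \<alpha> * V t) \<mu> n ?u" "flow (\<lambda>t. \<beta> * V t) \<mu> n ?v"] b by simp
  qed
qed

lemma orbit_Lipschitz_start:
  assumes "b \<ge> 1" "potential V" "0 < \<mu>"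
  obtains K where "K \<ge> 0" "\<And>x y. \<bar>orbit b l V \<mu> x n - orbit b l V \<mu> y n\<bar> \<le> K * \<bar>x - y\<bar>"
proof -
  obtain K where K: "K \<ge> 0" "\<forall>\<alpha>\<in>{0..1}. \<forall>\<beta>\<in>{0..1}. \<forall>x y.
     \<bar>orbit b l (\<lambda>t. \<alpha> * V t) \<mu> x n - orbit b l (\<lambda>t. \<beta> * V t) \<mu> y n\<bar> \<le> K * (\<bar>x - y\<bar> + \<bar>\<alpha> - \<beta>\<bar>)"
    using orbit_Lipschitz[OF assms] by blast
  show thesis by (rule that[OF K(1)]) (use K(2)[rule_format, of 1 1] in simp)
qed

lemma continuous_orbit:
  assumes "b \<ge> 1" "potential V" "0 < \<mu>" shows "continuous_on S (\<lambda>a. orbit b l V \<mu> a n)"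
proof -
  obtain K where "K \<ge> 0" "\<And>x y. \<bar>orbit b l V \<mu> x n - orbit b l V \<mu> y n\<bar> \<le> K * \<bar>x - y\<bar>"
    using orbit_Lipschitz_start[OF assms] by blast
  then have "K-lipschitz_on S (\<lambda>a. orbit b l V \<mu> a n)" by (intro lipschitz_onI) (auto simp: dist_real_def)
  then show ?thesis by (rule lipschitz_on_continuous_on)
qed

text \<open>Shifting the start by multiples of \<pi> shifts the orbit by the same amount, so its
  value at \<open>n\<close> is unbounded in both directions and the intermediate value theorem
  applies. This allows angles to be pulled back to 0.\<close>

lemma orbit_surj:
  assumes b: "b \<ge> 1" and V: "potential V" and \<mu>: "0 < \<mu>" shows "\<exists>a. orbit b l V \<mu> a n = y"
proof -
  let ?X = "\<lambda>a. orbit b l V \<mu> a n"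
  obtain i :: int where i: "of_int i * pi \<le> y - ?X 0" using ex_of_int_less[of "(y - ?X 0) / pi"]
    by (metis less_imp_le pi_gt_zero pos_less_divide_eq)
  obtain j :: int where j: "y - ?X 0 \<le> of_int j * pi" using ex_less_of_int[of "(y - ?X 0) / pi"]
    by (metis less_imp_le pi_gt_zero pos_divide_less_eq)
  have "\<exists>a\<ge>of_int i * pi. a \<le> of_int j * pi \<and> ?X a = y"
  proof (rule IVT')
    show "?X (of_int i * pi) \<le> y" "y \<le> ?X (of_int j * pi)"
      using i j orbit_add_int_pi[OF V \<mu>, of b l 0 i n] orbit_add_int_pi[OF V \<mu>, of b l 0 j n] by auto
    have "of_int i * pi \<le> of_int j * pi" using i j by linarith
    then show "of_int i * pi \<le> of_int j * pi" .
  qed (rule continuous_orbit[OF assms])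
  then show ?thesis by blast
qed

text \<open>\<open>zfix\<close> is the angle at the right end of a cell. The empty cell turns the
  solution by \<mu>; with \<pi> l removed, subtracting the remaining turn gives the angle at the
  left end, just after the vertex.\<close>

definition wfix :: "nat \<Rightarrow> nat \<Rightarrow> real \<Rightarrow> real" where
  "wfix b l \<mu> = zfix b (\<mu> - pi * real l) - (\<mu> - pi * real l)"

text \<open>The ends of the gap are included so that estimates hold uniformly up to them; where
  decay enters, a strict inequality is assumed in addition.\<close>

definition in_gap :: "nat \<Rightarrow> nat \<Rightarrow> real \<Rightarrow> bool" where
  "in_gap b l \<mu> \<longleftrightarrow> b \<ge> 2 \<and> 0 < \<mu> \<and> \<bar>\<mu> - pi * real l\<bar> \<le> tree_theta b"

lemma jump_add_nat_pi: "jump b (x + pi * real l) = jump b x + pi * real l"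
  using jump_add_int_pi[of b x "int l"] by (simp add: mult.commute)

lemma jump_wfix:
  assumes "in_gap b l \<mu>" shows "jump b (wfix b l \<mu> + \<mu>) - pi * real l = wfix b l \<mu>"
    "wfix b l \<mu> = jump b (zfix b (\<mu> - pi * real l))"
proof -
  have e: "wfix b l \<mu> + \<mu> = zfix b (\<mu> - pi * real l) + pi * real l" by (simp add: wfix_def)
  have z: "jump b (zfix b (\<mu> - pi * real l)) = wfix b l \<mu>"
    using zfix(2)[of b "\<mu> - pi * real l"] assms by (simp add: in_gap_def wfix_def)
  then show "wfix b l \<mu> = jump b (zfix b (\<mu> - pi * real l))" by simp
  show "jump b (wfix b l \<mu> + \<mu>) - pi * real l = wfix b l \<mu>" unfolding e jump_add_nat_pi z by simp
qed

lemma wfix_antimono: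
  assumes "in_gap b l \<mu>1" "in_gap b l \<mu>2" "\<mu>1 \<le> \<mu>2" shows "wfix b l \<mu>2 \<le> wfix b l \<mu>1"
proof (cases "\<mu>1 = \<mu>2")
  case False
  then have "zfix b (\<mu>2 - pi * real l) < zfix b (\<mu>1 - pi * real l)"
    using assms by (intro zfix_antimono) (auto simp: in_gap_def abs_le_iff)
  then show ?thesis unfolding jump_wfix(2)[OF assms(1)] jump_wfix(2)[OF assms(2)]
    using assms by (intro jump_mono) (auto simp: in_gap_def)
qed simp

lemma orbit_step_less:
  assumes "in_gap b l \<mu>" "potential V" "orbit b l V \<mu> a n < wfix b l \<mu>"
  shows "orbit b l V \<mu> a (Suc n) < wfix b l \<mu>"
proof -
  have "flow V \<mu> n (orbit b l V \<mu> a n) < wfix b l \<mu> + \<mu>"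
    using flow_bounds(1)[of V \<mu> n "orbit b l V \<mu> a n"] assms by (auto simp: in_gap_def)
  then have "jump b (flow V \<mu> n (orbit b l V \<mu> a n)) < jump b (wfix b l \<mu> + \<mu>)"
    using assms by (intro jump_strict_mono) (auto simp: in_gap_def)
  then show ?thesis using jump_wfix(1)[OF assms(1)] by simp
qed

lemma orbit_absorb:
  assumes "in_gap b l \<mu>" "potential V" "orbit b l V \<mu> a n < wfix b l \<mu>" "n \<le> m"
  shows "orbit b l V \<mu> a m < wfix b l \<mu>"
  using assms(4) by (induction m rule: dec_induct) (use assms orbit_step_less in auto)

text \<open>
  A nonnegative potential turns angles back, so an orbit that has fallen below \<open>wfix\<close> stays there.
  The threshold \<open>weyl\<close> is the angle at $0$ of the solution of the perturbed equation that decays at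
  infinity (\<open>Inf\<close> is meaningful only if \<open>weylset\<close> is nonempty; \<open>barrier_nonempty\<close> ensures that).
\<close>

definition weylset :: "nat \<Rightarrow> nat \<Rightarrow> (real \<Rightarrow> real) \<Rightarrow> real \<Rightarrow> real set" where
  "weylset b l V \<mu> = {a. \<forall>n. wfix b l \<mu> \<le> orbit b l V \<mu> a n}"

definition weyl :: "nat \<Rightarrow> nat \<Rightarrow> (real \<Rightarrow> real) \<Rightarrow> real \<Rightarrow> real" where
  "weyl b l V \<mu> = Inf (weylset b l V \<mu>)"

lemma weylset_ge: "a \<in> weylset b l V \<mu> \<Longrightarrow> wfix b l \<mu> \<le> a"
  unfolding weylset_def by (metis (mono_tags, lifting) mem_Collect_eq orbit.simps(1))

lemma weyl_le: "a \<in> weylset b l V \<mu> \<Longrightarrow> weyl b l V \<mu> \<le> a"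
  unfolding weyl_def by (intro cInf_lower bdd_belowI[of _ "wfix b l \<mu>"] weylset_ge)

lemma wfix_le_weyl: "weylset b l V \<mu> \<noteq> {} \<Longrightarrow> wfix b l \<mu> \<le> weyl b l V \<mu>"
  unfolding weyl_def by (intro cInf_greatest weylset_ge)

lemma weyl_in_weylset:
  assumes g: "in_gap b l \<mu>" and V: "potential V" and ne: "weylset b l V \<mu> \<noteq> {}"
  shows "weyl b l V \<mu> \<in> weylset b l V \<mu>"
proof -
  have "closed {a. wfix b l \<mu> \<le> orbit b l V \<mu> a n}" for n
    using continuous_orbit[of b V \<mu> UNIV l n] g V by (intro closed_Collect_le) (auto simp: in_gap_def)
  then have "closed (\<Inter>n. {a. wfix b l \<mu> \<le> orbit b l V \<mu> a n})" by auto
  moreover have "(\<Inter>n. {a. wfix b l \<mu> \<le> orbit b l V \<mu> a n}) = weylset b l V \<mu>" by (auto simp: weylset_def)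
  ultimately show ?thesis unfolding weyl_def
    using ne by (intro closed_contains_Inf) (auto intro!: bdd_belowI[of _ "wfix b l \<mu>"] weylset_ge)
qed

lemma weyl_orbit_ge:
  assumes "in_gap b l \<mu>" "potential V" "weylset b l V \<mu> \<noteq> {}" 
  shows "wfix b l \<mu> \<le> orbit b l V \<mu> (weyl b l V \<mu>) n"
  using weyl_in_weylset[OF assms] by (auto simp: weylset_def)

lemma weylset_mono:
  assumes "in_gap b l \<mu>1" "in_gap b l \<mu>2" "potential V1" "potential V2" "\<mu>1 \<le> \<mu>2" "\<And>t. t \<ge> 0 \<Longrightarrow> V2 t \<le> V1 t"
    and a: "a \<in> weylset b l V1 \<mu>1" "a \<le> a'"
  shows "a' \<in> weylset b l V2 \<mu>2"
  unfolding weylset_def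
proof safe
  fix n
  have "wfix b l \<mu>2 \<le> wfix b l \<mu>1" using assms by (intro wfix_antimono)
  also have "\<dots> \<le> orbit b l V1 \<mu>1 a n" using a by (auto simp: weylset_def)
  also have "\<dots> \<le> orbit b l V2 \<mu>2 a' n" by (rule orbit_mono[where n=0]) (use assms in \<open>auto simp: in_gap_def\<close>)
  finally show "wfix b l \<mu>2 \<le> orbit b l V2 \<mu>2 a' n" .
qed

lemma weyl_mono:
  assumes "in_gap b l \<mu>1" "in_gap b l \<mu>2" "potential V1" "potential V2" "\<mu>1 \<le> \<mu>2" "\<And>t. t \<ge> 0 \<Longrightarrow> V2 t \<le> V1 t"
    and ne: "weylset b l V1 \<mu>1 \<noteq> {}"
  shows "weyl b l V2 \<mu>2 \<le> weyl b l V1 \<mu>1"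
  by (intro weyl_le weylset_mono[OF assms(1-6) weyl_in_weylset order_refl] assms)

lemma weylset_tail:
  assumes g: "in_gap b l \<mu>" and V: "potential V" and ge: "\<And>m. m \<ge> n \<Longrightarrow> wfix b l \<mu> \<le> orbit b l V \<mu> a m"
  shows "a \<in> weylset b l V \<mu>"
  unfolding weylset_def
proof safe
  fix m
  show "wfix b l \<mu> \<le> orbit b l V \<mu> a m"
    using ge[of n] ge[of m] orbit_absorb[OF g V, of a m n] by (cases "m \<le> n") (auto simp: not_le[symmetric])
qed

text \<open>Take the orbit of the first Weyl angle at \<open>n\<close> and pull its value back to 0
  along the second flow. Strictness makes the resulting start \<open>a'\<close> smaller than the
  first Weyl angle, while from \<open>n\<close> on its orbit stays above the first one; so
  \<open>a'\<close> lies in the second set.\<close>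

lemma weyl_strict_mono:
  assumes g: "in_gap b l \<mu>1" "in_gap b l \<mu>2" and V: "potential V1" "potential V2" and le: "\<mu>1 \<le> \<mu>2" "\<And>t. t \<ge> 0 \<Longrightarrow> V2 t \<le> V1 t"
    and ne: "weylset b l V1 \<mu>1 \<noteq> {}" and strict: "\<And>a. orbit b l V1 \<mu>1 a n < orbit b l V2 \<mu>2 a n"
  shows "weyl b l V2 \<mu>2 < weyl b l V1 \<mu>1"
proof -
  let ?a = "weyl b l V1 \<mu>1"
  have b: "b \<ge> 1" and \<mu>: "\<mu>1 > 0" "\<mu>2 > 0" using g by (auto simp: in_gap_def)
  obtain a' where a': "orbit b l V2 \<mu>2 a' n = orbit b l V1 \<mu>1 ?a n" using orbit_surj[OF b V(2) \<mu>(2)] by blast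
  have "a' < ?a"
  proof (rule ccontr)
    assume "\<not> a' < ?a"
    then have "orbit b l V2 \<mu>2 ?a n \<le> orbit b l V2 \<mu>2 a' n"
      using orbit_strict_mono[OF b V(2) \<mu>(2), of ?a a' l n] by (cases "a' = ?a") auto
    then show False using strict[of ?a] a' by simp
  qed
  moreover have "a' \<in> weylset b l V2 \<mu>2"
  proof (rule weylset_tail[OF g(2) V(2), of n])
    fix m assume m: "n \<le> m"
    have "wfix b l \<mu>2 \<le> wfix b l \<mu>1" using g le by (intro wfix_antimono)
    also have "\<dots> \<le> orbit b l V1 \<mu>1 ?a m" using weyl_orbit_ge[OF g(1) V(1) ne] .
    also have "\<dots> \<le> orbit b l V2 \<mu>2 a' m" by (rule orbit_mono[OF b V \<mu>(1) le _ m]) (use a' in auto)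
    finally show "wfix b l \<mu>2 \<le> orbit b l V2 \<mu>2 a' m" .
  qed
  ultimately show ?thesis using weyl_le by force
qed

text \<open>A subsolution of the orbit recursion above \<open>wfix\<close>: an orbit that reaches it
  once stays above it. Its existence makes \<open>weylset\<close> nonempty, and its values bound the
  orbit of the Weyl angle from above.\<close>

definition barrier :: "nat \<Rightarrow> nat \<Rightarrow> (real \<Rightarrow> real) \<Rightarrow> real \<Rightarrow> nat \<Rightarrow> (nat \<Rightarrow> real) \<Rightarrow> bool" where
  "barrier b l V \<mu> n0 \<beta> \<longleftrightarrow>
     (\<forall>n\<ge>n0. wfix b l \<mu> \<le> \<beta> n \<and> \<beta> (Suc n) \<le> jump b (flow V \<mu> n (\<beta> n)) - pi * real l)"

lemma barrier_mem:
  assumes g: "in_gap b l \<mu>" and V: "potential V" and B: "barrier b l V \<mu> n0 \<beta>" and n: "n0 \<le> n" and le: "\<beta> n \<le> orbit b l V \<mu> a n"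
  shows "a \<in> weylset b l V \<mu>"
proof (rule weylset_tail[OF g V, of n])
  fix m assume "n \<le> m"
  then have "\<beta> m \<le> orbit b l V \<mu> a m"
  proof (induction m rule: dec_induct)
    case base show ?case by (rule le)
  next
    case (step m)
    have "\<beta> (Suc m) \<le> jump b (flow V \<mu> m (\<beta> m)) - pi * real l" using B step n by (auto simp: barrier_def)
    also have "\<dots> \<le> orbit b l V \<mu> a (Suc m)"
      using step g V by (auto simp: in_gap_def intro!: jump_mono flow_mono)
    finally show ?case .
  qed
  moreover have "wfix b l \<mu> \<le> \<beta> m" using B n \<open>n \<le> m\<close> by (auto simp: barrier_def)
  ultimately show "wfix b l \<mu> \<le> orbit b l V \<mu> a m" by linarith
qed

lemma barrier_nonempty:
  assumes g: "in_gap b l \<mu>" and V: "potential V" and B: "barrier b l V \<mu> n0 \<beta>"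
  shows "weylset b l V \<mu> \<noteq> {}"
proof -
  obtain a where "orbit b l V \<mu> a n0 = \<beta> n0" using orbit_surj[of b V \<mu> l n0 "\<beta> n0"] g V by (auto simp: in_gap_def)
  then show ?thesis using barrier_mem[OF g V B, of n0 a] by auto
qed

lemma weyl_barrier:
  assumes g: "in_gap b l \<mu>" and V: "potential V" and B: "barrier b l V \<mu> n0 \<beta>" and n: "n0 \<le> n"
  shows "orbit b l V \<mu> (weyl b l V \<mu>) n \<le> \<beta> n"
proof -
  obtain a where a: "orbit b l V \<mu> a n = \<beta> n" using orbit_surj[of b V \<mu> l n "\<beta> n"] g V by (auto simp: in_gap_def)
  then have "weyl b l V \<mu> \<le> a" using barrier_mem[OF g V B n, of a] weyl_le by auto
  have "orbit b l V \<mu> (weyl b l V \<mu>) n \<le> orbit b l V \<mu> a n"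
    by (rule orbit_mono[where n=0]) (use g V \<open>weyl b l V \<mu> \<le> a\<close> in \<open>auto simp: in_gap_def\<close>)
  then show ?thesis using a by simp
qed

lemma barrier_antimono:
  assumes g: "in_gap b l \<mu>" and V: "potential V1" "potential V2" "\<And>t. t \<ge> 0 \<Longrightarrow> V2 t \<le> V1 t" and B: "barrier b l V1 \<mu> n0 \<beta>"
  shows "barrier b l V2 \<mu> n0 \<beta>"
  unfolding barrier_def
proof (intro allI impI conjI)
  fix n assume n: "n0 \<le> n"
  then show "wfix b l \<mu> \<le> \<beta> n" using B by (auto simp: barrier_def)
  have "\<beta> (Suc n) \<le> jump b (flow V1 \<mu> n (\<beta> n)) - pi * real l" using B n by (auto simp: barrier_def)
  also have "jump b (flow V1 \<mu> n (\<beta> n)) \<le> jump b (flow V2 \<mu> n (\<beta> n))"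
    using g V by (intro jump_mono flow_mono) (auto simp: in_gap_def)
  finally show "\<beta> (Suc n) \<le> jump b (flow V2 \<mu> n (\<beta> n)) - pi * real l" by simp
qed

text \<open>
  At a gap end the fixed angle is only neutral; the quadratic loss in \<open>jump_quadratic\<close> is then absorbed
  by the exponential decay of the barrier, which makes the bound uniform up to the gap ends.
\<close>

lemma exp_barrier:
  assumes g: "in_gap b l \<mu>" and V: "potential V" and \<kappa>: "\<kappa> > 0" and A: "A \<ge> 0" and \<epsilon>: "\<epsilon> \<ge> 0"
    and dec: "\<And>t. t \<ge> real n0 \<Longrightarrow> V t \<le> \<epsilon> * exp (- 2 * \<kappa> * (t - real n0))"
    and A1: "b * A \<le> (1 - exp (- 2 * \<kappa>)) / 2" and A2: "b * (\<epsilon> / \<mu>) \<le> A * ((1 - exp (- 2 * \<kappa>)) / 2)"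
  shows "barrier b l V \<mu> n0 (\<lambda>n. wfix b l \<mu> + A * exp (- 2 * \<kappa> * (real n - real n0)))"
  unfolding barrier_def
proof (intro allI impI conjI)
  fix n assume n: "n0 \<le> n"
  define e where "e = exp (- 2 * \<kappa> * (real n - real n0))"
  have e: "e > 0" "e \<le> 1" using \<kappa> n by (auto simp: e_def)
  show "wfix b l \<mu> \<le> wfix b l \<mu> + A * exp (- 2 * \<kappa> * (real n - real n0))" using A by simp
  have \<mu>: "\<mu> > 0" and b: "b \<ge> 2" and \<delta>: "\<bar>\<mu> - pi * real l\<bar> \<le> tree_theta b" using g by (auto simp: in_gap_def)
  let ?z = "zfix b (\<mu> - pi * real l)" and ?d = "A * e" and ?x = "wfix b l \<mu> + A * e"
  have eS: "exp (- 2 * \<kappa> * (real (Suc n) - real n0)) = e * exp (- 2 * \<kappa>)"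
    by (simp add: e_def exp_add[symmetric] algebra_simps)
  have "flow V \<mu> n ?x \<ge> ?x + \<mu> - \<epsilon> * e / \<mu>"
  proof (rule flow_bounds(2)[OF V \<mu>])
    fix t assume t: "t \<in> {real n..real n + 1}"
    have "V t \<le> \<epsilon> * exp (- 2 * \<kappa> * (t - real n0))" using dec[of t] t n by simp
    also have "\<dots> \<le> \<epsilon> * e" unfolding e_def using t \<kappa> \<epsilon> by (intro mult_left_mono) auto
    finally show "V t \<le> \<epsilon> * e" .
  qed
  then have "jump b (?x + \<mu> - \<epsilon> * e / \<mu>) \<le> jump b (flow V \<mu> n ?x)" using b by (intro jump_mono) auto
  moreover have "jump b (?x + \<mu>) - jump b (?x + \<mu> - \<epsilon> * e / \<mu>) \<le> b * (\<epsilon> * e / \<mu>)"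
  proof -
    have "\<bar>jump b (?x + \<mu>) - jump b (?x + \<mu> - \<epsilon> * e / \<mu>)\<bar> \<le> b * \<bar>(?x + \<mu>) - (?x + \<mu> - \<epsilon> * e / \<mu>)\<bar>"
      using b by (intro jump_Lipschitz) auto
    also have "\<bar>(?x + \<mu>) - (?x + \<mu> - \<epsilon> * e / \<mu>)\<bar> = \<epsilon> * e / \<mu>" using \<epsilon> e \<mu> by simp
    finally show ?thesis by linarith
  qed
  moreover have "jump b (?x + \<mu>) - pi * real l \<ge> wfix b l \<mu> + ?d - b * ?d\<^sup>2"
  proof -
    have "?x + \<mu> = (?z + ?d) + pi * real l" by (simp add: wfix_def)
    then have "jump b (?x + \<mu>) - pi * real l = jump b (?z + ?d)" by (simp only: jump_add_nat_pi)
    moreover have "jump b (?z + ?d) \<ge> jump b ?z + ?d - b * ?d\<^sup>2"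
      using zfix(1)[OF b \<delta>] b A e by (intro jump_quadratic) auto
    ultimately show ?thesis using jump_wfix(2)[OF g] by simp
  qed
  moreover have "b * ?d\<^sup>2 \<le> ?d * ((1 - exp (- 2 * \<kappa>)) / 2)"
  proof -
    have "b * ?d \<le> b * A" using A e b by (simp add: mult_left_le)
    then have "b * ?d \<le> (1 - exp (- 2 * \<kappa>)) / 2" using A1 by linarith
    then have "?d * (b * ?d) \<le> ?d * ((1 - exp (- 2 * \<kappa>)) / 2)" using A e by (intro mult_left_mono) auto
    then show ?thesis by (simp add: power2_eq_square algebra_simps)
  qed
  moreover have "b * (\<epsilon> * e / \<mu>) \<le> ?d * ((1 - exp (- 2 * \<kappa>)) / 2)"
    using mult_right_mono[OF A2, of e] e by (simp add: algebra_simps)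
  \<comment> \<open>From \<open>n\<close> to \<open>n + 1\<close> the barrier descends by ?d(1 -
    exp(-2\<kappa>)). One half of this pays for the quadratic loss (\<open>A1\<close>), the other
    for the potential on the cell (\<open>A2\<close>).\<close>
  moreover have "?d * ((1 - exp (- 2 * \<kappa>)) / 2) + ?d * ((1 - exp (- 2 * \<kappa>)) / 2) = ?d - A * (e * exp (- 2 * \<kappa>))"
    by (simp add: algebra_simps)
  ultimately have "wfix b l \<mu> + A * (e * exp (- 2 * \<kappa>)) \<le> jump b (flow V \<mu> n ?x) - pi * real l" by linarith
  then show "wfix b l \<mu> + A * exp (- 2 * \<kappa> * (real (Suc n) - real n0))
    \<le> jump b (flow V \<mu> n (wfix b l \<mu> + A * exp (- 2 * \<kappa> * (real n - real n0)))) - pi * real l"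
    unfolding eS by (simp add: e_def)
qed

subsection \<open>Solutions on the half-line\<close>

text \<open>
  A solution is given by its restrictions to the closed cells, because the two one-sided values at
  a vertex differ.
\<close>

definition family :: "nat \<Rightarrow> (real \<Rightarrow> real) \<Rightarrow> real \<Rightarrow> (nat \<Rightarrow> real \<Rightarrow> 'a) \<Rightarrow> (nat \<Rightarrow> real \<Rightarrow> 'a::{real_normed_field, euclidean_space}) \<Rightarrow> bool" where
  "family b V lam y y1 \<longleftrightarrow> (\<forall>n.
     ac_on (real n) (real n + 1) (y n) (y1 n) \<and>
     ac_on (real n) (real n + 1) (y1 n) (\<lambda>t. of_real (V t - lam) * y n t) \<and>
     y (Suc n) (real n + 1) = of_real (sqrt (real b)) * y n (real n + 1) \<and>
     y1 (Suc n) (real n + 1) = of_real (1 / sqrt (real b)) * y1 n (real n + 1))"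

text \<open>Inside a cell the potential terms cancel. The vertex factors sqrt b and 1/sqrt b
  multiply to 1, so the Wronskian also passes the vertices unchanged.\<close>

lemma wronskian_const:
  fixes y y1 w w1 :: "nat \<Rightarrow> real \<Rightarrow> 'a::{real_normed_field, euclidean_space}"
  assumes y: "family b V lam y y1" and w: "family b V lam w w1" and b: "b \<ge> 1" and t: "t \<in> {real n..real n + 1}"
  shows "w1 n t * y n t - w n t * y1 n t = w1 0 0 * y 0 0 - w 0 0 * y1 0 0"
proof -
  have cell: "w1 n t * y n t - w n t * y1 n t = w1 n (real n) * y n (real n) - w n (real n) * y1 n (real n)"
    if "t \<in> {real n..real n + 1}" for n t
  proof -
    have "ac_on (real n) (real n + 1) (\<lambda>t. w1 n t * y n t - w n t * y1 n t)
      (\<lambda>t. (of_real (V t - lam) * w n t * y n t + w1 n t * y1 n t) - (w1 n t * y1 n t + w n t * (of_real (V t - lam) * y n t)))"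
      using y w unfolding family_def by (intro ac_on_diff ac_on_mult) auto
    from ac_on_zero_const[OF this _ that] show ?thesis by (simp add: algebra_simps)
  qed
  have nodes: "w1 n (real n) * y n (real n) - w n (real n) * y1 n (real n) = w1 0 0 * y 0 0 - w 0 0 * y1 0 0" for n
  proof (induction n)
    case (Suc n)
    have e: "real (Suc n) = real n + 1" by simp
    let ?s = "of_real (sqrt (real b)) :: 'a" and ?r = "of_real (1 / sqrt (real b)) :: 'a"
    have sr: "?s * ?r = 1" using b unfolding of_real_mult[symmetric] by simp
    have Y: "y (Suc n) (real n + 1) = ?s * y n (real n + 1)" "y1 (Suc n) (real n + 1) = ?r * y1 n (real n + 1)"
      and W: "w (Suc n) (real n + 1) = ?s * w n (real n + 1)" "w1 (Suc n) (real n + 1) = ?r * w1 n (real n + 1)"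
      using y w unfolding family_def by blast+
    have "w1 (Suc n) (real n + 1) * y (Suc n) (real n + 1) - w (Suc n) (real n + 1) * y1 (Suc n) (real n + 1) =
       (?s * ?r) * (w1 n (real n + 1) * y n (real n + 1) - w n (real n + 1) * y1 n (real n + 1))"
      unfolding Y W by (simp only: algebra_simps)
    also have "\<dots> = w1 0 0 * y 0 0 - w 0 0 * y1 0 0" using cell[of "real n + 1" n] Suc unfolding sr by simp
    finally show ?case unfolding e .
  qed simp
  show ?thesis using cell[OF t] nodes[of n] by simp
qed

text \<open>Bounds per cell on the solution and its derivative: square summability puts the solution
  into the operator domain, and the resulting convergence to 0 makes Wronskians vanish.\<close>

definition decfam :: "(nat \<Rightarrow> real \<Rightarrow> real) \<Rightarrow> (nat \<Rightarrow> real \<Rightarrow> real) \<Rightarrow> bool" where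
  "decfam w w1 \<longleftrightarrow> (\<exists>M. (\<forall>n. M n \<ge> 0) \<and> (\<forall>n. \<forall>t\<in>{real n..real n + 1}. \<bar>w n t\<bar> \<le> M n \<and> \<bar>w1 n t\<bar> \<le> M n) \<and> summable (\<lambda>n. (M n)\<^sup>2))"

lemma decfamD:
  assumes "decfam w w1"
  shows "\<exists>M. (\<forall>n. M n \<ge> 0) \<and> (\<forall>n. \<forall>t\<in>{real n..real n + 1}. \<bar>w n t\<bar> \<le> M n) \<and>
    (\<forall>n. \<forall>t\<in>{real n..real n + 1}. \<bar>w1 n t\<bar> \<le> M n) \<and> summable (\<lambda>n. (M n)\<^sup>2) \<and> M \<longlonglongrightarrow> 0"
proof -
  obtain M where M: "\<forall>n. M n \<ge> 0" "\<forall>n. \<forall>t\<in>{real n..real n + 1}. \<bar>w n t\<bar> \<le> M n \<and> \<bar>w1 n t\<bar> \<le> M n" "summable (\<lambda>n. (M n)\<^sup>2)"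
    using assms by (auto simp: decfam_def)
  have "(\<lambda>n. sqrt ((M n)\<^sup>2)) \<longlonglongrightarrow> sqrt 0" by (intro tendsto_real_sqrt summable_LIMSEQ_zero M)
  then have "M \<longlonglongrightarrow> 0" using M(1) by simp
  then show ?thesis using M by blast
qed

lemma decfam_wronskian:
  assumes y: "family b V lam y y1" "decfam y y1" and w: "family b V lam w w1" "decfam w w1" and b: "b \<ge> 1"
  shows "w1 0 0 * y 0 0 - w 0 0 * y1 0 0 = 0"
proof -
  obtain M where "(\<forall>n. M n \<ge> 0) \<and> (\<forall>n. \<forall>t\<in>{real n..real n + 1}. \<bar>y n t\<bar> \<le> M n) \<and>
    (\<forall>n. \<forall>t\<in>{real n..real n + 1}. \<bar>y1 n t\<bar> \<le> M n) \<and> summable (\<lambda>n. (M n)\<^sup>2) \<and> M \<longlonglongrightarrow> 0"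
    using decfamD[OF y(2)] by (elim exE)
  then have M: "\<And>n. M n \<ge> 0" "\<And>n t. t \<in> {real n..real n + 1} \<Longrightarrow> \<bar>y n t\<bar> \<le> M n"
    "\<And>n t. t \<in> {real n..real n + 1} \<Longrightarrow> \<bar>y1 n t\<bar> \<le> M n" "M \<longlonglongrightarrow> 0" by blast+
  obtain N where "(\<forall>n. N n \<ge> 0) \<and> (\<forall>n. \<forall>t\<in>{real n..real n + 1}. \<bar>w n t\<bar> \<le> N n) \<and>
    (\<forall>n. \<forall>t\<in>{real n..real n + 1}. \<bar>w1 n t\<bar> \<le> N n) \<and> summable (\<lambda>n. (N n)\<^sup>2) \<and> N \<longlonglongrightarrow> 0"
    using decfamD[OF w(2)] by (elim exE)
  then have N: "\<And>n. N n \<ge> 0" "\<And>n t. t \<in> {real n..real n + 1} \<Longrightarrow> \<bar>w n t\<bar> \<le> N n"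
    "\<And>n t. t \<in> {real n..real n + 1} \<Longrightarrow> \<bar>w1 n t\<bar> \<le> N n" "N \<longlonglongrightarrow> 0" by blast+
  have "norm (w1 0 0 * y 0 0 - w 0 0 * y1 0 0) \<le> N n * M n + N n * M n" for n
  proof -
    have "\<bar>w1 n (real n) * y n (real n) - w n (real n) * y1 n (real n)\<bar> \<le> N n * M n + N n * M n"
      by (intro order_trans[OF abs_triangle_ineq4] add_mono) (auto simp: abs_mult intro!: mult_mono M N)
    then show ?thesis using wronskian_const[OF y(1) w(1) b, of "real n" n] by simp
  qed
  then have ex: "\<exists>k. \<forall>n\<ge>k. norm (w1 0 0 * y 0 0 - w 0 0 * y1 0 0) \<le> N n * M n + N n * M n" by blast
  have lim: "(\<lambda>n. N n * M n + N n * M n) \<longlonglongrightarrow> 0 * 0 + 0 * 0" by (intro tendsto_intros M N)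
  have "norm (w1 0 0 * y 0 0 - w 0 0 * y1 0 0) \<le> 0 * 0 + 0 * 0"
    by (rule LIMSEQ_le_const[OF lim ex])
  then show ?thesis by simp
qed

lemma exists_small_value:
  fixes f :: "real \<Rightarrow> real"
  assumes c: "continuous_on {a..b} f" and pos: "\<And>t. t \<in> {a..b} \<Longrightarrow> f t \<ge> 0" and I: "integral {a..b} f \<le> C"
    and uv: "a \<le> u" "u < v" "v \<le> b"
  shows "\<exists>s\<in>{u..v}. f s < (C + 1) / (v - u)"
proof (rule ccontr)
  assume "\<not> ?thesis"
  then have ge: "(C + 1) / (v - u) \<le> f s" if "s \<in> {u..v}" for s using that by force
  have int: "f integrable_on {x..y}" if "a \<le> x" "y \<le> b" for x y
    by (rule integrable_continuous_real) (rule continuous_on_subset[OF c], use that in auto)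
  have "(C + 1) / (v - u) * (v - u) \<le> integral {u..v} f"
    using integral_le[OF integrable_const_ivl[of "(C + 1) / (v - u)" u v] int[of u v] ge] uv by simp
  also have "\<dots> \<le> integral {a..b} f"
    by (rule integral_subset_le) (use uv int pos in auto)
  finally show False using I uv by simp
qed

text \<open>
  Integrating $w'y-wy'=2w'y-(wy)'$ between two points where \<open>y\<close> is small avoids bounding $y'$.
\<close>

lemma L2_test:
  fixes y y1 w w1 :: "real \<Rightarrow> 'a::{real_normed_field, euclidean_space}"
  assumes y: "ac_on r (r + 1) y y1" and w: "ac_on r (r + 1) w w1"
    and I: "integral {r..r + 1} (\<lambda>t. (norm (y t))\<^sup>2) \<le> C" and C: "C \<ge> 0"
    and M: "\<And>t. t \<in> {r..r + 1} \<Longrightarrow> norm (w t) \<le> M" "\<And>t. t \<in> {r..r + 1} \<Longrightarrow> norm (w1 t) \<le> M"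
  obtains s t where "r \<le> s" "s \<le> r + 1/3" "r + 2/3 \<le> t" "t \<le> r + 1"
    "norm (integral {s..t} (\<lambda>t. w1 t * y t - w t * y1 t)) \<le> M * (8 * (C + 2))"
proof -
  have M0: "M \<ge> 0" using M(1)[of r] norm_ge_zero[of "w r"] by (simp del: norm_ge_zero)
  have cy: "continuous_on {r..r + 1} (\<lambda>t. (norm (y t))\<^sup>2)" using ac_on_continuous[OF y] by (intro continuous_intros)
  \<comment> \<open>One point in each outer third keeps the interval of integration at least 1/3
    long.\<close>
  obtain s where s: "s \<in> {r..r+1/3}" "(norm (y s))\<^sup>2 < (C + 1) / (1/3)"
    using exists_small_value[OF cy _ I, of r "r + 1/3"] by auto
  obtain t where t: "t \<in> {r+2/3..r+1}" "(norm (y t))\<^sup>2 < (C + 1) / (1/3)"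
    using exists_small_value[OF cy _ I, of "r+2/3" "r + 1"] by auto
  have sq: "norm x \<le> 3 * (C + 2)" if "(norm x)\<^sup>2 < (C + 1) / (1/3)" for x :: 'a
  proof (rule power2_le_imp_le)
    have "(norm x)\<^sup>2 \<le> 3 * (C + 2) * 1" using that C by simp
    also have "\<dots> \<le> 3 * (C + 2) * (3 * (C + 2))" using C by (intro mult_left_mono) auto
    finally show "(norm x)\<^sup>2 \<le> (3 * (C + 2))\<^sup>2" by (simp add: power2_eq_square)
  qed (use C in simp)
  have st: "r \<le> s" "s \<le> t" "t \<le> r + 1" using s t by auto
  have ywy: "ac_on r (r + 1) (\<lambda>t. w t * y t) (\<lambda>t. w1 t * y t + w t * y1 t)" by (rule ac_on_mult[OF w y])
  have by1: "bdd_meas r (r + 1) (\<lambda>t. w1 t * y t)" "bdd_meas r (r + 1) (\<lambda>t. w1 t * y t + w t * y1 t)"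
    using ac_on_bdd_meas[OF w] bdd_meas_continuous[OF ac_on_continuous[OF y]] ac_on_bdd_meas[OF ywy] by (auto intro: bdd_meas_mult)
  have i1: "(\<lambda>t. w1 t * y t) integrable_on {s..t}" and i2: "(\<lambda>t. w1 t * y t + w t * y1 t) integrable_on {s..t}"
    using bdd_meas_integrable[OF by1(1)] bdd_meas_integrable[OF by1(2)] st by auto
  have "integral {s..t} (\<lambda>t. w1 t * y t - w t * y1 t) =
     integral {s..t} (\<lambda>t. 2 * (w1 t * y t) - (w1 t * y t + w t * y1 t))"
    by (intro Henstock_Kurzweil_Integration.integral_cong) (simp add: algebra_simps)
  also have "\<dots> = integral {s..t} (\<lambda>t. 2 * (w1 t * y t)) - (w t * y t - w s * y s)"
    using integral_diff[OF integrable_on_mult_right[OF i1, of 2] i2] ac_on_increment[OF ywy st] by simp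
  also have "norm \<dots> \<le> norm (integral {s..t} (\<lambda>t. 2 * (w1 t * y t))) + (norm (w t * y t) + norm (w s * y s))"
    by (intro order_trans[OF norm_triangle_ineq4] add_mono order_refl norm_triangle_ineq4)
  also have "norm (integral {s..t} (\<lambda>t. 2 * (w1 t * y t))) \<le> integral {s..t} (\<lambda>t. 2 * M * (1 + (norm (y t))\<^sup>2))"
  proof (rule integral_norm_bound_integral)
    show "(\<lambda>t. 2 * (w1 t * y t)) integrable_on {s..t}" using i1 by (rule integrable_on_mult_right)
    show "(\<lambda>t. 2 * M * (1 + (norm (y t))\<^sup>2)) integrable_on {s..t}"
      by (intro integrable_continuous_real continuous_intros continuous_on_subset[OF ac_on_continuous[OF y]]) (use st in auto)
    fix x assume x: "x \<in> {s..t}"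
    have "norm (y x) * 1 \<le> (1 + (norm (y x))\<^sup>2)" using sum_squares_bound[of "norm (y x)" 1] norm_ge_zero[of "y x"]
      by (simp add: power2_eq_square del: norm_ge_zero)
    then have "norm (w1 x) * norm (y x) \<le> M * (1 + (norm (y x))\<^sup>2)"
      using M(2)[of x] x st M0 by (intro mult_mono) auto
    then show "norm (2 * (w1 x * y x)) \<le> 2 * M * (1 + (norm (y x))\<^sup>2)" by (simp add: norm_mult)
  qed
  also have "\<dots> \<le> integral {r..r+1} (\<lambda>t. 2 * M * (1 + (norm (y t))\<^sup>2))"
    by (rule integral_subset_le)
      (use st M0 in \<open>auto intro!: integrable_continuous_real continuous_intros continuous_on_subset[OF ac_on_continuous[OF y]]\<close>)
  also have "\<dots> = 2 * M * (1 + integral {r..r+1} (\<lambda>t. (norm (y t))\<^sup>2))"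
    using integral_add[OF integrable_const_ivl[of "1::real" r "r+1"] integrable_continuous_real[OF cy]] by simp
  also have "\<dots> \<le> 2 * M * (1 + C)" using I M0 by (intro mult_left_mono) auto
  also have "norm (w t * y t) \<le> M * (3 * (C + 2))" unfolding norm_mult using M(1)[of t] sq[OF t(2)] st M0 by (intro mult_mono) auto
  also have "norm (w s * y s) \<le> M * (3 * (C + 2))" unfolding norm_mult using M(1)[of s] sq[OF s(2)] st M0 by (intro mult_mono) auto
  finally have "norm (integral {s..t} (\<lambda>t. w1 t * y t - w t * y1 t)) \<le> 2 * M * (1 + C) + (M * (3 * (C + 2)) + M * (3 * (C + 2)))" by simp
  also have "\<dots> \<le> M * (8 * (C + 2))" using M0 C by (simp add: algebra_simps)
  finally show ?thesis using that s t by auto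
qed

lemma of_real_family: "family b V lam w w1 \<Longrightarrow>
  family b V lam (\<lambda>n t. complex_of_real (w n t)) (\<lambda>n t. complex_of_real (w1 n t))"
  unfolding family_def using ac_on_of_real by (simp add: of_real_mult[symmetric] del: of_real_mult of_real_diff)

text \<open>Of a kernel element it is known that its L2 norms on the cells are bounded, while its
  derivative is not controlled. Averaging the constant Wronskian over at least a third of a cell
  replaces the pointwise estimate, and the bound tends to 0 along the cells.\<close>

lemma L2_wronskian:
  fixes y y1 :: "nat \<Rightarrow> real \<Rightarrow> complex"
  assumes y: "family b V lam y y1" and I: "\<And>n. integral {real n..real n + 1} (\<lambda>t. (cmod (y n t))\<^sup>2) \<le> C" and C: "C \<ge> 0"
    and w: "family b V lam w w1" "decfam w w1" and b: "b \<ge> 1"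
  shows "of_real (w1 0 0) * y 0 0 - of_real (w 0 0) * y1 0 0 = 0"
proof -
  let ?w = "\<lambda>n t. complex_of_real (w n t)" and ?w1 = "\<lambda>n t. complex_of_real (w1 n t)"
  let ?W = "?w1 0 0 * y 0 0 - ?w 0 0 * y1 0 0"
  obtain M where "(\<forall>n. M n \<ge> 0) \<and> (\<forall>n. \<forall>t\<in>{real n..real n + 1}. \<bar>w n t\<bar> \<le> M n) \<and>
    (\<forall>n. \<forall>t\<in>{real n..real n + 1}. \<bar>w1 n t\<bar> \<le> M n) \<and> summable (\<lambda>n. (M n)\<^sup>2) \<and> M \<longlonglongrightarrow> 0"
    using decfamD[OF w(2)] by (elim exE)
  then have M: "\<And>n. M n \<ge> 0" "\<And>n t. t \<in> {real n..real n + 1} \<Longrightarrow> \<bar>w n t\<bar> \<le> M n"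
    "\<And>n t. t \<in> {real n..real n + 1} \<Longrightarrow> \<bar>w1 n t\<bar> \<le> M n" "M \<longlonglongrightarrow> 0" by blast+
  note fw = of_real_family[OF w(1)]
  have "norm ?W / 3 \<le> M n * (8 * (C + 2))" for n
  proof -
    have ay: "ac_on (real n) (real n + 1) (y n) (y1 n)" and aw: "ac_on (real n) (real n + 1) (?w n) (?w1 n)"
      using y fw by (auto simp: family_def)
    obtain s t where st: "real n \<le> s" "s \<le> real n + 1/3" "real n + 2/3 \<le> t" "t \<le> real n + 1"
      "norm (integral {s..t} (\<lambda>t. ?w1 n t * y n t - ?w n t * y1 n t)) \<le> M n * (8 * (C + 2))"
      by (rule L2_test[OF ay aw I C, of "M n"]) (use M in auto)
    have "integral {s..t} (\<lambda>t. ?w1 n t * y n t - ?w n t * y1 n t) = integral {s..t} (\<lambda>_. ?W)"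
      by (rule Henstock_Kurzweil_Integration.integral_cong, rule wronskian_const[OF y fw b]) (use st in auto)
    also have "\<dots> = (t - s) *\<^sub>R ?W" using st by simp
    finally have "\<bar>t - s\<bar> * norm ?W \<le> M n * (8 * (C + 2))" using st(5) by simp
    moreover have "1/3 * norm ?W \<le> \<bar>t - s\<bar> * norm ?W" using st by (intro mult_right_mono) auto
    ultimately show ?thesis by simp
  qed
  moreover have "(\<lambda>n. M n * (8 * (C + 2))) \<longlonglongrightarrow> 0 * (8 * (C + 2))" by (intro tendsto_intros M)
  ultimately have "norm ?W / 3 \<le> 0 * (8 * (C + 2))" by (intro LIMSEQ_le_const) auto
  then show ?thesis by simp
qed

text \<open>
  The sign $(-1)^l$ compensates the subtraction of $\<pi> l$ in \<open>orbit\<close>.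
\<close>

primrec amplitude :: "nat \<Rightarrow> nat \<Rightarrow> (real \<Rightarrow> real) \<Rightarrow> real \<Rightarrow> real \<Rightarrow> nat \<Rightarrow> real" where
  "amplitude b l V \<mu> a 0 = 1"
| "amplitude b l V \<mu> a (Suc n) = (-1) ^ l * amplitude b l V \<mu> a n *
     exp (integral {real n..real n + 1} (\<lambda>s. V s / \<mu> * sin (prufer V \<mu> n (orbit b l V \<mu> a n) s) * cos (prufer V \<mu> n (orbit b l V \<mu> a n) s))) *
     sqrt (gain b (flow V \<mu> n (orbit b l V \<mu> a n)))"

text \<open>The radius in polar coordinates satisfies \<rho>' = (V/\<mu>) sin \<phi> cos \<phi>
  \<rho>, which gives the exponential; dividing by \<mu> undoes the scaling of the angle.\<close>

definition prufer_y :: "nat \<Rightarrow> nat \<Rightarrow> (real \<Rightarrow> real) \<Rightarrow> real \<Rightarrow> real \<Rightarrow> nat \<Rightarrow> real \<Rightarrow> real" where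
  "prufer_y b l V \<mu> a n t = amplitude b l V \<mu> a n *
     (exp (integral {real n..t} (\<lambda>s. V s / \<mu> * sin (prufer V \<mu> n (orbit b l V \<mu> a n) s) * cos (prufer V \<mu> n (orbit b l V \<mu> a n) s))) *
     sin (prufer V \<mu> n (orbit b l V \<mu> a n) t)) / \<mu>"

definition prufer_y1 :: "nat \<Rightarrow> nat \<Rightarrow> (real \<Rightarrow> real) \<Rightarrow> real \<Rightarrow> real \<Rightarrow> nat \<Rightarrow> real \<Rightarrow> real" where
  "prufer_y1 b l V \<mu> a n t = amplitude b l V \<mu> a n *
     (exp (integral {real n..t} (\<lambda>s. V s / \<mu> * sin (prufer V \<mu> n (orbit b l V \<mu> a n) s) * cos (prufer V \<mu> n (orbit b l V \<mu> a n) s))) *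
     cos (prufer V \<mu> n (orbit b l V \<mu> a n) t))"

lemma prufer_rate_bdd_meas:
  assumes V: "potential V" and \<mu>: "\<mu> > 0"
  shows "bdd_meas (real n) (real n + 1) (\<lambda>s. V s / \<mu> * sin (prufer V \<mu> n x s) * cos (prufer V \<mu> n x s))"
proof -
  have c: "continuous_on {real n..real n + 1} (prufer V \<mu> n x)" using ac_on_continuous[OF prufer_ac[OF V \<mu>]] .
  have "bdd_meas (real n) (real n + 1) (\<lambda>s. (1/\<mu>) * V s * sin (prufer V \<mu> n x s) * cos (prufer V \<mu> n x s))"
    by (intro bdd_meas_mult bdd_meas_const potential_bdd_meas[OF V] bdd_meas_continuous continuous_intros c) auto
  then show ?thesis by simp
qed

lemma prufer_y_family:
  assumes V: "potential V" and \<mu>: "\<mu> > 0" and b: "b \<ge> 1"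
  shows "family b V (\<mu>\<^sup>2) (prufer_y b l V \<mu> a) (prufer_y1 b l V \<mu> a)"
  unfolding family_def
proof (intro allI conjI)
  fix n
  let ?\<phi> = "prufer V \<mu> n (orbit b l V \<mu> a n)"
  let ?G = "\<lambda>s. V s / \<mu> * sin (?\<phi> s) * cos (?\<phi> s)"
  let ?E = "\<lambda>t. exp (integral {real n..t} ?G)"
  let ?A = "amplitude b l V \<mu> a n"
  have E: "ac_on (real n) (real n + 1) ?E (\<lambda>t. ?E t * ?G t)"
    by (intro ac_on_exp ac_on_integral prufer_rate_bdd_meas V \<mu>)
  note P = prufer_ac[OF V \<mu>, of n "orbit b l V \<mu> a n"]
  have prufer_y: "prufer_y b l V \<mu> a n = (\<lambda>t. ?A / \<mu> * (?E t * sin (?\<phi> t)))" 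
    and prufer_y1: "prufer_y1 b l V \<mu> a n = (\<lambda>t. ?A * (?E t * cos (?\<phi> t)))"
    by (auto simp: prufer_y_def prufer_y1_def)
  show "ac_on (real n) (real n + 1) (prufer_y b l V \<mu> a n) (prufer_y1 b l V \<mu> a n)"
    unfolding prufer_y prufer_y1
  proof (rule ac_on_cong[OF ac_on_cmult[OF ac_on_mult[OF E ac_on_sin[OF P]]] refl])
    fix t
    have "?E t * ?G t * sin (?\<phi> t) + ?E t * (cos (?\<phi> t) * (\<mu> - V t / \<mu> * (sin (?\<phi> t))\<^sup>2)) = \<mu> * (?E t * cos (?\<phi> t))"
      by (simp add: power2_eq_square algebra_simps)
    then show "?A / \<mu> * (?E t * ?G t * sin (?\<phi> t) + ?E t * (cos (?\<phi> t) * (\<mu> - V t / \<mu> * (sin (?\<phi> t))\<^sup>2))) = ?A * (?E t * cos (?\<phi> t))"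
      using \<mu> by simp
  qed
  show "ac_on (real n) (real n + 1) (prufer_y1 b l V \<mu> a n) (\<lambda>t. of_real (V t - \<mu>\<^sup>2) * prufer_y b l V \<mu> a n t)"
    unfolding prufer_y prufer_y1
  proof (rule ac_on_cong[OF ac_on_cmult[OF ac_on_mult[OF E ac_on_cos[OF P]]] refl])
    fix t
    have "?E t * ?G t * cos (?\<phi> t) + ?E t * (- sin (?\<phi> t) * (\<mu> - V t / \<mu> * (sin (?\<phi> t))\<^sup>2))
       = ?E t * sin (?\<phi> t) * (V t / \<mu> * ((sin (?\<phi> t))\<^sup>2 + (cos (?\<phi> t))\<^sup>2) - \<mu>)"
      unfolding power2_eq_square by (simp only: algebra_simps)
    also have "\<dots> = ?E t * sin (?\<phi> t) * (V t - \<mu>\<^sup>2) / \<mu>" using \<mu> by (simp add: field_simps power2_eq_square)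
    finally show "?A * (?E t * ?G t * cos (?\<phi> t) + ?E t * (- sin (?\<phi> t) * (\<mu> - V t / \<mu> * (sin (?\<phi> t))\<^sup>2)))
       = of_real (V t - \<mu>\<^sup>2) * (?A / \<mu> * (?E t * sin (?\<phi> t)))" by simp
  qed
  have S: "real (Suc n) = real n + 1" by simp
  let ?F = "flow V \<mu> n (orbit b l V \<mu> a n)"
  have F: "?\<phi> (real n + 1) = ?F" by (simp add: flow_def)
  have start: "prufer V \<mu> (Suc n) (orbit b l V \<mu> a (Suc n)) (real n + 1) = jump b ?F - pi * real l"
    using prufer_start[OF V \<mu>, of "Suc n" "orbit b l V \<mu> a (Suc n)"] by (simp add: add.commute)
  have m1: "((-1) ^ l :: real) * ((-1) ^ l) = 1" by (simp add: power_mult_distrib[symmetric])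
  have sJ: "sin (jump b ?F - pi * real l) = (-1) ^ l * sin (jump b ?F)"
    and cJ: "cos (jump b ?F - pi * real l) = (-1) ^ l * cos (jump b ?F)"
    by (simp_all add: sin_diff cos_diff sin_npi2 cos_npi2 mult.commute)
  note J = jump_polar[of "real b" ?F]
  have "prufer_y b l V \<mu> a (Suc n) (real n + 1) = amplitude b l V \<mu> a (Suc n) * ((-1) ^ l * sin (jump b ?F)) / \<mu>"
    using start sJ unfolding prufer_y_def S by simp
  also have "\<dots> = (((-1) ^ l) * ((-1) ^ l)) * ?A * ?E (real n + 1) * (sin (jump b ?F) * sqrt (gain b ?F)) / \<mu>" by simp
  also have "\<dots> = of_real (sqrt (real b)) * prufer_y b l V \<mu> a n (real n + 1)"
    using J b unfolding m1 prufer_y F by simp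
  finally show "prufer_y b l V \<mu> a (Suc n) (real n + 1) = of_real (sqrt (real b)) * prufer_y b l V \<mu> a n (real n + 1)" .
  have "prufer_y1 b l V \<mu> a (Suc n) (real n + 1) = amplitude b l V \<mu> a (Suc n) * ((-1) ^ l * cos (jump b ?F))"
    using start cJ unfolding prufer_y1_def S by simp
  also have "\<dots> = (((-1) ^ l) * ((-1) ^ l)) * ?A * ?E (real n + 1) * (cos (jump b ?F) * sqrt (gain b ?F))" by simp
  also have "\<dots> = of_real (1 / sqrt (real b)) * prufer_y1 b l V \<mu> a n (real n + 1)"
    using J b unfolding m1 prufer_y1 F by simp
  finally show "prufer_y1 b l V \<mu> a (Suc n) (real n + 1) = of_real (1 / sqrt (real b)) * prufer_y1 b l V \<mu> a n (real n + 1)" .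
qed

lemma prufer_y_start:
  assumes "potential V" "\<mu> > 0"
  shows "prufer_y b l V \<mu> a 0 0 = sin a / \<mu>" "prufer_y1 b l V \<mu> a 0 0 = cos a"
  using prufer_start[OF assms, of 0 a] by (simp_all add: prufer_y_def prufer_y1_def)

text \<open>A qualitative notion: for the shifted and scaled potentials its constant depends on g
  and k. Bounds uniform in both are obtained in \<open>weyl_uniform\<close>.\<close>

definition expdec :: "real \<Rightarrow> (real \<Rightarrow> real) \<Rightarrow> bool" where
  "expdec \<kappa> V \<longleftrightarrow> (\<exists>C\<ge>0. \<forall>t\<ge>0. V t \<le> C * exp (- 2 * \<kappa> * t))"

lemma expdec_barrier:
  assumes g: "in_gap b l \<mu>" and V: "potential V" and \<kappa>: "\<kappa> > 0" and dec: "expdec \<kappa> V"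
  shows "\<exists>n0 A. A \<ge> 0 \<and> barrier b l V \<mu> n0 (\<lambda>n. wfix b l \<mu> + A * exp (- 2 * \<kappa> * (real n - real n0)))"
proof -
  obtain C where C: "C \<ge> 0" "\<And>t. t \<ge> 0 \<Longrightarrow> V t \<le> C * exp (- 2 * \<kappa> * t)" using dec by (auto simp: expdec_def)
  have \<mu>: "\<mu> > 0" and b: "b \<ge> 2" using g by (auto simp: in_gap_def)
  define \<eta> where "\<eta> = (1 - exp (- 2 * \<kappa>)) / 2"
  have \<eta>: "\<eta> > 0" using \<kappa> by (simp add: \<eta>_def)
  \<comment> \<open>The largest \<open>A\<close> allowed by the first smallness condition of
    \<open>exp_barrier\<close>. The second is met by starting at a late \<open>n0\<close>, where the
    potential is small.\<close>
  define A where "A = \<eta> / b"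
  have A: "A > 0" using \<eta> b by (simp add: A_def)
  have "(\<lambda>n. b * (C * exp (- 2 * \<kappa>) ^ n / \<mu>)) \<longlonglongrightarrow> b * (C * 0 / \<mu>)"
    using \<kappa> \<mu> by (intro tendsto_intros LIMSEQ_power_zero) auto
  then have "\<forall>\<^sub>F n in sequentially. b * (C * exp (- 2 * \<kappa>) ^ n / \<mu>) < A * \<eta>"
    by (rule order_tendstoD) (use A \<eta> in auto)
  then obtain n0 where n0: "b * (C * exp (- 2 * \<kappa>) ^ n0 / \<mu>) < A * \<eta>" by (auto simp: eventually_sequentially)
  have e: "exp (- 2 * \<kappa>) ^ n0 = exp (- 2 * \<kappa> * real n0)" by (simp add: exp_of_nat_mult[symmetric] algebra_simps)
  have "barrier b l V \<mu> n0 (\<lambda>n. wfix b l \<mu> + A * exp (- 2 * \<kappa> * (real n - real n0)))"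
  proof (rule exp_barrier[OF g V \<kappa>, where \<epsilon>="C * exp (- 2 * \<kappa> * real n0)"])
    show "A \<ge> 0" "C * exp (- 2 * \<kappa> * real n0) \<ge> 0" using A C by auto
    show "V t \<le> C * exp (- 2 * \<kappa> * real n0) * exp (- 2 * \<kappa> * (t - real n0))" if "t \<ge> real n0" for t
    proof -
      have "exp (- 2 * \<kappa> * real n0) * exp (- 2 * \<kappa> * (t - real n0)) = exp (- 2 * \<kappa> * t)"
        unfolding exp_add[symmetric] by (rule arg_cong[where f=exp]) (simp add: algebra_simps)
      then show ?thesis using C(2)[of t] that by (simp add: mult.assoc)
    qed
    show "b * A \<le> (1 - exp (- 2 * \<kappa>)) / 2" using b by (simp add: A_def \<eta>_def)
    show "b * (C * exp (- 2 * \<kappa> * real n0) / \<mu>) \<le> A * ((1 - exp (- 2 * \<kappa>)) / 2)"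
      using n0 unfolding e \<eta>_def by simp
  qed
  then show ?thesis using A by (intro exI[of _ n0] exI[of _ A]) auto
qed

text \<open>The orbit of the Weyl angle is squeezed between \<open>wfix\<close> and an exponentially
  closing barrier.\<close>

lemma expdec_weyl:
  assumes g: "in_gap b l \<mu>" and V: "potential V" and \<kappa>: "\<kappa> > 0" and dec: "expdec \<kappa> V"
  shows "weylset b l V \<mu> \<noteq> {}" "orbit b l V \<mu> (weyl b l V \<mu>) \<longlonglongrightarrow> wfix b l \<mu>"
proof -
  obtain n0 A where A: "A \<ge> 0" and B: "barrier b l V \<mu> n0 (\<lambda>n. wfix b l \<mu> + A * exp (- 2 * \<kappa> * (real n - real n0)))"
    using expdec_barrier[OF assms] by blast
  show ne: "weylset b l V \<mu> \<noteq> {}" by (rule barrier_nonempty[OF g V B])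
  show "orbit b l V \<mu> (weyl b l V \<mu>) \<longlonglongrightarrow> wfix b l \<mu>"
  proof (rule tendsto_sandwich)
    show "\<forall>\<^sub>F n in sequentially. wfix b l \<mu> \<le> orbit b l V \<mu> (weyl b l V \<mu>) n"
      using weyl_orbit_ge[OF g V ne] by simp
    show "\<forall>\<^sub>F n in sequentially. orbit b l V \<mu> (weyl b l V \<mu>) n \<le> wfix b l \<mu> + (A * exp (2 * \<kappa> * real n0)) * exp (- 2 * \<kappa>) ^ n"
      unfolding eventually_sequentially
    proof (intro exI allI impI)
      fix n assume n: "n0 \<le> n"
      have "exp (- 2 * \<kappa> * (real n - real n0)) = exp (2 * \<kappa> * real n0) * exp (- 2 * \<kappa>) ^ n"
        unfolding exp_of_nat_mult[symmetric] exp_add[symmetric] by (rule arg_cong[where f=exp]) (simp add: algebra_simps)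
      then show "orbit b l V \<mu> (weyl b l V \<mu>) n \<le> wfix b l \<mu> + (A * exp (2 * \<kappa> * real n0)) * exp (- 2 * \<kappa>) ^ n"
        using weyl_barrier[OF g V B n] by (simp add: mult.assoc)
    qed
    have "(\<lambda>n. wfix b l \<mu> + (A * exp (2 * \<kappa> * real n0)) * exp (- 2 * \<kappa>) ^ n) \<longlonglongrightarrow> wfix b l \<mu> + (A * exp (2 * \<kappa> * real n0)) * 0"
      using \<kappa> by (intro tendsto_intros LIMSEQ_power_zero) auto
    then show "(\<lambda>n. wfix b l \<mu> + (A * exp (2 * \<kappa> * real n0)) * exp (- 2 * \<kappa>) ^ n) \<longlonglongrightarrow> wfix b l \<mu>" by simp
  qed simp
qed

text \<open>The angle converges to the fixed angle and the potential to 0, so the ratio of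
  successive amplitudes is eventually controlled by the square root of the gain at
  \<open>zfix\<close>. That number is less than 1 in the open gap and equals 1 at its ends, hence
  the strict inequality; the rest is the ratio test.\<close>

lemma orbit_decfam:
  assumes g: "in_gap b l \<mu>" and V: "potential V" and \<kappa>: "\<kappa> > 0" and dec: "expdec \<kappa> V"
    and strict: "\<bar>\<mu> - pi * real l\<bar> < tree_theta b" and lim: "orbit b l V \<mu> a \<longlonglongrightarrow> wfix b l \<mu>"
  shows "decfam (prufer_y b l V \<mu> a) (prufer_y1 b l V \<mu> a)"
proof -
  obtain C where C: "C \<ge> 0" "\<And>t. t \<ge> 0 \<Longrightarrow> V t \<le> C * exp (- 2 * \<kappa> * t)" using dec by (auto simp: expdec_def)
  have \<mu>: "\<mu> > 0" and b: "b \<ge> 2" using g by (auto simp: in_gap_def)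
  define v where "v n = C * exp (- 2 * \<kappa>) ^ n" for n
  have v0: "v \<longlonglongrightarrow> C * 0" unfolding v_def using \<kappa> by (intro tendsto_intros LIMSEQ_power_zero) auto
  have vC: "0 \<le> v n" "v n \<le> C" for n using C \<kappa> by (auto simp: v_def mult_left_le power_le_one)
  have Vv: "V t \<le> v n" if "t \<in> {real n..real n + 1}" for n t
  proof -
    have "V t \<le> C * exp (- 2 * \<kappa> * t)" using C(2)[of t] that by simp
    also have "\<dots> \<le> C * exp (real n * (- 2 * \<kappa>))" using that \<kappa> C by (intro mult_left_mono) auto
    finally show ?thesis unfolding v_def exp_of_nat_mult .
  qed
  let ?A = "amplitude b l V \<mu> a" and ?X = "orbit b l V \<mu> a"
  let ?\<phi> = "\<lambda>n. prufer V \<mu> n (?X n)"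
  let ?G = "\<lambda>n s. V s / \<mu> * sin (?\<phi> n s) * cos (?\<phi> n s)"
  have I: "integral {real n..t} (?G n) \<le> v n / \<mu>" if t: "t \<in> {real n..real n + 1}" for n t
  proof -
    have "norm (integral {real n..t} (?G n)) \<le> v n / \<mu> * (t - real n)"
    proof (rule bdd_meas_integral_norm[OF prufer_rate_bdd_meas[OF V \<mu>]])
      fix s assume "s \<in> {real n..t}"
      then have s: "s \<in> {real n..real n + 1}" using t by auto
      have "\<bar>V s / \<mu> * sin (?\<phi> n s) * cos (?\<phi> n s)\<bar> \<le> v n / \<mu> * 1 * 1"
        unfolding abs_mult using Vv[OF s] potential_nonneg[OF V, of s] s \<mu> vC[of n]
        by (intro mult_mono) (auto simp: divide_right_mono)
      then show "norm (?G n s) \<le> v n / \<mu>" by simp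
    qed (use t in auto)
    also have "\<dots> \<le> v n / \<mu> * 1" using t vC[of n] \<mu> by (intro mult_left_mono) auto
    finally show ?thesis unfolding real_norm_def by linarith
  qed
  let ?z = "zfix b (\<mu> - pi * real l)"
  have fl: "(\<lambda>n. flow V \<mu> n (?X n)) \<longlonglongrightarrow> wfix b l \<mu> + \<mu>"
  proof (rule tendsto_sandwich)
    show "\<forall>\<^sub>F n in sequentially. ?X n + \<mu> - v n / \<mu> \<le> flow V \<mu> n (?X n)"
      using flow_bounds(2)[OF V \<mu>] Vv by (intro always_eventually allI) blast
    show "\<forall>\<^sub>F n in sequentially. flow V \<mu> n (?X n) \<le> ?X n + \<mu>"
      using flow_bounds(1)[OF V \<mu>] by simp
    have "(\<lambda>n. ?X n + \<mu> - v n / \<mu>) \<longlonglongrightarrow> wfix b l \<mu> + \<mu> - (C * 0) / \<mu>" using \<mu> by (intro tendsto_intros lim v0) auto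
    then show "(\<lambda>n. ?X n + \<mu> - v n / \<mu>) \<longlonglongrightarrow> wfix b l \<mu> + \<mu>" by simp
    show "(\<lambda>n. ?X n + \<mu>) \<longlonglongrightarrow> wfix b l \<mu> + \<mu>" by (intro tendsto_intros lim)
  qed
  have gz: "gain b (wfix b l \<mu> + \<mu>) = gain b ?z"
  proof -
    have "wfix b l \<mu> + \<mu> = ?z + of_int (int l) * pi" by (simp add: wfix_def mult.commute)
    then show ?thesis using b unfolding gain_eq[of "real b", OF order.strict_trans2[OF zero_less_one, of "real b"]]
      by (simp add: gain_eq sin_sq_add_int_pi[of ?z "int l", simplified])
  qed
  have "gain b ?z < 1" using b strict by (intro gain_less_1 zfix_theta) auto
  define r where "r = sqrt (gain b ?z)"
  have r: "r < 1" "r \<ge> 0" using \<open>gain b ?z < 1\<close> gain_pos[of b ?z] b by (auto simp: r_def)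
  define f where "f n = exp (v n / \<mu>) * sqrt (gain b (flow V \<mu> n (?X n)))" for n
  have "f \<longlonglongrightarrow> exp ((C * 0) / \<mu>) * sqrt (gain b (wfix b l \<mu> + \<mu>))"
    unfolding f_def gain_def using b \<mu> by (intro tendsto_intros v0 fl) auto
  then have "f \<longlonglongrightarrow> r" unfolding gz by (simp add: r_def)
  then have "\<forall>\<^sub>F n in sequentially. f n < (1 + r) / 2" by (rule order_tendstoD) (use r in auto)
  then obtain N where N: "\<And>n. n \<ge> N \<Longrightarrow> f n < (1 + r) / 2" by (auto simp: eventually_sequentially)
  have amplitude: "\<bar>?A (Suc n)\<bar> \<le> f n * \<bar>?A n\<bar>" for n
  proof -
    have g0: "sqrt (gain b (flow V \<mu> n (?X n))) \<ge> 0" using gain_pos[of b "flow V \<mu> n (?X n)"] b by simp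
    have "exp (integral {real n..real n + 1} (?G n)) \<le> exp (v n / \<mu>)" using I[of "real n + 1" n] by simp
    then have "exp (integral {real n..real n + 1} (?G n)) * sqrt (gain b (flow V \<mu> n (?X n))) \<le> f n"
      unfolding f_def using g0 by (rule mult_right_mono)
    then have "\<bar>?A n\<bar> * (exp (integral {real n..real n + 1} (?G n)) * sqrt (gain b (flow V \<mu> n (?X n)))) \<le> \<bar>?A n\<bar> * f n"
      by (rule mult_left_mono) simp
    then show ?thesis using g0 by (simp add: abs_mult mult_ac)
  qed
  have sumA: "summable (\<lambda>n. (?A n)\<^sup>2)"
  proof (rule summable_ratio_test[where c="((1 + r) / 2)\<^sup>2" and N=N])
    have "((1 + r) / 2)\<^sup>2 < 1\<^sup>2" using r by (intro power_strict_mono) auto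
    then show "((1 + r) / 2)\<^sup>2 < 1" by simp
    fix n assume "n \<ge> N"
    have "\<bar>?A (Suc n)\<bar> \<le> (1 + r) / 2 * \<bar>?A n\<bar>"
      using amplitude[of n] mult_right_mono[OF less_imp_le[OF N[OF \<open>n \<ge> N\<close>]], of "\<bar>?A n\<bar>"] by linarith
    then have "\<bar>?A (Suc n)\<bar>\<^sup>2 \<le> ((1 + r) / 2 * \<bar>?A n\<bar>)\<^sup>2" by (intro power_mono) auto
    then show "norm ((?A (Suc n))\<^sup>2) \<le> ((1 + r) / 2)\<^sup>2 * norm ((?A n)\<^sup>2)" unfolding power_mult_distrib power2_abs by simp
  qed
  define K where "K = exp (C / \<mu>) * (1 / \<mu> + 1)"
  have K: "K \<ge> 0" using \<mu> by (simp add: K_def)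
  show ?thesis unfolding decfam_def
  proof (intro exI[of _ "\<lambda>n. K * \<bar>?A n\<bar>"] conjI allI ballI)
    show "K * \<bar>?A n\<bar> \<ge> 0" for n using K by simp
    show "summable (\<lambda>n. (K * \<bar>?A n\<bar>)\<^sup>2)" unfolding power_mult_distrib power2_abs by (intro summable_mult sumA)
    fix n t assume t: "t \<in> {real n..real n + 1}"
    have E: "exp (integral {real n..t} (?G n)) \<le> exp (C / \<mu>)"
      using I[OF t] vC(2)[of n] \<mu> by (simp add: divide_right_mono order_trans[of _ "v n / \<mu>"])
    have "\<bar>prufer_y b l V \<mu> a n t\<bar> = \<bar>?A n\<bar> * (exp (integral {real n..t} (?G n)) * \<bar>sin (?\<phi> n t)\<bar>) / \<mu>"
      using \<mu> by (simp add: prufer_y_def abs_mult)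
    also have "\<dots> \<le> \<bar>?A n\<bar> * (exp (C / \<mu>) * 1) / \<mu>" using E \<mu> by (intro divide_right_mono mult_left_mono mult_mono) auto
    also have "\<dots> \<le> K * \<bar>?A n\<bar>" using \<mu> by (simp add: K_def algebra_simps)
    finally show "\<bar>prufer_y b l V \<mu> a n t\<bar> \<le> K * \<bar>?A n\<bar>" .
    have "\<bar>prufer_y1 b l V \<mu> a n t\<bar> = \<bar>?A n\<bar> * (exp (integral {real n..t} (?G n)) * \<bar>cos (?\<phi> n t)\<bar>)"
      by (simp add: prufer_y1_def abs_mult)
    also have "\<dots> \<le> \<bar>?A n\<bar> * (exp (C / \<mu>) * 1)" using E by (intro mult_left_mono mult_mono) auto
    also have "\<dots> \<le> K * \<bar>?A n\<bar>" using \<mu> by (simp add: K_def algebra_simps)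
    finally show "\<bar>prufer_y1 b l V \<mu> a n t\<bar> \<le> K * \<bar>?A n\<bar>" .
  qed
qed

text \<open>Both solutions decay, so their Wronskian is 0; evaluated at 0 it equals sin(a -
  a')/\<mu>.\<close>

lemma weyl_unique:
  assumes g: "in_gap b l \<mu>" and V: "potential V" and \<kappa>: "\<kappa> > 0" and dec: "expdec \<kappa> V"
    and strict: "\<bar>\<mu> - pi * real l\<bar> < tree_theta b" 
    and "orbit b l V \<mu> a \<longlonglongrightarrow> wfix b l \<mu>" "orbit b l V \<mu> a' \<longlonglongrightarrow> wfix b l \<mu>"
  shows "sin (a - a') = 0"
proof -
  have \<mu>: "\<mu> > 0" and b: "b \<ge> 1" using g by (auto simp: in_gap_def)
  have "prufer_y1 b l V \<mu> a' 0 0 * prufer_y b l V \<mu> a 0 0 - prufer_y b l V \<mu> a' 0 0 * prufer_y1 b l V \<mu> a 0 0 = 0"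
    by (intro decfam_wronskian[OF prufer_y_family _ prufer_y_family] orbit_decfam[OF g V \<kappa> dec strict] V \<mu> b assms)
  then show ?thesis using \<mu> by (simp add: prufer_y_start[OF V \<mu>] sin_diff field_simps)
qed

subsection \<open>Kernel elements and solutions\<close>

text \<open>Bridge between the Lebesgue integrals over open cells in the operator domain and the
  gauge integrals over closed intervals used for \<open>ac_on\<close>.\<close>

lemma lebesgue_on_open_interval:
  fixes g h :: "real \<Rightarrow> 'a::euclidean_space"
  assumes h: "bdd_meas r s h" and eq: "\<And>t. t \<in> {r<..<s} \<Longrightarrow> g t = h t"
  shows "g \<in> borel_measurable (lebesgue_on {r<..<s})" "integrable (lebesgue_on {r<..<s}) g"
    "integral\<^sup>L (lebesgue_on {r<..<s}) g = integral {r..s} h"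
proof -
  have "h \<in> borel_measurable (lebesgue_on {r<..<s})"
    by (rule measurable_restrict_mono[OF bdd_meas_measurable[OF h]]) auto
  then show m: "g \<in> borel_measurable (lebesgue_on {r<..<s})"
    using eq by (subst measurable_cong[of _ _ h]) auto
  obtain B where B: "\<And>t. t \<in> {r..s} \<Longrightarrow> norm (h t) \<le> B" using bdd_meas_bound[OF h] by blast
  have fin: "finite_measure (lebesgue_on {r<..<s})" by (intro finite_measure_lebesgue_on) auto
  show i: "integrable (lebesgue_on {r<..<s}) g"
    by (rule finite_measure.integrable_const_bound[OF fin _ m, of B]) (use B eq in \<open>auto intro!: AE_I2\<close>)
  have "integral\<^sup>L (lebesgue_on {r<..<s}) g = integral {r<..<s} g"
    by (rule lebesgue_integral_eq_integral[OF i]) simp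
  also have "\<dots> = integral {r<..<s} h" by (rule Henstock_Kurzweil_Integration.integral_cong) (rule eq)
  finally show "integral\<^sup>L (lebesgue_on {r<..<s}) g = integral {r..s} h" by (simp add: integral_open_interval_real)
qed

lemma lebesgue_on_closed_interval:
  fixes h :: "real \<Rightarrow> 'a::euclidean_space"
  assumes h: "bdd_meas r s h" "r \<le> u" "v \<le> s"
  shows "integrable (lebesgue_on {u..v}) h" "integral\<^sup>L (lebesgue_on {u..v}) h = integral {u..v} h"
proof -
  have fin: "finite_measure (lebesgue_on {u..v})" by (intro finite_measure_lebesgue_on) auto
  have h': "bdd_meas u v h" using bdd_meas_subset[OF h] .
  obtain B where B: "\<And>t. t \<in> {u..v} \<Longrightarrow> norm (h t) \<le> B" using bdd_meas_bound[OF h'] by blast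
  show i: "integrable (lebesgue_on {u..v}) h"
    by (rule finite_measure.integrable_const_bound[OF fin _ bdd_meas_measurable[OF h'], of B]) (use B in \<open>auto intro!: AE_I2\<close>)
  show "integral\<^sup>L (lebesgue_on {u..v}) h = integral {u..v} h"
    by (rule lebesgue_integral_eq_integral[OF i]) simp
qed

lemma bdd_meas_L2:
  fixes h :: "real \<Rightarrow> complex"
  assumes h: "bdd_meas r s h" and eq: "\<And>t. t \<in> {r<..<s} \<Longrightarrow> g t = h t"
  shows "g \<in> L2 {r<..<s}"
proof -
  obtain B where B: "B \<ge> 0" "\<And>t. t \<in> {r..s} \<Longrightarrow> norm (h t) \<le> B" using bdd_meas_bound[OF h] by blast
  have "bdd_meas r s (\<lambda>t. (cmod (h t))\<^sup>2)"
  proof (rule bdd_measI[where B="B\<^sup>2"])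
    show "(\<lambda>t. (cmod (h t))\<^sup>2) \<in> borel_measurable (lebesgue_on {r..s})" using bdd_meas_measurable[OF h] by measurable
  qed (use B in \<open>auto intro!: power_mono\<close>)
  from lebesgue_on_open_interval(2)[OF this, of "\<lambda>t. (cmod (g t))\<^sup>2"] lebesgue_on_open_interval(1)[OF h eq]
  show ?thesis using eq by (auto simp: L2_def)
qed

lemma floor_cell: "t \<in> {real m..<real m + 1} \<Longrightarrow> nat \<lfloor>t\<rfloor> = m"
  using floor_unique[of "int m" t] by auto

text \<open>The restrictions to the cells are glued by the floor, which at a vertex selects the cell
  to the right. The vertex conditions speak of one-sided limits, so this choice is harmless;
  \<open>decfam\<close> gives the summability required by the domain.\<close>

lemma family_kernel:
  assumes w: "family b V lam w w1" and d: "decfam w w1" and w0: "w 0 0 = 0" and V: "potential V" and b: "b \<ge> 1"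
  shows "(\<lambda>t. complex_of_real (w (nat \<lfloor>t\<rfloor>) t)) \<in> kernel_minus (operator_A b V) lam"
proof -
  define y y1 y2 where "y t = complex_of_real (w (nat \<lfloor>t\<rfloor>) t)" and "y1 t = complex_of_real (w1 (nat \<lfloor>t\<rfloor>) t)"
    and "y2 t = of_real (V t - lam) * y t" for t
  note fl = floor_cell
  have acw: "ac_on (real m) (real m + 1) (w m) (w1 m)"
    and acw1: "ac_on (real m) (real m + 1) (w1 m) (\<lambda>t. (V t - lam) * w m t)"
    and jmp: "w (Suc m) (real m + 1) = sqrt (real b) * w m (real m + 1)" "w1 (Suc m) (real m + 1) = 1 / sqrt (real b) * w1 m (real m + 1)"
    for m using w by (auto simp: family_def)
  obtain M where "(\<forall>n. M n \<ge> 0) \<and> (\<forall>n. \<forall>t\<in>{real n..real n + 1}. \<bar>w n t\<bar> \<le> M n) \<and>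
    (\<forall>n. \<forall>t\<in>{real n..real n + 1}. \<bar>w1 n t\<bar> \<le> M n) \<and> summable (\<lambda>n. (M n)\<^sup>2) \<and> M \<longlonglongrightarrow> 0"
    using decfamD[OF d] by (elim exE)
  then have M: "\<And>n. M n \<ge> 0" "\<And>n t. t \<in> {real n..real n + 1} \<Longrightarrow> \<bar>w n t\<bar> \<le> M n" "summable (\<lambda>n. (M n)\<^sup>2)" by blast+
  obtain B where B: "B \<ge> 0" "\<And>t. t \<ge> 0 \<Longrightarrow> V t \<le> B" using potential_bound[OF V] by blast
  have cw: "bdd_meas (real m) (real m + 1) (w m)" "bdd_meas (real m) (real m + 1) (w1 m)" for m
    by (rule bdd_meas_continuous[OF ac_on_continuous[OF acw]], rule bdd_meas_continuous[OF ac_on_continuous[OF acw1]])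
  have bw2: "bdd_meas (real m) (real m + 1) (\<lambda>t. (V t - lam) * w m t)" for m using ac_on_bdd_meas[OF acw1] .
  have H: "H2_derivs (real m) (real m + 1) y y1 y2" for m
    unfolding H2_derivs_def
  proof (intro conjI ballI allI impI)
    show "y \<in> L2 {real m<..<real m + 1}"
      by (rule bdd_meas_L2[OF bdd_meas_of_real[OF cw(1)]]) (simp add: y_def fl[of _ m])
    show "y1 \<in> L2 {real m<..<real m + 1}"
      by (rule bdd_meas_L2[OF bdd_meas_of_real[OF cw(2)]]) (simp add: y1_def fl[of _ m])
    show "y2 \<in> L2 {real m<..<real m + 1}"
      by (rule bdd_meas_L2[OF bdd_meas_of_real[OF bw2]]) (simp add: y2_def y_def fl[of _ m])
    fix t assume t: "t \<in> {real m<..<real m + 1}"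
    have "((\<lambda>t. complex_of_real (w m t)) has_vector_derivative complex_of_real (w1 m t)) (at t)"
      by (rule ac_on_vector_derivative[OF ac_on_of_real[OF acw]])
        (use t ac_on_continuous[OF acw1] in \<open>auto intro!: continuous_intros\<close>)
    then have "(y has_vector_derivative complex_of_real (w1 m t)) (at t)"
      by (rule has_vector_derivative_transform_within_open[where S="{real m<..<real m + 1}"])
        (use t in \<open>auto simp: y_def fl[of _ m]\<close>)
    then show "(y has_vector_derivative y1 t) (at t)" using t by (simp add: y1_def fl[of _ m])
  next
    fix u v assume uv: "real m < u \<and> u \<le> v \<and> v < real m + 1"
    have "y1 v - y1 u = integral {u..v} (\<lambda>t. complex_of_real ((V t - lam) * w m t))"
      using ac_on_increment[OF ac_on_of_real[OF acw1], of m u v] uv by (simp add: y1_def fl[of _ m])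
    also have "\<dots> = integral {u..v} y2"
      by (rule Henstock_Kurzweil_Integration.integral_cong) (use uv in \<open>auto simp: y2_def y_def fl[of _ m]\<close>)
    also have "\<dots> = (LINT t|lebesgue_on {u..v}. y2 t)"
    proof (rule lebesgue_on_closed_interval(2)[symmetric])
      show "bdd_meas u v y2" by (rule bdd_meas_cong[OF bdd_meas_subset[OF bdd_meas_of_real[OF bw2[of m]]]]) (use uv in \<open>auto simp: y2_def y_def fl[of _ m]\<close>)
    qed auto
    finally show "y1 v - y1 u = (LINT t|lebesgue_on {u..v}. y2 t)" .
  qed
  have lim_right: "((\<lambda>t. complex_of_real (h (nat \<lfloor>t\<rfloor>) t)) \<longlongrightarrow> complex_of_real (h m (real m))) (at_right (real m))"
    if c: "\<And>m. continuous_on {real m..real m + 1} (h m)" for h :: "nat \<Rightarrow> real \<Rightarrow> real" and m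
  proof (rule Lim_transform_eventually)
    have "(h m \<longlongrightarrow> h m (real m)) (at (real m) within {real m..real m + 1})"
      using c[of m] unfolding continuous_on_def by auto
    then have "(h m \<longlongrightarrow> h m (real m)) (at_right (real m))" by (simp add: at_within_Icc_at_right)
    then show "((\<lambda>t. complex_of_real (h m t)) \<longlongrightarrow> complex_of_real (h m (real m))) (at_right (real m))" by (rule tendsto_of_real)
    show "\<forall>\<^sub>F t in at_right (real m). complex_of_real (h m t) = complex_of_real (h (nat \<lfloor>t\<rfloor>) t)"
      unfolding eventually_at_right_field by (intro exI[of _ "real m + 1"]) (auto simp: fl[of _ m])
  qed
  have lim_left: "((\<lambda>t. complex_of_real (h (nat \<lfloor>t\<rfloor>) t)) \<longlongrightarrow> complex_of_real (h m (real m + 1))) (at_left (real m + 1))"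
    if c: "\<And>m. continuous_on {real m..real m + 1} (h m)" for h :: "nat \<Rightarrow> real \<Rightarrow> real" and m
  proof (rule Lim_transform_eventually)
    have "(h m \<longlongrightarrow> h m (real m + 1)) (at (real m + 1) within {real m..real m + 1})"
      using c[of m] unfolding continuous_on_def by auto
    then have "(h m \<longlongrightarrow> h m (real m + 1)) (at_left (real m + 1))" by (simp add: at_within_Icc_at_left)
    then show "((\<lambda>t. complex_of_real (h m t)) \<longlongrightarrow> complex_of_real (h m (real m + 1))) (at_left (real m + 1))" by (rule tendsto_of_real)
    show "\<forall>\<^sub>F t in at_left (real m + 1). complex_of_real (h m t) = complex_of_real (h (nat \<lfloor>t\<rfloor>) t)"
      unfolding eventually_at_left_field by (intro exI[of _ "real m"]) (auto simp: fl[of _ m])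
  qed
  have contw: "continuous_on {real m..real m + 1} (w m)" "continuous_on {real m..real m + 1} (w1 m)" for m
    using ac_on_continuous acw acw1 by blast+
  have dom: "in_domain b y y1 y2"
    unfolding in_domain_def
  proof (intro conjI allI impI)
    show "H2_derivs (real n - 1) (real n) y y1 y2" if "n \<ge> 1" for n
      using H[of "n - 1"] that by (simp add: of_nat_diff)
    have "(y \<longlongrightarrow> of_real (w 0 (real 0))) (at_right (real 0))" unfolding y_def[abs_def] by (rule lim_right) (rule contw)
    then show "(y \<longlongrightarrow> 0) (at_right 0)" using w0 by simp
    show "\<exists>u. (y \<longlongrightarrow> u) (at_left (real n)) \<and> (y \<longlongrightarrow> of_real (sqrt (real b)) * u) (at_right (real n))" if "n \<ge> 1" for n
    proof -
      obtain m where m: "n = Suc m" using \<open>n \<ge> 1\<close> by (cases n) auto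
      have "(y \<longlongrightarrow> of_real (w m (real m + 1))) (at_left (real m + 1))" unfolding y_def[abs_def] by (rule lim_left) (rule contw)
      moreover have "(y \<longlongrightarrow> of_real (w (Suc m) (real (Suc m)))) (at_right (real (Suc m)))" unfolding y_def[abs_def] by (rule lim_right) (rule contw)
      ultimately show ?thesis using jmp(1)[of m] unfolding m by (intro exI[of _ "of_real (w m (real m + 1))"]) (simp add: add.commute)
    qed
    show "\<exists>u. (y1 \<longlongrightarrow> u) (at_left (real n)) \<and> (y1 \<longlongrightarrow> of_real (1 / sqrt (real b)) * u) (at_right (real n))" if "n \<ge> 1" for n
    proof -
      obtain m where m: "n = Suc m" using \<open>n \<ge> 1\<close> by (cases n) auto
      have "(y1 \<longlongrightarrow> of_real (w1 m (real m + 1))) (at_left (real m + 1))" unfolding y1_def[abs_def] by (rule lim_left) (rule contw)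
      moreover have "(y1 \<longlongrightarrow> of_real (w1 (Suc m) (real (Suc m)))) (at_right (real (Suc m)))" unfolding y1_def[abs_def] by (rule lim_right) (rule contw)
      ultimately show ?thesis using jmp(2)[of m] unfolding m by (intro exI[of _ "of_real (w1 m (real m + 1))"]) (simp add: add.commute)
    qed
    show "summable (\<lambda>n. LINT t|lebesgue_on (cell (Suc n)). (cmod (y2 t))\<^sup>2 + (cmod (y t))\<^sup>2)"
    proof (rule summable_comparison_test'[where N=0])
      show "summable (\<lambda>n. ((B + \<bar>lam\<bar>)\<^sup>2 + 1) * (M n)\<^sup>2)" by (intro summable_mult M)
      fix n :: nat
      let ?h = "\<lambda>t. ((V t - lam) * w n t) * ((V t - lam) * w n t) + w n t * w n t"
      have bh: "bdd_meas (real n) (real n + 1) ?h" by (intro bdd_meas_add bdd_meas_mult bw2 cw(1))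
      have "(LINT t|lebesgue_on (cell (Suc n)). (cmod (y2 t))\<^sup>2 + (cmod (y t))\<^sup>2) = integral {real n..real n + 1} ?h"
        unfolding cell_def using lebesgue_on_open_interval(3)[OF bh, of "\<lambda>t. (cmod (y2 t))\<^sup>2 + (cmod (y t))\<^sup>2"]
        by (simp add: y2_def y_def fl[of _ n] norm_mult power_mult_distrib power2_eq_square add.commute del: of_real_diff)
      also have "norm \<dots> \<le> (((B + \<bar>lam\<bar>)\<^sup>2 + 1) * (M n)\<^sup>2) * (real n + 1 - real n)"
      proof (rule bdd_meas_integral_norm[OF bh])
        fix t assume t: "t \<in> {real n..real n + 1}"
        have V1: "\<bar>V t - lam\<bar> \<le> B + \<bar>lam\<bar>" using B(2)[of t] potential_nonneg[OF V, of t] t by auto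
        have "?h t = \<bar>V t - lam\<bar>\<^sup>2 * \<bar>w n t\<bar>\<^sup>2 + \<bar>w n t\<bar>\<^sup>2"
          unfolding power2_abs by (simp only: power2_eq_square mult_ac)
        then have "norm (?h t) = \<bar>V t - lam\<bar>\<^sup>2 * \<bar>w n t\<bar>\<^sup>2 + \<bar>w n t\<bar>\<^sup>2" by simp
        also have "\<dots> \<le> (B + \<bar>lam\<bar>)\<^sup>2 * (M n)\<^sup>2 + (M n)\<^sup>2"
          using V1 M(2)[OF t] by (intro add_mono mult_mono power_mono) auto
        finally show "norm (?h t) \<le> ((B + \<bar>lam\<bar>)\<^sup>2 + 1) * (M n)\<^sup>2" by (simp add: algebra_simps)
      qed auto
      finally show "norm (LINT t|lebesgue_on (cell (Suc n)). (cmod (y2 t))\<^sup>2 + (cmod (y t))\<^sup>2) \<le> ((B + \<bar>lam\<bar>)\<^sup>2 + 1) * (M n)\<^sup>2" by simp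
    qed
  qed
  have "\<And>t. of_real lam * y t = - y2 t + of_real (V t) * y t" by (simp add: y2_def algebra_simps)
  then have "AE t in lebesgue_on {0..}. of_real lam * y t = - y2 t + of_real (V t) * y t" by simp
  then have "(y, \<lambda>t. of_real lam * y t) \<in> operator_A b V"
    using dom unfolding operator_A_def by blast
  then have "y \<in> kernel_minus (operator_A b V) lam" unfolding kernel_minus_def by (auto intro!: exI[of _ "\<lambda>t. of_real lam * y t"])
  then show ?thesis by (simp add: y_def[abs_def])
qed

text \<open>The equation upgrades the regularity: the second derivative equals (V - lam) y almost
  everywhere, and once \<open>y\<close> is extended continuously to the closed cells this is bounded
  there. Replacing \<open>y2\<close> by this function turns H2 functions into pairs that fit
  \<open>ac_on\<close>.\<close>

lemma kernel_family:
  assumes y: "y \<in> kernel_minus (operator_A b V) lam" and V: "potential V" and b: "b \<ge> 1"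
  shows "\<exists>Y Y1 C. family b V lam Y Y1 \<and> Y 0 0 = 0 \<and> (\<forall>n. \<forall>t\<in>{real n<..<real n + 1}. Y n t = y t) \<and>
    C \<ge> 0 \<and> (\<forall>n. integral {real n..real n + 1} (\<lambda>t. (cmod (Y n t))\<^sup>2) \<le> C)"
proof -
  obtain f y1 y2 where dom: "in_domain b y y1 y2"
    and f1: "AE t in lebesgue_on {0..}. f t = - y2 t + of_real (V t) * y t"
    and f2: "AE t in lebesgue_on {0..}. f t = of_real lam * y t"
    using y by (auto simp: kernel_minus_def operator_A_def)
  have AE: "AE t in lebesgue_on {0..}. y2 t = of_real (V t - lam) * y t"
    using f1 f2 by eventually_elim (simp add: algebra_simps)
  have dH: "\<And>n. n \<ge> 1 \<Longrightarrow> H2_derivs (real n - 1) (real n) y y1 y2"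
    and dl: "\<And>n. n \<ge> 1 \<Longrightarrow> \<exists>u. (y \<longlongrightarrow> u) (at_left (real n)) \<and> (y \<longlongrightarrow> of_real (sqrt (real b)) * u) (at_right (real n))"
    and dl1: "\<And>n. n \<ge> 1 \<Longrightarrow> \<exists>u. (y1 \<longlongrightarrow> u) (at_left (real n)) \<and> (y1 \<longlongrightarrow> of_real (1 / sqrt (real b)) * u) (at_right (real n))"
    and d0: "(y \<longlongrightarrow> 0) (at_right 0)"
    and dsum: "summable (\<lambda>n. LINT t|lebesgue_on (cell (Suc n)). (cmod (y2 t))\<^sup>2 + (cmod (y t))\<^sup>2)"
    using dom unfolding in_domain_def by simp_all
  have Sn: "real (Suc n) = real n + 1" for n by simp
  have H: "H2_derivs (real n) (real n + 1) y y1 y2" for n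
    using dH[of "Suc n"] unfolding Sn by simp
  have "\<exists>u. (y \<longlongrightarrow> u) (at_left (real n + 1)) \<and> (y \<longlongrightarrow> of_real (sqrt (real b)) * u) (at_right (real n + 1))" for n
    using dl[of "Suc n"] unfolding Sn by simp
  then obtain u where u: "\<And>n. (y \<longlongrightarrow> u n) (at_left (real n + 1))" 
    "\<And>n. (y \<longlongrightarrow> of_real (sqrt (real b)) * u n) (at_right (real n + 1))" by metis
  have "\<exists>u. (y1 \<longlongrightarrow> u) (at_left (real n + 1)) \<and> (y1 \<longlongrightarrow> of_real (1 / sqrt (real b)) * u) (at_right (real n + 1))" for n
    using dl1[of "Suc n"] unfolding Sn by simp
  then obtain u1 where u1: "\<And>n. (y1 \<longlongrightarrow> u1 n) (at_left (real n + 1))" 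
    "\<And>n. (y1 \<longlongrightarrow> of_real (1 / sqrt (real b)) * u1 n) (at_right (real n + 1))" by metis
  \<comment> \<open>The limits from the right: 0 at the root by the Dirichlet condition, elsewhere
    sqrt b times the limit from the left.\<close>
  define R where "R n = (case n of 0 \<Rightarrow> 0 | Suc m \<Rightarrow> of_real (sqrt (real b)) * u m)" for n
  have R: "(y \<longlongrightarrow> R n) (at_right (real n))" for n
    using d0 u(2) by (cases n) (simp_all add: R_def add.commute)
  define Y where "Y n t = (if t \<le> real n then R n else if t \<ge> real n + 1 then u n else y t)" for n t
  have Yy: "Y n t = y t" if "t \<in> {real n<..<real n + 1}" for n t using that by (auto simp: Y_def)
  have der: "(y has_vector_derivative y1 t) (at t)" if "t \<in> {real n<..<real n + 1}" for n t
    using H[of n] that by (auto simp: H2_derivs_def)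
  have contY: "continuous_on {real n..real n + 1} (Y n)" for n
    unfolding continuous_on_def
  proof
    fix x assume x: "x \<in> {real n..real n + 1}"
    consider "x = real n" | "x = real n + 1" | "x \<in> {real n<..<real n + 1}" using x by fastforce
    then show "(Y n \<longlongrightarrow> Y n x) (at x within {real n..real n + 1})"
    proof cases
      case 1
      have "(Y n \<longlongrightarrow> R n) (at_right (real n))"
        by (rule Lim_transform_eventually[OF R]) (auto simp: eventually_at_right_field Y_def intro!: exI[of _ "real n + 1"])
      then show ?thesis using 1 by (simp add: at_within_Icc_at_right Y_def)
    next
      case 2
      have "(Y n \<longlongrightarrow> u n) (at_left (real n + 1))"
        by (rule Lim_transform_eventually[OF u(1)]) (auto simp: eventually_at_left_field Y_def intro!: exI[of _ "real n"])
      then show ?thesis using 2 by (simp add: at_within_Icc_at_left Y_def)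
    next
      case 3
      have "(y \<longlongrightarrow> y x) (at x)" using has_vector_derivative_continuous[OF der[OF 3]] by (simp add: isCont_def)
      then have "(Y n \<longlongrightarrow> y x) (at x)"
        by (rule Lim_transform_within_open[where s="{real n<..<real n + 1}"]) (use 3 Yy in auto)
      then have "(Y n \<longlongrightarrow> Y n x) (at x)" using Yy[OF 3] by simp
      then show ?thesis by (rule tendsto_within_subset) simp
    qed
  qed
  define g where "g n t = of_real (V t - lam) * Y n t" for n t
  have bg: "bdd_meas (real n) (real n + 1) (g n)" for n
    unfolding g_def by (intro bdd_meas_mult bdd_meas_of_real bdd_meas_diff bdd_meas_const potential_bdd_meas[OF V] bdd_meas_continuous contY) auto
  have y1d: "y1 q - y1 p = integral {p..q} (g n)" if pq: "real n < p" "p \<le> q" "q < real n + 1" for n p q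
  proof -
    have sub: "{p..q} \<subseteq> {0..}" using pq by auto
    have "y1 q - y1 p = (LINT t|lebesgue_on {p..q}. y2 t)" using H[of n] pq by (auto simp: H2_derivs_def)
    also have "\<dots> = (LINT t|lebesgue_on {p..q}. g n t)"
    proof (rule integral_cong_AE)
      have "y2 \<in> borel_measurable (lebesgue_on {real n<..<real n + 1})" using H[of n] by (auto simp: H2_derivs_def L2_def)
      then show "y2 \<in> borel_measurable (lebesgue_on {p..q})"
        by (rule measurable_restrict_mono) (use pq in auto)
      show "g n \<in> borel_measurable (lebesgue_on {p..q})"
        by (rule bdd_meas_measurable[OF bdd_meas_subset[OF bg]]) (use pq in auto)
      have "AE t in lebesgue. t \<in> {0..} \<longrightarrow> y2 t = of_real (V t - lam) * y t"
        using AE by (simp add: AE_restrict_space_iff)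
      then have "AE t in lebesgue. t \<in> {p..q} \<longrightarrow> y2 t = g n t"
        by eventually_elim (use pq sub Yy[of _ n] in \<open>auto simp: g_def\<close>)
      then show "AE t in lebesgue_on {p..q}. y2 t = g n t" by (simp add: AE_restrict_space_iff)
    qed
    also have "\<dots> = integral {p..q} (g n)" by (rule lebesgue_on_closed_interval(2)[OF bg]) (use pq in auto)
    finally show ?thesis .
  qed
  \<comment> \<open>Anchored at the midpoint of the cell: \<open>y1\<close> is controlled in the
    interior, and its values at the ends come out of the integral.\<close>
  define Y1 where "Y1 n t = (y1 (real n + 1/2) - integral {real n..real n + 1/2} (g n)) + integral {real n..t} (g n)" for n t
  have Y1y: "Y1 n t = y1 t" if t: "t \<in> {real n<..<real n + 1}" for n t
  proof -
    have comb: "integral {real n..q} (g n) = integral {real n..p} (g n) + integral {p..q} (g n)"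
      if "real n \<le> p" "p \<le> q" "q \<le> real n + 1" for p q
      by (rule Henstock_Kurzweil_Integration.integral_combine[symmetric])
        (use that in \<open>auto intro: bdd_meas_integrable[OF bg]\<close>)
    show ?thesis
    proof (cases "t \<le> real n + 1/2")
      case True
      then show ?thesis using comb[of t "real n + 1/2"] y1d[of n t "real n + 1/2"] t
        by (simp add: Y1_def) (metis add_diff_cancel_left' diff_diff_eq2 add.commute diff_add_cancel)
    next
      case False
      then show ?thesis using comb[of "real n + 1/2" t] y1d[of n "real n + 1/2" t] t
        by (simp add: Y1_def) (metis add_diff_cancel_left' diff_diff_eq2 add.commute diff_add_cancel)
    qed
  qed
  have acY1: "ac_on (real n) (real n + 1) (Y1 n) (g n)" for n
    unfolding Y1_def using ac_on_add[OF ac_on_const ac_on_integral[OF bg[of n]]] by simp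
  have cY1: "continuous_on {real n..real n + 1} (Y1 n)" for n by (rule ac_on_continuous[OF acY1])
  have acY: "ac_on (real n) (real n + 1) (Y n) (Y1 n)" for n
  proof (rule ac_onI[OF bdd_meas_continuous[OF cY1]])
    fix t assume t: "t \<in> {real n..real n + 1}"
    have "(Y1 n has_integral (Y n t - Y n (real n))) {real n..t}"
    proof (rule fundamental_theorem_of_calculus_interior)
      show "continuous_on {real n..t} (Y n)" by (rule continuous_on_subset[OF contY]) (use t in auto)
      fix x assume x: "x \<in> {real n<..<t}"
      then have x': "x \<in> {real n<..<real n + 1}" using t by auto
      have "(Y n has_vector_derivative y1 x) (at x)"
        by (rule has_vector_derivative_transform_within_open[OF der[OF x'], where S="{real n<..<real n + 1}"])
          (use x' Yy in auto)
      then show "(Y n has_vector_derivative Y1 n x) (at x)" using Y1y[OF x'] by simp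
    qed (use t in auto)
    then show "Y n t = Y n (real n) + integral {real n..t} (Y1 n)" by (simp add: integral_unique)
  qed
  have j0: "Y (Suc n) (real n + 1) = of_real (sqrt (real b)) * Y n (real n + 1)" for n
    by (simp add: Y_def R_def)
  have j1: "Y1 (Suc n) (real n + 1) = of_real (1 / sqrt (real b)) * Y1 n (real n + 1)" for n
  proof -
    have "(Y1 n \<longlongrightarrow> Y1 n (real n + 1)) (at_left (real n + 1))"
      using cY1[of n] unfolding continuous_on_def by (metis atLeastAtMost_iff at_within_Icc_at_left less_add_one less_imp_le order_refl)
    then have "(y1 \<longlongrightarrow> Y1 n (real n + 1)) (at_left (real n + 1))"
      by (rule Lim_transform_eventually) (auto simp: eventually_at_left_field Y1y intro!: exI[of _ "real n"])
    then have e: "Y1 n (real n + 1) = u1 n" using u1(1)[of n] tendsto_unique[OF trivial_limit_at_left_real] by blast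
    have S: "real (Suc n) = real n + 1" by simp
    have "(Y1 (Suc n) \<longlongrightarrow> Y1 (Suc n) (real (Suc n))) (at_right (real (Suc n)))"
      using cY1[of "Suc n"] unfolding continuous_on_def by (metis atLeastAtMost_iff at_within_Icc_at_right less_add_one less_imp_le order_refl)
    then have "(y1 \<longlongrightarrow> Y1 (Suc n) (real (Suc n))) (at_right (real (Suc n)))"
      by (rule Lim_transform_eventually) (use Y1y[of _ "Suc n"] in \<open>auto simp: eventually_at_right_field intro!: exI[of _ "real (Suc n) + 1"]\<close>)
    then have "(y1 \<longlongrightarrow> Y1 (Suc n) (real n + 1)) (at_right (real n + 1))" unfolding S .
    then have "Y1 (Suc n) (real n + 1) = of_real (1 / sqrt (real b)) * u1 n"
      using u1(2)[of n] tendsto_unique[OF trivial_limit_at_right_real] by blast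
    then show ?thesis using e by simp
  qed
  have fam: "family b V lam Y Y1"
    unfolding family_def using acY acY1 j0 j1 by (simp add: g_def[abs_def])
  let ?a = "\<lambda>n. LINT t|lebesgue_on (cell (Suc n)). (cmod (y2 t))\<^sup>2 + (cmod (y t))\<^sup>2"
  \<comment> \<open>The cell norms are the terms of a convergent series, hence bounded; this
    provides \<open>C\<close>.\<close>
  from dsum have "?a \<longlonglongrightarrow> 0" by (rule summable_LIMSEQ_zero)
  then have "Bseq ?a" by (intro convergent_imp_Bseq) (auto simp: convergent_def)
  then obtain C where C: "C > 0" "\<And>n. norm (?a n) \<le> C" by (auto simp: Bseq_def)
  have I: "integral {real n..real n + 1} (\<lambda>t. (cmod (Y n t))\<^sup>2) \<le> C" for n
  proof -
    have cell: "cell (Suc n) = {real n<..<real n + 1}" by (auto simp: cell_def)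
    have c: "bdd_meas (real n) (real n + 1) (\<lambda>t. (cmod (Y n t))\<^sup>2)" by (intro bdd_meas_continuous continuous_intros contY)
    have iy: "integrable (lebesgue_on (cell (Suc n))) (\<lambda>t. (cmod (y t))\<^sup>2)" "integrable (lebesgue_on (cell (Suc n))) (\<lambda>t. (cmod (y2 t))\<^sup>2)"
      unfolding cell using H[of n] by (auto simp: H2_derivs_def L2_def)
    have "integral {real n..real n + 1} (\<lambda>t. (cmod (Y n t))\<^sup>2) = (LINT t|lebesgue_on (cell (Suc n)). (cmod (y t))\<^sup>2)"
      unfolding cell by (rule lebesgue_on_open_interval(3)[symmetric, OF c]) (simp add: Yy)
    also have "\<dots> \<le> ?a n" by (rule integral_mono) (use iy in auto)
    also have "\<dots> \<le> C" using C(2)[of n] by simp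
    finally show ?thesis .
  qed
  have "Y 0 0 = 0" by (simp add: Y_def R_def)
  then show ?thesis using fam Yy C(1) I by (intro exI[of _ Y] exI[of _ Y1] exI[of _ C]) auto
qed

text \<open>Uniqueness of the initial value problem comes from Wronskians with the two solutions
  started at the angles 0 and \<pi>/2. As kernel elements vanish at 0, they are multiples of the
  first, with the derivative at 0 as factor. The other two conclusions are the tests by which this
  factor is shown to vanish.\<close>

lemma kernel_multiple:
  assumes y: "y \<in> kernel_minus (operator_A b V) (\<mu>\<^sup>2)" and V: "potential V" and b: "b \<ge> 1" and \<mu>: "\<mu> > 0"
  shows "\<exists>c. (\<forall>n. \<forall>t\<in>{real n<..<real n + 1}. y t = c * of_real (prufer_y b l V \<mu> 0 n t)) \<and>
    (c \<noteq> 0 \<longrightarrow> (\<exists>C\<ge>0. \<forall>n. integral {real n..real n + 1} (\<lambda>t. (prufer_y b l V \<mu> 0 n t)\<^sup>2) \<le> C)) \<and>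
    (\<forall>w w1. family b V (\<mu>\<^sup>2) w w1 \<longrightarrow> decfam w w1 \<longrightarrow> c * of_real (w 0 0) = 0)"
proof -
  obtain Y Y1 C where Y: "family b V (\<mu>\<^sup>2) Y Y1" "Y 0 0 = 0" "\<And>n t. t \<in> {real n<..<real n + 1} \<Longrightarrow> Y n t = y t"
    "C \<ge> 0" "\<And>n. integral {real n..real n + 1} (\<lambda>t. (cmod (Y n t))\<^sup>2) \<le> C"
    using kernel_family[OF y V b] by blast
  define c where "c = Y1 0 0"
  let ?u = "\<lambda>n t. complex_of_real (prufer_y b l V \<mu> 0 n t)" and ?u1 = "\<lambda>n t. complex_of_real (prufer_y1 b l V \<mu> 0 n t)"
  let ?v = "\<lambda>n t. complex_of_real (prufer_y b l V \<mu> (pi/2) n t)" and ?v1 = "\<lambda>n t. complex_of_real (prufer_y1 b l V \<mu> (pi/2) n t)"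
  have fu: "family b V (\<mu>\<^sup>2) ?u ?u1" and fv: "family b V (\<mu>\<^sup>2) ?v ?v1"
    by (intro of_real_family prufer_y_family V \<mu> b)+
  have Ycu: "Y n t = c * ?u n t" if t: "t \<in> {real n..real n + 1}" for n t
  proof -
    have 1: "?u1 n t * Y n t - ?u n t * Y1 n t = 0"
      using wronskian_const[OF Y(1) fu b t] Y(2) by (simp add: prufer_y_start[OF V \<mu>])
    have 2: "?v1 n t * Y n t - ?v n t * Y1 n t = - c / of_real \<mu>"
      using wronskian_const[OF Y(1) fv b t] Y(2) by (simp add: prufer_y_start[OF V \<mu>] c_def)
    have 3: "?v1 n t * ?u n t - ?v n t * ?u1 n t = - 1 / of_real \<mu>"
      using wronskian_const[OF fu fv b t] by (simp add: prufer_y_start[OF V \<mu>])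
    \<comment> \<open>Cramer's rule: the value of \<open>Y\<close> is recovered from three
      Wronskians, all of them constant.\<close>
    have "Y n t * (?v1 n t * ?u n t - ?v n t * ?u1 n t) = ?u n t * (?v1 n t * Y n t - ?v n t * Y1 n t) - ?v n t * (?u1 n t * Y n t - ?u n t * Y1 n t)"
      by (simp add: algebra_simps)
    then have "Y n t * (- 1 / of_real \<mu>) = ?u n t * (- c / of_real \<mu>)" unfolding 1 2 3 by simp
    then show ?thesis using \<mu> by (simp add: field_simps)
  qed
  show ?thesis
  proof (intro exI[of _ c] conjI allI ballI impI)
    show "y t = c * ?u n t" if "t \<in> {real n<..<real n + 1}" for n t
      using Y(3)[OF that] Ycu[of t n] that by simp
    show "\<exists>C\<ge>0. \<forall>n. integral {real n..real n + 1} (\<lambda>t. (prufer_y b l V \<mu> 0 n t)\<^sup>2) \<le> C" if "c \<noteq> 0"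
    proof (intro exI[of _ "C / (cmod c)\<^sup>2"] conjI allI)
      show "C / (cmod c)\<^sup>2 \<ge> 0" using Y(4) by simp
      fix n
      have "integral {real n..real n + 1} (\<lambda>t. (cmod (Y n t))\<^sup>2) = integral {real n..real n + 1} (\<lambda>t. (cmod c)\<^sup>2 * (prufer_y b l V \<mu> 0 n t)\<^sup>2)"
        by (rule Henstock_Kurzweil_Integration.integral_cong) (simp add: Ycu norm_mult power_mult_distrib)
      then have "(cmod c)\<^sup>2 * integral {real n..real n + 1} (\<lambda>t. (prufer_y b l V \<mu> 0 n t)\<^sup>2) \<le> C" using Y(5)[of n] by simp
      then show "integral {real n..real n + 1} (\<lambda>t. (prufer_y b l V \<mu> 0 n t)\<^sup>2) \<le> C / (cmod c)\<^sup>2"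
        using that by (simp add: field_simps)
    qed
    show "c * of_real (w 0 0) = 0" if "family b V (\<mu>\<^sup>2) w w1" "decfam w w1" for w w1
      using L2_wronskian[OF Y(1) Y(5) Y(4) that b] Y(2) by (simp add: c_def mult.commute)
  qed
qed

section \<open>Dimension modulo null functions, and the kernel\<close>

lemma AE_cells:
  assumes "\<And>n t. t \<in> {real n<..<real n + 1} \<Longrightarrow> P t"
  shows "AE t in lebesgue_on {0..}. P t"
proof -
  have "range real \<in> null_sets lebesgue"
    by (intro null_sets_completionI countable_imp_null_set_lborel) simp
  then have "AE t in lebesgue. t \<notin> range real" by (rule AE_not_in)
  then have "AE t in lebesgue. t \<in> {0..} \<longrightarrow> P t"
  proof eventually_elim
    fix t assume t: "t \<notin> range real"
    show "t \<in> {0..} \<longrightarrow> P t"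
    proof
      assume t0: "t \<in> {0..}"
      let ?m = "nat \<lfloor>t\<rfloor>"
      have "real ?m \<le> t" "t < real ?m + 1" using t0 by (auto simp: le_nat_floor)
      moreover have "t \<noteq> real ?m" using t by auto
      ultimately show "P t" by (intro assms[of t ?m]) auto
    qed
  qed
  then show ?thesis by (simp add: AE_restrict_space_iff)
qed

lemma L2_dim_multiples:
  assumes S: "\<And>y. y \<in> S \<Longrightarrow> \<exists>c. AE t in lebesgue_on {0..}. y t = c * U t"
  shows "L2_dim S \<le> 1"
  unfolding L2_dim_def
proof (rule SUP_least)
  fix F assume F: "F \<in> {F. F \<subseteq> S \<and> L2_independent F}"
  then have fin: "finite F" and ind: "\<And>c f. (AE t in lebesgue_on {0..}. (\<Sum>f\<in>F. c f * f t) = 0) \<Longrightarrow> f \<in> F \<Longrightarrow> c f = 0"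
    unfolding L2_independent_def by blast+
  have "f = g" if fg: "f \<in> F" "g \<in> F" for f g
  proof (rule ccontr)
    assume ne: "f \<noteq> g"
    obtain a where a: "AE t in lebesgue_on {0..}. f t = a * U t" using S[of f] fg F by auto
    obtain d where d: "AE t in lebesgue_on {0..}. g t = d * U t" using S[of g] fg F by auto
    \<comment> \<open>The relation d f - a g = 0; if a = 0 it could be trivial, and then f = 0
      itself serves as the relation.\<close>
    define c where "c h = (if h = f then (if a = 0 then 1 else d) else if h = g then - a else 0)" for h
    have "AE t in lebesgue_on {0..}. (\<Sum>h\<in>F. c h * h t) = 0"
      using a d
    proof eventually_elim
      fix t assume t: "f t = a * U t" "g t = d * U t"
      have "(\<Sum>h\<in>F. c h * h t) = (\<Sum>h\<in>{f, g}. c h * h t)"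
        by (rule sum.mono_neutral_right) (use fin fg in \<open>auto simp: c_def\<close>)
      also have "\<dots> = c f * f t + c g * g t" using ne by simp
      also have "\<dots> = 0" using ne t by (simp add: c_def)
      finally show "(\<Sum>h\<in>F. c h * h t) = 0" .
    qed
    then have "c f = 0" "c g = 0" using ind fg by blast+
    then show False using ne by (auto simp: c_def split: if_splits)
  qed
  then have "card F \<le> 1" using fin by (metis One_nat_def card_le_Suc0_iff_eq)
  then show "of_nat (card F) \<le> (1 :: ennreal)" by (metis of_nat_1 of_nat_mono)
qed

lemma L2_dim_zero:
  assumes S: "\<And>y. y \<in> S \<Longrightarrow> AE t in lebesgue_on {0..}. y t = 0"
  shows "L2_dim S = 0"
proof -
  have *: "F = {}" if F: "F \<subseteq> S" "L2_independent F" for F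
  proof (rule ccontr)
    assume "F \<noteq> {}"
    then obtain f where f: "f \<in> F" by auto
    have fin: "finite F" and ind: "\<And>c f. (AE t in lebesgue_on {0..}. (\<Sum>f\<in>F. c f * f t) = 0) \<Longrightarrow> f \<in> F \<Longrightarrow> c f = 0"
      using F(2) unfolding L2_independent_def by blast+
    let ?c = "\<lambda>h. if h = f then 1 else 0 :: complex"
    have "AE t in lebesgue_on {0..}. f t = 0" using S f F by auto
    then have "AE t in lebesgue_on {0..}. (\<Sum>h\<in>F. ?c h * h t) = 0"
      by eventually_elim (use fin f in \<open>simp add: if_distrib[of "\<lambda>x. x * _"] sum.delta cong: if_cong\<close>)
    from ind[OF this f] show False by simp
  qed
  have "L2_dim S \<le> 0" unfolding L2_dim_def
  proof (rule SUP_least)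
    fix F assume "F \<in> {F. F \<subseteq> S \<and> L2_independent F}"
    then have "F = {}" using * by blast
    then show "of_nat (card F) \<le> (0::ennreal)" by simp
  qed
  then show ?thesis by simp
qed

lemma L2_dim_pos:
  assumes "y \<in> S" "\<not> (AE t in lebesgue_on {0..}. y t = 0)"
  shows "L2_dim S \<ge> 1"
proof -
  have "L2_independent {y}" unfolding L2_independent_def
  proof (intro conjI allI impI ballI)
    fix c :: "(real \<Rightarrow> complex) \<Rightarrow> complex" and f
    assume A: "AE t in lebesgue_on {0..}. (\<Sum>f\<in>{y}. c f * f t) = 0" "f \<in> {y}"
    show "c f = 0"
    proof (rule ccontr)
      assume "c f \<noteq> 0"
      then have "AE t in lebesgue_on {0..}. y t = 0" using A by auto
      then show False using assms(2) by simp
    qed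
  qed simp
  then have "of_nat (card {y}) \<le> L2_dim S" unfolding L2_dim_def using assms(1) by (intro SUP_upper) auto
  then show ?thesis by simp
qed

text \<open>By continuity the solution would vanish on the whole first cell, and so would its
  derivative; at 0 this gives cos a = 0 next to sin a = 0.\<close>

lemma prufer_y_nonzero:
  assumes V: "potential V" and \<mu>: "\<mu> > 0" and b: "b \<ge> 1" and s: "sin a = 0"
  shows "\<not> (AE t in lebesgue_on {0..}. complex_of_real (prufer_y b l V \<mu> a (nat \<lfloor>t\<rfloor>) t) = 0)"
proof
  assume AE: "AE t in lebesgue_on {0..}. complex_of_real (prufer_y b l V \<mu> a (nat \<lfloor>t\<rfloor>) t) = 0"
  let ?w = "prufer_y b l V \<mu> a 0" and ?w1 = "prufer_y1 b l V \<mu> a 0"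
  have ac: "ac_on 0 1 ?w ?w1" "ac_on 0 1 ?w1 (\<lambda>t. (V t - \<mu>\<^sup>2) * ?w t)"
  proof -
    have "ac_on (real 0) (real 0 + 1) ?w ?w1 \<and> ac_on (real 0) (real 0 + 1) ?w1 (\<lambda>t. of_real (V t - \<mu>\<^sup>2) * ?w t)"
      using prufer_y_family[OF V \<mu> b, of l a] unfolding family_def by blast
    then show "ac_on 0 1 ?w ?w1" "ac_on 0 1 ?w1 (\<lambda>t. (V t - \<mu>\<^sup>2) * ?w t)" by simp_all
  qed
  have "AE t in lebesgue. t \<in> {0..} \<longrightarrow> prufer_y b l V \<mu> a (nat \<lfloor>t\<rfloor>) t = 0"
    using AE by (simp add: AE_restrict_space_iff)
  then obtain N where N: "N \<in> null_sets lebesgue" "{t \<in> space lebesgue. \<not> (t \<in> {0..} \<longrightarrow> prufer_y b l V \<mu> a (nat \<lfloor>t\<rfloor>) t = 0)} \<subseteq> N"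
    unfolding eventually_ae_filter by blast
  \<comment> \<open>The point 1 is added to the null set because the floor already selects the next
    cell there.\<close>
  have neg: "negligible (N \<union> {1})" using N(1) by (simp add: negligible_iff_null_sets)
  have "integral {0..1} (\<lambda>t. (?w t)\<^sup>2) = integral {0..1::real} (\<lambda>_. 0)"
  proof (rule Henstock_Kurzweil_Integration.integral_spike[OF neg, of "{0..1}" "\<lambda>_. 0" "\<lambda>t. (?w t)\<^sup>2"])
    fix t assume t: "t \<in> {0..1} - (N \<union> {1::real})"
    then have "nat \<lfloor>t\<rfloor> = 0" using floor_cell[of t 0] by auto
    then show "0 = (?w t)\<^sup>2" using N(2) t by auto
  qed
  then have "integral {0..1} (\<lambda>t. (?w t)\<^sup>2) = 0" by simp
  then have z: "\<forall>t\<in>{0..1}. (?w t)\<^sup>2 = 0"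
    using integral_eq_0_iff[of 0 1 "\<lambda>t. (?w t)\<^sup>2"] ac_on_continuous[OF ac(1)] by (auto intro!: continuous_intros)
  have "?w1 t = 0" if t: "t \<in> {0<..<1}" for t
  proof -
    have "(?w has_vector_derivative ?w1 t) (at t)"
      by (rule ac_on_vector_derivative[OF ac(1) ac_on_continuous[OF ac(2)] t])
    moreover have "(?w has_vector_derivative 0) (at t)"
      by (rule has_vector_derivative_transform_within_open[OF has_vector_derivative_const, where S="{0<..<1}"]) (use t z in auto)
    ultimately show ?thesis by (rule vector_derivative_unique_at)
  qed
  moreover have "continuous_on (closure {0<..<1::real}) ?w1" using ac_on_continuous[OF ac(2)] by simp
  ultimately have "?w1 0 = 0"
    using continuous_constant_on_closure[of "{0<..<1::real}" ?w1 0 0] by simp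
  then have "cos a = 0" by (simp add: prufer_y_start[OF V \<mu>])
  then show False using s sin_cos_squared_add[of a] by simp
qed

text \<open>The solution started at the Weyl angle decays. If it vanishes at 0, it lies in the
  kernel; otherwise its Wronskian with a kernel element c u is 0 and forces c = 0.\<close>

lemma kernel_dim:
  assumes g: "in_gap b l \<mu>" and V: "potential V" and \<kappa>: "\<kappa> > 0" and dec: "expdec \<kappa> V"
    and strict: "\<bar>\<mu> - pi * real l\<bar> < tree_theta b" 
  shows "L2_dim (kernel_minus (operator_A b V) (\<mu>\<^sup>2)) = (if sin (weyl b l V \<mu>) = 0 then 1 else 0)"
proof -
  have \<mu>: "\<mu> > 0" and b: "b \<ge> 1" using g by (auto simp: in_gap_def)
  let ?S = "weyl b l V \<mu>" and ?K = "kernel_minus (operator_A b V) (\<mu>\<^sup>2)"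
  have fw: "family b V (\<mu>\<^sup>2) (prufer_y b l V \<mu> ?S) (prufer_y1 b l V \<mu> ?S)" by (intro prufer_y_family V \<mu> b)
  have dw: "decfam (prufer_y b l V \<mu> ?S) (prufer_y1 b l V \<mu> ?S)"
    by (rule orbit_decfam[OF g V \<kappa> dec strict expdec_weyl(2)[OF g V \<kappa> dec]])
  let ?U = "\<lambda>t. complex_of_real (prufer_y b l V \<mu> 0 (nat \<lfloor>t\<rfloor>) t)"
  have mult: "\<exists>c. (AE t in lebesgue_on {0..}. y t = c * ?U t) \<and> c * of_real (sin ?S) = 0" if y: "y \<in> ?K" for y
  proof -
    obtain c where c: "\<And>n t. t \<in> {real n<..<real n + 1} \<Longrightarrow> y t = c * of_real (prufer_y b l V \<mu> 0 n t)"
      "c * of_real (prufer_y b l V \<mu> ?S 0 0) = 0"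
      using kernel_multiple[OF y V b \<mu>, of l] fw dw by blast
    have "AE t in lebesgue_on {0..}. y t = c * ?U t"
    proof (rule AE_cells)
      fix n t assume t: "t \<in> {real n<..<real n + 1}"
      then have "nat \<lfloor>t\<rfloor> = n" by (intro floor_cell) auto
      then show "y t = c * ?U t" using c(1)[OF t] by simp
    qed
    moreover have "c * of_real (sin ?S) = 0" using c(2) \<mu> by (simp add: prufer_y_start[OF V \<mu>])
    ultimately show ?thesis by blast
  qed
  show ?thesis
  proof (cases "sin ?S = 0")
    case True
    have "L2_dim ?K \<le> 1" by (rule L2_dim_multiples[of _ ?U]) (use mult in blast)
    moreover have "L2_dim ?K \<ge> 1"
      by (rule L2_dim_pos[OF family_kernel[OF fw dw _ V b] prufer_y_nonzero[OF V \<mu> b True]])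
        (simp add: prufer_y_start[OF V \<mu>] True)
    ultimately show ?thesis using True by simp
  next
    case False
    have "L2_dim ?K = 0"
    proof (rule L2_dim_zero)
      fix y assume "y \<in> ?K"
      then obtain c where c: "AE t in lebesgue_on {0..}. y t = c * ?U t" "c * of_real (sin ?S) = 0" using mult by blast
      then have "c = 0" using False by simp
      then show "AE t in lebesgue_on {0..}. y t = 0" using c(1) by simp
    qed
    then show ?thesis using False by simp
  qed
qed

lemma expdec_scale:
  assumes "expdec \<kappa> V" "0 \<le> c" shows "expdec \<kappa> (\<lambda>t. c * V t)"
proof -
  obtain C where C: "C \<ge> 0" "\<And>t. t \<ge> 0 \<Longrightarrow> V t \<le> C * exp (- 2 * \<kappa> * t)" using assms(1) by (auto simp: expdec_def)
  show ?thesis unfolding expdec_def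
  proof (intro exI[of _ "c * C"] conjI allI impI)
    show "c * C \<ge> 0" using C assms by simp
    fix t :: real assume "t \<ge> 0"
    then show "c * V t \<le> c * C * exp (- 2 * \<kappa> * t)" using mult_left_mono[OF C(2) assms(2)] by (simp add: mult.assoc)
  qed
qed

lemma weylset_iff:
  assumes "in_gap b l \<mu>" "potential V" "weylset b l V \<mu> \<noteq> {}"
  shows "a \<in> weylset b l V \<mu> \<longleftrightarrow> weyl b l V \<mu> \<le> a"
proof
  assume "weyl b l V \<mu> \<le> a"
  then show "a \<in> weylset b l V \<mu>"
    by (intro weylset_mono[OF assms(1) assms(1) assms(2) assms(2) _ _ weyl_in_weylset[OF assms]]) auto
qed (rule weyl_le)

subsection \<open>Eigenvalue counts through the Weyl angle\<close>

text \<open>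
  Below \<open>weyl\<close> an orbit falls under \<open>wfix\<close> after finitely many steps, and above it an orbit passes the
  barrier, since two decaying solutions would have Wronskian zero; both are open conditions in \<open>\<alpha>\<close>.
\<close>

lemma continuous_weyl:
  assumes g: "in_gap b l \<mu>" and V: "potential V" and \<kappa>: "\<kappa> > 0" and dec: "expdec \<kappa> V"
    and strict: "\<bar>\<mu> - pi * real l\<bar> < tree_theta b" 
  shows "continuous_on {0..1} (\<lambda>\<alpha>. weyl b l (\<lambda>t. \<alpha> * V t) \<mu>)"
  unfolding continuous_on_def
proof
  fix \<alpha>0 :: real assume \<alpha>0: "\<alpha>0 \<in> {0..1}"
  let ?S = "\<lambda>\<alpha>. weyl b l (\<lambda>t. \<alpha> * V t) \<mu>" and ?F = "at \<alpha>0 within {0..1}"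
  have \<mu>: "\<mu> > 0" and b: "b \<ge> 1" using g by (auto simp: in_gap_def)
  have pV: "potential (\<lambda>t. \<alpha> * V t)" and dV: "expdec \<kappa> (\<lambda>t. \<alpha> * V t)" if "\<alpha> \<in> {0..1}" for \<alpha>
    using that potential_scale[OF V] expdec_scale[OF dec] by auto
  note W = expdec_weyl[OF g pV \<kappa> dV]
  have cont: "((\<lambda>\<alpha>. orbit b l (\<lambda>t. \<alpha> * V t) \<mu> a n) \<longlongrightarrow> orbit b l (\<lambda>t. \<alpha>0 * V t) \<mu> a n) ?F" for a n
  proof -
    obtain K where K: "K \<ge> 0" "\<forall>\<alpha>\<in>{0..1}. \<forall>\<beta>\<in>{0..1}. \<forall>x y.
      \<bar>orbit b l (\<lambda>t. \<alpha> * V t) \<mu> x n - orbit b l (\<lambda>t. \<beta> * V t) \<mu> y n\<bar> \<le> K * (\<bar>x - y\<bar> + \<bar>\<alpha> - \<beta>\<bar>)"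
      using orbit_Lipschitz[OF b V \<mu>, of l n] by blast
    have "K-lipschitz_on {0..1} (\<lambda>\<alpha>. orbit b l (\<lambda>t. \<alpha> * V t) \<mu> a n)"
    proof (rule lipschitz_onI)
      fix x y :: real assume "x \<in> {0..1}" "y \<in> {0..1}"
      then show "dist (orbit b l (\<lambda>t. x * V t) \<mu> a n) (orbit b l (\<lambda>t. y * V t) \<mu> a n) \<le> K * dist x y"
        using K(2)[rule_format, of x y a a] by (simp add: dist_real_def)
    qed fact
    then have "continuous_on {0..1} (\<lambda>\<alpha>. orbit b l (\<lambda>t. \<alpha> * V t) \<mu> a n)" by (rule lipschitz_on_continuous_on)
    then show ?thesis using \<alpha>0 by (auto simp: continuous_on_def)
  qed
  have evF: "\<forall>\<^sub>F \<alpha> in ?F. \<alpha> \<in> {0..1}" by (simp add: eventually_at_filter)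
  show "(?S \<longlongrightarrow> ?S \<alpha>0) ?F"
  proof (rule order_tendstoI)
    fix a assume "a < ?S \<alpha>0"
    then obtain a' where a': "a < a'" "a' < ?S \<alpha>0" using dense by blast
    then have "a' \<notin> weylset b l (\<lambda>t. \<alpha>0 * V t) \<mu>" using weyl_le[of a' b l "\<lambda>t. \<alpha>0 * V t" \<mu>] by fastforce
    then obtain n where n: "orbit b l (\<lambda>t. \<alpha>0 * V t) \<mu> a' n < wfix b l \<mu>" by (auto simp: weylset_def not_le)
    have "\<forall>\<^sub>F \<alpha> in ?F. orbit b l (\<lambda>t. \<alpha> * V t) \<mu> a' n < wfix b l \<mu>"
      by (rule order_tendstoD(2)[OF cont n])
    then show "\<forall>\<^sub>F \<alpha> in ?F. a < ?S \<alpha>" using evF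
    proof eventually_elim
      fix \<alpha> assume A: "orbit b l (\<lambda>t. \<alpha> * V t) \<mu> a' n < wfix b l \<mu>" "\<alpha> \<in> {0..1::real}"
      then have "a' \<notin> weylset b l (\<lambda>t. \<alpha> * V t) \<mu>" unfolding weylset_def by (auto simp: not_le intro!: exI[of _ n])
      then have "a' < ?S \<alpha>" using weylset_iff[OF g pV W(1)] A(2) by (metis not_le)
      then show "a < ?S \<alpha>" using a' by simp
    qed
  next
    fix a assume "?S \<alpha>0 < a"
    \<comment> \<open>Staying less than \<pi> above the threshold makes the sine of the difference
      positive, so \<open>weyl_unique\<close> excludes that the orbit of \<open>a'\<close> converges
      to the fixed angle.\<close>
    then have "?S \<alpha>0 < min a (?S \<alpha>0 + pi)" by simp
    then obtain a' where a': "?S \<alpha>0 < a'" "a' < min a (?S \<alpha>0 + pi)" using dense by blast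
    let ?X = "orbit b l (\<lambda>t. \<alpha>0 * V t) \<mu> a'" and ?s = "wfix b l \<mu>"
    have "sin (a' - ?S \<alpha>0) > 0" using a' by (intro sin_gt_zero) auto
    then have nl: "\<not> ?X \<longlonglongrightarrow> ?s"
      using weyl_unique[OF g pV[OF \<alpha>0] \<kappa> dV[OF \<alpha>0] strict _ W(2)[OF \<alpha>0 \<alpha>0]] by fastforce
    have ge: "?s \<le> ?X n" for n
      using weylset_iff[OF g pV[OF \<alpha>0] W(1)[OF \<alpha>0 \<alpha>0], of a'] a' by (auto simp: weylset_def)
    obtain \<eta> where \<eta>: "\<eta> > 0" "\<And>N. \<exists>n\<ge>N. \<bar>?X n - ?s\<bar> \<ge> \<eta>"
      using nl unfolding LIMSEQ_iff by (auto simp: not_less)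
    \<comment> \<open>The barrier built for \<open>V\<close> itself, that is for \<alpha> = 1,
      remains one for all smaller couplings and hence does not depend on \<alpha>.\<close>
    obtain n0 A where A: "A \<ge> 0" and B: "barrier b l V \<mu> n0 (\<lambda>n. ?s + A * exp (- 2 * \<kappa> * (real n - real n0)))"
      using expdec_barrier[OF g V \<kappa> dec] by blast
    have "(\<lambda>n. (A * exp (2 * \<kappa> * real n0)) * exp (- 2 * \<kappa>) ^ n) \<longlonglongrightarrow> (A * exp (2 * \<kappa> * real n0)) * 0"
      using \<kappa> by (intro tendsto_intros LIMSEQ_power_zero) auto
    then have "\<forall>\<^sub>F n in sequentially. (A * exp (2 * \<kappa> * real n0)) * exp (- 2 * \<kappa>) ^ n < \<eta>"
      by (rule order_tendstoD) (use \<eta> in auto)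
    then obtain N where N: "\<And>n. n \<ge> N \<Longrightarrow> (A * exp (2 * \<kappa> * real n0)) * exp (- 2 * \<kappa>) ^ n < \<eta>" by (auto simp: eventually_sequentially)
    obtain n where n: "n \<ge> max N n0" "\<bar>?X n - ?s\<bar> \<ge> \<eta>" using \<eta>(2) by blast
    have e: "exp (- 2 * \<kappa> * (real n - real n0)) = exp (2 * \<kappa> * real n0) * exp (- 2 * \<kappa>) ^ n"
      unfolding exp_of_nat_mult[symmetric] exp_add[symmetric] by (rule arg_cong[where f=exp]) (simp add: algebra_simps)
    have lt: "?s + A * exp (- 2 * \<kappa> * (real n - real n0)) < ?X n"
      using N[of n] n ge[of n] unfolding e by (simp add: mult.assoc)
    have "\<forall>\<^sub>F \<alpha> in ?F. ?s + A * exp (- 2 * \<kappa> * (real n - real n0)) < orbit b l (\<lambda>t. \<alpha> * V t) \<mu> a' n"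
      by (rule order_tendstoD(1)[OF cont lt])
    then show "\<forall>\<^sub>F \<alpha> in ?F. ?S \<alpha> < a" using evF
    proof eventually_elim
      fix \<alpha> assume C: "?s + A * exp (- 2 * \<kappa> * (real n - real n0)) < orbit b l (\<lambda>t. \<alpha> * V t) \<mu> a' n" "\<alpha> \<in> {0..1::real}"
      have "barrier b l (\<lambda>t. \<alpha> * V t) \<mu> n0 (\<lambda>n. ?s + A * exp (- 2 * \<kappa> * (real n - real n0)))"
        by (rule barrier_antimono[OF g V pV[OF C(2)] _ B]) (use C(2) potential_nonneg[OF V] in \<open>auto intro: mult_left_le_one_le\<close>)
      then have "a' \<in> weylset b l (\<lambda>t. \<alpha> * V t) \<mu>"
        by (rule barrier_mem[OF g pV[OF C(2)]]) (use n C in auto)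
      then show "?S \<alpha> < a" using weyl_le[of a'] a' by fastforce
    qed
  qed
qed

lemma weyl_zero:
  assumes g: "in_gap b l \<mu>" shows "weyl b l (\<lambda>_. 0) \<mu> = wfix b l \<mu>"
proof -
  have \<mu>: "\<mu> > 0" and b: "b \<ge> 1" using g by (auto simp: in_gap_def)
  have "flow (\<lambda>_. 0) \<mu> n x = x + \<mu>" for n x
    using flow_bounds(1)[OF potential_zero \<mu>, of n x] flow_bounds(2)[OF potential_zero \<mu>, of n 0 x] by force
  then have B: "barrier b l (\<lambda>_. 0) \<mu> 0 (\<lambda>_. wfix b l \<mu>)"
    unfolding barrier_def using jump_wfix(1)[OF g] by simp
  have "wfix b l \<mu> \<in> weylset b l (\<lambda>_. 0) \<mu>"
    by (rule barrier_mem[OF g potential_zero B order_refl]) simp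
  then show ?thesis using weyl_le[of "wfix b l \<mu>"] wfix_le_weyl[of b l "\<lambda>_. 0" \<mu>] by (metis antisym empty_iff)
qed

text \<open>A positive lower bound on a single cell is enough: the strict gain there shows in the
  orbit at \<open>Suc n\<close>, and \<open>weyl_strict_mono\<close> carries it back to 0.\<close>

lemma weyl_strict_V:
  assumes g: "in_gap b l \<mu>" and V: "potential V" and \<kappa>: "\<kappa> > 0" and dec: "expdec \<kappa> V"
    and \<eta>: "\<eta> > 0" "\<And>t. t \<in> {real n..real n + 1} \<Longrightarrow> \<eta> \<le> V t"
    and \<alpha>: "0 \<le> \<alpha>" "\<alpha> < \<beta>"
  shows "weyl b l (\<lambda>t. \<alpha> * V t) \<mu> < weyl b l (\<lambda>t. \<beta> * V t) \<mu>"
proof (rule weyl_strict_mono[OF g g, where n="Suc n"])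
  have \<mu>: "\<mu> > 0" and b: "b \<ge> 1" using g by (auto simp: in_gap_def)
  show p: "potential (\<lambda>t. \<alpha> * V t)" "potential (\<lambda>t. \<beta> * V t)" using potential_scale[OF V] \<alpha> by auto
  show le: "\<alpha> * V t \<le> \<beta> * V t" if "t \<ge> 0" for t using \<alpha> potential_nonneg[OF V that] by (intro mult_right_mono) auto
  show "weylset b l (\<lambda>t. \<beta> * V t) \<mu> \<noteq> {}"
    by (rule expdec_weyl(1)[OF g p(2) \<kappa> expdec_scale[OF dec]]) (use \<alpha> in auto)
  fix a
  let ?u = "orbit b l (\<lambda>t. \<beta> * V t) \<mu> a n" and ?v = "orbit b l (\<lambda>t. \<alpha> * V t) \<mu> a n"
  have uv: "?u \<le> ?v" by (rule orbit_mono[OF b p(2,1) \<mu> order_refl le, where n=0]) auto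
  have "flow (\<lambda>t. \<beta> * V t) \<mu> n ?u < flow (\<lambda>t. \<alpha> * V t) \<mu> n ?u"
  proof (rule flow_strict_V[OF p(2,1) \<mu>, of "(\<beta> - \<alpha>) * \<eta>"])
    fix t assume t: "t \<in> {real n..real n + 1}"
    have "(\<beta> - \<alpha>) * \<eta> \<le> (\<beta> - \<alpha>) * V t" using \<eta>(2)[OF t] \<alpha> by (intro mult_left_mono) auto
    then show "\<alpha> * V t + (\<beta> - \<alpha>) * \<eta> \<le> \<beta> * V t" by (simp add: algebra_simps)
  qed (use \<eta> \<alpha> in auto)
  also have "\<dots> \<le> flow (\<lambda>t. \<alpha> * V t) \<mu> n ?v" by (rule flow_mono[OF p(1) p(1) \<mu> order_refl uv]) simp
  finally show "orbit b l (\<lambda>t. \<beta> * V t) \<mu> a (Suc n) < orbit b l (\<lambda>t. \<alpha> * V t) \<mu> a (Suc n)"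
    using b by (simp add: jump_strict_mono)
qed simp

lemma weyl_strict_mu:
  assumes g: "in_gap b l \<mu>1" "in_gap b l \<mu>2" and V: "potential V" and \<kappa>: "\<kappa> > 0" and dec: "expdec \<kappa> V"
    and lt: "\<mu>1 < \<mu>2"
  shows "weyl b l V \<mu>2 < weyl b l V \<mu>1"
proof (rule weyl_strict_mono[OF g V V, where n="Suc 0"])
  have \<mu>: "\<mu>1 > 0" and b: "b \<ge> 1" using g by (auto simp: in_gap_def)
  show "weylset b l V \<mu>1 \<noteq> {}" by (rule expdec_weyl(1)[OF g(1) V \<kappa> dec])
  show "orbit b l V \<mu>1 a (Suc 0) < orbit b l V \<mu>2 a (Suc 0)" for a
    using flow_strict_mu[OF V \<mu> lt, of 0 a] b by (simp add: jump_strict_mono)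
qed (use lt in auto)

section \<open>Counting multiples of pi\<close>

lemma sin_zero_floor:
  fixes x :: real
  assumes "sin x = 0" shows "x = of_int \<lfloor>x / pi\<rfloor> * pi"
proof -
  obtain i :: int where "x = of_int i * pi" using assms by (auto simp: sin_zero_iff_int2)
  then show ?thesis by simp
qed

lemma sin_of_int_pi: "sin (of_int m * pi) = (0::real)"
  by (auto simp: sin_zero_iff_int2)

lemma infsum_indicator_card:
  assumes "finite {x\<in>A. P x}"
  shows "(\<Sum>\<^sub>\<infinity>x\<in>A. if P x then 1 else 0) = (of_nat (card {x\<in>A. P x}) :: ennreal)"
proof -
  have "(\<Sum>\<^sub>\<infinity>x\<in>A. if P x then 1 else 0) = (\<Sum>\<^sub>\<infinity>x\<in>{x\<in>A. P x}. 1 :: ennreal)"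
    by (rule infsum_cong_neutral) auto
  then show ?thesis using assms by simp
qed

lemma finite_pi_interval: "finite {m::int. x < of_int m * pi \<and> of_int m * pi < y}"
proof (rule finite_subset)
  show "{m::int. x < of_int m * pi \<and> of_int m * pi < y} \<subseteq> {\<lfloor>x / pi\<rfloor>..\<lceil>y / pi\<rceil>}"
  proof
    fix m :: int assume "m \<in> {m::int. x < of_int m * pi \<and> of_int m * pi < y}"
    then have "x / pi < of_int m" "of_int m < y / pi" by (auto simp: field_simps)
    then show "m \<in> {\<lfloor>x / pi\<rfloor>..\<lceil>y / pi\<rceil>}" by (auto simp: floor_le_iff le_ceiling_iff)
  qed
qed simp

text \<open>Strict growth in \<alpha> makes the map from couplings to multiples of \<pi> injective,
  continuity makes it onto. The couplings 0 and 1 correspond to the two ends of the interval and are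
  excluded, so both inequalities are strict.\<close>

lemma counting_M_inner_eq:
  assumes g: "in_gap b l \<mu>" and V: "potential V" and \<kappa>: "\<kappa> > 0" and dec: "expdec \<kappa> V"
    and strict: "\<bar>\<mu> - pi * real l\<bar> < tree_theta b" 
    and \<eta>: "\<eta> > 0" "\<And>t. t \<in> {real n..real n + 1} \<Longrightarrow> \<eta> \<le> V t"
  shows "counting_M_inner b (\<mu>\<^sup>2) V = of_nat (card {m::int. wfix b l \<mu> < of_int m * pi \<and> of_int m * pi < weyl b l V \<mu>})"
proof -
  let ?S = "\<lambda>\<alpha>. weyl b l (\<lambda>t. \<alpha> * V t) \<mu>"
  let ?Z = "{m::int. wfix b l \<mu> < of_int m * pi \<and> of_int m * pi < weyl b l V \<mu>}"
  let ?A = "{\<alpha>\<in>{0<..<1}. sin (?S \<alpha>) = 0}"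
  have S0: "?S 0 = wfix b l \<mu>" and S1: "?S 1 = weyl b l V \<mu>" using weyl_zero[OF g] by auto
  have mono: "?S \<alpha> < ?S \<beta>" if "0 \<le> \<alpha>" "\<alpha> < \<beta>" for \<alpha> \<beta>
    by (rule weyl_strict_V[OF g V \<kappa> dec \<eta> that])
  have bij: "bij_betw (\<lambda>\<alpha>. \<lfloor>?S \<alpha> / pi\<rfloor>) ?A ?Z"
    unfolding bij_betw_def
  proof
    show "inj_on (\<lambda>\<alpha>. \<lfloor>?S \<alpha> / pi\<rfloor>) ?A"
    proof (rule inj_onI)
      fix x y assume xy: "x \<in> ?A" "y \<in> ?A" "\<lfloor>?S x / pi\<rfloor> = \<lfloor>?S y / pi\<rfloor>"
      then have "?S x = ?S y" using sin_zero_floor[of "?S x"] sin_zero_floor[of "?S y"] by auto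
      then show "x = y" using mono[of x y] mono[of y x] xy by (cases x y rule: linorder_cases) auto
    qed
    show "(\<lambda>\<alpha>. \<lfloor>?S \<alpha> / pi\<rfloor>) ` ?A = ?Z"
    proof safe
      fix \<alpha> :: real assume a: "\<alpha> \<in> {0<..<1}" "sin (?S \<alpha>) = 0"
      then have "of_int \<lfloor>?S \<alpha> / pi\<rfloor> * pi = ?S \<alpha>" using sin_zero_floor[of "?S \<alpha>"] by simp
      then show "wfix b l \<mu> < of_int \<lfloor>?S \<alpha> / pi\<rfloor> * pi" "of_int \<lfloor>?S \<alpha> / pi\<rfloor> * pi < weyl b l V \<mu>"
        using mono[of 0 \<alpha>] mono[of \<alpha> 1] a S0 S1 by auto
    next
      fix m :: int assume m: "wfix b l \<mu> < of_int m * pi" "of_int m * pi < weyl b l V \<mu>"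
      have "\<exists>\<alpha>\<ge>0. \<alpha> \<le> 1 \<and> ?S \<alpha> = of_int m * pi"
        by (rule IVT'[OF _ _ _ continuous_weyl[OF g V \<kappa> dec strict]]) (use m S0 S1 in auto)
      then obtain \<alpha> where \<alpha>: "0 \<le> \<alpha>" "\<alpha> \<le> 1" "?S \<alpha> = of_int m * pi" by blast
      have "\<alpha> \<noteq> 0" "\<alpha> \<noteq> 1" using \<alpha> m S0 S1 by auto
      then have "\<alpha> \<in> ?A" using \<alpha> sin_of_int_pi[of m] by auto
      moreover have "\<lfloor>?S \<alpha> / pi\<rfloor> = m" using \<alpha>(3) by simp
      ultimately show "m \<in> (\<lambda>\<alpha>. \<lfloor>?S \<alpha> / pi\<rfloor>) ` ?A" by (metis (no_types, lifting) image_eqI)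
    qed
  qed
  have fin: "finite ?A" using bij_betw_finite[OF bij] finite_pi_interval by blast
  have "counting_M_inner b (\<mu>\<^sup>2) V = (\<Sum>\<^sub>\<infinity>\<alpha>\<in>{0<..<1}. if sin (?S \<alpha>) = 0 then 1 else 0)"
    unfolding counting_M_inner_def
  proof (rule infsum_cong)
    fix \<alpha> :: real assume "\<alpha> \<in> {0<..<1}"
    then show "L2_dim (kernel_minus (operator_A b (\<lambda>t. \<alpha> * V t)) (\<mu>\<^sup>2)) = (if sin (?S \<alpha>) = 0 then 1 else 0)"
      by (intro kernel_dim[OF g _ \<kappa> _ strict] potential_scale[OF V] expdec_scale[OF dec]) auto
  qed
  also have "\<dots> = of_nat (card ?A)" by (rule infsum_indicator_card[OF fin])
  finally show ?thesis using bij_betw_same_card[OF bij] by simp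
qed

text \<open>For an upper bound injectivity suffices, and strict monotonicity of the Weyl angle in
  \<mu> provides it.\<close>

lemma counting_N_le:
  assumes V: "potential V" and \<kappa>: "\<kappa> > 0" and dec: "expdec \<kappa> V"
    and G: "\<And>lam. lam \<in> {lam1<..<lam2} \<Longrightarrow> lam > 0 \<and> in_gap b l (sqrt lam) \<and> \<bar>sqrt lam - pi * real l\<bar> < tree_theta b"
    and bd: "\<And>lam. lam \<in> {lam1<..<lam2} \<Longrightarrow> lo < weyl b l V (sqrt lam) \<and> weyl b l V (sqrt lam) < hi"
  shows "counting_N b lam1 lam2 V \<le> of_nat (card {m::int. lo < of_int m * pi \<and> of_int m * pi < hi})"
proof -
  let ?S = "\<lambda>lam. weyl b l V (sqrt lam)"
  let ?Z = "{m::int. lo < of_int m * pi \<and> of_int m * pi < hi}"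
  let ?A = "{lam\<in>{lam1<..<lam2}. sin (?S lam) = 0}"
  have inj: "inj_on (\<lambda>lam. \<lfloor>?S lam / pi\<rfloor>) ?A"
  proof (rule inj_onI)
    fix x y assume xy: "x \<in> ?A" "y \<in> ?A" "\<lfloor>?S x / pi\<rfloor> = \<lfloor>?S y / pi\<rfloor>"
    then have e: "?S x = ?S y" using sin_zero_floor[of "?S x"] sin_zero_floor[of "?S y"] by auto
    show "x = y"
    proof (rule ccontr)
      assume "x \<noteq> y"
      then consider "sqrt x < sqrt y" | "sqrt y < sqrt x" by fastforce
      then show False
        using weyl_strict_mu[of b l "sqrt x" "sqrt y", OF _ _ V \<kappa> dec] weyl_strict_mu[of b l "sqrt y" "sqrt x", OF _ _ V \<kappa> dec]
          G[of x] G[of y] xy e by cases auto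
    qed
  qed
  have sub: "(\<lambda>lam. \<lfloor>?S lam / pi\<rfloor>) ` ?A \<subseteq> ?Z"
  proof safe
    fix lam assume a: "lam \<in> {lam1<..<lam2}" "sin (?S lam) = 0"
    then have "of_int \<lfloor>?S lam / pi\<rfloor> * pi = ?S lam" using sin_zero_floor[of "?S lam"] by simp
    then show "lo < of_int \<lfloor>?S lam / pi\<rfloor> * pi" "of_int \<lfloor>?S lam / pi\<rfloor> * pi < hi" using bd[OF a(1)] by auto
  qed
  have finZ: "finite ?Z" by (rule finite_pi_interval)
  have fin: "finite ?A" by (rule finite_imageD[OF finite_subset[OF sub finZ] inj])
  have "counting_N b lam1 lam2 V = (\<Sum>\<^sub>\<infinity>lam\<in>{lam1<..<lam2}. if sin (?S lam) = 0 then 1 else 0)"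
    unfolding counting_N_def
  proof (rule infsum_cong)
    fix lam assume lam: "lam \<in> {lam1<..<lam2}"
    have "L2_dim (kernel_minus (operator_A b V) ((sqrt lam)\<^sup>2)) = (if sin (?S lam) = 0 then 1 else 0)"
      using G[OF lam] by (intro kernel_dim[OF _ V \<kappa> dec]) auto
    then show "L2_dim (kernel_minus (operator_A b V) lam) = (if sin (?S lam) = 0 then 1 else 0)" using G[OF lam] by simp
  qed
  also have "\<dots> = of_nat (card ?A)" by (rule infsum_indicator_card[OF fin])
  also have "\<dots> \<le> of_nat (card ?Z)" by (intro of_nat_mono card_inj_on_le[OF inj sub finZ])
  finally show ?thesis .
qed

subsection \<open>Uniform bounds for the Weyl angle\<close>

text \<open>With l = 0 nothing is subtracted, so \<open>orbit b 0\<close> is the true angle and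
  records the whole rotation.\<close>

lemma orbit_shift:
  assumes "potential V" "\<mu> > 0"
  shows "orbit b 0 V \<mu> a n = orbit b l V \<mu> a n + pi * real l * real n"
proof (induction n)
  case (Suc n)
  have e: "orbit b l V \<mu> a n + pi * real l * real n = orbit b l V \<mu> a n + of_int (int (l * n)) * pi" by simp
  have "orbit b 0 V \<mu> a (Suc n) = jump b (flow V \<mu> n (orbit b l V \<mu> a n + of_int (int (l * n)) * pi))"
    using Suc e by simp
  also have "\<dots> = jump b (flow V \<mu> n (orbit b l V \<mu> a n)) + of_int (int (l * n)) * pi"
    using assms by (simp only: flow_def prufer_add_int_pi[OF assms] jump_add_int_pi atLeastAtMost_iff order_refl less_add_one less_imp_le)
  finally show ?case by (simp add: algebra_simps)
qed simp

lemma orbit0_nonneg: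
  assumes "b \<ge> 1" "potential V" "\<mu> > 0" shows "orbit b 0 V \<mu> 0 n \<ge> 0"
proof (induction n)
  case (Suc n)
  have "flow V \<mu> n (orbit b 0 V \<mu> 0 n) \<ge> 0" unfolding flow_def using assms Suc by (intro prufer_nonneg) auto
  then have "jump b 0 \<le> jump b (flow V \<mu> n (orbit b 0 V \<mu> 0 n))" using assms by (intro jump_mono) auto
  then show ?case by (simp add: jump_0)
qed simp

text \<open>
  On cells where $V\<ge>\<mu>^2$ the angle cannot pass an odd multiple of $\<pi>/2$ upwards, so only the
  remaining cells contribute.
\<close>

lemma orbit0_upper:
  assumes b: "b \<ge> 1" and V: "potential V" and \<mu>: "\<mu> > 0" and L: "\<mu> + pi/2 \<le> of_int L * pi"
  shows "orbit b 0 V \<mu> 0 n \<le> pi/2 + of_int (L * int (card {j\<in>{..<n}. \<not> (\<forall>t\<in>{real j..real j + 1}. \<mu>\<^sup>2 \<le> V t)})) * pi"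
proof (induction n)
  case (Suc n)
  let ?B = "\<lambda>j. \<forall>t\<in>{real j..real j + 1}. \<mu>\<^sup>2 \<le> V t"
  let ?c = "\<lambda>n. int (card {j\<in>{..<n}. \<not> ?B j})"
  let ?x = "orbit b 0 V \<mu> 0 n"
  show ?case
  proof (cases "?B n")
    case True
    then have "{j\<in>{..<Suc n}. \<not> ?B j} = {j\<in>{..<n}. \<not> ?B j}" by (auto simp: less_Suc_eq)
    moreover have "flow V \<mu> n ?x \<le> pi/2 + of_int (L * ?c n) * pi"
      by (rule flow_barrier[OF V \<mu> _ Suc]) (use True in auto)
    then have "jump b (flow V \<mu> n ?x) \<le> jump b (pi/2 + of_int (L * ?c n) * pi)" using b by (intro jump_mono) auto
    ultimately show ?thesis by (simp add: jump_half_pi del: of_int_mult)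
  next
    case False
    then have "{j\<in>{..<Suc n}. \<not> ?B j} = insert n {j\<in>{..<n}. \<not> ?B j}" by (auto simp: less_Suc_eq)
    then have c: "?c (Suc n) = ?c n + 1" by simp
    \<comment> \<open>The cell contributes at most \<mu> and the vertex less than \<pi>/2. Rounding
      the sum up to L \<pi> keeps the bound at an odd multiple of \<pi>/2, where the next barrier
      cell can hold it.\<close>
    have "jump b (flow V \<mu> n ?x) < flow V \<mu> n ?x + pi/2" by (rule jump_bounds)
    also have "\<dots> \<le> ?x + of_int L * pi" using flow_bounds(1)[OF V \<mu>, of n ?x] L by simp
    also have "\<dots> \<le> pi/2 + of_int (L * ?c n) * pi + of_int L * pi" using Suc by simp
    also have "\<dots> = pi/2 + of_int (L * ?c (Suc n)) * pi" unfolding c by (simp add: algebra_simps)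
    finally show ?thesis by simp
  qed
qed simp

text \<open>The orbits from m \<pi> and (m + 1) \<pi> are translates of the orbit from 0, so all
  orbits rotate by the same amount up to \<pi>. That amount lies between 0 and \<open>K\<close>,
  while the unshifted angle at \<open>N\<close> is \<pi> l N up to \<pi>; this locates
  \<open>S\<close>.\<close>

lemma weyl_asymp:
  assumes b: "b \<ge> 1" and V: "potential V" and \<mu>: "\<mu> > 0" 
    and S: "\<bar>orbit b l V \<mu> S N\<bar> \<le> pi" and K: "orbit b 0 V \<mu> 0 N \<le> K"
  shows "\<bar>S - pi * real l * real N\<bar> \<le> K + 3 * pi"
proof -
  define m where "m = \<lfloor>S / pi\<rfloor>"
  have m: "of_int m * pi \<le> S" "S \<le> of_int (m + 1) * pi"
    unfolding m_def using floor_correct[of "S / pi"]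
    by (auto simp only: pos_le_divide_eq[OF pi_gt_zero] pos_divide_less_eq[OF pi_gt_zero] less_imp_le)
  let ?o = "\<lambda>a. orbit b 0 V \<mu> a N"
  have mono: "?o a \<le> ?o a'" if "a \<le> a'" for a a'
    by (rule orbit_mono[OF b V V \<mu> order_refl, where n=0]) (use that in auto)
  have "?o (of_int m * pi) = ?o 0 + of_int m * pi" "?o (of_int (m + 1) * pi) = ?o 0 + of_int (m + 1) * pi"
    using orbit_add_int_pi[OF V \<mu>, of b 0 0 m N] orbit_add_int_pi[OF V \<mu>, of b 0 0 "m + 1" N] by auto
  then have "?o 0 + of_int m * pi \<le> ?o S" "?o S \<le> ?o 0 + of_int (m + 1) * pi" using mono[OF m(1)] mono[OF m(2)] by auto
  moreover have "?o S = orbit b l V \<mu> S N + pi * real l * real N" by (rule orbit_shift[OF V \<mu>])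
  moreover have "?o 0 \<ge> 0" by (rule orbit0_nonneg[OF b V \<mu>])
  moreover have "of_int (m + 1) * pi = of_int m * pi + pi" by (simp add: algebra_simps)
  ultimately show ?thesis using m S K unfolding abs_le_iff by linarith
qed

lemma pi_interval_eq: "{m::int. x < of_int m * pi \<and> of_int m * pi < y} = {\<lfloor>x / pi\<rfloor> + 1..\<lceil>y / pi\<rceil> - 1}"
proof -
  have "x < of_int m * pi \<longleftrightarrow> \<lfloor>x / pi\<rfloor> + 1 \<le> m" for m :: int
    by (metis add1_zle_eq floor_less_iff pi_gt_zero pos_divide_less_eq)
  moreover have "of_int m * pi < y \<longleftrightarrow> m \<le> \<lceil>y / pi\<rceil> - 1" for m :: int
    by (metis less_ceiling_iff pi_gt_zero pos_less_divide_eq zle_diff1_eq)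
  ultimately show ?thesis by auto
qed

lemma card_pi_interval:
  "real (card {m::int. x < of_int m * pi \<and> of_int m * pi < y}) \<le> max 0 ((y - x) / pi + 1)"
  "real (card {m::int. x < of_int m * pi \<and> of_int m * pi < y}) \<ge> (y - x) / pi - 1"
  unfolding pi_interval_eq diff_divide_distrib by (auto simp: of_nat_nat) linarith+

lemma wfix_bounds:
  assumes "in_gap b l \<mu>" shows "\<bar>wfix b l \<mu>\<bar> < pi/2"
proof -
  let ?z = "zfix b (\<mu> - pi * real l)"
  have b: "b \<ge> 2" and z: "\<bar>?z\<bar> \<le> zstar b" using zfix(1)[of b "\<mu> - pi * real l"] assms by (auto simp: in_gap_def)
  have "\<bar>?z\<bar> < pi/2" using z zstar(2)[of b] b by simp
  then have "jump b (- (pi/2)) < jump b ?z" "jump b ?z < jump b (pi/2)" using b by (auto intro!: jump_strict_mono)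
  then show ?thesis using jump_half_pi[of b 0] unfolding jump_wfix(2)[OF assms] by (simp add: jump_minus abs_less_iff)
qed

text \<open>\<open>zfix\<close> is decreasing and vanishes at 0, so the two terms of
  \<open>wfix\<close> have the same sign. In this way the distance from the excluded point keeps the
  fixed angle away from the multiples of \<pi>.\<close>

lemma wfix_sign:
  assumes g: "in_gap b l \<mu>" and d: "d > 0"
  shows "\<mu> - pi * real l \<ge> d \<Longrightarrow> wfix b l \<mu> \<le> - d" "\<mu> - pi * real l \<le> - d \<Longrightarrow> wfix b l \<mu> \<ge> d"
proof -
  let ?\<delta> = "\<mu> - pi * real l"
  have b: "b \<ge> 2" and \<delta>: "\<bar>?\<delta>\<bar> \<le> tree_theta b" using g by (auto simp: in_gap_def)
  show "wfix b l \<mu> \<le> - d" if "?\<delta> \<ge> d"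
    using zfix_antimono[OF b, of 0 ?\<delta>] zfix_0[OF b] that d \<delta> tree_theta_bounds[OF b] by (simp add: wfix_def)
  show "wfix b l \<mu> \<ge> d" if "?\<delta> \<le> - d"
    using zfix_antimono[OF b, of ?\<delta> 0] zfix_0[OF b] that d \<delta> tree_theta_bounds[OF b] by (simp add: wfix_def)
qed

lemma potential_shift:
  assumes "potential q" "g \<ge> 0" shows "potential (\<lambda>t. g * q (t + real k))"
proof -
  have "(\<lambda>x. real k + (\<Sum>j\<in>Basis. ((1::real) * (x \<bullet> j)) *\<^sub>R j)) \<in> lebesgue \<rightarrow>\<^sub>M (lebesgue :: real measure)"
    by (rule lebesgue_affine_measurable) simp
  then have "(\<lambda>x. x + real k) \<in> lebesgue \<rightarrow>\<^sub>M (lebesgue :: real measure)" by (simp add: add.commute)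
  then have "(\<lambda>x. x + real k) \<in> lebesgue_on {0..} \<rightarrow>\<^sub>M lebesgue_on {0..}"
    by (intro measurable_restrict_space2 measurable_restrict_space1) auto
  then have m: "(\<lambda>t. q (t + real k)) \<in> borel_measurable (lebesgue_on {0..})"
    using assms(1) unfolding potential_def by (auto intro: measurable_compose)
  obtain B where "\<And>t. t \<ge> 0 \<Longrightarrow> q t \<le> B" using potential_bound[OF assms(1)] by blast
  then have "\<forall>t\<ge>0. q (t + real k) \<le> B" by auto
  then have "potential (\<lambda>t. q (t + real k))" using m assms(1) unfolding potential_def by auto
  then show ?thesis by (rule potential_scale) fact
qed

lemma expdec_shift:
  assumes q: "potential q" and \<kappa>: "\<kappa> > 0" and C: "C \<ge> 0" and R0: "R0 \<ge> 0"
    and le: "\<And>t. t \<ge> R0 \<Longrightarrow> q t \<le> C * exp (- 2 * \<kappa> * t)" and g: "g \<ge> 0"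
  shows "expdec \<kappa> (\<lambda>t. g * q (t + real k))"
proof -
  obtain B where B: "B \<ge> 0" "\<And>t. t \<ge> 0 \<Longrightarrow> q t \<le> B" using potential_bound[OF q] by blast
  \<comment> \<open>The second term of the maximum extends the decay estimate to [0, R0], where
    \<open>q\<close> is known to be bounded.\<close>
  define D where "D = max C (B * exp (2 * \<kappa> * R0))"
  have D: "D \<ge> 0" using C by (simp add: D_def)
  have qD: "q t \<le> D * exp (- 2 * \<kappa> * t)" if "t \<ge> 0" for t
  proof (cases "t \<ge> R0")
    case True
    have "C * exp (- 2 * \<kappa> * t) \<le> D * exp (- 2 * \<kappa> * t)" by (intro mult_right_mono) (auto simp: D_def)
    then show ?thesis using le[OF True] by linarith
  next
    case False
    have "q t \<le> B * 1" using B that by simp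
    also have "\<dots> \<le> B * exp (2 * \<kappa> * (R0 - t))" using False \<kappa> B by (intro mult_left_mono) auto
    also have "\<dots> = B * exp (2 * \<kappa> * R0) * exp (- 2 * \<kappa> * t)" by (simp add: exp_add[symmetric] algebra_simps)
    also have "\<dots> \<le> D * exp (- 2 * \<kappa> * t)" by (intro mult_right_mono) (auto simp: D_def)
    finally show ?thesis .
  qed
  show ?thesis unfolding expdec_def
  proof (intro exI[of _ "g * D"] conjI allI impI)
    show "g * D \<ge> 0" using g D by simp
    fix t :: real assume t: "t \<ge> 0"
    have "q (t + real k) \<le> D * exp (- 2 * \<kappa> * (t + real k))" using qD[of "t + real k"] t by simp
    also have "\<dots> \<le> D * exp (- 2 * \<kappa> * t)" using D \<kappa> by (intro mult_left_mono) auto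
    finally show "g * q (t + real k) \<le> g * D * exp (- 2 * \<kappa> * t)" using mult_left_mono[OF _ g] by (simp add: mult.assoc)
  qed
qed

text \<open>The cut \<open>m2 g\<close> is ln g/(2\<kappa>) + O(1) and at least \<open>R0\<close>;
  beyond it the potential is small enough for \<open>exp_barrier\<close> with constants independent
  of g, k and \<mu>. Before it all cells but boundedly many are barrier cells, so the orbit from 0
  turns by a bounded amount and \<open>weyl_asymp\<close> applies at the cut.\<close>

lemma weyl_uniform:
  assumes b: "b \<ge> 2" and l: "l \<ge> 1" and \<kappa>: "\<kappa> > 0" and q: "potential q" and c: "c > 0" and C: "C > 0" and R0: "R0 \<ge> 0"
    and qb: "\<And>t. t \<ge> R0 \<Longrightarrow> c * exp (- 2 * \<kappa> * t) \<le> q t \<and> q t \<le> C * exp (- 2 * \<kappa> * t)" and d: "d > 0"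
  shows "\<exists>(m2 :: real \<Rightarrow> nat) K Km. K \<ge> 0 \<and> (\<forall>g\<ge>exp 1. \<bar>real (m2 g) - ln g / (2 * \<kappa>)\<bar> \<le> Km) \<and>
    (\<forall>g\<ge>exp 1. \<forall>k. \<forall>\<mu>. in_gap b l \<mu> \<longrightarrow>
      (k < m2 g \<longrightarrow> \<bar>weyl b l (\<lambda>t. g * q (t + real k)) \<mu> - pi * real l * real (m2 g - k)\<bar> \<le> K) \<and>
      (m2 g \<le> k \<longrightarrow> weyl b l (\<lambda>t. g * q (t + real k)) \<mu> \<le> wfix b l \<mu> + min (d / 2) 1))"
proof -
  define \<tau> \<mu>lo \<mu>hi where "\<tau> = tree_theta b" and "\<mu>lo = pi * real l - \<tau>" and "\<mu>hi = pi * real l + \<tau>"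
  have \<tau>: "0 < \<tau>" "\<tau> < pi/2" using tree_theta_bounds[OF b] by (auto simp: \<tau>_def)
  have "pi * 1 \<le> pi * real l" using l by (intro mult_left_mono) auto
  then have \<mu>lo: "\<mu>lo > 0" and \<mu>hi: "\<mu>hi > 0" using \<tau> pi_gt_zero unfolding \<mu>lo_def \<mu>hi_def by linarith+
  have \<mu>r: "\<mu>lo \<le> \<mu>" "\<mu> \<le> \<mu>hi" "\<mu> > 0" if "in_gap b l \<mu>" for \<mu>
    using that by (auto simp: in_gap_def \<mu>lo_def \<mu>hi_def \<tau>_def abs_le_iff)
  define \<eta> where "\<eta> = (1 - exp (- 2 * \<kappa>)) / 2"
  have \<eta>: "\<eta> > 0" using \<kappa> by (simp add: \<eta>_def)
  \<comment> \<open>The inner minimum is the accuracy claimed for k beyond the cut; the bound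
    \<eta>/b is the first smallness condition of \<open>exp_barrier\<close>.\<close>
  define A where "A = min (min (d / 2) 1) (\<eta> / b)"
  have A: "A > 0" "A \<le> min (d / 2) 1" "A \<le> \<eta> / b" 
  proof -
    show "A > 0" using \<eta> d b by (simp add: A_def)
  qed (simp_all only: A_def min.cobounded1 min.cobounded2)
  \<comment> \<open>The second smallness condition of \<open>exp_barrier\<close>, solved for the
    size of the tail at the least \<mu> of the closed gap.\<close>
  define \<epsilon> where "\<epsilon> = \<mu>lo * A * \<eta> / b"
  have \<epsilon>: "\<epsilon> > 0" using \<mu>lo A \<eta> b by (simp add: \<epsilon>_def)
  \<comment> \<open>At the point ln g/(2\<kappa>) + a1 the lower bound for g q has fallen to the
    square of \<open>\<mu>hi\<close>, and at ln g/(2\<kappa>) + a2 the upper bound has fallen to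
    \<epsilon>.\<close>
  define a1 a2 where "a1 = ln (c / \<mu>hi\<^sup>2) / (2 * \<kappa>)" and "a2 = ln (C / \<epsilon>) / (2 * \<kappa>)"
  define m2 where "m2 g = nat \<lceil>max R0 (ln g / (2 * \<kappa>) + a2)\<rceil>" for g
  define Km where "Km = R0 + \<bar>a2\<bar> + 1"
  \<comment> \<open>\<open>D\<close> is \<open>Km\<close> plus the modulus of \<open>a1\<close>, and
    bounds the excess of \<open>m2 g\<close> over ln g/(2\<kappa>) + a1; cells more than
    \<open>dd\<close> steps before the cut still carry a potential above \<mu>^2.\<close>
  define D where "D = R0 + \<bar>a2\<bar> + \<bar>a1\<bar> + 1"
  define dd where "dd = nat \<lceil>D + 1\<rceil>"
  define L where "L = \<lceil>(\<mu>hi + pi/2) / pi\<rceil>"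
  define K1 where "K1 = pi/2 + of_int (L * int (nat \<lceil>R0\<rceil> + dd)) * pi"
  have L: "\<mu>hi + pi/2 \<le> of_int L * pi" "L \<ge> 0"
  proof -
    have "(\<mu>hi + pi/2) / pi \<le> of_int L" by (simp add: L_def)
    then show "\<mu>hi + pi/2 \<le> of_int L * pi" by (simp add: field_simps)
    have "(\<mu>hi + pi/2) / pi > 0" using \<mu>hi by (simp add: add_pos_pos)
    then show "L \<ge> 0" by (simp add: L_def)
  qed
  have m2: "real (m2 g) \<ge> R0" "real (m2 g) \<ge> ln g / (2 * \<kappa>) + a2" "real (m2 g) \<le> ln g / (2 * \<kappa>) + Km"
    if g: "g \<ge> exp 1" for g
  proof -
    have "ln g \<ge> ln (exp 1)" using g by (subst ln_le_cancel_iff) (auto intro: less_le_trans[OF exp_gt_zero])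
    then have lg: "ln g / (2 * \<kappa>) \<ge> 0" using \<kappa> by simp
    have r: "real (m2 g) = of_int \<lceil>max R0 (ln g / (2 * \<kappa>) + a2)\<rceil>" using R0 by (simp add: m2_def le_max_iff_disj)
    have "max R0 (ln g / (2 * \<kappa>) + a2) \<le> real (m2 g)" "real (m2 g) \<le> max R0 (ln g / (2 * \<kappa>) + a2) + 1"
      unfolding r by linarith+
    then show "real (m2 g) \<ge> R0" "real (m2 g) \<ge> ln g / (2 * \<kappa>) + a2" "real (m2 g) \<le> ln g / (2 * \<kappa>) + Km"
      using lg R0 by (auto simp: Km_def)
  qed
  have main: "(k < m2 g \<longrightarrow> \<bar>weyl b l (\<lambda>t. g * q (t + real k)) \<mu> - pi * real l * real (m2 g - k)\<bar> \<le> K1 + 3 * pi) \<and>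
      (m2 g \<le> k \<longrightarrow> weyl b l (\<lambda>t. g * q (t + real k)) \<mu> \<le> wfix b l \<mu> + min (d / 2) 1)"
    if g: "g \<ge> exp 1" and G: "in_gap b l \<mu>" for g k \<mu>
  proof -
    let ?V = "\<lambda>t. g * q (t + real k)" and ?N = "m2 g - k" and ?x = "ln g / (2 * \<kappa>)"
    have g0: "g > 0" using g by (meson exp_gt_zero less_le_trans)
    have V: "potential ?V" using potential_shift[OF q] g0 by simp
    note \<mu> = \<mu>r[OF G]
    have N: "real (m2 g) - real k \<le> real ?N" by linarith
    have eg: "exp (- 2 * \<kappa> * (?x + s / (2 * \<kappa>))) = exp (- s) / g" for s
    proof -
      have "- 2 * \<kappa> * (?x + s / (2 * \<kappa>)) = - s - ln g" using \<kappa> by (simp add: field_simps)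
      then show ?thesis using g0 by (simp add: exp_diff)
    qed
    have tail: "?V t \<le> \<epsilon> * exp (- 2 * \<kappa> * (t - real ?N))" if t: "t \<ge> real ?N" for t
    proof -
      have "t + real k \<ge> R0" using t N m2(1)[OF g] by linarith
      then have "g * q (t + real k) \<le> g * (C * exp (- 2 * \<kappa> * (t + real k)))" using qb g0 by (intro mult_left_mono) auto
      also have "\<dots> \<le> g * (C * exp (- 2 * \<kappa> * ((?x + a2) + (t - real ?N))))"
      proof -
        have "(?x + a2) + (t - real ?N) \<le> t + real k" using N m2(2)[OF g] by linarith
        then have "2 * \<kappa> * ((?x + a2) + (t - real ?N)) \<le> 2 * \<kappa> * (t + real k)" using \<kappa> by (intro mult_left_mono) auto
        then show ?thesis using g0 C by (intro mult_left_mono) auto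
      qed
      also have "\<dots> = g * C * exp (- 2 * \<kappa> * (?x + a2)) * exp (- 2 * \<kappa> * (t - real ?N))"
        by (simp add: exp_add[symmetric] algebra_simps)
      also have "g * C * exp (- 2 * \<kappa> * (?x + a2)) = \<epsilon>"
        unfolding a2_def eg using g0 C \<epsilon> by (simp add: exp_minus exp_ln)
      finally show ?thesis .
    qed
    have B: "barrier b l ?V \<mu> ?N (\<lambda>n. wfix b l \<mu> + A * exp (- 2 * \<kappa> * (real n - real ?N)))"
    proof (rule exp_barrier[OF G V \<kappa> _ _ tail])
      show "A \<ge> 0" "\<epsilon> \<ge> 0" using A \<epsilon> by auto
      have "b * A \<le> \<eta>" using A(3) b by (simp add: field_simps)
      then show "b * A \<le> (1 - exp (- 2 * \<kappa>)) / 2" by (simp only: \<eta>_def)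
      have "\<epsilon> / \<mu> \<le> \<epsilon> / \<mu>lo" using \<mu> \<mu>lo \<epsilon> by (intro divide_left_mono) auto
      then have "b * (\<epsilon> / \<mu>) \<le> b * (\<epsilon> / \<mu>lo)" by (intro mult_left_mono) auto
      also have "\<dots> = A * \<eta>" using \<mu>lo b by (simp add: \<epsilon>_def)
      finally show "b * (\<epsilon> / \<mu>) \<le> A * ((1 - exp (- 2 * \<kappa>)) / 2)" by (simp add: \<eta>_def)
    qed
    have ne: "weylset b l ?V \<mu> \<noteq> {}" by (rule barrier_nonempty[OF G V B])
    have up: "orbit b l ?V \<mu> (weyl b l ?V \<mu>) ?N \<le> wfix b l \<mu> + A"
      using weyl_barrier[OF G V B order_refl] by simp
    have low: "wfix b l \<mu> \<le> orbit b l ?V \<mu> (weyl b l ?V \<mu>) ?N" by (rule weyl_orbit_ge[OF G V ne])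
    show ?thesis
    proof (intro conjI impI)
      assume "m2 g \<le> k"
      then have "?N = 0" by simp
      then have "weyl b l ?V \<mu> \<le> wfix b l \<mu> + A" using up by simp
      then show "weyl b l ?V \<mu> \<le> wfix b l \<mu> + min (d / 2) 1" using A(2) by linarith
    next
      assume k: "k < m2 g"
      let ?nb = "{j\<in>{..<?N}. \<not> (\<forall>t\<in>{real j..real j + 1}. \<mu>\<^sup>2 \<le> ?V t)}"
      \<comment> \<open>A cell can fail to be a barrier for two reasons: it lies before
        \<open>R0\<close>, where \<open>q\<close> has no positive lower bound, or close to the cut,
        where g q is already small.\<close>
      have "?nb \<subseteq> {..<nat \<lceil>R0\<rceil>} \<union> {?N - dd..<?N}"
      proof
        fix j assume j: "j \<in> ?nb"
        then obtain t where t: "t \<in> {real j..real j + 1}" "?V t < \<mu>\<^sup>2" by (auto simp: not_le)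
        have jN: "j < ?N" using j by simp
        show "j \<in> {..<nat \<lceil>R0\<rceil>} \<union> {?N - dd..<?N}"
        proof (rule ccontr)
          assume n: "\<not> ?thesis"
          then have "\<lceil>R0\<rceil> \<le> int j" by auto
          then have "R0 \<le> real j" by (simp add: ceiling_le_iff)
          then have "R0 \<le> t + real k" using t by auto
          then have "g * (c * exp (- 2 * \<kappa> * (t + real k))) \<le> ?V t" using qb g0 by (intro mult_left_mono) auto
          moreover have "t + real k \<le> ?x + a1"
          proof -
            have "j + dd < ?N" using n jN by auto
            then have "real j + real dd + 1 \<le> real (m2 g) - real k" using k by linarith
            moreover have "real dd \<ge> D + 1" unfolding dd_def by linarith
            moreover have "t \<le> real j + 1" using t(1) by simp
            moreover have "real (m2 g) \<le> ?x + Km" by (rule m2(3)[OF g])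
            ultimately show ?thesis using abs_ge_minus_self[of a1] unfolding D_def Km_def by linarith
          qed
          then have "2 * \<kappa> * (t + real k) \<le> 2 * \<kappa> * (?x + a1)" using \<kappa> by (intro mult_left_mono) auto
          then have "g * (c * exp (- 2 * \<kappa> * (?x + a1))) \<le> g * (c * exp (- 2 * \<kappa> * (t + real k)))"
            using g0 c by (intro mult_left_mono) auto
          moreover have "g * (c * exp (- 2 * \<kappa> * (?x + a1))) = \<mu>hi\<^sup>2"
            unfolding a1_def eg using g0 c \<mu>hi by (simp add: exp_minus exp_ln)
          moreover have "\<mu>\<^sup>2 \<le> \<mu>hi\<^sup>2" using \<mu> by (intro power_mono) auto
          ultimately show False using t(2) by linarith
        qed
      qed
      then have "card ?nb \<le> card ({..<nat \<lceil>R0\<rceil>} \<union> {?N - dd..<?N})" by (intro card_mono) auto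
      also have "\<dots> \<le> card {..<nat \<lceil>R0\<rceil>} + card {?N - dd..<?N}" by (rule card_Un_le)
      also have "\<dots> \<le> nat \<lceil>R0\<rceil> + dd" by simp
      finally have "int (card ?nb) \<le> int (nat \<lceil>R0\<rceil> + dd)" by (simp only: of_nat_le_iff)
      then have "L * int (card ?nb) \<le> L * int (nat \<lceil>R0\<rceil> + dd)" using L(2) by (rule mult_left_mono)
      then have cb: "of_int (L * int (card ?nb)) * pi \<le> of_int (L * int (nat \<lceil>R0\<rceil> + dd)) * pi"
        by (intro mult_right_mono) (auto simp only: of_int_le_iff pi_ge_zero)
      have "orbit b 0 ?V \<mu> 0 ?N \<le> pi/2 + of_int (L * int (card ?nb)) * pi"
        by (rule orbit0_upper[OF _ V \<mu>(3)]) (use b L(1) \<mu> in auto)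
      then have K1: "orbit b 0 ?V \<mu> 0 ?N \<le> K1" using cb unfolding K1_def by linarith
      have "\<bar>orbit b l ?V \<mu> (weyl b l ?V \<mu>) ?N\<bar> \<le> pi"
      proof -
        have "A \<le> 1" "- (pi/2) < wfix b l \<mu>" "wfix b l \<mu> < pi/2"
          using A(2) wfix_bounds[OF G] unfolding abs_less_iff by auto
        then show ?thesis using up low pi_gt3 unfolding abs_le_iff by linarith
      qed
      then show "\<bar>weyl b l ?V \<mu> - pi * real l * real ?N\<bar> \<le> K1 + 3 * pi"
        by (intro weyl_asymp[OF _ V \<mu>(3) _ K1]) (use b in auto)
    qed
  qed
  have nn: "K1 + 3 * pi \<ge> 0" using L(2) by (simp add: K1_def)
  have Km: "\<forall>g\<ge>exp 1. \<bar>real (m2 g) - ln g / (2 * \<kappa>)\<bar> \<le> Km"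
  proof (intro allI impI)
    fix g :: real assume "g \<ge> exp 1"
    from m2[OF this] show "\<bar>real (m2 g) - ln g / (2 * \<kappa>)\<bar> \<le> Km"
      using R0 abs_ge_minus_self[of a2] unfolding Km_def abs_le_iff by linarith
  qed
  have m': "\<forall>g\<ge>exp 1. \<forall>k. \<forall>\<mu>. in_gap b l \<mu> \<longrightarrow>
      (k < m2 g \<longrightarrow> \<bar>weyl b l (\<lambda>t. g * q (t + real k)) \<mu> - pi * real l * real (m2 g - k)\<bar> \<le> K1 + 3 * pi) \<and>
      (m2 g \<le> k \<longrightarrow> weyl b l (\<lambda>t. g * q (t + real k)) \<mu> \<le> wfix b l \<mu> + min (d / 2) 1)"
    by (rule allI, rule impI, rule allI, rule allI, rule impI, rule main)
  show ?thesis
    by (rule exI[of _ m2], rule exI[of _ "K1 + 3 * pi"], rule exI[of _ Km], rule conjI, rule nn, rule conjI, rule Km, rule m')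
qed

lemma pi_interval_empty:
  assumes "i * pi \<le> x" "y \<le> (i + 1) * pi" "i \<in> \<int>" shows "{m::int. x < of_int m * pi \<and> of_int m * pi < y} = {}"
proof -
  obtain j :: int where j: "i = of_int j" using assms(3) by (auto elim: Ints_cases)
  have False if "x < of_int m * pi" "of_int m * pi < y" for m :: int
  proof -
    have "of_int j * pi < of_int m * pi" "of_int m * pi < (of_int j + 1) * pi" using that assms(1,2) unfolding j by linarith+
    then have "of_int j < (of_int m :: real)" "of_int m < (of_int j + 1 :: real)"
      using mult_less_cancel_right_pos[OF pi_gt_zero] by blast+
    then have "j < m" "real_of_int m < real_of_int (j + 1)" by simp_all
    then show False by (simp only: of_int_less_iff)
  qed
  then show ?thesis by blast
qed

text \<open>The number \<open>j\<close> is given together with the cardinality it equals, because at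
  the ends of the gap it is the cardinality whose monotonicity in \<mu> is exploited
  (\<open>M_card_antimono\<close>).\<close>

lemma counts_uniform:
  assumes b: "b \<ge> 2" and l: "l \<ge> 1" and \<kappa>: "\<kappa> > 0" and q: "potential q" and c: "c > 0" and C: "C > 0" and R0: "R0 \<ge> 0"
    and qb: "\<And>t. t \<ge> R0 \<Longrightarrow> c * exp (- 2 * \<kappa> * t) \<le> q t \<and> q t \<le> C * exp (- 2 * \<kappa> * t)" and d: "d > 0"
  shows "\<exists>(m2 :: real \<Rightarrow> nat) K Km. K \<ge> 0 \<and> (\<forall>g\<ge>exp 1. \<bar>real (m2 g) - ln g / (2 * \<kappa>)\<bar> \<le> Km) \<and>
    (\<forall>g\<ge>exp 1. \<forall>k.
      (\<forall>\<mu>. in_gap b l \<mu> \<longrightarrow> \<bar>\<mu> - pi * real l\<bar> < tree_theta b \<longrightarrow> d \<le> \<bar>\<mu> - pi * real l\<bar> \<longrightarrow>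
        (\<exists>j::nat. j = card {m::int. wfix b l \<mu> < of_int m * pi \<and> of_int m * pi < weyl b l (\<lambda>t. g * q (t + real k)) \<mu>} \<and>
          counting_M_inner b (\<mu>\<^sup>2) (\<lambda>t. g * q (t + real k)) = of_nat j \<and>
          (k < m2 g \<longrightarrow> \<bar>real j - real l * real (m2 g - k)\<bar> \<le> K) \<and> (m2 g \<le> k \<longrightarrow> j = 0))) \<and>
      (\<forall>lam1 lam2.
        (\<forall>lam\<in>{lam1<..<lam2}. lam > 0 \<and> in_gap b l (sqrt lam) \<and> \<bar>sqrt lam - pi * real l\<bar> < tree_theta b) \<longrightarrow>
        (\<forall>lam\<in>{lam1<..<lam2}. sqrt lam - pi * real l \<ge> d) \<or> (\<forall>lam\<in>{lam1<..<lam2}. sqrt lam - pi * real l \<le> - d) \<longrightarrow>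
        counting_N b lam1 lam2 (\<lambda>t. g * q (t + real k)) \<le> (if k < m2 g then ennreal K else 0)))"
proof -
  obtain m2 :: "real \<Rightarrow> nat" and K Km where K: "K \<ge> 0" and Km: "\<And>g. g \<ge> exp 1 \<Longrightarrow> \<bar>real (m2 g) - ln g / (2 * \<kappa>)\<bar> \<le> Km"
    and W: "\<And>g k \<mu>. g \<ge> exp 1 \<Longrightarrow> in_gap b l \<mu> \<Longrightarrow>
      (k < m2 g \<longrightarrow> \<bar>weyl b l (\<lambda>t. g * q (t + real k)) \<mu> - pi * real l * real (m2 g - k)\<bar> \<le> K) \<and>
      (m2 g \<le> k \<longrightarrow> weyl b l (\<lambda>t. g * q (t + real k)) \<mu> \<le> wfix b l \<mu> + min (d / 2) 1)"
    using weyl_uniform[OF b l \<kappa> q c C R0 qb d] by blast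
  \<comment> \<open>One constant for both counts: rounding to multiples of \<pi> needs at most K + 2
    in the first and 2K + 2 in the second.\<close>
  define K' where "K' = 2 * K + 4"
  have KK: "K' \<ge> 0" "K / pi \<le> K" "K \<ge> 0"
  proof -
    have "K / pi \<le> K / 1" using K pi_gt3 by (intro divide_left_mono) auto
    then show "K / pi \<le> K" by simp
  qed (use K in \<open>auto simp: K'_def\<close>)
  have pV: "potential (\<lambda>t. g * q (t + real k))" and dV: "expdec \<kappa> (\<lambda>t. g * q (t + real k))" if "g \<ge> exp 1" for g k
  proof -
    have "g \<ge> 0" using that by (meson exp_ge_zero order_trans)
    then show "potential (\<lambda>t. g * q (t + real k))" "expdec \<kappa> (\<lambda>t. g * q (t + real k))"
      using potential_shift[OF q] expdec_shift[OF q \<kappa> less_imp_le[OF C] R0] qb by auto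
  qed
  have M: "\<exists>j::nat. j = card {m::int. wfix b l \<mu> < of_int m * pi \<and> of_int m * pi < weyl b l (\<lambda>t. g * q (t + real k)) \<mu>} \<and>
          counting_M_inner b (\<mu>\<^sup>2) (\<lambda>t. g * q (t + real k)) = of_nat j \<and>
          (k < m2 g \<longrightarrow> \<bar>real j - real l * real (m2 g - k)\<bar> \<le> K') \<and> (m2 g \<le> k \<longrightarrow> j = 0)"
    if g: "g \<ge> exp 1" and G: "in_gap b l \<mu>" and s: "\<bar>\<mu> - pi * real l\<bar> < tree_theta b" and dd: "d \<le> \<bar>\<mu> - pi * real l\<bar>" for g k \<mu>
  proof -
    let ?V = "\<lambda>t. g * q (t + real k)" and ?s = "wfix b l \<mu>"
    let ?S = "weyl b l ?V \<mu>"
    let ?Z = "{m::int. ?s < of_int m * pi \<and> of_int m * pi < ?S}"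
    have g0: "g > 0" using g by (meson exp_gt_zero less_le_trans)
    \<comment> \<open>A cell beyond \<open>R0\<close>, where \<open>q\<close> has a positive lower
      bound; this gives the strict growth in \<alpha> that \<open>counting_M_inner_eq\<close> asks
      for.\<close>
    define n where "n = nat \<lceil>R0\<rceil>"
    have n: "R0 \<le> real n" unfolding n_def by linarith
    define \<eta> where "\<eta> = g * (c * exp (- 2 * \<kappa> * (real n + 1 + real k)))"
    have e: "counting_M_inner b (\<mu>\<^sup>2) ?V = of_nat (card ?Z)"
    proof (rule counting_M_inner_eq[OF G pV[OF g] \<kappa> dV[OF g] s])
      show "\<eta> > 0" using g0 c by (simp add: \<eta>_def)
      fix t assume t: "t \<in> {real n..real n + 1}"
      have "2 * \<kappa> * (t + real k) \<le> 2 * \<kappa> * (real n + 1 + real k)" using t \<kappa> by (intro mult_left_mono) auto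
      then have "\<eta> \<le> g * (c * exp (- 2 * \<kappa> * (t + real k)))" unfolding \<eta>_def using g0 c by (intro mult_left_mono) auto
      also have "\<dots> \<le> ?V t" using qb[of "t + real k"] t n g0 by (intro mult_left_mono) auto
      finally show "\<eta> \<le> ?V t" .
    qed
    have sb: "\<bar>?s\<bar> < pi/2" by (rule wfix_bounds[OF G])
    have ge: "?s \<le> ?S" by (rule wfix_le_weyl[OF expdec_weyl(1)[OF G pV[OF g] \<kappa> dV[OF g]]])
    have "\<bar>real (card ?Z) - real l * real (m2 g - k)\<bar> \<le> K'" if "k < m2 g"
    proof -
      let ?y = "real l * real (m2 g - k)"
      have "\<bar>?S - pi * ?y\<bar> \<le> K" using W[OF g G, of k] that by (simp add: mult.assoc)
      then have "\<bar>?S - pi * ?y\<bar> / pi \<le> K / pi" by (intro divide_right_mono) auto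
      moreover have "\<bar>?S - pi * ?y\<bar> / pi = \<bar>?S / pi - ?y\<bar>"
      proof -
        have "?S / pi - ?y = (?S - pi * ?y) / pi" by (simp add: diff_divide_distrib)
        then show ?thesis by (simp add: abs_divide)
      qed
      ultimately have "\<bar>?S / pi - ?y\<bar> \<le> K" using KK by linarith
      moreover have "\<bar>?s / pi\<bar> \<le> 1" using sb by (simp add: abs_divide)
      moreover have "(?S - ?s) / pi \<ge> 0" using ge by simp
      moreover have "(?S - ?s) / pi = ?S / pi - ?s / pi" by (rule diff_divide_distrib)
      ultimately show ?thesis using card_pi_interval(1)[of ?s ?S] card_pi_interval(2)[of ?S ?s] KK(3) unfolding K'_def by linarith
    qed
    moreover have "card ?Z = 0" if "m2 g \<le> k"
    proof -
      \<comment> \<open>If the fixed angle is at most -d, the term d/2 keeps the Weyl angle below 0;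
        if it is at least d, the term 1 keeps it below \<pi>. In both cases no multiple of \<pi>
        lies in between.\<close>
      have up: "?S \<le> ?s + min (d / 2) 1" using W[OF g G, of k] that by simp
      consider "\<mu> - pi * real l \<ge> d" | "\<mu> - pi * real l \<le> - d" using dd by linarith
      then have "?Z = {}"
      proof cases
        case 1
        then have "?s \<le> - d" by (rule wfix_sign(1)[OF G d])
        then show ?thesis using up sb d by (intro pi_interval_empty[of "-1"]) auto
      next
        case 2
        then have "?s \<ge> d" by (rule wfix_sign(2)[OF G d])
        then show ?thesis using up sb d pi_gt3 by (intro pi_interval_empty[of "0"]) auto
      qed
      then show ?thesis by (simp only: card.empty)
    qed
    ultimately show ?thesis using e by blast
  qed
  have N: "counting_N b lam1 lam2 (\<lambda>t. g * q (t + real k)) \<le> (if k < m2 g then ennreal K' else 0)"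
    if g: "g \<ge> exp 1" and G: "\<forall>lam\<in>{lam1<..<lam2}. lam > 0 \<and> in_gap b l (sqrt lam) \<and> \<bar>sqrt lam - pi * real l\<bar> < tree_theta b"
      and s: "(\<forall>lam\<in>{lam1<..<lam2}. sqrt lam - pi * real l \<ge> d) \<or> (\<forall>lam\<in>{lam1<..<lam2}. sqrt lam - pi * real l \<le> - d)" for g k lam1 lam2
  proof -
    let ?V = "\<lambda>t. g * q (t + real k)"
    let ?S = "\<lambda>lam. weyl b l ?V (sqrt lam)"
    note CN = counting_N_le[OF pV[OF g] \<kappa> dV[OF g], of lam1 lam2 b l]
    have W': "wfix b l (sqrt lam) \<le> ?S lam" "\<bar>wfix b l (sqrt lam)\<bar> < pi/2" if "lam \<in> {lam1<..<lam2}" for lam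
    proof -
      have Gl: "in_gap b l (sqrt lam)" using G that by blast
      show "wfix b l (sqrt lam) \<le> ?S lam" by (rule wfix_le_weyl[OF expdec_weyl(1)[OF Gl pV[OF g] \<kappa> dV[OF g]]])
      show "\<bar>wfix b l (sqrt lam)\<bar> < pi/2" by (rule wfix_bounds[OF Gl])
    qed
    show ?thesis
    proof (cases "k < m2 g")
      case True
      let ?y = "pi * real l * real (m2 g - k)"
      have "counting_N b lam1 lam2 ?V \<le> of_nat (card {m::int. ?y - K - 1 < of_int m * pi \<and> of_int m * pi < ?y + K + 1})"
      proof (rule CN)
        fix lam assume lam: "lam \<in> {lam1<..<lam2}"
        then have "\<bar>?S lam - ?y\<bar> \<le> K" using W[OF g, of "sqrt lam" k] G True by blast
        then show "?y - K - 1 < ?S lam \<and> ?S lam < ?y + K + 1" by linarith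
      qed (use G in auto)
      also have "\<dots> \<le> ennreal K'"
      proof -
        let ?n = "card {m::int. ?y - K - 1 < of_int m * pi \<and> of_int m * pi < ?y + K + 1}"
        have "real ?n \<le> max 0 ((?y + K + 1 - (?y - K - 1)) / pi + 1)" by (rule card_pi_interval(1))
        also have "(?y + K + 1 - (?y - K - 1)) / pi = 2 * (K / pi) + 2 / pi" by (simp add: field_simps)
        also have "2 / pi \<le> 1" using pi_gt3 by simp
        finally have "real ?n \<le> K'" using KK unfolding K'_def by linarith
        then have "ennreal (real ?n) \<le> ennreal K'" by (rule ennreal_leI)
        then show ?thesis by (simp add: ennreal_of_nat_eq_real_of_nat)
      qed
      finally show ?thesis using True by simp
    next
      case False
      then have up: "?S lam \<le> wfix b l (sqrt lam) + min (d / 2) 1" if "lam \<in> {lam1<..<lam2}" for lam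
        using W[OF g, of "sqrt lam" k] G that by auto
      have "\<exists>i::int. \<forall>lam\<in>{lam1<..<lam2}. of_int i * pi < ?S lam \<and> ?S lam < (of_int i + 1) * pi"
        using s
      proof
        assume A: "\<forall>lam\<in>{lam1<..<lam2}. sqrt lam - pi * real l \<ge> d"
        show ?thesis
        proof (intro exI[of _ "-1"] ballI)
          fix lam assume lam: "lam \<in> {lam1<..<lam2}"
          then have "wfix b l (sqrt lam) \<le> - d" using A G by (intro wfix_sign(1)[OF _ d]) auto
          then show "of_int (-1) * pi < ?S lam \<and> ?S lam < (of_int (-1) + 1) * pi"
            using W'[OF lam] up[OF lam] d by (auto simp: abs_less_iff)
        qed
      next
        assume A: "\<forall>lam\<in>{lam1<..<lam2}. sqrt lam - pi * real l \<le> - d"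
        show ?thesis
        proof (intro exI[of _ "0"] ballI)
          fix lam assume lam: "lam \<in> {lam1<..<lam2}"
          then have "wfix b l (sqrt lam) \<ge> d" using A G by (intro wfix_sign(2)[OF _ d]) auto
          then show "of_int 0 * pi < ?S lam \<and> ?S lam < (of_int 0 + 1) * pi"
            using W'[OF lam] up[OF lam] d pi_gt3 by (auto simp: abs_less_iff)
        qed
      qed
      then obtain i :: int where i: "\<And>lam. lam \<in> {lam1<..<lam2} \<Longrightarrow> of_int i * pi < ?S lam \<and> ?S lam < (of_int i + 1) * pi" by blast
      have "counting_N b lam1 lam2 ?V \<le> of_nat (card {m::int. of_int i * pi < of_int m * pi \<and> of_int m * pi < (of_int i + 1) * pi})"
        by (rule CN) (use G i in auto)
      also have "{m::int. of_int i * pi < of_int m * pi \<and> of_int m * pi < (of_int i + 1) * pi} = {}"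
        by (rule pi_interval_empty[of "of_int i"]) auto
      finally show ?thesis using False by simp
    qed
  qed
  show ?thesis
    by (intro exI[of _ m2] exI[of _ K'] exI[of _ Km] conjI KK(1) allI impI Km M N)
qed

text \<open>Both ends of the interval move down as \<mu> grows. With both parameters on the same
  side of \<pi> l, the lower end crosses no multiple of \<pi>, so the count can only lose at the
  upper end.\<close>

lemma M_card_antimono:
  assumes g: "in_gap b l \<mu>1" "in_gap b l \<mu>2" and V: "potential V" and \<kappa>: "\<kappa> > 0" and dec: "expdec \<kappa> V"
    and le: "\<mu>1 \<le> \<mu>2" and d: "d > 0" and side: "\<mu>1 - pi * real l \<ge> d \<or> \<mu>2 - pi * real l \<le> - d"
  shows "card {m::int. wfix b l \<mu>2 < of_int m * pi \<and> of_int m * pi < weyl b l V \<mu>2} \<le>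
    card {m::int. wfix b l \<mu>1 < of_int m * pi \<and> of_int m * pi < weyl b l V \<mu>1}"
proof (rule card_mono[OF finite_pi_interval], safe)
  fix m :: int assume m: "wfix b l \<mu>2 < of_int m * pi" "of_int m * pi < weyl b l V \<mu>2"
  have "weyl b l V \<mu>2 \<le> weyl b l V \<mu>1" by (rule weyl_mono[OF g V V le _ expdec_weyl(1)[OF g(1) V \<kappa> dec]]) simp
  then show "of_int m * pi < weyl b l V \<mu>1" using m by simp
  note wb = wfix_bounds[OF g(1)] wfix_bounds[OF g(2)]
  show "wfix b l \<mu>1 < of_int m * pi"
    using side
  proof
    assume s: "\<mu>1 - pi * real l \<ge> d"
    then have "wfix b l \<mu>1 \<le> - d" by (rule wfix_sign(1)[OF g(1) d])
    moreover have "m \<ge> 0"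
    proof (rule ccontr)
      assume "\<not> 0 \<le> m"
      then have "of_int m * pi \<le> (-1) * pi" by (intro mult_right_mono) auto
      then show False using m(1) wb(2) by (simp add: abs_less_iff)
    qed
    then have "of_int m * pi \<ge> 0" by simp
    ultimately show ?thesis using d by linarith
  next
    assume s: "\<mu>2 - pi * real l \<le> - d"
    then have "wfix b l \<mu>2 \<ge> d" by (rule wfix_sign(2)[OF g(2) d])
    then have "of_int m * pi > 0" using m d by linarith
    then have "m \<ge> 1" by (simp add: zero_less_mult_iff)
    then have "1 * pi \<le> of_int m * pi" by (intro mult_right_mono) auto
    then show ?thesis using wb(1) pi_gt_zero unfolding abs_less_iff by linarith
  qed
qed

lemma gap_sqrt:
  assumes b: "b \<ge> 2" and l: "l \<ge> 1"
  shows "lam \<in> gap b l \<longleftrightarrow> lam > 0 \<and> in_gap b l (sqrt lam) \<and> \<bar>sqrt lam - pi * real l\<bar> < tree_theta b"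
proof -
  have t: "0 < tree_theta b" "tree_theta b < pi/2" by (rule tree_theta_bounds[OF b])+
  have "pi * 1 \<le> pi * real l" using l by (intro mult_left_mono) auto
  then have p: "pi * real l - tree_theta b > 0" using t by linarith
  have 1: "(pi * real l - tree_theta b)\<^sup>2 < lam \<longleftrightarrow> pi * real l - tree_theta b < sqrt lam"
    using p real_less_rsqrt[of "pi * real l - tree_theta b" lam] 
    by (metis less_imp_le not_le real_le_lsqrt real_less_rsqrt zero_le_power2 order.strict_trans2 le_less_trans)
  have 2: "lam < (pi * real l + tree_theta b)\<^sup>2 \<longleftrightarrow> sqrt lam < pi * real l + tree_theta b"
    using p t real_le_rsqrt by (metis add_pos_pos diff_gt_0_iff_gt not_le order.strict_trans real_less_lsqrt less_imp_le real_sqrt_lt_0_iff)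
  have "lam > 0" if "pi * real l - tree_theta b < sqrt lam" using that p by (metis order.strict_trans real_sqrt_gt_0_iff)
  then show ?thesis using l b 1 2 unfolding gap_def in_gap_def by (auto simp: abs_less_iff)
qed

subsection \<open>Below the spectrum, and the ends of the gaps\<close>

lemma amplitude_pos:
  assumes "b \<ge> 1" shows "amplitude b 0 V \<mu> a n > 0"
  by (induction n) (use assms gain_pos[of "real b"] in auto)

text \<open>
  Raising the spectral parameter to some $\<mu>^2$ below the gap end, and the potential with it, we
  may assume that the parameter is positive. The Wronskian of the solution \<open>u\<close> with the decaying
  unperturbed one is positive and nondecreasing, so \<open>u\<close> is not square integrable.
\<close>

lemma kernel_below_gap0:
  assumes b: "b \<ge> 2" and V: "potential V" and lam: "lam < (tree_theta b)\<^sup>2" and y: "y \<in> kernel_minus (operator_A b V) lam"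
  shows "AE t in lebesgue_on {0..}. y t = 0"
proof -
  let ?\<tau> = "tree_theta b"
  have \<tau>: "0 < ?\<tau>" "?\<tau> < pi/2" by (rule tree_theta_bounds[OF b])+
  have b1: "b \<ge> 1" using b by simp
  obtain \<mu> where \<mu>: "0 < \<mu>" "\<mu> < ?\<tau>" "lam \<le> \<mu>\<^sup>2"
  proof -
    have "sqrt (max lam 0) < sqrt (?\<tau>\<^sup>2)" using lam \<tau> by (intro real_sqrt_less_mono) simp
    then have "max (sqrt (max lam 0)) 0 < ?\<tau>" using \<tau> by simp
    then obtain \<mu> where m: "max (sqrt (max lam 0)) 0 < \<mu>" "\<mu> < ?\<tau>" using dense by blast
    then have "(sqrt (max lam 0))\<^sup>2 \<le> \<mu>\<^sup>2" by (intro power_mono) auto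
    moreover have "0 < \<mu>" by (rule le_less_trans[OF max.cobounded2 m(1)])
    ultimately show ?thesis using m that[of \<mu>] by simp
  qed
  define V' where "V' t = V t + (\<mu>\<^sup>2 - lam)" for t
  have V': "potential V'"
  proof -
    obtain B where "\<And>t. t \<ge> 0 \<Longrightarrow> V t \<le> B" using potential_bound[OF V] by blast
    then have "\<forall>t\<ge>0. V' t \<le> B + (\<mu>\<^sup>2 - lam)" by (simp add: V'_def)
    moreover have "V' \<in> borel_measurable (lebesgue_on {0..})"
      unfolding V'_def[abs_def] using V by (auto simp: potential_def)
    moreover have "\<forall>t\<ge>0. 0 \<le> V' t" using potential_nonneg[OF V] \<mu>(3) by (simp add: V'_def)
    ultimately show ?thesis unfolding potential_def by blast
  qed
  have y': "y \<in> kernel_minus (operator_A b V') (\<mu>\<^sup>2)"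
  proof -
    obtain f y1 y2 where f: "in_domain b y y1 y2" "AE t in lebesgue_on {0..}. f t = - y2 t + of_real (V t) * y t"
      "AE t in lebesgue_on {0..}. f t = of_real lam * y t"
      using y by (auto simp: kernel_minus_def operator_A_def)
    have "AE t in lebesgue_on {0..}. of_real (\<mu>\<^sup>2) * y t = - y2 t + of_real (V' t) * y t"
      using f(2,3) by eventually_elim (simp add: V'_def algebra_simps)
    then have "(y, \<lambda>t. of_real (\<mu>\<^sup>2) * y t) \<in> operator_A b V'" unfolding operator_A_def using f(1) by blast
    then show ?thesis unfolding kernel_minus_def by (auto intro!: exI[of _ "\<lambda>t. of_real (\<mu>\<^sup>2) * y t"])
  qed
  have G: "in_gap b 0 \<mu>" and strict: "\<bar>\<mu> - pi * real 0\<bar> < ?\<tau>" using b \<mu> by (auto simp: in_gap_def)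
  let ?s = "wfix b 0 \<mu>"
  have s: "- (pi/2) < ?s" "?s \<le> - \<mu>" using wfix_bounds[OF G] wfix_sign(1)[OF G \<mu>(1)] by (auto simp: abs_less_iff)
  have z: "?s + \<mu> \<le> 0" using s by simp
  have sp: "0 \<le> ?s + pi" using s pi_gt_zero by linarith
  let ?u = "prufer_y b 0 V' \<mu> 0" and ?u1 = "prufer_y1 b 0 V' \<mu> 0" and ?w = "prufer_y b 0 (\<lambda>_. 0) \<mu> ?s" and ?w1 = "prufer_y1 b 0 (\<lambda>_. 0) \<mu> ?s"
  have orb: "orbit b 0 (\<lambda>_. 0) \<mu> ?s n = ?s" for n
  proof (induction n)
    case (Suc n)
    have "flow (\<lambda>_. 0) \<mu> n ?s = ?s + \<mu>"
      using flow_bounds(1)[OF potential_zero \<mu>(1), of n ?s] flow_bounds(2)[OF potential_zero \<mu>(1), of n 0 ?s] by force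
    then show ?case using Suc jump_wfix(1)[OF G] by simp
  qed simp
  have fu: "family b V' (\<mu>\<^sup>2) ?u ?u1" by (rule prufer_y_family[OF V' \<mu>(1) b1])
  have fw: "family b (\<lambda>_. 0) (\<mu>\<^sup>2) ?w ?w1" by (rule prufer_y_family[OF potential_zero \<mu>(1) b1])
  have "orbit b 0 (\<lambda>_. 0) \<mu> ?s = (\<lambda>_. ?s)" using orb by (rule ext)
  then have "orbit b 0 (\<lambda>_. 0) \<mu> ?s \<longlonglongrightarrow> ?s" by (metis tendsto_const)
  then have dw: "decfam ?w ?w1"
    by (intro orbit_decfam[OF G potential_zero zero_less_one _ strict]) (auto simp: expdec_def intro!: exI[of _ 0])
  have ph_w: "?s \<le> prufer (\<lambda>_. 0) \<mu> n ?s t \<and> prufer (\<lambda>_. 0) \<mu> n ?s t \<le> ?s + \<mu>" if t: "t \<in> {real n..real n + 1}" for n t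
  proof -
    have "\<mu> * (t - real n) \<le> \<mu> * 1" "0 \<le> \<mu> * (t - real n)" using t \<mu> by (auto intro!: mult_left_mono)
    then show ?thesis
      using prufer_bounds(1)[OF potential_zero \<mu>(1) t, of ?s] prufer_bounds(2)[OF potential_zero \<mu>(1) t, of 0 ?s] by simp
  qed
  \<comment> \<open>The angles of \<open>?w\<close> stay in [-\<pi>, 0]: the cell starts at the
    fixed angle and advances by \<mu>, which does not bring it above 0.\<close>
  have w_neg: "?w n t \<le> 0" if t: "t \<in> {real n..real n + 1}" for n t
  proof -
    have "sin (prufer (\<lambda>_. 0) \<mu> n ?s t) \<le> 0"
    proof -
      have "0 \<le> - prufer (\<lambda>_. 0) \<mu> n ?s t" "- prufer (\<lambda>_. 0) \<mu> n ?s t \<le> pi"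
        using ph_w[OF t] sp z by linarith+
      then show ?thesis using sin_ge_zero[of "- prufer (\<lambda>_. 0) \<mu> n ?s t"] by simp
    qed
    then show ?thesis unfolding prufer_y_def orb using amplitude_pos[OF b1, of "\<lambda>_. 0" \<mu> ?s n] \<mu>(1)
      by (intro divide_nonpos_pos mult_nonneg_nonpos) auto
  qed
  \<comment> \<open>The angle of \<open>?u\<close> is trapped between 0 and the angle of minus
    \<open>?w\<close>, which is the unperturbed orbit shifted by \<pi>. Hence \<open>?u\<close> does
    not change sign.\<close>
  have orb_u: "0 \<le> orbit b 0 V' \<mu> 0 n" "orbit b 0 V' \<mu> 0 n \<le> ?s + pi" for n
  proof -
    show "0 \<le> orbit b 0 V' \<mu> 0 n" by (rule orbit0_nonneg[OF b1 V' \<mu>(1)])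
    have "orbit b 0 V' \<mu> 0 n \<le> orbit b 0 (\<lambda>_. 0) \<mu> (?s + pi) n"
      by (rule orbit_mono[OF b1 V' potential_zero \<mu>(1) order_refl, where n=0]) (use potential_nonneg[OF V'] sp in auto)
    also have "\<dots> = ?s + pi" using orbit_add_int_pi[OF potential_zero \<mu>(1), of b 0 ?s 1 n] orb by simp
    finally show "orbit b 0 V' \<mu> 0 n \<le> ?s + pi" .
  qed
  have u_nonneg: "?u n t \<ge> 0" if t: "t \<in> {real n..real n + 1}" for n t
  proof -
    let ?\<phi> = "prufer V' \<mu> n (orbit b 0 V' \<mu> 0 n) t"
    have "?\<phi> \<ge> 0" by (rule prufer_nonneg[OF V' \<mu>(1) orb_u(1) t])
    moreover have "\<mu> * (t - real n) \<le> \<mu> * 1" using t \<mu> by (intro mult_left_mono) auto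
    then have "?\<phi> \<le> pi" using prufer_bounds(1)[OF V' \<mu>(1) t, of "orbit b 0 V' \<mu> 0 n"] orb_u(2)[of n] z by simp
    ultimately have "sin ?\<phi> \<ge> 0" by (intro sin_ge_zero) auto
    then show ?thesis unfolding prufer_y_def using amplitude_pos[OF b1, of V' \<mu> 0 n] \<mu>(1) by simp
  qed
  define T where "T n t = ?w1 n t * ?u n t - ?w n t * ?u1 n t" for n t
  have acT: "ac_on (real n) (real n + 1) (T n) (\<lambda>t. - V' t * ?w n t * ?u n t)" for n
  proof -
    have "ac_on (real n) (real n + 1) (\<lambda>t. ?w1 n t * ?u n t - ?w n t * ?u1 n t)
      (\<lambda>t. (of_real (0 - \<mu>\<^sup>2) * ?w n t * ?u n t + ?w1 n t * ?u1 n t) - (?w1 n t * ?u1 n t + ?w n t * (of_real (V' t - \<mu>\<^sup>2) * ?u n t)))"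
      using fu fw unfolding family_def by (intro ac_on_diff ac_on_mult) auto
    then show ?thesis by (rule ac_on_cong) (auto simp: T_def algebra_simps)
  qed
  have T_mono: "T n (real n) \<le> T n t" if t: "t \<in> {real n..real n + 1}" for n t
  proof (rule ac_on_mono[OF acT])
    fix x assume "x \<in> {real n..t}"
    then have x: "x \<in> {real n..real n + 1}" using t by auto
    have "V' x * (- ?w n x) * ?u n x \<ge> 0"
      using w_neg[OF x] u_nonneg[OF x] potential_nonneg[OF V', of x] x by (intro mult_nonneg_nonneg) auto
    then show "- V' x * ?w n x * ?u n x \<ge> 0" by simp
  qed (use t in auto)
  have T0: "T 0 0 > 0"
  proof -
    have "0 < - ?s" "- ?s < pi" using s \<mu>(1) pi_gt_zero by linarith+
    then have "sin ?s < 0" using sin_gt_zero[of "- ?s"] by simp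
    then show ?thesis using \<mu>(1) by (simp add: T_def prufer_y_start[OF V' \<mu>(1)] prufer_y_start[OF potential_zero \<mu>(1)] divide_neg_pos)
  qed
  have T_node: "T n (real n) \<ge> T 0 0" for n
  proof (induction n)
    case (Suc n)
    have "T (Suc n) (real n + 1) = T n (real n + 1)"
      using fu fw b1 unfolding family_def T_def by simp
    moreover have "T n (real n + 1) \<ge> T n (real n)" by (rule T_mono) auto
    ultimately show ?case using Suc by (simp add: add.commute)
  qed simp
  have T_ge: "T n t \<ge> T 0 0" if "t \<in> {real n..real n + 1}" for n t
    using T_mono[OF that] T_node[of n] by simp
  obtain c where c: "\<And>n t. t \<in> {real n<..<real n + 1} \<Longrightarrow> y t = c * of_real (?u n t)"
    "c \<noteq> 0 \<Longrightarrow> \<exists>C\<ge>0. \<forall>n. integral {real n..real n + 1} (\<lambda>t. (?u n t)\<^sup>2) \<le> C"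
    using kernel_multiple[OF y' V' b1 \<mu>(1), of 0] by blast
  have "c = 0"
  proof (rule ccontr)
    assume "c \<noteq> 0"
    then obtain C where C: "C \<ge> 0" "\<And>n. integral {real n..real n + 1} (\<lambda>t. (?u n t)\<^sup>2) \<le> C" using c(2) by blast
    obtain M where "(\<forall>n. M n \<ge> 0) \<and> (\<forall>n. \<forall>t\<in>{real n..real n + 1}. \<bar>?w n t\<bar> \<le> M n) \<and>
      (\<forall>n. \<forall>t\<in>{real n..real n + 1}. \<bar>?w1 n t\<bar> \<le> M n) \<and> summable (\<lambda>n. (M n)\<^sup>2) \<and> M \<longlonglongrightarrow> 0"
      using decfamD[OF dw] by (elim exE)
    then have M: "\<And>n t. t \<in> {real n..real n + 1} \<Longrightarrow> \<bar>?w n t\<bar> \<le> M n"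
      "\<And>n t. t \<in> {real n..real n + 1} \<Longrightarrow> \<bar>?w1 n t\<bar> \<le> M n" "M \<longlonglongrightarrow> 0" by blast+
    have le: "T 0 0 / 3 \<le> M n * (8 * (C + 2))" for n
    proof -
      have au: "ac_on (real n) (real n + 1) (?u n) (?u1 n)" and aw: "ac_on (real n) (real n + 1) (?w n) (?w1 n)"
        using fu fw by (auto simp: family_def)
      obtain p r where pr: "real n \<le> p" "p \<le> real n + 1/3" "real n + 2/3 \<le> r" "r \<le> real n + 1"
        "norm (integral {p..r} (\<lambda>t. ?w1 n t * ?u n t - ?w n t * ?u1 n t)) \<le> M n * (8 * (C + 2))"
        by (rule L2_test[OF au aw _ C(1), of "M n"]) (use M C(2) in auto)
      have "integral {p..r} (\<lambda>_. T 0 0) \<le> integral {p..r} (T n)"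
      proof (rule integral_le)
        show "T n integrable_on {p..r}"
          by (rule integrable_continuous_real, rule continuous_on_subset[OF ac_on_continuous[OF acT]]) (use pr in auto)
        show "(\<lambda>_. T 0 0) integrable_on {p..r}" by (intro integrable_continuous_real continuous_intros)
        show "T 0 0 \<le> T n x" if "x \<in> {p..r}" for x using T_ge[of x n] that pr by auto
      qed
      then have "(r - p) * T 0 0 \<le> M n * (8 * (C + 2))" using pr unfolding T_def[abs_def] by simp
      moreover have "(1/3) * T 0 0 \<le> (r - p) * T 0 0" using pr T0 by (intro mult_right_mono) auto
      ultimately show ?thesis by simp
    qed
    have "(\<lambda>n. M n * (8 * (C + 2))) \<longlonglongrightarrow> 0 * (8 * (C + 2))" by (intro tendsto_intros M)
    then have "T 0 0 / 3 \<le> 0 * (8 * (C + 2))" by (rule LIMSEQ_le_const) (use le in blast)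
    then show False using T0 by simp
  qed
  then show ?thesis by (intro AE_cells) (use c(1) in auto)
qed

lemma counting_M_inner_gap0:
  assumes "b \<ge> 2" "potential V" "lam < (tree_theta b)\<^sup>2" shows "counting_M_inner b lam V = 0"
  unfolding counting_M_inner_def
proof (rule infsum_0)
  fix \<alpha> :: real assume "\<alpha> \<in> {0<..<1}"
  then have "potential (\<lambda>t. \<alpha> * V t)" using potential_scale[OF assms(2)] by simp
  then show "L2_dim (kernel_minus (operator_A b (\<lambda>t. \<alpha> * V t)) lam) = 0"
    using kernel_below_gap0[OF assms(1) _ assms(3)] by (intro L2_dim_zero)
qed

lemma counting_N_gap0:
  assumes "b \<ge> 2" "potential V" "lam2 \<le> (tree_theta b)\<^sup>2" shows "counting_N b lam1 lam2 V = 0"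
  unfolding counting_N_def
proof (rule infsum_0)
  fix lam assume "lam \<in> {lam1<..<lam2}"
  then have "lam < (tree_theta b)\<^sup>2" using assms(3) by simp
  then show "L2_dim (kernel_minus (operator_A b V) lam) = 0"
    using kernel_below_gap0[OF assms(1,2)] by (intro L2_dim_zero)
qed

lemma counting_M_end:
  assumes cl: "lam \<in> closure (gap b l)" and ng: "lam \<notin> gap b l"
    and ev: "\<forall>\<^sub>F \<nu> in at lam within gap b l. counting_M_inner b \<nu> V = j"
  shows "counting_M b l lam V = j"
proof -
  have "at lam within gap b l \<noteq> bot" using cl ng by (simp add: at_within_eq_bot_iff)
  moreover have "((\<lambda>\<nu>. counting_M_inner b \<nu> V) \<longlongrightarrow> j) (at lam within gap b l)" using ev by (rule tendsto_eventually)
  ultimately have "Lim (at lam within gap b l) (\<lambda>\<nu>. counting_M_inner b \<nu> V) = j" by (rule tendsto_Lim)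
  then show ?thesis using ng by (simp add: counting_M_def)
qed

section \<open>Gaps, bands and the density of states\<close>

lemma closure_gap:
  assumes "b \<ge> 2"
  shows "closure (gap b 0) = {..(tree_theta b)\<^sup>2}"
    "l \<ge> 1 \<Longrightarrow> closure (gap b l) = {(pi * real l - tree_theta b)\<^sup>2..(pi * real l + tree_theta b)\<^sup>2}"
proof -
  show "closure (gap b 0) = {..(tree_theta b)\<^sup>2}" by (simp add: gap_def closure_lessThan)
  assume l: "l \<ge> 1"
  have t: "0 < tree_theta b" "tree_theta b < pi/2" by (rule tree_theta_bounds[OF assms])+
  have "pi * 1 \<le> pi * real l" using l by (intro mult_left_mono) auto
  then have "pi * real l - tree_theta b > 0" using t by linarith
  then have "(pi * real l - tree_theta b)\<^sup>2 < (pi * real l + tree_theta b)\<^sup>2" using t by (intro power_strict_mono) auto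
  then show "closure (gap b l) = {(pi * real l - tree_theta b)\<^sup>2..(pi * real l + tree_theta b)\<^sup>2}"
    using l by (simp add: gap_def closure_greaterThanLessThan)
qed

lemma gap_ends_ordered:
  assumes b: "b \<ge> 2" and "l < l'"
  shows "(pi * real l + tree_theta b)\<^sup>2 < (pi * real l' - tree_theta b)\<^sup>2"
proof -
  have t: "0 < tree_theta b" "tree_theta b < pi/2" by (rule tree_theta_bounds[OF b])+
  have "pi * (real l + 1) \<le> pi * real l'" using assms by (intro mult_left_mono) auto
  then have "pi * real l + tree_theta b < pi * real l' - tree_theta b" using t by (simp add: algebra_simps)
  then show ?thesis using t by (intro power_strict_mono) auto
qed

lemma gap_less: "b \<ge> 2 \<Longrightarrow> lam \<in> gap b l \<Longrightarrow> lam < (pi * real l + tree_theta b)\<^sup>2"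
  by (auto simp: gap_def split: if_splits)

lemma gap_greater: "l \<ge> 1 \<Longrightarrow> lam \<in> gap b l \<Longrightarrow> (pi * real l - tree_theta b)\<^sup>2 < lam"
  by (auto simp: gap_def)

lemma gap_unique:
  assumes "b \<ge> 2" "lam \<in> gap b l" "lam \<in> gap b l'" shows "l = l'"
proof (rule ccontr)
  assume "l \<noteq> l'"
  then consider "l < l'" | "l' < l" by linarith
  then show False
    using gap_ends_ordered[OF assms(1), of l l'] gap_ends_ordered[OF assms(1), of l' l]
      gap_less[OF assms(1,2)] gap_less[OF assms(1,3)] gap_greater[of l lam b] gap_greater[of l' lam b] assms(2,3)
    by cases auto
qed

lemma band_unique:
  assumes b: "b \<ge> 2" and "m \<ge> 1" "n \<ge> 1" "lam \<in> band b m" "lam \<in> band b n" shows "m = n"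
proof -
  have t: "0 < tree_theta b" "tree_theta b < pi/2" by (rule tree_theta_bounds[OF b])+
  have *: False if mn: "m < n" "m \<ge> 1" "lam \<in> band b m" "lam \<in> band b n" for m n
  proof -
    have "pi * 1 \<le> pi * real m" using mn by (intro mult_left_mono) auto
    moreover have "pi * real m \<le> pi * (real n - 1)" using mn by (intro mult_left_mono) auto
    ultimately have "pi * real m - tree_theta b < pi * (real n - 1) + tree_theta b" "0 \<le> pi * real m - tree_theta b"
      using t by linarith+
    then have "(pi * real m - tree_theta b)\<^sup>2 < (pi * (real n - 1) + tree_theta b)\<^sup>2"
      by (intro power_strict_mono) auto
    then show False using mn by (auto simp: band_def)
  qed
  show ?thesis using *[of m n] *[of n m] assms by (metis linorder_neqE_nat)
qed

lemma cos_tree_theta: assumes "b \<ge> 2" shows "tree_R b * cos (tree_theta b) = 1"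
proof -
  have R: "tree_R b \<ge> 1"
  proof -
    have "(sqrt (real b) - 1)\<^sup>2 \<ge> 0" by simp
    then have "2 * sqrt (real b) \<le> real b + 1" by (simp add: power2_eq_square algebra_simps)
    then show ?thesis using assms by (simp add: tree_R_eq)
  qed
  then have "cos (tree_theta b) = 1 / tree_R b" unfolding tree_theta_def by (intro cos_arccos) (auto simp: field_simps)
  then show ?thesis using R by simp
qed

text \<open>An end of a gap belongs to a neighbouring band. The upper end of gap l is the left end
  of band l + 1, where the arccosine is arccos 1 = 0; the lower end is the right end of band l,
  where it is arccos (-1) = \<pi>. Both give the value l.\<close>

lemma density_closure:
  assumes b: "b \<ge> 2" and cl: "lam \<in> closure (gap b l)"
  shows "density_of_states b lam = real l"
proof (cases "lam \<in> gap b l")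
  case True
  then have "(THE l. lam \<in> gap b l) = l" using gap_unique[OF b] by blast
  then show ?thesis using True unfolding density_of_states_def by auto
next
  case False
  let ?\<tau> = "tree_theta b"
  have t: "0 < ?\<tau>" "?\<tau> < pi/2" by (rule tree_theta_bounds[OF b])+
  have cases: "lam = (pi * real l + ?\<tau>)\<^sup>2 \<or> l \<ge> 1 \<and> lam = (pi * real l - ?\<tau>)\<^sup>2"
    using cl False closure_gap(1)[OF b] closure_gap(2)[OF b, of l] by (cases "l = 0") (auto simp: gap_def)
  then show ?thesis
  proof
    assume e: "lam = (pi * real l + ?\<tau>)\<^sup>2"
    have ng: "\<not> (\<exists>l'. lam \<in> gap b l')"
    proof safe
      fix l' assume g: "lam \<in> gap b l'"
      show False
      proof (cases "l < l'")
        case True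
        then show False using gap_ends_ordered[OF b True] gap_greater[OF _ g] e by simp
      next
        case False
        then have "pi * real l' \<le> pi * real l" by (intro mult_left_mono) auto
        then have "(pi * real l' + ?\<tau>)\<^sup>2 \<le> lam" unfolding e using t by (intro power_mono) auto
        then show False using gap_less[OF b g] by simp
      qed
    qed
    have "lam \<in> band b (Suc l)"
      using gap_ends_ordered[OF b, of l "Suc l"] e by (simp add: band_def)
    then have "(THE n. n \<ge> 1 \<and> lam \<in> band b n) = Suc l" using band_unique[OF b] by (intro the_equality) auto
    moreover have "sqrt lam = pi * real l + ?\<tau>" unfolding e using t by simp
    ultimately show ?thesis using ng cos_tree_theta[OF b] by (simp add: density_of_states_def Let_def)
  next
    assume "l \<ge> 1 \<and> lam = (pi * real l - ?\<tau>)\<^sup>2"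
    then have l: "l \<ge> 1" and e: "lam = (pi * real l - ?\<tau>)\<^sup>2" by auto
    have pl: "pi * 1 \<le> pi * real l" using l by (intro mult_left_mono) auto
    have ng: "\<not> (\<exists>l'. lam \<in> gap b l')"
    proof safe
      fix l' assume g: "lam \<in> gap b l'"
      show False
      proof (cases "l' < l")
        case True
        then show False using gap_ends_ordered[OF b True] gap_less[OF b g] e by simp
      next
        case False
        then have "pi * real l \<le> pi * real l'" by (intro mult_left_mono) auto
        then have "pi * real l - ?\<tau> \<le> pi * real l' - ?\<tau>" "0 \<le> pi * real l - ?\<tau>" using t pl by linarith+
        then have "lam \<le> (pi * real l' - ?\<tau>)\<^sup>2" unfolding e by (intro power_mono)
        then show False using gap_greater[OF _ g] False l by simp
      qed
    qed
    have "(pi * (real l - 1) + ?\<tau>)\<^sup>2 \<le> lam"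
    proof -
      have "pi * (real l - 1) = pi * real l - pi" by (simp add: algebra_simps)
      moreover have "pi * (real l - 1) \<ge> 0" using l by (intro mult_nonneg_nonneg) auto
      ultimately have "pi * (real l - 1) + ?\<tau> \<le> pi * real l - ?\<tau>" "0 \<le> pi * (real l - 1) + ?\<tau>" using t by linarith+
      then show ?thesis unfolding e by (intro power_mono)
    qed
    then have "lam \<in> band b l" using e by (simp add: band_def)
    then have T: "(THE n. n \<ge> 1 \<and> lam \<in> band b n) = l" using band_unique[OF b] l by (intro the_equality) auto
    have "0 \<le> pi * real l - ?\<tau>" using t pl by linarith
    then have "sqrt lam = pi * real l - ?\<tau>" unfolding e by simp
    then have "sqrt lam - pi * (real l - 1) = pi - ?\<tau>" by (simp add: algebra_simps)
    then have "tree_R b * cos (sqrt lam - pi * (real l - 1)) = -1" using cos_tree_theta[OF b] by (simp add: cos_diff)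
    then have "arccos (tree_R b * cos (sqrt lam - pi * (real l - 1))) = pi" by simp
    then show ?thesis using ng T unfolding density_of_states_def Let_def by simp
  qed
qed

subsection \<open>The asymptotics\<close>

lemma sum_staircase: "(\<Sum>k<n. real (n - k)) = real n * (real n + 1) / 2"
proof (induction n)
  case (Suc n)
  have "(\<Sum>k<Suc n. real (Suc n - k)) = real (Suc n) + (\<Sum>k<n. real (n - k))"
    by (simp add: sum.lessThan_Suc_shift del: sum.lessThan_Suc)
  then show ?case using Suc by (simp add: field_simps)
qed simp

text \<open>With m = L/(2\<kappa>) + O(1) the triangular number m(m + 1)/2 becomes L^2/(8\<kappa>^2)
  + O(L), which is the origin of the constant 1/(8\<kappa>^2). The assumption that L is at least 1
  turns bounded errors into multiples of L.\<close>

lemma quadratic_asymptotics: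
  fixes m x Km K S L \<kappa> r :: real
  assumes m: "m \<ge> 0" "\<bar>m - L / (2 * \<kappa>)\<bar> \<le> Km" and L: "L \<ge> 1" and \<kappa>: "\<kappa> > 0" and K: "K \<ge> 0" and r: "r \<ge> 0"
    and S: "\<bar>S - r * (m * (m + 1) / 2)\<bar> \<le> K * m"
  shows "m \<le> (1 / (2 * \<kappa>) + Km) * L"
    "\<bar>S - 1 / (8 * \<kappa>\<^sup>2) * r * L\<^sup>2\<bar> \<le> (K * (1 / (2 * \<kappa>) + Km) + r / 2 * (Km * (1 / \<kappa> + Km) + (1 / (2 * \<kappa>) + Km))) * L"
proof -
  define x where "x = L / (2 * \<kappa>)"
  have x: "x \<ge> 0" using L \<kappa> by (simp add: x_def)
  have Km: "Km \<ge> 0" "\<bar>m - x\<bar> \<le> Km" using m by (auto simp: x_def)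
  have KmL: "Km \<le> Km * L" using Km(1) L by (simp add: mult_le_cancel_left1)
  have eL: "1 / (2 * \<kappa>) * L = x" by (simp add: x_def)
  show m1: "m \<le> (1 / (2 * \<kappa>) + Km) * L" using Km KmL eL unfolding abs_le_iff distrib_right by linarith
  have "\<bar>m\<^sup>2 - x\<^sup>2\<bar> = \<bar>m - x\<bar> * \<bar>m + x\<bar>" by (simp add: power2_eq_square abs_mult[symmetric] algebra_simps)
  also have "\<dots> \<le> Km * ((1 / \<kappa> + Km) * L)"
  proof (rule mult_mono[OF Km(2)])
    have "\<bar>m + x\<bar> = m + x" using m x by simp
    moreover have "1 / \<kappa> * L = 2 * x" using \<kappa> by (simp add: x_def)
    ultimately show "\<bar>m + x\<bar> \<le> (1 / \<kappa> + Km) * L" using Km KmL unfolding abs_le_iff distrib_right by linarith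
  qed (use Km in auto)
  finally have sq: "\<bar>m\<^sup>2 - x\<^sup>2\<bar> \<le> Km * (1 / \<kappa> + Km) * L" by (simp add: mult.assoc)
  have "S - 1 / (8 * \<kappa>\<^sup>2) * r * L\<^sup>2 = (S - r * (m * (m + 1) / 2)) + r / 2 * ((m\<^sup>2 - x\<^sup>2) + m)"
    using \<kappa> by (simp add: x_def power2_eq_square field_simps)
  also have "\<bar>\<dots>\<bar> \<le> K * m + r / 2 * (Km * (1 / \<kappa> + Km) * L + (1 / (2 * \<kappa>) + Km) * L)"
  proof (rule order_trans[OF abs_triangle_ineq], rule add_mono[OF S])
    have "\<bar>(m\<^sup>2 - x\<^sup>2) + m\<bar> \<le> Km * (1 / \<kappa> + Km) * L + (1 / (2 * \<kappa>) + Km) * L"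
      using sq m1 m(1) unfolding abs_le_iff by linarith
    then show "\<bar>r / 2 * ((m\<^sup>2 - x\<^sup>2) + m)\<bar> \<le> r / 2 * (Km * (1 / \<kappa> + Km) * L + (1 / (2 * \<kappa>) + Km) * L)"
      using r by (simp add: abs_mult mult_left_mono)
  qed
  also have "K * m \<le> K * ((1 / (2 * \<kappa>) + Km) * L)" using m1 K by (rule mult_left_mono)
  finally show "\<bar>S - 1 / (8 * \<kappa>\<^sup>2) * r * L\<^sup>2\<bar> \<le> (K * (1 / (2 * \<kappa>) + Km) + r / 2 * (Km * (1 / \<kappa> + Km) + (1 / (2 * \<kappa>) + Km))) * L"
    by (simp add: algebra_simps)
qed

theorem theorem5p10:
  fixes b l :: nat and \<kappa> c C R0 g0 :: real and q Q :: "real \<Rightarrow> real" and I :: "real set"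
  assumes "b \<ge> 2"
    and "\<kappa> > 0"
    and "\<And>t. Q t = exp (- 2 * \<kappa> * t)"
    and "q \<in> borel_measurable (lebesgue_on {0..})"
    and "bounded (q ` {0..})"
    and "\<And>t. t \<ge> 0 \<Longrightarrow> q t \<ge> 0"
    and "c > 0" and "C > 0" and "R0 \<ge> 0"
    and "\<And>t. t \<ge> R0 \<Longrightarrow> c * Q t \<le> q t \<and> q t \<le> C * Q t"
    and "is_interval I" and "compact I"
    and "I \<subseteq> closure (gap b l)"
    and "l \<ge> 1 \<Longrightarrow> (pi * real l)\<^sup>2 \<notin> I"
    and "g0 > exp 1"
  shows "(\<exists>K. \<forall>\<mu>\<in>I. \<forall>g\<ge>g0.
            tree_M b l \<mu> (\<lambda>t. g * q t) < \<infinity> \<and>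
            \<bar>enn2real (tree_M b l \<mu> (\<lambda>t. g * q t))
               - 1 / (8 * \<kappa>\<^sup>2) * density_of_states b \<mu> * (ln g)\<^sup>2\<bar> \<le> K * ln g) \<and>
         (\<exists>C'. \<forall>\<mu>1\<in>I. \<forall>\<mu>2\<in>I. \<mu>1 < \<mu>2 \<longrightarrow>
            (\<forall>g\<ge>g0. tree_N b \<mu>1 \<mu>2 (\<lambda>t. g * q t) \<le> ennreal (C' * ln g)))"
proof -
  note b = assms(1) and \<kappa> = assms(2)
  have q: "potential q"
  proof -
    obtain B where B: "\<forall>x\<in>q ` {0..}. norm x \<le> B" using assms(5) unfolding bounded_iff by blast
    have "q t \<le> B" if "t \<ge> 0" for t
    proof -
      have "norm (q t) \<le> B" using B that by blast
      then show ?thesis by simp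
    qed
    then have "\<forall>t\<ge>0. q t \<le> B" by blast
    then show ?thesis using assms(4,6) unfolding potential_def by blast
  qed
  have qb: "c * exp (- 2 * \<kappa> * t) \<le> q t \<and> q t \<le> C * exp (- 2 * \<kappa> * t)" if "t \<ge> R0" for t
    using assms(10)[OF that] unfolding assms(3) .
  have pV: "potential (\<lambda>t. g * q (t + real k))" if "g \<ge> exp 1" for g k
    using potential_shift[OF q, of g k] that by (meson exp_ge_zero order_trans)
  have g1: "g \<ge> exp 1" "ln g \<ge> 1" if "g \<ge> g0" for g
  proof -
    show ge: "g \<ge> exp 1" using that assms(15) by simp
    then have "ln (exp 1) \<le> ln g" by (subst ln_le_cancel_iff) (auto intro: less_le_trans[OF exp_gt_zero])
    then show "ln g \<ge> 1" by simp
  qed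
  have dens: "density_of_states b \<mu> = real l" if "\<mu> \<in> I" for \<mu>
    using density_closure[OF b] assms(13) that by blast
  let ?\<tau> = "tree_theta b"
  have \<tau>: "0 < ?\<tau>" "?\<tau> < pi/2" by (rule tree_theta_bounds[OF b])+
  show ?thesis
  proof (cases "l = 0")
    case True
    \<comment> \<open>A nonnegative potential creates no eigenvalue below the spectrum and the
      density is 0 there, so for l = 0 all terms vanish.\<close>
    have cl: "\<mu> \<le> ?\<tau>\<^sup>2" if "\<mu> \<in> I" for \<mu> using assms(13) that True closure_gap(1)[OF b] by auto
    have "tree_M b l \<mu> (\<lambda>t. g * q t) = 0" if \<mu>: "\<mu> \<in> I" and g: "g \<ge> g0" for \<mu> g
    proof -
      have "counting_M b l \<mu> (\<lambda>t. g * q (t + real k)) = 0" for k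
      proof (cases "\<mu> \<in> gap b l")
        case in_g: True
        then show ?thesis using True counting_M_inner_gap0[OF b pV[OF g1(1)[OF g]], of \<mu> k]
          by (simp add: counting_M_def gap_def)
      next
        case False
        show ?thesis
        proof (rule counting_M_end[OF _ False])
          show "\<mu> \<in> closure (gap b l)" using assms(13) \<mu> by blast
          show "\<forall>\<^sub>F \<nu> in at \<mu> within gap b l. counting_M_inner b \<nu> (\<lambda>t. g * q (t + real k)) = 0"
            unfolding eventually_at_filter
            by (rule always_eventually) (use counting_M_inner_gap0[OF b pV[OF g1(1)[OF g]]] True in \<open>auto simp: gap_def\<close>)
        qed
      qed
      then show ?thesis by (simp add: tree_M_def)
    qed
    moreover have "tree_N b \<mu>1 \<mu>2 (\<lambda>t. g * q t) = 0" if "\<mu>2 \<in> I" "g \<ge> g0" for \<mu>1 \<mu>2 g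
      using counting_N_gap0[OF b pV[OF g1(1)[OF that(2)]] cl[OF that(1)]] by (simp add: tree_N_def)
    ultimately show ?thesis using True by (intro conjI exI[of _ 0]) (auto simp: dens)
  next
    case False
    then have l: "l \<ge> 1" by simp
    have pl: "pi * 1 \<le> pi * real l" using l by (intro mult_left_mono) auto
    have lo: "pi * real l - ?\<tau> > 0" using pl \<tau> by linarith
    have cl: "(pi * real l - ?\<tau>)\<^sup>2 \<le> \<mu>" "\<mu> \<le> (pi * real l + ?\<tau>)\<^sup>2" if "\<mu> \<in> I" for \<mu>
      using assms(13) that closure_gap(2)[OF b l] by auto
    have pos: "\<mu> > 0" if "\<mu> \<in> I" for \<mu> using cl(1)[OF that] lo by (meson less_le_trans zero_less_power)
    \<comment> \<open>The interval is compact and misses (\<pi> l)^2, so the distance of sqrt \<mu>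
      from \<pi> l has a positive minimum.\<close>
    obtain d0 where d0: "d0 > 0" "\<And>\<mu>. \<mu> \<in> I \<Longrightarrow> d0 \<le> \<bar>sqrt \<mu> - pi * real l\<bar>"
    proof (cases "I = {}")
      case True then show ?thesis using that[of 1] by auto
    next
      case False
      have "continuous_on I (\<lambda>\<mu>. \<bar>sqrt \<mu> - pi * real l\<bar>)" by (intro continuous_intros)
      then obtain x where x: "x \<in> I" "\<And>\<mu>. \<mu> \<in> I \<Longrightarrow> \<bar>sqrt x - pi * real l\<bar> \<le> \<bar>sqrt \<mu> - pi * real l\<bar>"
        using continuous_attains_inf[OF assms(12) False] by blast
      have "sqrt x \<noteq> pi * real l"
      proof
        assume "sqrt x = pi * real l"
        then have "x = (pi * real l)\<^sup>2" using pos[OF x(1)] by (metis less_imp_le real_sqrt_pow2)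
        then show False using assms(14)[OF l] x(1) by simp
      qed
      then show ?thesis using that[of "\<bar>sqrt x - pi * real l\<bar>"] x by simp
    qed
    \<comment> \<open>The bound ?\<tau>/2 ensures that the points at distance 3/4 ?\<tau> from \<pi>
      l, which lie in the open gap, are at least \<open>d\<close> away from \<pi> l.\<close>
    define d where "d = min d0 (?\<tau> / 2)"
    have d: "d > 0" "d \<le> ?\<tau> / 2" and dI: "\<And>\<mu>. \<mu> \<in> I \<Longrightarrow> d \<le> \<bar>sqrt \<mu> - pi * real l\<bar>"
    proof -
      show "d > 0" "d \<le> ?\<tau> / 2" using d0 \<tau> by (auto simp: d_def)
      fix \<mu> assume "\<mu> \<in> I"
      then show "d \<le> \<bar>sqrt \<mu> - pi * real l\<bar>" using d0(2)[of \<mu>] unfolding d_def by linarith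
    qed
    let ?V = "\<lambda>g k t. g * q (t + real k)"
    let ?card = "\<lambda>g k \<mu>. card {m::int. wfix b l \<mu> < of_int m * pi \<and> of_int m * pi < weyl b l (?V g k) \<mu>}"
    have "\<exists>(m2 :: real \<Rightarrow> nat) K Km. K \<ge> 0 \<and> (\<forall>g\<ge>exp 1. \<bar>real (m2 g) - ln g / (2 * \<kappa>)\<bar> \<le> Km) \<and>
      (\<forall>g\<ge>exp 1. \<forall>k.
        (\<forall>\<mu>. in_gap b l \<mu> \<longrightarrow> \<bar>\<mu> - pi * real l\<bar> < ?\<tau> \<longrightarrow> d \<le> \<bar>\<mu> - pi * real l\<bar> \<longrightarrow>
          (\<exists>j::nat. j = ?card g k \<mu> \<and> counting_M_inner b (\<mu>\<^sup>2) (?V g k) = of_nat j \<and>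
            (k < m2 g \<longrightarrow> \<bar>real j - real l * real (m2 g - k)\<bar> \<le> K) \<and> (m2 g \<le> k \<longrightarrow> j = 0))) \<and>
        (\<forall>lam1 lam2.
          (\<forall>lam\<in>{lam1<..<lam2}. lam > 0 \<and> in_gap b l (sqrt lam) \<and> \<bar>sqrt lam - pi * real l\<bar> < ?\<tau>) \<longrightarrow>
          (\<forall>lam\<in>{lam1<..<lam2}. sqrt lam - pi * real l \<ge> d) \<or> (\<forall>lam\<in>{lam1<..<lam2}. sqrt lam - pi * real l \<le> - d) \<longrightarrow>
          counting_N b lam1 lam2 (?V g k) \<le> (if k < m2 g then ennreal K else 0)))" (is "\<exists>m2 K Km. ?P m2 K Km")
      by (rule counts_uniform[OF b l \<kappa> q assms(7-9) qb d(1)])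
    then obtain m2 K Km where H: "?P m2 K Km" by (elim exE)
    note K = H[THEN conjunct1]
      and Km = H[THEN conjunct2, THEN conjunct1, rule_format]
      and M = H[THEN conjunct2, THEN conjunct2, THEN spec, THEN mp, THEN spec, THEN conjunct1, THEN spec, THEN mp, THEN mp, THEN mp]
      and N = H[THEN conjunct2, THEN conjunct2, THEN spec, THEN mp, THEN spec, THEN conjunct2, THEN spec, THEN spec, THEN mp, THEN mp]
    have CM: "\<exists>j::nat. counting_M b l \<mu> (?V g k) = of_nat j \<and>
        (k < m2 g \<longrightarrow> \<bar>real j - real l * real (m2 g - k)\<bar> \<le> K) \<and> (m2 g \<le> k \<longrightarrow> j = 0)"
      if \<mu>: "\<mu> \<in> I" and g: "g \<ge> exp 1" for \<mu> g k
    proof -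
      have dV: "expdec \<kappa> (?V g k)"
        using expdec_shift[OF q \<kappa> less_imp_le[OF assms(8)] assms(9)] qb g by (meson exp_ge_zero order_trans)
      have gd: "\<exists>j::nat. j = ?card g k (sqrt \<nu>) \<and> counting_M_inner b \<nu> (?V g k) = of_nat j \<and>
          (k < m2 g \<longrightarrow> \<bar>real j - real l * real (m2 g - k)\<bar> \<le> K) \<and> (m2 g \<le> k \<longrightarrow> j = 0)"
        if "\<nu> \<in> gap b l" "d \<le> \<bar>sqrt \<nu> - pi * real l\<bar>" for \<nu>
        using M[OF g, of "sqrt \<nu>" k] that gap_sqrt[OF b l, of \<nu>] by simp
      have gd': "counting_M_inner b \<nu> (?V g k) = of_nat (?card g k (sqrt \<nu>)) \<and>
          (k < m2 g \<longrightarrow> \<bar>real (?card g k (sqrt \<nu>)) - real l * real (m2 g - k)\<bar> \<le> K) \<and> (m2 g \<le> k \<longrightarrow> ?card g k (sqrt \<nu>) = 0)"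
        if "\<nu> \<in> gap b l" "d \<le> \<bar>sqrt \<nu> - pi * real l\<bar>" for \<nu>
        using gd[OF that] unfolding simp_thms .
      show ?thesis
      proof (cases "\<mu> \<in> gap b l")
        case True
        then have "counting_M b l \<mu> (?V g k) = counting_M_inner b \<mu> (?V g k)" by (simp only: counting_M_def if_True)
        from trans[OF this gd'[OF True dI[OF \<mu>], THEN conjunct1]] show ?thesis
          by (intro exI[of _ "?card g k (sqrt \<mu>)"] conjI[OF _ gd'[OF True dI[OF \<mu>], THEN conjunct2]])
      next
        case False
        have mcl: "\<mu> \<in> closure (gap b l)" using assms(13) \<mu> by blast
        \<comment> \<open>On the side of \<open>\<mu>\<close> in the gap the count is an antitone function with bounded natural values.\<close>
        have "\<exists>\<nu>0. \<nu>0 \<in> gap b l \<and> d \<le> \<bar>sqrt \<nu>0 - pi * real l\<bar> \<and>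
          (\<forall>\<^sub>F \<nu> in at \<mu> within gap b l. counting_M_inner b \<nu> (?V g k) = of_nat (?card g k (sqrt \<nu>0)))"
        proof -
          consider "\<mu> = (pi * real l - ?\<tau>)\<^sup>2" | "\<mu> = (pi * real l + ?\<tau>)\<^sup>2"
            using False cl[OF \<mu>] l by (auto simp: gap_def)
          then show ?thesis
          proof cases
            case 1
            define U where "U \<nu> \<longleftrightarrow> \<nu> \<in> gap b l \<and> sqrt \<nu> - pi * real l \<le> - d" for \<nu>
            have far: "d \<le> \<bar>sqrt \<nu> - pi * real l\<bar>" if "U \<nu>" for \<nu> using that d unfolding U_def by linarith
            have U0: "U ((pi * real l - 3 / 4 * ?\<tau>)\<^sup>2)"
            proof -
              have "(pi * real l - ?\<tau>)\<^sup>2 < (pi * real l - 3 / 4 * ?\<tau>)\<^sup>2" "(pi * real l - 3 / 4 * ?\<tau>)\<^sup>2 < (pi * real l + ?\<tau>)\<^sup>2"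
                using lo \<tau> by (intro power_strict_mono; simp)+
              moreover have "sqrt ((pi * real l - 3 / 4 * ?\<tau>)\<^sup>2) = pi * real l - 3 / 4 * ?\<tau>" using lo \<tau> by simp
              ultimately show ?thesis using l d \<tau> by (simp add: U_def gap_def)
            qed
            \<comment> \<open>Towards the lower end of the gap the counts grow. They stay bounded
              because \<open>K\<close> is uniform up to the end, so a largest count is
              attained.\<close>
            have bd: "?card g k (sqrt \<nu>) \<le> nat \<lceil>K + real l * real (m2 g)\<rceil>" if Unu: "U \<nu>" for \<nu>
            proof -
              obtain j :: nat where j: "j = ?card g k (sqrt \<nu>)"
                "k < m2 g \<longrightarrow> \<bar>real j - real l * real (m2 g - k)\<bar> \<le> K" "m2 g \<le> k \<longrightarrow> j = 0"
                using gd[OF _ far[OF Unu]] Unu unfolding U_def by blast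
              have "real l * real (m2 g - k) \<le> real l * real (m2 g)" by (intro mult_left_mono) auto
              then have "real j \<le> K + real l * real (m2 g)" using j(2,3) K by (cases "k < m2 g") (auto simp: abs_le_iff)
              then have "j \<le> nat \<lceil>K + real l * real (m2 g)\<rceil>" by linarith
              then show ?thesis unfolding j(1) .
            qed
            have "\<forall>\<nu>. U \<nu> \<longrightarrow> ?card g k (sqrt \<nu>) < Suc (nat \<lceil>K + real l * real (m2 g)\<rceil>)"
              using bd by (simp only: less_Suc_eq_le simp_thms) blast
            from ex_has_greatest_nat[of U, OF U0 this]
            obtain \<nu>0 where "U \<nu>0 \<and> (\<forall>\<nu>. U \<nu> \<longrightarrow> ?card g k (sqrt \<nu>) \<le> ?card g k (sqrt \<nu>0))" by (elim exE)
            then have \<nu>0: "U \<nu>0" "\<And>\<nu>. U \<nu> \<Longrightarrow> ?card g k (sqrt \<nu>) \<le> ?card g k (sqrt \<nu>0)" by (blast dest: conjunct1, blast)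
            have "\<mu> < \<nu>0" using \<nu>0(1) 1 l by (auto simp: U_def gap_def)
            have "\<forall>\<^sub>F \<nu> in at \<mu> within gap b l. counting_M_inner b \<nu> (?V g k) = of_nat (?card g k (sqrt \<nu>0))"
              unfolding eventually_at
            proof (intro exI[of _ "\<nu>0 - \<mu>"] conjI ballI impI)
              show "\<nu>0 - \<mu> > 0" using \<open>\<mu> < \<nu>0\<close> by simp
              fix \<nu> assume \<nu>: "\<nu> \<in> gap b l" "\<nu> \<noteq> \<mu> \<and> dist \<nu> \<mu> < \<nu>0 - \<mu>"
              then have "\<nu> < \<nu>0" by (auto simp: dist_real_def)
              then have le: "sqrt \<nu> \<le> sqrt \<nu>0" by simp
              have "sqrt \<nu>0 - pi * real l \<le> - d" using \<nu>0(1) unfolding U_def by (rule conjunct2)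
              then have U: "U \<nu>" using le \<nu>(1) unfolding U_def by linarith
              have "?card g k (sqrt \<nu>0) \<le> ?card g k (sqrt \<nu>)"
                by (rule M_card_antimono[OF _ _ pV[OF g] \<kappa> dV le d(1)])
                  (use \<nu>0(1) U gap_sqrt[OF b l] in \<open>auto simp: U_def\<close>)
              then have "?card g k (sqrt \<nu>) = ?card g k (sqrt \<nu>0)" using \<nu>0(2)[OF U] by (rule antisym[rotated])
              then show "counting_M_inner b \<nu> (?V g k) = of_nat (?card g k (sqrt \<nu>0))"
                using gd'[OF \<nu>(1) far[OF U]] by (simp only:)
            qed
            then show ?thesis using \<nu>0(1) far[OF \<nu>0(1)] by (auto simp: U_def)
          next
            case 2
            define U where "U \<nu> \<longleftrightarrow> \<nu> \<in> gap b l \<and> sqrt \<nu> - pi * real l \<ge> d" for \<nu>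
            have far: "d \<le> \<bar>sqrt \<nu> - pi * real l\<bar>" if "U \<nu>" for \<nu> using that d unfolding U_def by linarith
            have U0: "U ((pi * real l + 3 / 4 * ?\<tau>)\<^sup>2)"
            proof -
              have "(pi * real l - ?\<tau>)\<^sup>2 < (pi * real l + 3 / 4 * ?\<tau>)\<^sup>2" "(pi * real l + 3 / 4 * ?\<tau>)\<^sup>2 < (pi * real l + ?\<tau>)\<^sup>2"
                using lo \<tau> by (intro power_strict_mono; simp)+
              moreover have "sqrt ((pi * real l + 3 / 4 * ?\<tau>)\<^sup>2) = pi * real l + 3 / 4 * ?\<tau>" using \<tau> by simp
              ultimately show ?thesis using l d \<tau> by (simp add: U_def gap_def)
            qed
            \<comment> \<open>Towards the upper end the counts decrease, and a set of natural
              numbers attains its minimum; beyond the minimizing point the count is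
              constant.\<close>
            from ex_has_least_nat[of U, OF U0, of "\<lambda>\<nu>. ?card g k (sqrt \<nu>)"]
            obtain \<nu>0 where "U \<nu>0 \<and> (\<forall>\<nu>. U \<nu> \<longrightarrow> ?card g k (sqrt \<nu>0) \<le> ?card g k (sqrt \<nu>))" by (elim exE)
            then have \<nu>0: "U \<nu>0" "\<And>\<nu>. U \<nu> \<Longrightarrow> ?card g k (sqrt \<nu>0) \<le> ?card g k (sqrt \<nu>)" by (blast dest: conjunct1, blast)
            have "\<nu>0 < \<mu>" using \<nu>0(1) 2 l by (auto simp: U_def gap_def)
            have "\<forall>\<^sub>F \<nu> in at \<mu> within gap b l. counting_M_inner b \<nu> (?V g k) = of_nat (?card g k (sqrt \<nu>0))"
              unfolding eventually_at
            proof (intro exI[of _ "\<mu> - \<nu>0"] conjI ballI impI)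
              show "\<mu> - \<nu>0 > 0" using \<open>\<nu>0 < \<mu>\<close> by simp
              fix \<nu> assume \<nu>: "\<nu> \<in> gap b l" "\<nu> \<noteq> \<mu> \<and> dist \<nu> \<mu> < \<mu> - \<nu>0"
              then have "\<nu>0 < \<nu>" by (auto simp: dist_real_def)
              then have le: "sqrt \<nu>0 \<le> sqrt \<nu>" by simp
              have "sqrt \<nu>0 - pi * real l \<ge> d" using \<nu>0(1) unfolding U_def by (rule conjunct2)
              then have U: "U \<nu>" using le \<nu>(1) unfolding U_def by linarith
              have "?card g k (sqrt \<nu>) \<le> ?card g k (sqrt \<nu>0)"
                by (rule M_card_antimono[OF _ _ pV[OF g] \<kappa> dV le d(1)])
                  (use \<nu>0(1) U gap_sqrt[OF b l] in \<open>auto simp: U_def\<close>)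
              then have "?card g k (sqrt \<nu>) = ?card g k (sqrt \<nu>0)" using \<nu>0(2)[OF U] by (rule antisym)
              then show "counting_M_inner b \<nu> (?V g k) = of_nat (?card g k (sqrt \<nu>0))"
                using gd'[OF \<nu>(1) far[OF U]] by (simp only:)
            qed
            then show ?thesis using \<nu>0(1) far[OF \<nu>0(1)] by (auto simp: U_def)
          qed
        qed
        then obtain \<nu>0 where \<nu>0: "\<nu>0 \<in> gap b l" "d \<le> \<bar>sqrt \<nu>0 - pi * real l\<bar>"
          "\<forall>\<^sub>F \<nu> in at \<mu> within gap b l. counting_M_inner b \<nu> (?V g k) = of_nat (?card g k (sqrt \<nu>0))" by blast
        have "counting_M b l \<mu> (?V g k) = of_nat (?card g k (sqrt \<nu>0))" by (rule counting_M_end[OF mcl False \<nu>0(3)])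
        then show ?thesis
          by (intro exI[of _ "?card g k (sqrt \<nu>0)"] conjI[OF _ gd'[OF \<nu>0(1,2), THEN conjunct2]])
      qed
    qed
    define K1 where "K1 = K * (1 / (2 * \<kappa>) + Km) + real l / 2 * (Km * (1 / \<kappa> + Km) + (1 / (2 * \<kappa>) + Km))"
    have Mres: "tree_M b l \<mu> (\<lambda>t. g * q t) < \<infinity> \<and>
      \<bar>enn2real (tree_M b l \<mu> (\<lambda>t. g * q t)) - 1 / (8 * \<kappa>\<^sup>2) * density_of_states b \<mu> * (ln g)\<^sup>2\<bar> \<le> K1 * ln g"
      if \<mu>: "\<mu> \<in> I" and g: "g \<ge> g0" for \<mu> g
    proof -
      note g' = g1[OF g]
      obtain j :: "nat \<Rightarrow> nat" where j: "\<And>k. counting_M b l \<mu> (?V g k) = of_nat (j k)"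
        "\<And>k. k < m2 g \<Longrightarrow> \<bar>real (j k) - real l * real (m2 g - k)\<bar> \<le> K" "\<And>k. m2 g \<le> k \<Longrightarrow> j k = 0"
        using CM[OF \<mu> g'(1)] by metis
      have "tree_M b l \<mu> (\<lambda>t. g * q t) = (\<Sum>k. of_nat (j k))" unfolding tree_M_def j(1) ..
      also have "\<dots> = (\<Sum>k<m2 g. of_nat (j k))" by (rule suminf_finite) (auto simp: j(3))
      also have "\<dots> = of_nat (\<Sum>k<m2 g. j k)" by simp
      finally have tM: "tree_M b l \<mu> (\<lambda>t. g * q t) = ennreal (real (\<Sum>k<m2 g. j k))"
        by (simp add: ennreal_of_nat_eq_real_of_nat)
      have "\<bar>real (\<Sum>k<m2 g. j k) - real l * (real (m2 g) * (real (m2 g) + 1) / 2)\<bar> =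
          \<bar>\<Sum>k<m2 g. (real (j k) - real l * real (m2 g - k))\<bar>"
        by (simp only: sum_staircase[symmetric] sum_subtractf sum_distrib_left of_nat_sum)
      also have "\<dots> \<le> (\<Sum>k<m2 g. K)" by (rule order_trans[OF sum_abs sum_mono]) (use j(2) in auto)
      finally have "\<bar>real (\<Sum>k<m2 g. j k) - real l * (real (m2 g) * (real (m2 g) + 1) / 2)\<bar> \<le> K * real (m2 g)"
        by (simp add: mult.commute)
      note Q = quadratic_asymptotics(2)[OF of_nat_0_le_iff Km[OF g'(1)] g'(2) \<kappa> K of_nat_0_le_iff this]
      have e: "enn2real (ennreal (real (\<Sum>k<m2 g. j k))) = real (\<Sum>k<m2 g. j k)" by (rule enn2real_ennreal) (rule of_nat_0_le_iff)
      show ?thesis unfolding tM dens[OF \<mu>] K1_def e by (rule conjI[OF _ Q]) simp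
    qed
    define K2 where "K2 = K * (1 / (2 * \<kappa>) + Km)"
    have Nres: "tree_N b \<mu>1 \<mu>2 (\<lambda>t. g * q t) \<le> ennreal (K2 * ln g)"
      if \<mu>: "\<mu>1 \<in> I" "\<mu>2 \<in> I" "\<mu>1 < \<mu>2" and g: "g \<ge> g0" for \<mu>1 \<mu>2 g
    proof -
      note g' = g1[OF g]
      have inI: "lam \<in> I" if "lam \<in> {\<mu>1..\<mu>2}" for lam
      proof -
        have "\<mu>1 \<le> lam" "lam \<le> \<mu>2" using that by auto
        then show ?thesis using assms(11)[unfolded is_interval_1, rule_format, OF \<mu>(1) \<mu>(2), of lam] by blast
      qed
      have gp: "\<forall>lam\<in>{\<mu>1<..<\<mu>2}. lam > 0 \<and> in_gap b l (sqrt lam) \<and> \<bar>sqrt lam - pi * real l\<bar> < ?\<tau>"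
      proof
        fix lam assume "lam \<in> {\<mu>1<..<\<mu>2}"
        then have "lam \<in> gap b l" using cl(1)[OF \<mu>(1)] cl(2)[OF \<mu>(2)] l by (auto simp: gap_def)
        then show "lam > 0 \<and> in_gap b l (sqrt lam) \<and> \<bar>sqrt lam - pi * real l\<bar> < ?\<tau>" using gap_sqrt[OF b l] by blast
      qed
      \<comment> \<open>The set \<open>I\<close> is an interval that avoids (\<pi> l)^2, so the
        whole range between the two spectral parameters lies on one side of that point.\<close>
      have side: "(\<forall>lam\<in>{\<mu>1<..<\<mu>2}. sqrt lam - pi * real l \<ge> d) \<or> (\<forall>lam\<in>{\<mu>1<..<\<mu>2}. sqrt lam - pi * real l \<le> - d)"
      proof -
        have "(pi * real l)\<^sup>2 \<notin> {\<mu>1..\<mu>2}" using inI assms(14)[OF l] by blast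
        then consider "(pi * real l)\<^sup>2 < \<mu>1" | "\<mu>2 < (pi * real l)\<^sup>2" by fastforce
        then show ?thesis
        proof cases
          case 1
          have "sqrt lam - pi * real l \<ge> d" if lam: "lam \<in> {\<mu>1<..<\<mu>2}" for lam
          proof -
            have "(pi * real l)\<^sup>2 < lam" using 1 lam by simp
            then have "pi * real l < sqrt lam" by (rule real_less_rsqrt)
            then show ?thesis using dI[OF inI, of lam] lam by simp
          qed
          then show ?thesis by blast
        next
          case 2
          have "sqrt lam - pi * real l \<le> - d" if lam: "lam \<in> {\<mu>1<..<\<mu>2}" for lam
          proof -
            have "sqrt lam < sqrt ((pi * real l)\<^sup>2)" using 2 lam by (intro real_sqrt_less_mono) simp
            then have "sqrt lam < pi * real l" by simp
            then show ?thesis using dI[OF inI, of lam] lam by simp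
          qed
          then show ?thesis by blast
        qed
      qed
      \<comment> \<open>Each k before the cut contributes at most \<open>K\<close> and the others
        nothing; the cut \<open>m2 g\<close> itself is of order ln g.\<close>
      have "tree_N b \<mu>1 \<mu>2 (\<lambda>t. g * q t) \<le> (\<Sum>k. if k < m2 g then ennreal K else 0)"
        unfolding tree_N_def by (intro suminf_le N[OF g'(1) gp side]) auto
      also have "\<dots> = (\<Sum>k<m2 g. if k < m2 g then ennreal K else 0)" by (rule suminf_finite) auto
      also have "\<dots> = ennreal (real (m2 g) * K)" using K by (simp add: ennreal_mult ennreal_of_nat_eq_real_of_nat)
      also have "\<dots> \<le> ennreal (K2 * ln g)"
      proof (rule ennreal_leI)
        have "real (m2 g) \<le> (1 / (2 * \<kappa>) + Km) * ln g"
          by (rule quadratic_asymptotics(1)[where K=0 and r=0 and S=0, OF _ Km[OF g'(1)] g'(2) \<kappa>]) auto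
        then have "real (m2 g) * K \<le> (1 / (2 * \<kappa>) + Km) * ln g * K" using K by (rule mult_right_mono)
        then show "real (m2 g) * K \<le> K2 * ln g" by (simp only: K2_def mult_ac)
      qed
      finally show ?thesis .
    qed
    show ?thesis
    proof (rule conjI)
      show "\<exists>K. \<forall>\<mu>\<in>I. \<forall>g\<ge>g0. tree_M b l \<mu> (\<lambda>t. g * q t) < \<infinity> \<and>
          \<bar>enn2real (tree_M b l \<mu> (\<lambda>t. g * q t)) - 1 / (8 * \<kappa>\<^sup>2) * density_of_states b \<mu> * (ln g)\<^sup>2\<bar> \<le> K * ln g"
        by (rule exI[of _ K1], rule ballI, rule allI, rule impI, rule Mres)
      show "\<exists>C'. \<forall>\<mu>1\<in>I. \<forall>\<mu>2\<in>I. \<mu>1 < \<mu>2 \<longrightarrow> (\<forall>g\<ge>g0. tree_N b \<mu>1 \<mu>2 (\<lambda>t. g * q t) \<le> ennreal (C' * ln g))"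
        by (rule exI[of _ K2], rule ballI, rule ballI, rule impI, rule allI, rule impI, rule Nres)
    qed
  qed
qed

end
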